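(* Let $\mathbf{Esp}$ be a category with finite inverse limits, equipped with a subcanonical Grothendieck topology, a monoid object $\mathbb{A}^1$, and a class of small arrows, satisfying the assumptions listed in the context. Suppose that $P$ is a fine and torsion-free monoid. Then the stack $\mathcal{A}(P)$ over $\mathbf{Esp}$ is the quotient stack $[\mathbb{A}(P)/\mathbb{G}(P)]$.
   Context: All monoids are commutative. A monoid is fine if it is integral (cancellative) and finitely generated; an integral monoid $P$ is torsion-free if $P^{\mathrm{gp}}$ is torsion-free. Assumptions on $\mathbf{Esp}$: it admits finite inverse limits, and is equipped with a subcanonical Grothendieck topology, a monoid object $\mathbb{A}^1$, and a class of arrows called small, such that: (1) isomorphisms are small; (2) small arrows are closed under composition; (3) small arrows are closed under pullback; (4) any covering of an object $U$ has a refinement $\{U_i\to U\}$ in which every $U_i\to U$ is small. $\mathcal{O}$ denotes the sheaf of monoids on $\mathbf{Esp}$ of morphisms to $\mathbb{A}^1$, and $\mathcal{O}^\times\subseteq\mathcal{O}$ the subsheaf of invertible sections, represented by a subobject $\mathbb{G}_{\mathrm m}\subseteq\mathbb{A}^1$. For a finitely generated monoid $P$, $\mathbb{A}(P)$ is the monoid object of $\mathbf{Esp}$ representing the functor $S\mapsto\mathrm{Hom}(P,\mathcal{O}(S))$ (it exists because $P$ is finitely presented and $\mathbf{Esp}$ has finite limits), and $\mathbb{G}(P)=\mathbb{A}(P^{\mathrm{gp}})$ is the group object representing $S\mapsto\mathrm{Hom}(P,\mathcal{O}^\times(S))$. The group $\mathbb{G}(P)$ acts on $\mathbb{A}(P)$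 by pointwise multiplication of homomorphisms, $(\phi,\alpha)\mapsto\phi\alpha$. $\mathrm{Div}=[\mathcal{O}/\mathcal{O}^\times]=[\mathbb{A}^1/\mathbb{G}_{\mathrm m}]$ is the quotient stack over the site $\mathbf{Esp}$ for the multiplication action, with the symmetric monoidal structure induced by the multiplication of $\mathcal{O}$. The stack $\mathcal{A}(P)$ over $\mathbf{Esp}$ has as its sections over an object $S$ the (strong) symmetric monoidal functors $P\to\mathrm{Div}(S)$ ($P$ viewed as a symmetric monoidal category with only identity arrows), with monoidal natural isomorphisms as arrows. The natural map $\mathbb{A}(P)\to\mathcal{A}(P)$ sends $\phi\colon P\to\mathcal{O}(S)$ to its composite with the projection $\mathcal{O}(S)\to\mathrm{Div}(S)$; the identification in the claim is the one for which this map is the quotient map. *)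

theory Defs
  imports "HOL-Algebra.Group"
begin

section \<open>Categories\<close>

text \<open>Composition is written in the usual order: in \<open>g \<cdot>\<^bsub>C\<^esub> f\<close> the arrow \<open>f\<close> comes first.\<close>

record ('o, 'a) cat =
  Obj :: "'o set"
  Arr :: "'a set"
  Dom :: "'a \<Rightarrow> 'o"
  Cod :: "'a \<Rightarrow> 'o"
  Ident :: "'o \<Rightarrow> 'a"
  Comp :: "'a \<Rightarrow> 'a \<Rightarrow> 'a"  (infixl "\<cdot>\<index>" 70)

definition Hom :: "('o, 'a, 'm) cat_scheme \<Rightarrow> 'o \<Rightarrow> 'o \<Rightarrow> 'a set" where
  "Hom C X Y = {f \<in> Arr C. Dom C f = X \<and> Cod C f = Y}"

locale category =
  fixes C :: "('o, 'a, 'm) cat_scheme"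
  assumes dom_cod: "f \<in> Arr C \<Longrightarrow> Dom C f \<in> Obj C \<and> Cod C f \<in> Obj C"
    and ident: "X \<in> Obj C \<Longrightarrow> Ident C X \<in> Hom C X X"
    and comp: "\<lbrakk>f \<in> Hom C X Y; g \<in> Hom C Y Z\<rbrakk> \<Longrightarrow> g \<cdot>\<^bsub>C\<^esub> f \<in> Hom C X Z"
    and comp_ident: "f \<in> Hom C X Y \<Longrightarrow> f \<cdot>\<^bsub>C\<^esub> Ident C X = f \<and> Ident C Y \<cdot>\<^bsub>C\<^esub> f = f"
    and comp_assoc: "\<lbrakk>f \<in> Hom C W X; g \<in> Hom C X Y; h \<in> Hom C Y Z\<rbrakk>
      \<Longrightarrow> h \<cdot>\<^bsub>C\<^esub> (g \<cdot>\<^bsub>C\<^esub> f) = h \<cdot>\<^bsub>C\<^esub> g \<cdot>\<^bsub>C\<^esub> f"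

definition is_iso :: "('o, 'a, 'm) cat_scheme \<Rightarrow> 'a \<Rightarrow> bool" where
  "is_iso C f \<longleftrightarrow> f \<in> Arr C \<and> (\<exists>g \<in> Hom C (Cod C f) (Dom C f).
     g \<cdot>\<^bsub>C\<^esub> f = Ident C (Dom C f) \<and> f \<cdot>\<^bsub>C\<^esub> g = Ident C (Cod C f))"

definition is_functor ::
  "('o, 'a, 'm) cat_scheme \<Rightarrow> ('x, 'e, 'n) cat_scheme \<Rightarrow> ('o \<Rightarrow> 'x) \<Rightarrow> ('a \<Rightarrow> 'e) \<Rightarrow> bool" where
  "is_functor C D Fo Fa \<longleftrightarrow>
     (\<forall>X \<in> Obj C. Fo X \<in> Obj D \<and> Fa (Ident C X) = Ident D (Fo X)) \<and>
     (\<forall>f \<in> Arr C. Fa f \<in> Hom D (Fo (Dom C f)) (Fo (Cod C f))) \<and>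
     (\<forall>f \<in> Arr C. \<forall>g \<in> Arr C. Dom C g = Cod C f \<longrightarrow> Fa (g \<cdot>\<^bsub>C\<^esub> f) = Fa g \<cdot>\<^bsub>D\<^esub> Fa f)"

subsection \<open>Finite limits\<close>

definition is_cone ::
  "('o, 'a) cat \<Rightarrow> ('i, 'j) cat \<Rightarrow> ('i \<Rightarrow> 'o) \<Rightarrow> ('j \<Rightarrow> 'a) \<Rightarrow> 'o \<Rightarrow> ('i \<Rightarrow> 'a) \<Rightarrow> bool" where
  "is_cone C J Do Da L \<pi> \<longleftrightarrow> L \<in> Obj C \<and> (\<forall>i \<in> Obj J. \<pi> i \<in> Hom C L (Do i)) \<and>
     (\<forall>j \<in> Arr J. Da j \<cdot>\<^bsub>C\<^esub> \<pi> (Dom J j) = \<pi> (Cod J j))"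

definition is_limit ::
  "('o, 'a) cat \<Rightarrow> ('i, 'j) cat \<Rightarrow> ('i \<Rightarrow> 'o) \<Rightarrow> ('j \<Rightarrow> 'a) \<Rightarrow> 'o \<Rightarrow> ('i \<Rightarrow> 'a) \<Rightarrow> bool" where
  "is_limit C J Do Da L \<pi> \<longleftrightarrow> is_cone C J Do Da L \<pi> \<and>
     (\<forall>L' \<pi>'. is_cone C J Do Da L' \<pi>' \<longrightarrow>
        (\<exists>!h. h \<in> Hom C L' L \<and> (\<forall>i \<in> Obj J. \<pi> i \<cdot>\<^bsub>C\<^esub> h = \<pi>' i)))"

text \<open>Every finite category is isomorphic to one whose objects and arrows are natural numbers.\<close>

definition has_finite_limits :: "('o, 'a) cat \<Rightarrow> bool" where
  "has_finite_limits C \<longleftrightarrow>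
     (\<forall>(J :: (nat, nat) cat) Do Da.
        category J \<and> finite (Obj J) \<and> finite (Arr J) \<and> is_functor J C Do Da \<longrightarrow>
        (\<exists>L \<pi>. is_limit C J Do Da L \<pi>))"

definition is_terminal :: "('o, 'a) cat \<Rightarrow> 'o \<Rightarrow> bool" where
  "is_terminal C T \<longleftrightarrow> T \<in> Obj C \<and> (\<forall>X \<in> Obj C. \<exists>!h. h \<in> Hom C X T)"

definition is_product :: "('o, 'a) cat \<Rightarrow> 'o \<Rightarrow> 'o \<Rightarrow> 'o \<Rightarrow> 'a \<Rightarrow> 'a \<Rightarrow> bool" where
  "is_product C X Y W p q \<longleftrightarrow> p \<in> Hom C W X \<and> q \<in> Hom C W Y \<and>
     (\<forall>Z \<in> Obj C. \<forall>a \<in> Hom C Z X. \<forall>b \<in> Hom C Z Y.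
        \<exists>!h. h \<in> Hom C Z W \<and> p \<cdot>\<^bsub>C\<^esub> h = a \<and> q \<cdot>\<^bsub>C\<^esub> h = b)"

text \<open>In \<open>is_pullback C f g p q\<close>, the arrow \<open>p\<close> is opposite to \<open>g\<close>, hence \<open>q\<close> is the pullback of
  \<open>f\<close> along \<open>g\<close>.\<close>

definition is_pullback :: "('o, 'a) cat \<Rightarrow> 'a \<Rightarrow> 'a \<Rightarrow> 'a \<Rightarrow> 'a \<Rightarrow> bool" where
  "is_pullback C f g p q \<longleftrightarrow> f \<in> Arr C \<and> g \<in> Arr C \<and> Cod C f = Cod C g \<and>
     p \<in> Hom C (Dom C p) (Dom C f) \<and> q \<in> Hom C (Dom C p) (Dom C g) \<and>
     f \<cdot>\<^bsub>C\<^esub> p = g \<cdot>\<^bsub>C\<^esub> q \<and>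
     (\<forall>Z \<in> Obj C. \<forall>a \<in> Hom C Z (Dom C f). \<forall>b \<in> Hom C Z (Dom C g). f \<cdot>\<^bsub>C\<^esub> a = g \<cdot>\<^bsub>C\<^esub> b \<longrightarrow>
        (\<exists>!h. h \<in> Hom C Z (Dom C p) \<and> p \<cdot>\<^bsub>C\<^esub> h = a \<and> q \<cdot>\<^bsub>C\<^esub> h = b))"

section \<open>Grothendieck topologies\<close>

text \<open>A topology assigns to every object \<open>U\<close> a collection \<open>Cov U\<close> of coverings, which are sets of
  arrows with codomain \<open>U\<close>.\<close>

definition grothendieck_topology :: "('o, 'a) cat \<Rightarrow> ('o \<Rightarrow> 'a set set) \<Rightarrow> bool" where
  "grothendieck_topology C Cov \<longleftrightarrow>
     (\<forall>U \<in> Obj C. \<forall>\<U> \<in> Cov U. \<forall>f \<in> \<U>. f \<in> Arr C \<and> Cod C f = U) \<and>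
     (\<forall>f. is_iso C f \<longrightarrow> {f} \<in> Cov (Cod C f)) \<and>
     (\<forall>g \<in> Arr C. \<forall>\<U> \<in> Cov (Cod C g). \<forall>p q. (\<forall>f \<in> \<U>. is_pullback C f g (p f) (q f)) \<longrightarrow>
        q ` \<U> \<in> Cov (Dom C g)) \<and>
     (\<forall>U \<in> Obj C. \<forall>\<U> \<in> Cov U. \<forall>\<V>. (\<forall>f \<in> \<U>. \<V> f \<in> Cov (Dom C f)) \<longrightarrow>
        {f \<cdot>\<^bsub>C\<^esub> g | f g. f \<in> \<U> \<and> g \<in> \<V> f} \<in> Cov U)"

definition subcanonical :: "('o, 'a) cat \<Rightarrow> ('o \<Rightarrow> 'a set set) \<Rightarrow> bool" where
  "subcanonical C Cov \<longleftrightarrow>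
     (\<forall>X \<in> Obj C. \<forall>U \<in> Obj C. \<forall>\<U> \<in> Cov U. \<forall>s.
        (\<forall>f \<in> \<U>. s f \<in> Hom C (Dom C f) X) \<and>
        (\<forall>f \<in> \<U>. \<forall>f' \<in> \<U>. \<forall>W \<in> Obj C. \<forall>a \<in> Hom C W (Dom C f). \<forall>b \<in> Hom C W (Dom C f').
           f \<cdot>\<^bsub>C\<^esub> a = f' \<cdot>\<^bsub>C\<^esub> b \<longrightarrow> s f \<cdot>\<^bsub>C\<^esub> a = s f' \<cdot>\<^bsub>C\<^esub> b) \<longrightarrow>
        (\<exists>!t. t \<in> Hom C U X \<and> (\<forall>f \<in> \<U>. t \<cdot>\<^bsub>C\<^esub> f = s f)))"

definition refines :: "('o, 'a) cat \<Rightarrow> 'a set \<Rightarrow> 'a set \<Rightarrow> bool" where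
  "refines C \<V> \<U> \<longleftrightarrow> (\<forall>g \<in> \<V>. \<exists>f \<in> \<U>. \<exists>h \<in> Hom C (Dom C g) (Dom C f). g = f \<cdot>\<^bsub>C\<^esub> h)"

definition sieve :: "('o, 'a) cat \<Rightarrow> 'a set \<Rightarrow> 'a set" where
  "sieve C \<U> = {f \<cdot>\<^bsub>C\<^esub> h | f h. f \<in> \<U> \<and> h \<in> Arr C \<and> Cod C h = Dom C f}"

section \<open>The ambient category\<close>

text \<open>The carrier, its square with the two projections, the multiplication, the terminal object
  and the unit of a monoid object.\<close>

record ('o, 'a) monoid_data =
  mcar :: 'o
  msq :: 'o
  mfst :: 'a
  msnd :: 'a
  mmul :: 'a
  mterm :: 'o
  munit :: 'a

text \<open>The monoid of sections over \<open>S\<close> of the presheaf represented by a monoid object; the sheaf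
  \<open>\<O>\<close> is \<open>sections C A\<close>, and \<open>\<O>\<^sup>\<times>\<close> is \<open>\<lambda>S. units_of (sections C A S)\<close>. Here and in all presheaves
  below the restriction along \<open>f\<close> is precomposition with \<open>f\<close>.\<close>

definition sections :: "('o, 'a) cat \<Rightarrow> ('o, 'a) monoid_data \<Rightarrow> 'o \<Rightarrow> 'a monoid" where
  "sections C A S = \<lparr>carrier = Hom C S (mcar A),
     monoid.mult = (\<lambda>s t. mmul A \<cdot>\<^bsub>C\<^esub>
       (THE h. h \<in> Hom C S (msq A) \<and> mfst A \<cdot>\<^bsub>C\<^esub> h = s \<and> msnd A \<cdot>\<^bsub>C\<^esub> h = t)),
     one = munit A \<cdot>\<^bsub>C\<^esub> (THE h. h \<in> Hom C S (mterm A))\<rparr>"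

text \<open>The axioms of a commutative monoid object, expressed through generalized elements.\<close>

definition monoid_object :: "('o, 'a) cat \<Rightarrow> ('o, 'a) monoid_data \<Rightarrow> bool" where
  "monoid_object C A \<longleftrightarrow> mcar A \<in> Obj C \<and>
     is_product C (mcar A) (mcar A) (msq A) (mfst A) (msnd A) \<and> is_terminal C (mterm A) \<and>
     mmul A \<in> Hom C (msq A) (mcar A) \<and> munit A \<in> Hom C (mterm A) (mcar A) \<and>
     (\<forall>S \<in> Obj C. comm_monoid (sections C A S))"

definition esp ::
  "('o, 'a) cat \<Rightarrow> ('o \<Rightarrow> 'a set set) \<Rightarrow> ('o, 'a) monoid_data \<Rightarrow> 'a set \<Rightarrow> bool" where
  "esp C Cov A Small \<longleftrightarrow> category C \<and> has_finite_limits C \<and>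
     grothendieck_topology C Cov \<and> subcanonical C Cov \<and> monoid_object C A \<and>
     Small \<subseteq> Arr C \<and>
     (\<forall>f. is_iso C f \<longrightarrow> f \<in> Small) \<and>
     (\<forall>f \<in> Small. \<forall>g \<in> Small. Dom C g = Cod C f \<longrightarrow> g \<cdot>\<^bsub>C\<^esub> f \<in> Small) \<and>
     (\<forall>f g p q. f \<in> Small \<and> is_pullback C f g p q \<longrightarrow> q \<in> Small) \<and>
     (\<forall>U \<in> Obj C. \<forall>\<U> \<in> Cov U. \<exists>\<V> \<in> Cov U. refines C \<V> \<U> \<and> \<V> \<subseteq> Small)"

section \<open>Monoids\<close>

definition monoid_hom :: "('p, 'm) monoid_scheme \<Rightarrow> ('g, 'n) monoid_scheme \<Rightarrow> ('p \<Rightarrow> 'g) set" where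
  "monoid_hom P M = {\<phi> \<in> hom P M. \<phi> \<one>\<^bsub>P\<^esub> = \<one>\<^bsub>M\<^esub>}"

definition integral_monoid :: "('p, 'm) monoid_scheme \<Rightarrow> bool" where
  "integral_monoid P \<longleftrightarrow> comm_monoid P \<and>
     (\<forall>x \<in> carrier P. \<forall>y \<in> carrier P. \<forall>z \<in> carrier P. x \<otimes>\<^bsub>P\<^esub> z = y \<otimes>\<^bsub>P\<^esub> z \<longrightarrow> x = y)"

definition finitely_generated_monoid :: "('p, 'm) monoid_scheme \<Rightarrow> bool" where
  "finitely_generated_monoid P \<longleftrightarrow>
     (\<exists>A. finite A \<and> A \<subseteq> carrier P \<and> (\<forall>H. submonoid H P \<and> A \<subseteq> H \<longrightarrow> H = carrier P))"

definition fine_monoid :: "('p, 'm) monoid_scheme \<Rightarrow> bool" where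
  "fine_monoid P \<longleftrightarrow> integral_monoid P \<and> finitely_generated_monoid P"

text \<open>The group \<open>P\<^sup>g\<^sup>p\<close>; the pair \<open>(a, b)\<close> stands for the fraction \<open>a / b\<close>.\<close>

definition gp_rel :: "('p, 'm) monoid_scheme \<Rightarrow> (('p \<times> 'p) \<times> ('p \<times> 'p)) set" where
  "gp_rel P = {((a, b), (c, d)). {a, b, c, d} \<subseteq> carrier P \<and>
     (\<exists>k \<in> carrier P. a \<otimes>\<^bsub>P\<^esub> d \<otimes>\<^bsub>P\<^esub> k = c \<otimes>\<^bsub>P\<^esub> b \<otimes>\<^bsub>P\<^esub> k)}"

definition gp :: "('p, 'm) monoid_scheme \<Rightarrow> ('p \<times> 'p) set monoid" where
  "gp P = \<lparr>carrier = (carrier P \<times> carrier P) // gp_rel P,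
     monoid.mult = (\<lambda>X Y. gp_rel P `` {(a \<otimes>\<^bsub>P\<^esub> c, b \<otimes>\<^bsub>P\<^esub> d) | a b c d. (a, b) \<in> X \<and> (c, d) \<in> Y}),
     one = gp_rel P `` {(\<one>\<^bsub>P\<^esub>, \<one>\<^bsub>P\<^esub>)}\<rparr>"

definition torsion_free_monoid :: "('p, 'm) monoid_scheme \<Rightarrow> bool" where
  "torsion_free_monoid P \<longleftrightarrow> integral_monoid P \<and>
     (\<forall>x \<in> carrier (gp P). \<forall>n::nat. n > 0 \<and> x [^]\<^bsub>gp P\<^esub> n = \<one>\<^bsub>gp P\<^esub> \<longrightarrow> x = \<one>\<^bsub>gp P\<^esub>)"

text \<open>\<open>R\<close> represents \<open>S \<mapsto> Hom(P, M(S))\<close> with universal homomorphism \<open>u : P \<rightarrow> M(R)\<close>, where the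
  sections of the presheaf of monoids \<open>M\<close> over \<open>S\<close> are arrows with domain \<open>S\<close>.\<close>

definition represents_homs ::
  "('o, 'a) cat \<Rightarrow> ('o \<Rightarrow> 'a monoid) \<Rightarrow> ('p, 'm) monoid_scheme \<Rightarrow> 'o \<Rightarrow> ('p \<Rightarrow> 'a) \<Rightarrow> bool" where
  "represents_homs C M P R u \<longleftrightarrow> R \<in> Obj C \<and> u \<in> monoid_hom P (M R) \<and>
     (\<forall>S \<in> Obj C. \<forall>\<phi> \<in> monoid_hom P (M S).
        \<exists>!s. s \<in> Hom C S R \<and> (\<forall>p \<in> carrier P. u p \<cdot>\<^bsub>C\<^esub> s = \<phi> p))"

text \<open>The monoid structure on \<open>Hom(S, R)\<close> that corresponds to pointwise multiplication in
  \<open>Hom(P, M(S))\<close>.\<close>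

definition pointwise_monoid ::
  "('o, 'a) cat \<Rightarrow> ('o \<Rightarrow> 'a monoid) \<Rightarrow> ('p, 'm) monoid_scheme \<Rightarrow> 'o \<Rightarrow> ('p \<Rightarrow> 'a) \<Rightarrow> 'o \<Rightarrow> 'a monoid"
  where
  "pointwise_monoid C M P R u S = \<lparr>carrier = Hom C S R,
     monoid.mult = (\<lambda>s t. THE r. r \<in> Hom C S R \<and>
       (\<forall>p \<in> carrier P. u p \<cdot>\<^bsub>C\<^esub> r = (u p \<cdot>\<^bsub>C\<^esub> s) \<otimes>\<^bsub>M S\<^esub> (u p \<cdot>\<^bsub>C\<^esub> t))),
     one = (THE r. r \<in> Hom C S R \<and> (\<forall>p \<in> carrier P. u p \<cdot>\<^bsub>C\<^esub> r = \<one>\<^bsub>M S\<^esub>))\<rparr>"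

text \<open>The action of the group object representing \<open>Hom(P, \<O>\<^sup>\<times>(S))\<close>, with universal homomorphism \<open>v\<close>, on
  the object \<open>AP\<close> representing \<open>Hom(P, \<O>(S))\<close>, with universal homomorphism \<open>u\<close>, by pointwise
  multiplication.\<close>

definition pointwise_action ::
  "('o, 'a) cat \<Rightarrow> ('o, 'a) monoid_data \<Rightarrow> ('p, 'm) monoid_scheme \<Rightarrow>
   'o \<Rightarrow> ('p \<Rightarrow> 'a) \<Rightarrow> ('p \<Rightarrow> 'a) \<Rightarrow> 'o \<Rightarrow> 'a \<Rightarrow> 'a \<Rightarrow> 'a" where
  "pointwise_action C A P AP u v S g s = (THE t. t \<in> Hom C S AP \<and>
     (\<forall>p \<in> carrier P. u p \<cdot>\<^bsub>C\<^esub> t = (v p \<cdot>\<^bsub>C\<^esub> g) \<otimes>\<^bsub>sections C A S\<^esub> (u p \<cdot>\<^bsub>C\<^esub> s)))"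

section \<open>Stacks\<close>

record ('o, 'a, 'x, 'e) fibcat = "('x, 'e) cat" +
  PObj :: "'x \<Rightarrow> 'o"
  PArr :: "'e \<Rightarrow> 'a"

definition Over :: "('o, 'a, 'x, 'e) fibcat \<Rightarrow> 'o \<Rightarrow> 'x set" where
  "Over E S = {x \<in> Obj E. PObj E x = S}"

definition HomOver :: "('o, 'a, 'x, 'e) fibcat \<Rightarrow> 'a \<Rightarrow> 'x \<Rightarrow> 'x \<Rightarrow> 'e set" where
  "HomOver E f y x = {a \<in> Hom E y x. PArr E a = f}"

definition fibre :: "('o, 'a) cat \<Rightarrow> ('o, 'a, 'x, 'e) fibcat \<Rightarrow> 'o \<Rightarrow> ('x, 'e) cat" where
  "fibre C E S = \<lparr>Obj = Over E S, Arr = {a \<in> Arr E. PArr E a = Ident C S \<and> PObj E (Dom E a) = S},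
     Dom = Dom E, Cod = Cod E, Ident = Ident E, Comp = Comp E\<rparr>"

definition fibred_in_groupoids :: "('o, 'a) cat \<Rightarrow> ('o, 'a, 'x, 'e) fibcat \<Rightarrow> bool" where
  "fibred_in_groupoids C E \<longleftrightarrow> category E \<and> is_functor E C (PObj E) (PArr E) \<and>
     (\<forall>f \<in> Arr C. \<forall>x \<in> Over E (Cod C f). \<exists>y \<in> Over E (Dom C f). \<exists>a. a \<in> HomOver E f y x) \<and>
     (\<forall>f h x y z. \<forall>a \<in> HomOver E f y x. \<forall>b \<in> HomOver E (f \<cdot>\<^bsub>C\<^esub> h) z x.
        h \<in> Hom C (PObj E z) (PObj E y) \<longrightarrow>
        (\<exists>!c. c \<in> HomOver E h z y \<and> a \<cdot>\<^bsub>E\<^esub> c = b))"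

text \<open>The stack conditions say that for every covering of \<open>S\<close>, with generated sieve \<open>R\<close>,
  restriction is an equivalence from the category of cartesian functors \<open>C/S \<rightarrow> E\<close> over \<open>C\<close>, that is,
  from the fibre over \<open>S\<close>, to that of cartesian functors \<open>R \<rightarrow> E\<close>, that is, descent data. They are
  written without choosing pullbacks: instead of the pullback of \<open>x\<close> along \<open>f\<close> all arrows to \<open>x\<close> over
  \<open>f\<close> are used.\<close>

definition arrows_glue :: "('o, 'a) cat \<Rightarrow> ('o, 'a, 'x, 'e) fibcat \<Rightarrow> 'o \<Rightarrow> 'a set \<Rightarrow> bool" where
  "arrows_glue C E S R \<longleftrightarrow>
     (\<forall>x \<in> Over E S. \<forall>y \<in> Over E S. \<forall>\<beta>.
        (\<forall>c \<in> Arr E. Cod E c = x \<and> PArr E c \<in> R \<longrightarrow>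
           \<beta> c \<in> HomOver E (PArr E c) (Dom E c) y \<and>
           (\<forall>d \<in> Arr E. Cod E d = Dom E c \<longrightarrow> \<beta> (c \<cdot>\<^bsub>E\<^esub> d) = \<beta> c \<cdot>\<^bsub>E\<^esub> d)) \<longrightarrow>
        (\<exists>!b. b \<in> HomOver E (Ident C S) x y \<and>
           (\<forall>c \<in> Arr E. Cod E c = x \<and> PArr E c \<in> R \<longrightarrow> b \<cdot>\<^bsub>E\<^esub> c = \<beta> c)))"

definition descent_datum ::
  "('o, 'a) cat \<Rightarrow> ('o, 'a, 'x, 'e) fibcat \<Rightarrow> 'a set \<Rightarrow> ('a \<Rightarrow> 'x) \<Rightarrow> ('a \<Rightarrow> 'a \<Rightarrow> 'e) \<Rightarrow> bool" where
  "descent_datum C E R X a \<longleftrightarrow>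
     (\<forall>f \<in> R. X f \<in> Over E (Dom C f) \<and> a f (Ident C (Dom C f)) = Ident E (X f) \<and>
       (\<forall>h \<in> Arr C. Cod C h = Dom C f \<longrightarrow> a f h \<in> HomOver E h (X (f \<cdot>\<^bsub>C\<^esub> h)) (X f) \<and>
         (\<forall>k \<in> Arr C. Cod C k = Dom C h \<longrightarrow> a f (h \<cdot>\<^bsub>C\<^esub> k) = a f h \<cdot>\<^bsub>E\<^esub> a (f \<cdot>\<^bsub>C\<^esub> h) k)))"

definition objects_glue :: "('o, 'a) cat \<Rightarrow> ('o, 'a, 'x, 'e) fibcat \<Rightarrow> 'o \<Rightarrow> 'a set \<Rightarrow> bool" where
  "objects_glue C E S R \<longleftrightarrow>
     (\<forall>X a. descent_datum C E R X a \<longrightarrow>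
        (\<exists>x \<in> Over E S. \<exists>b. \<forall>f \<in> R. b f \<in> HomOver E f (X f) x \<and>
           (\<forall>h \<in> Arr C. Cod C h = Dom C f \<longrightarrow> b f \<cdot>\<^bsub>E\<^esub> a f h = b (f \<cdot>\<^bsub>C\<^esub> h))))"

definition stack :: "('o, 'a) cat \<Rightarrow> ('o \<Rightarrow> 'a set set) \<Rightarrow> ('o, 'a, 'x, 'e) fibcat \<Rightarrow> bool" where
  "stack C Cov E \<longleftrightarrow> fibred_in_groupoids C E \<and>
     (\<forall>S \<in> Obj C. \<forall>\<U> \<in> Cov S. arrows_glue C E S (sieve C \<U>) \<and> objects_glue C E S (sieve C \<U>))"

definition fibred_functor ::
  "('o, 'a, 'x, 'e) fibcat \<Rightarrow> ('o, 'a, 'y, 'd) fibcat \<Rightarrow> ('x \<Rightarrow> 'y) \<Rightarrow> ('e \<Rightarrow> 'd) \<Rightarrow> bool" where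
  "fibred_functor E D Fo Fa \<longleftrightarrow> is_functor E D Fo Fa \<and>
     (\<forall>x \<in> Obj E. PObj D (Fo x) = PObj E x) \<and> (\<forall>a \<in> Arr E. PArr D (Fa a) = PArr E a)"

text \<open>\<open>D\<close> is the stack associated with \<open>E\<close>, with canonical functor \<open>F\<close>: it is a stack, \<open>F\<close> identifies
  the presheaves of morphisms of \<open>D\<close> with the sheafifications of those of \<open>E\<close> (that is, \<open>F\<close> is locally
  injective and locally surjective on morphisms), and every object of \<open>D\<close> is locally isomorphic to
  one in the image of \<open>F\<close>.\<close>

definition stackification ::
  "('o, 'a) cat \<Rightarrow> ('o \<Rightarrow> 'a set set) \<Rightarrow> ('o, 'a, 'x, 'e) fibcat \<Rightarrow> ('o, 'a, 'y, 'd) fibcat \<Rightarrow>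
   ('x \<Rightarrow> 'y) \<Rightarrow> ('e \<Rightarrow> 'd) \<Rightarrow> bool" where
  "stackification C Cov E D Fo Fa \<longleftrightarrow>
     fibred_in_groupoids C E \<and> stack C Cov D \<and> fibred_functor E D Fo Fa \<and>
     (\<forall>S \<in> Obj C. \<forall>x \<in> Over E S. \<forall>y \<in> Over E S.
        \<forall>a \<in> HomOver E (Ident C S) x y. \<forall>b \<in> HomOver E (Ident C S) x y. Fa a = Fa b \<longrightarrow>
        (\<exists>\<U> \<in> Cov S. \<forall>f \<in> \<U>. \<forall>z. \<forall>c \<in> HomOver E f z x. a \<cdot>\<^bsub>E\<^esub> c = b \<cdot>\<^bsub>E\<^esub> c)) \<and>
     (\<forall>S \<in> Obj C. \<forall>x \<in> Over E S. \<forall>y \<in> Over E S.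
        \<forall>b \<in> HomOver D (Ident C S) (Fo x) (Fo y).
        (\<exists>\<U> \<in> Cov S. \<forall>f \<in> \<U>. \<forall>z. \<forall>c \<in> HomOver E f z x.
           \<exists>a \<in> HomOver E f z y. Fa a = b \<cdot>\<^bsub>D\<^esub> Fa c)) \<and>
     (\<forall>S \<in> Obj C. \<forall>y \<in> Over D S. \<exists>\<U> \<in> Cov S. \<forall>f \<in> \<U>.
        \<exists>x \<in> Over E (Dom C f). \<exists>b. b \<in> HomOver D f (Fo x) y)"

text \<open>The fibred category of action groupoids of a presheaf of groups \<open>G\<close> acting on an object \<open>X\<close>.
  Its objects over \<open>S\<close> are the arrows \<open>x : S \<rightarrow> X\<close>; an arrow \<open>(T, y) \<rightarrow> (S, x)\<close> over \<open>f : T \<rightarrow> S\<close> is an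
  element \<open>g\<close> of \<open>G(T)\<close> that carries \<open>y\<close> to the restriction of \<open>x\<close>.\<close>

definition action_groupoid ::
  "('o, 'a) cat \<Rightarrow> 'o \<Rightarrow> ('o \<Rightarrow> 'a monoid) \<Rightarrow> ('o \<Rightarrow> 'a \<Rightarrow> 'a \<Rightarrow> 'a) \<Rightarrow>
   ('o, 'a, 'o \<times> 'a, 'a \<times> 'a \<times> 'a \<times> 'a) fibcat" where
  "action_groupoid C X G act =
     \<lparr>Obj = {(S, x). S \<in> Obj C \<and> x \<in> Hom C S X},
      Arr = {(f, g, y, x). f \<in> Arr C \<and> g \<in> carrier (G (Dom C f)) \<and>
        y \<in> Hom C (Dom C f) X \<and> x \<in> Hom C (Cod C f) X \<and> act (Dom C f) g y = x \<cdot>\<^bsub>C\<^esub> f},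
      Dom = (\<lambda>(f, g, y, x). (Dom C f, y)),
      Cod = (\<lambda>(f, g, y, x). (Cod C f, x)),
      Ident = (\<lambda>(S, x). (Ident C S, \<one>\<^bsub>G S\<^esub>, x, x)),
      Comp = (\<lambda>(f, g, y, x) (h, k, z, w).
        (f \<cdot>\<^bsub>C\<^esub> h, (g \<cdot>\<^bsub>C\<^esub> h) \<otimes>\<^bsub>G (Dom C h)\<^esub> k, z, x)),
      PObj = fst,
      PArr = fst\<rparr>"

text \<open>\<open>D\<close> is the quotient stack \<open>[X/G]\<close>, with quotient map \<open>X \<rightarrow> D\<close> given by \<open>qo\<close> on objects; \<open>qa\<close> gives
  the effect of elements of \<open>G\<close>.\<close>

definition quotient_stack ::
  "('o, 'a) cat \<Rightarrow> ('o \<Rightarrow> 'a set set) \<Rightarrow> 'o \<Rightarrow> ('o \<Rightarrow> 'a monoid) \<Rightarrow> ('o \<Rightarrow> 'a \<Rightarrow> 'a \<Rightarrow> 'a) \<Rightarrow>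
   ('o, 'a, 'x, 'e) fibcat \<Rightarrow> ('o \<times> 'a \<Rightarrow> 'x) \<Rightarrow> ('a \<times> 'a \<times> 'a \<times> 'a \<Rightarrow> 'e) \<Rightarrow> bool" where
  "quotient_stack C Cov X G act D qo qa \<longleftrightarrow>
     stackification C Cov (action_groupoid C X G act) D qo qa"

section \<open>Symmetric monoidal structures\<close>

text \<open>Everything except the unit object:
  \<open>Assoc x y z : (x \<otimes> y) \<otimes> z \<rightarrow> x \<otimes> (y \<otimes> z)\<close>, \<open>LUnit x : I \<otimes> x \<rightarrow> x\<close>, \<open>RUnit x : x \<otimes> I \<rightarrow> x\<close>,
  \<open>Braid x y : x \<otimes> y \<rightarrow> y \<otimes> x\<close>.\<close>

record ('x, 'e) tensor =
  TObj :: "'x \<Rightarrow> 'x \<Rightarrow> 'x"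
  TArr :: "'e \<Rightarrow> 'e \<Rightarrow> 'e"
  Assoc :: "'x \<Rightarrow> 'x \<Rightarrow> 'x \<Rightarrow> 'e"
  LUnit :: "'x \<Rightarrow> 'e"
  RUnit :: "'x \<Rightarrow> 'e"
  Braid :: "'x \<Rightarrow> 'x \<Rightarrow> 'e"

definition iso_in :: "('x, 'e) cat \<Rightarrow> 'x \<Rightarrow> 'x \<Rightarrow> 'e \<Rightarrow> bool" where
  "iso_in D x y a \<longleftrightarrow> a \<in> Hom D x y \<and> is_iso D a"

definition symmetric_monoidal_category ::
  "('x, 'e) cat \<Rightarrow> ('x, 'e) tensor \<Rightarrow> 'x \<Rightarrow> bool" where
  "symmetric_monoidal_category D M I \<longleftrightarrow> category D \<and> I \<in> Obj D \<and>
     (\<forall>x \<in> Obj D. \<forall>y \<in> Obj D. TObj M x y \<in> Obj D \<and>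
        TArr M (Ident D x) (Ident D y) = Ident D (TObj M x y)) \<and>
     (\<forall>x x' y y'. \<forall>a \<in> Hom D x x'. \<forall>b \<in> Hom D y y'.
        TArr M a b \<in> Hom D (TObj M x y) (TObj M x' y')) \<and>
     (\<forall>x x' x'' y y' y''. \<forall>a \<in> Hom D x x'. \<forall>a' \<in> Hom D x' x''. \<forall>b \<in> Hom D y y'. \<forall>b' \<in> Hom D y' y''.
        TArr M (a' \<cdot>\<^bsub>D\<^esub> a) (b' \<cdot>\<^bsub>D\<^esub> b) = TArr M a' b' \<cdot>\<^bsub>D\<^esub> TArr M a b) \<and>
     (\<forall>x \<in> Obj D. \<forall>y \<in> Obj D. \<forall>z \<in> Obj D.
        iso_in D (TObj M (TObj M x y) z) (TObj M x (TObj M y z)) (Assoc M x y z)) \<and>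
     (\<forall>x \<in> Obj D. iso_in D (TObj M I x) x (LUnit M x) \<and> iso_in D (TObj M x I) x (RUnit M x)) \<and>
     (\<forall>x \<in> Obj D. \<forall>y \<in> Obj D. iso_in D (TObj M x y) (TObj M y x) (Braid M x y)) \<and>
     (\<forall>x x' y y' z z'. \<forall>a \<in> Hom D x x'. \<forall>b \<in> Hom D y y'. \<forall>c \<in> Hom D z z'.
        Assoc M x' y' z' \<cdot>\<^bsub>D\<^esub> TArr M (TArr M a b) c = TArr M a (TArr M b c) \<cdot>\<^bsub>D\<^esub> Assoc M x y z) \<and>
     (\<forall>x x'. \<forall>a \<in> Hom D x x'.
        LUnit M x' \<cdot>\<^bsub>D\<^esub> TArr M (Ident D I) a = a \<cdot>\<^bsub>D\<^esub> LUnit M x \<and>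
        RUnit M x' \<cdot>\<^bsub>D\<^esub> TArr M a (Ident D I) = a \<cdot>\<^bsub>D\<^esub> RUnit M x) \<and>
     (\<forall>x x' y y'. \<forall>a \<in> Hom D x x'. \<forall>b \<in> Hom D y y'.
        Braid M x' y' \<cdot>\<^bsub>D\<^esub> TArr M a b = TArr M b a \<cdot>\<^bsub>D\<^esub> Braid M x y) \<and>
     (\<forall>w \<in> Obj D. \<forall>x \<in> Obj D. \<forall>y \<in> Obj D. \<forall>z \<in> Obj D.
        Assoc M w x (TObj M y z) \<cdot>\<^bsub>D\<^esub> Assoc M (TObj M w x) y z =
        TArr M (Ident D w) (Assoc M x y z) \<cdot>\<^bsub>D\<^esub> Assoc M w (TObj M x y) z
          \<cdot>\<^bsub>D\<^esub> TArr M (Assoc M w x y) (Ident D z)) \<and>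
     (\<forall>x \<in> Obj D. \<forall>y \<in> Obj D.
        TArr M (Ident D x) (LUnit M y) \<cdot>\<^bsub>D\<^esub> Assoc M x I y = TArr M (RUnit M x) (Ident D y)) \<and>
     (\<forall>x \<in> Obj D. \<forall>y \<in> Obj D. \<forall>z \<in> Obj D.
        Assoc M y z x \<cdot>\<^bsub>D\<^esub> Braid M x (TObj M y z) \<cdot>\<^bsub>D\<^esub> Assoc M x y z =
        TArr M (Ident D y) (Braid M x z) \<cdot>\<^bsub>D\<^esub> Assoc M y x z
          \<cdot>\<^bsub>D\<^esub> TArr M (Braid M x y) (Ident D z)) \<and>
     (\<forall>x \<in> Obj D. \<forall>y \<in> Obj D. Braid M y x \<cdot>\<^bsub>D\<^esub> Braid M x y = Ident D (TObj M x y))"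

text \<open>Strong symmetric monoidal functors; the structure isomorphisms are
  \<open>m x y : F x \<otimes> F y \<rightarrow> F (x \<otimes> y)\<close> and \<open>e : I' \<rightarrow> F I\<close>.\<close>

definition symmetric_monoidal_functor ::
  "('x, 'e) cat \<Rightarrow> ('x, 'e) tensor \<Rightarrow> 'x \<Rightarrow> ('y, 'd) cat \<Rightarrow> ('y, 'd) tensor \<Rightarrow> 'y \<Rightarrow>
   ('x \<Rightarrow> 'y) \<Rightarrow> ('e \<Rightarrow> 'd) \<Rightarrow> ('x \<Rightarrow> 'x \<Rightarrow> 'd) \<Rightarrow> 'd \<Rightarrow> bool" where
  "symmetric_monoidal_functor D M I D' M' I' Fo Fa m e \<longleftrightarrow> is_functor D D' Fo Fa \<and>
     (\<forall>x \<in> Obj D. \<forall>y \<in> Obj D. iso_in D' (TObj M' (Fo x) (Fo y)) (Fo (TObj M x y)) (m x y)) \<and>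
     iso_in D' I' (Fo I) e \<and>
     (\<forall>x x' y y'. \<forall>a \<in> Hom D x x'. \<forall>b \<in> Hom D y y'.
        m x' y' \<cdot>\<^bsub>D'\<^esub> TArr M' (Fa a) (Fa b) = Fa (TArr M a b) \<cdot>\<^bsub>D'\<^esub> m x y) \<and>
     (\<forall>x \<in> Obj D. \<forall>y \<in> Obj D. \<forall>z \<in> Obj D.
        Fa (Assoc M x y z) \<cdot>\<^bsub>D'\<^esub> m (TObj M x y) z \<cdot>\<^bsub>D'\<^esub> TArr M' (m x y) (Ident D' (Fo z)) =
        m x (TObj M y z) \<cdot>\<^bsub>D'\<^esub> TArr M' (Ident D' (Fo x)) (m y z)
          \<cdot>\<^bsub>D'\<^esub> Assoc M' (Fo x) (Fo y) (Fo z)) \<and>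
     (\<forall>x \<in> Obj D.
        Fa (LUnit M x) \<cdot>\<^bsub>D'\<^esub> m I x \<cdot>\<^bsub>D'\<^esub> TArr M' e (Ident D' (Fo x)) = LUnit M' (Fo x) \<and>
        Fa (RUnit M x) \<cdot>\<^bsub>D'\<^esub> m x I \<cdot>\<^bsub>D'\<^esub> TArr M' (Ident D' (Fo x)) e = RUnit M' (Fo x)) \<and>
     (\<forall>x \<in> Obj D. \<forall>y \<in> Obj D.
        Fa (Braid M x y) \<cdot>\<^bsub>D'\<^esub> m x y = m y x \<cdot>\<^bsub>D'\<^esub> Braid M' (Fo x) (Fo y))"

text \<open>A fibred category with a tensor product \<open>E \<times>\<^bsub>C\<^esub> E \<rightarrow> E\<close> over \<open>C\<close>, a unit section \<open>C \<rightarrow> E\<close> with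
  values \<open>Io\<close> on objects and \<open>Ia\<close> on arrows, and vertical constraints that are natural with respect
  to all arrows of \<open>E\<close>.\<close>

definition symmetric_monoidal_fibred ::
  "('o, 'a) cat \<Rightarrow> ('o, 'a, 'x, 'e) fibcat \<Rightarrow> ('x, 'e) tensor \<Rightarrow> ('o \<Rightarrow> 'x) \<Rightarrow> ('a \<Rightarrow> 'e) \<Rightarrow> bool" where
  "symmetric_monoidal_fibred C E M Io Ia \<longleftrightarrow> fibred_in_groupoids C E \<and>
     (\<forall>S \<in> Obj C. symmetric_monoidal_category (fibre C E S) M (Io S)) \<and>
     is_functor C E Io Ia \<and> (\<forall>S \<in> Obj C. PObj E (Io S) = S) \<and> (\<forall>f \<in> Arr C. PArr E (Ia f) = f) \<and>
     (\<forall>f x x' y y'. \<forall>a \<in> HomOver E f x x'. \<forall>b \<in> HomOver E f y y'.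
        TArr M a b \<in> HomOver E f (TObj M x y) (TObj M x' y') \<and>
        Braid M x' y' \<cdot>\<^bsub>E\<^esub> TArr M a b = TArr M b a \<cdot>\<^bsub>E\<^esub> Braid M x y) \<and>
     (\<forall>f f' x x' x'' y y' y''. \<forall>a \<in> HomOver E f x x'. \<forall>a' \<in> HomOver E f' x' x''.
        \<forall>b \<in> HomOver E f y y'. \<forall>b' \<in> HomOver E f' y' y''.
        TArr M (a' \<cdot>\<^bsub>E\<^esub> a) (b' \<cdot>\<^bsub>E\<^esub> b) = TArr M a' b' \<cdot>\<^bsub>E\<^esub> TArr M a b) \<and>
     (\<forall>f x x' y y' z z'. \<forall>a \<in> HomOver E f x x'. \<forall>b \<in> HomOver E f y y'. \<forall>c \<in> HomOver E f z z'.
        Assoc M x' y' z' \<cdot>\<^bsub>E\<^esub> TArr M (TArr M a b) c = TArr M a (TArr M b c) \<cdot>\<^bsub>E\<^esub> Assoc M x y z) \<and>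
     (\<forall>f x x'. \<forall>a \<in> HomOver E f x x'.
        LUnit M x' \<cdot>\<^bsub>E\<^esub> TArr M (Ia f) a = a \<cdot>\<^bsub>E\<^esub> LUnit M x \<and>
        RUnit M x' \<cdot>\<^bsub>E\<^esub> TArr M a (Ia f) = a \<cdot>\<^bsub>E\<^esub> RUnit M x)"

definition symmetric_monoidal_fibred_functor ::
  "('o, 'a) cat \<Rightarrow> ('o, 'a, 'x, 'e) fibcat \<Rightarrow> ('x, 'e) tensor \<Rightarrow> ('o \<Rightarrow> 'x) \<Rightarrow> ('a \<Rightarrow> 'e) \<Rightarrow>
   ('o, 'a, 'y, 'd) fibcat \<Rightarrow> ('y, 'd) tensor \<Rightarrow> ('o \<Rightarrow> 'y) \<Rightarrow> ('a \<Rightarrow> 'd) \<Rightarrow>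
   ('x \<Rightarrow> 'y) \<Rightarrow> ('e \<Rightarrow> 'd) \<Rightarrow> ('x \<Rightarrow> 'x \<Rightarrow> 'd) \<Rightarrow> ('o \<Rightarrow> 'd) \<Rightarrow> bool" where
  "symmetric_monoidal_fibred_functor C E M Io Ia E' M' Io' Ia' Fo Fa m e \<longleftrightarrow>
     fibred_functor E E' Fo Fa \<and>
     (\<forall>S \<in> Obj C. symmetric_monoidal_functor (fibre C E S) M (Io S) (fibre C E' S) M' (Io' S)
        Fo Fa m (e S)) \<and>
     (\<forall>f x x' y y'. \<forall>a \<in> HomOver E f x x'. \<forall>b \<in> HomOver E f y y'.
        m x' y' \<cdot>\<^bsub>E'\<^esub> TArr M' (Fa a) (Fa b) = Fa (TArr M a b) \<cdot>\<^bsub>E'\<^esub> m x y) \<and>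
     (\<forall>f \<in> Arr C. e (Cod C f) \<cdot>\<^bsub>E'\<^esub> Ia' f = Fa (Ia f) \<cdot>\<^bsub>E'\<^esub> e (Dom C f))"

section \<open>The stack Div\<close>

definition O_groupoid ::
  "('o, 'a) cat \<Rightarrow> ('o, 'a) monoid_data \<Rightarrow> ('o, 'a, 'o \<times> 'a, 'a \<times> 'a \<times> 'a \<times> 'a) fibcat" where
  "O_groupoid C A =
     action_groupoid C (mcar A) (\<lambda>S. units_of (sections C A S)) (\<lambda>S. monoid.mult (sections C A S))"

text \<open>The strict symmetric monoidal structure on \<open>O_groupoid C A\<close> given by multiplication in \<open>\<O>\<close>.\<close>

definition O_tensor ::
  "('o, 'a) cat \<Rightarrow> ('o, 'a) monoid_data \<Rightarrow> ('o \<times> 'a, 'a \<times> 'a \<times> 'a \<times> 'a) tensor" where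
  "O_tensor C A =
     (let G = O_groupoid C A; tens = (\<lambda>(S, x) (T, y). (S, x \<otimes>\<^bsub>sections C A S\<^esub> y)) in
     \<lparr>TObj = tens,
      TArr = (\<lambda>(f, g, y, x) (f', g', y', x').
        (f, g \<otimes>\<^bsub>sections C A (Dom C f)\<^esub> g',
         y \<otimes>\<^bsub>sections C A (Dom C f)\<^esub> y', x \<otimes>\<^bsub>sections C A (Cod C f)\<^esub> x')),
      Assoc = (\<lambda>x y z. Ident G (tens (tens x y) z)),
      LUnit = Ident G,
      RUnit = Ident G,
      Braid = (\<lambda>x y. Ident G (tens x y))\<rparr>)"

definition O_unit_obj :: "('o, 'a) cat \<Rightarrow> ('o, 'a) monoid_data \<Rightarrow> 'o \<Rightarrow> 'o \<times> 'a" where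
  "O_unit_obj C A S = (S, \<one>\<^bsub>sections C A S\<^esub>)"

definition O_unit_arr :: "('o, 'a) cat \<Rightarrow> ('o, 'a) monoid_data \<Rightarrow> 'a \<Rightarrow> 'a \<times> 'a \<times> 'a \<times> 'a" where
  "O_unit_arr C A f = (f, \<one>\<^bsub>sections C A (Dom C f)\<^esub>,
     \<one>\<^bsub>sections C A (Dom C f)\<^esub>, \<one>\<^bsub>sections C A (Cod C f)\<^esub>)"

text \<open>\<open>D\<close> is the quotient stack \<open>[\<O>/\<O>\<^sup>\<times>]\<close>, with projection \<open>q\<close> from \<open>\<O>\<close>, and its symmetric monoidal
  structure is induced by multiplication in \<open>\<O>\<close>: the projection is symmetric monoidal, with structure
  isomorphisms \<open>m\<close> and \<open>e\<close>. As usual for quotient stacks, this determines \<open>D\<close> up to equivalence of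
  symmetric monoidal stacks.\<close>

definition is_Div ::
  "('o, 'a) cat \<Rightarrow> ('o \<Rightarrow> 'a set set) \<Rightarrow> ('o, 'a) monoid_data \<Rightarrow>
   ('o, 'a, 'x, 'e) fibcat \<Rightarrow> ('x, 'e) tensor \<Rightarrow> ('o \<Rightarrow> 'x) \<Rightarrow> ('a \<Rightarrow> 'e) \<Rightarrow>
   ('o \<times> 'a \<Rightarrow> 'x) \<Rightarrow> ('a \<times> 'a \<times> 'a \<times> 'a \<Rightarrow> 'e) \<Rightarrow>
   ('o \<times> 'a \<Rightarrow> 'o \<times> 'a \<Rightarrow> 'e) \<Rightarrow> ('o \<Rightarrow> 'e) \<Rightarrow> bool" where
  "is_Div C Cov A D M Io Ia qo qa m e \<longleftrightarrow>
     quotient_stack C Cov (mcar A)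
       (\<lambda>S. units_of (sections C A S)) (\<lambda>S. monoid.mult (sections C A S)) D qo qa \<and>
     symmetric_monoidal_fibred C D M Io Ia \<and>
     symmetric_monoidal_fibred_functor C
       (O_groupoid C A) (O_tensor C A) (O_unit_obj C A) (O_unit_arr C A)
       D M Io Ia qo qa m e"

section \<open>The stack of symmetric monoidal functors\<close>

text \<open>A monoid as a symmetric monoidal category with only identity arrows; the element \<open>p\<close> is also
  the identity arrow of the object \<open>p\<close>.\<close>

definition discrete_cat :: "('p, 'm) monoid_scheme \<Rightarrow> ('p, 'p) cat" where
  "discrete_cat P = \<lparr>Obj = carrier P, Arr = carrier P, Dom = (\<lambda>p. p), Cod = (\<lambda>p. p),
     Ident = (\<lambda>p. p), Comp = (\<lambda>p q. p)\<rparr>"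

definition discrete_tensor :: "('p, 'm) monoid_scheme \<Rightarrow> ('p, 'p) tensor" where
  "discrete_tensor P = \<lparr>TObj = (\<lambda>p q. p \<otimes>\<^bsub>P\<^esub> q), TArr = (\<lambda>p q. p \<otimes>\<^bsub>P\<^esub> q),
     Assoc = (\<lambda>p q r. p \<otimes>\<^bsub>P\<^esub> q \<otimes>\<^bsub>P\<^esub> r), LUnit = (\<lambda>p. p), RUnit = (\<lambda>p. p),
     Braid = (\<lambda>p q. p \<otimes>\<^bsub>P\<^esub> q)\<rparr>"

text \<open>An object over \<open>S\<close> is \<open>(S, L, \<mu>, \<epsilon>)\<close>, where \<open>L\<close> is a symmetric monoidal functor from \<open>P\<close> to the
  fibre over \<open>S\<close> with structure isomorphisms \<open>\<mu>\<close> and \<open>\<epsilon>\<close>. An arrow over \<open>f\<close> is \<open>(f, y, x, a)\<close>, where \<open>a\<close>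
  is a family of arrows over \<open>f\<close> compatible with the structure isomorphisms; equivalently, \<open>a\<close> is a
  monoidal natural isomorphism from \<open>y\<close> to the pullback of \<open>x\<close> along \<open>f\<close>. Functions with domain \<open>P\<close> are
  taken to be undefined outside the carrier.\<close>

type_synonym ('o, 'p, 'x, 'e) smfun = "'o \<times> ('p \<Rightarrow> 'x) \<times> ('p \<Rightarrow> 'p \<Rightarrow> 'e) \<times> 'e"

definition smfun_objects ::
  "('o, 'a) cat \<Rightarrow> ('p, 'm) monoid_scheme \<Rightarrow>
   ('o, 'a, 'x, 'e) fibcat \<Rightarrow> ('x, 'e) tensor \<Rightarrow> ('o \<Rightarrow> 'x) \<Rightarrow> ('o, 'p, 'x, 'e) smfun set" where
  "smfun_objects C P E M Io = {(S, L, \<mu>, \<epsilon>). S \<in> Obj C \<and>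
     L \<in> extensional (carrier P) \<and> \<mu> \<in> extensional (carrier P) \<and>
     (\<forall>p \<in> carrier P. \<mu> p \<in> extensional (carrier P)) \<and>
     symmetric_monoidal_functor (discrete_cat P) (discrete_tensor P) \<one>\<^bsub>P\<^esub>
       (fibre C E S) M (Io S) L (\<lambda>p. Ident E (L p)) \<mu> \<epsilon>}"

definition smfun_arrows ::
  "('o, 'a) cat \<Rightarrow> ('p, 'm) monoid_scheme \<Rightarrow>
   ('o, 'a, 'x, 'e) fibcat \<Rightarrow> ('x, 'e) tensor \<Rightarrow> ('o \<Rightarrow> 'x) \<Rightarrow> ('a \<Rightarrow> 'e) \<Rightarrow>
   ('a \<times> ('o, 'p, 'x, 'e) smfun \<times> ('o, 'p, 'x, 'e) smfun \<times> ('p \<Rightarrow> 'e)) set" where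
  "smfun_arrows C P E M Io Ia = {(f, (T, L, \<mu>, \<epsilon>), (S, L', \<mu>', \<epsilon>'), a). f \<in> Hom C T S \<and>
     (T, L, \<mu>, \<epsilon>) \<in> smfun_objects C P E M Io \<and> (S, L', \<mu>', \<epsilon>') \<in> smfun_objects C P E M Io \<and>
     a \<in> extensional (carrier P) \<and>
     (\<forall>p \<in> carrier P. a p \<in> HomOver E f (L p) (L' p)) \<and>
     (\<forall>p \<in> carrier P. \<forall>q \<in> carrier P.
        a (p \<otimes>\<^bsub>P\<^esub> q) \<cdot>\<^bsub>E\<^esub> \<mu> p q = \<mu>' p q \<cdot>\<^bsub>E\<^esub> TArr M (a p) (a q)) \<and>
     a \<one>\<^bsub>P\<^esub> \<cdot>\<^bsub>E\<^esub> \<epsilon> = \<epsilon>' \<cdot>\<^bsub>E\<^esub> Ia f}"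

definition smfun_stack ::
  "('o, 'a) cat \<Rightarrow> ('p, 'm) monoid_scheme \<Rightarrow>
   ('o, 'a, 'x, 'e) fibcat \<Rightarrow> ('x, 'e) tensor \<Rightarrow> ('o \<Rightarrow> 'x) \<Rightarrow> ('a \<Rightarrow> 'e) \<Rightarrow>
   ('o, 'a, ('o, 'p, 'x, 'e) smfun,
    'a \<times> ('o, 'p, 'x, 'e) smfun \<times> ('o, 'p, 'x, 'e) smfun \<times> ('p \<Rightarrow> 'e)) fibcat" where
  "smfun_stack C P E M Io Ia =
     \<lparr>Obj = smfun_objects C P E M Io,
      Arr = smfun_arrows C P E M Io Ia,
      Dom = (\<lambda>(f, y, x, a). y),
      Cod = (\<lambda>(f, y, x, a). x),
      Ident = (\<lambda>x. (Ident C (fst x), x, x, \<lambda>p \<in> carrier P. Ident E (fst (snd x) p))),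
      Comp = (\<lambda>(f, y, x, a) (h, z, w, b). (f \<cdot>\<^bsub>C\<^esub> h, z, x, \<lambda>p \<in> carrier P. a p \<cdot>\<^bsub>E\<^esub> b p)),
      PObj = fst,
      PArr = fst\<rparr>"

text \<open>The natural map from \<open>AP\<close> to the stack of symmetric monoidal functors: a section
  \<open>s : S \<rightarrow> AP\<close>, corresponding to the homomorphism \<open>\<lambda>p. u p \<cdot>\<^bsub>C\<^esub> s\<close>, goes to the composite of this
  homomorphism with the symmetric monoidal functor \<open>\<O>(S) \<rightarrow> Div(S)\<close>.\<close>

definition natural_map_obj ::
  "('o, 'a) cat \<Rightarrow> ('p, 'm) monoid_scheme \<Rightarrow> ('p \<Rightarrow> 'a) \<Rightarrow>
   ('o \<times> 'a \<Rightarrow> 'x) \<Rightarrow> ('o \<times> 'a \<Rightarrow> 'o \<times> 'a \<Rightarrow> 'e) \<Rightarrow> ('o \<Rightarrow> 'e) \<Rightarrow>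
   'o \<times> 'a \<Rightarrow> ('o, 'p, 'x, 'e) smfun" where
  "natural_map_obj C P u qo m e = (\<lambda>(S, s).
     (S, (\<lambda>p \<in> carrier P. qo (S, u p \<cdot>\<^bsub>C\<^esub> s)),
      (\<lambda>p \<in> carrier P. \<lambda>q \<in> carrier P. m (S, u p \<cdot>\<^bsub>C\<^esub> s) (S, u q \<cdot>\<^bsub>C\<^esub> s)), e S))"

text \<open>An element \<open>g : T \<rightarrow> GP\<close>, corresponding to the homomorphism \<open>\<lambda>p. v p \<cdot>\<^bsub>C\<^esub> g\<close>, acts through the
  images of the units \<open>v p \<cdot>\<^bsub>C\<^esub> g\<close>.\<close>

definition natural_map_arr ::
  "('o, 'a) cat \<Rightarrow> ('p, 'm) monoid_scheme \<Rightarrow> ('p \<Rightarrow> 'a) \<Rightarrow> ('p \<Rightarrow> 'a) \<Rightarrow>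
   ('o \<times> 'a \<Rightarrow> 'x) \<Rightarrow> ('a \<times> 'a \<times> 'a \<times> 'a \<Rightarrow> 'e) \<Rightarrow> ('o \<times> 'a \<Rightarrow> 'o \<times> 'a \<Rightarrow> 'e) \<Rightarrow> ('o \<Rightarrow> 'e) \<Rightarrow>
   'a \<times> 'a \<times> 'a \<times> 'a \<Rightarrow>
   'a \<times> ('o, 'p, 'x, 'e) smfun \<times> ('o, 'p, 'x, 'e) smfun \<times> ('p \<Rightarrow> 'e)" where
  "natural_map_arr C P u v qo qa m e = (\<lambda>(f, g, t, s).
     (f, natural_map_obj C P u qo m e (Dom C f, t), natural_map_obj C P u qo m e (Cod C f, s),
      \<lambda>p \<in> carrier P. qa (f, v p \<cdot>\<^bsub>C\<^esub> g, u p \<cdot>\<^bsub>C\<^esub> t, u p \<cdot>\<^bsub>C\<^esub> s)))"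

end

theory Submission
  imports Defs "HOL-Algebra.FiniteProduct"
begin

text \<open>Pulling back, gluing arrows and gluing objects can be done separately for every element of \<open>P\<close>,
  and the structure isomorphisms and their coherence then follow by uniqueness; so symmetric monoidal
  functors from \<open>P\<close> into a stack form a stack. Because \<open>\<O>\<^sup>\<times>\<close> is a sheaf, the projection \<open>\<O> \<rightarrow> Div\<close> is
  already fully faithful on its image, hence so is the natural map, for every monoid \<open>P\<close>. The
  hypotheses on \<open>P\<close> are needed for local surjectivity. After passing to a covering, a functor
  \<open>L : P \<rightarrow> Div(S)\<close> has \<open>L p\<close> in the image of \<open>\<O>\<close> for the finitely many generators \<open>p\<close>. The triples of
  an element \<open>p\<close>, a section \<open>s\<close> and an isomorphism \<open>L p \<cong> q(s)\<close> then form a commutative monoid that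
  is a torsor under \<open>\<O>\<^sup>\<times>(S)\<close> over \<open>P\<close>. It has a multiplicative section since \<open>P\<^sup>g\<^sup>p\<close> is free, and such
  a section is an isomorphism of \<open>L\<close> with an object of the image of the natural map.\<close>

section \<open>Fibred categories\<close>

text \<open>\<open>Div\<close> is known only through its description as an associated stack, and no
  pullbacks are chosen in it. Arrows over a given base arrow take the place of pullbacks, and the
  working principle is that every arrow of a category fibred in groupoids is cartesian: an equation
  may be proved after composing with such an arrow, or on a covering. For local surjectivity the
  only covering ever chosen is one that trivialises \<open>L\<close> on the generators. Over each of
  its members the torsor splits without further refinement: the obstruction lies in
  Ext(\<open>P^gp\<close>, G) with G the group of units over that member, and it vanishes for every
  abelian group G because \<open>P^gp\<close> is free. The splitting uses a presentation instead of
  a basis of \<open>P^gp\<close>. Generators X give a map from Z^X onto \<open>P^gp\<close>; its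
  kernel K is the group of relations, and vanishing of Ext means that every homomorphism from K to G
  extends to Z^X. The extension is built by an explicit reduction from the saturation of K, so the
  structure of finitely generated abelian groups is not invoked.\<close>

context category
begin

lemma arr_ends [simp]:
  assumes "f \<in> Arr C" shows "Dom C f \<in> Obj C" "Cod C f \<in> Obj C"
  using dom_cod[OF assms] by auto

lemma ident_simps [simp]:
  assumes "X \<in> Obj C"
  shows "Ident C X \<in> Arr C" "Dom C (Ident C X) = X" "Cod C (Ident C X) = X"
  using ident[OF assms] by (auto simp: Hom_def)

lemma comp_simps [simp]:
  assumes "f \<in> Arr C" "g \<in> Arr C" "Cod C f = Dom C g"
  shows "g \<cdot>\<^bsub>C\<^esub> f \<in> Arr C" "Dom C (g \<cdot>\<^bsub>C\<^esub> f) = Dom C f" "Cod C (g \<cdot>\<^bsub>C\<^esub> f) = Cod C g"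
  using comp[of f "Dom C f" "Cod C f" g "Cod C g"] assms by (auto simp: Hom_def)

lemma comp_ident_simps [simp]:
  assumes "f \<in> Arr C"
  shows "Dom C f = X \<Longrightarrow> f \<cdot>\<^bsub>C\<^esub> Ident C X = f" "Cod C f = Y \<Longrightarrow> Ident C Y \<cdot>\<^bsub>C\<^esub> f = f"
  using comp_ident[of f "Dom C f" "Cod C f"] assms by (auto simp: Hom_def)

lemma assoc:
  assumes "f \<in> Arr C" "g \<in> Arr C" "h \<in> Arr C" "Cod C f = Dom C g" "Cod C g = Dom C h"
  shows "h \<cdot>\<^bsub>C\<^esub> g \<cdot>\<^bsub>C\<^esub> f = h \<cdot>\<^bsub>C\<^esub> (g \<cdot>\<^bsub>C\<^esub> f)"
  using comp_assoc[of f "Dom C f" "Cod C f" g "Cod C g" h "Cod C h"] assms by (auto simp: Hom_def)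

lemma HomD:
  assumes "f \<in> Hom C X Y" shows "f \<in> Arr C" "Dom C f = X" "Cod C f = Y" "X \<in> Obj C" "Y \<in> Obj C"
  using assms arr_ends[of f] by (auto simp: Hom_def)

lemma comp_Hom:
  "g \<in> Hom C Y Z \<Longrightarrow> f \<in> Hom C X Y \<Longrightarrow> g \<cdot>\<^bsub>C\<^esub> f \<in> Hom C X Z"
  by (rule comp)

lemma is_iso_ident: "X \<in> Obj C \<Longrightarrow> is_iso C (Ident C X)"
  unfolding is_iso_def by (auto simp: Hom_def intro!: bexI[of _ "Ident C X"])

end

section \<open>Sieves generated by families of arrows\<close>

context
  fixes C :: "('o, 'a) cat"
  assumes "category C"
begin

interpretation category C by fact

lemma comp_in_sieve:
  assumes "\<And>f. f \<in> \<U> \<Longrightarrow> f \<in> Arr C" "f \<in> sieve C \<U>" "h \<in> Arr C" "Cod C h = Dom C f"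
  shows "f \<cdot>\<^bsub>C\<^esub> h \<in> sieve C \<U>"
proof -
  obtain g k where g: "f = g \<cdot>\<^bsub>C\<^esub> k" "g \<in> \<U>" "k \<in> Arr C" "Cod C k = Dom C g"
    using assms(2) unfolding sieve_def by blast
  have "f \<cdot>\<^bsub>C\<^esub> h = g \<cdot>\<^bsub>C\<^esub> (k \<cdot>\<^bsub>C\<^esub> h)" using g assms by (simp add: assoc)
  moreover have "k \<cdot>\<^bsub>C\<^esub> h \<in> Arr C" "Cod C (k \<cdot>\<^bsub>C\<^esub> h) = Dom C g" using g assms by simp_all
  ultimately show ?thesis using g(2) unfolding sieve_def by blast
qed

lemma sieve_arr:
  assumes "\<And>f. f \<in> \<U> \<Longrightarrow> f \<in> Arr C \<and> Cod C f = S" "f \<in> sieve C \<U>"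
  shows "f \<in> Arr C" "Cod C f = S"
proof -
  obtain g k where g: "f = g \<cdot>\<^bsub>C\<^esub> k" "g \<in> \<U>" "k \<in> Arr C" "Cod C k = Dom C g"
    using assms(2) unfolding sieve_def by blast
  then show "f \<in> Arr C" "Cod C f = S" using assms(1)[OF g(2)] by simp_all
qed

lemma covering_in_sieve:
  assumes "f \<in> \<U>" "f \<in> Arr C" shows "f \<in> sieve C \<U>"
proof -
  have "f = f \<cdot>\<^bsub>C\<^esub> Ident C (Dom C f)" "Ident C (Dom C f) \<in> Arr C"
    "Cod C (Ident C (Dom C f)) = Dom C f" using assms by simp_all
  then show ?thesis using assms(1) unfolding sieve_def by blast
qed

end

section \<open>Lifting, factoring and cancelling in categories fibred in groupoids\<close>

lemma HomOver_iff:
  "a \<in> HomOver E f y x \<longleftrightarrow> a \<in> Arr E \<and> Dom E a = y \<and> Cod E a = x \<and> PArr E a = f"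
  by (auto simp: HomOver_def Hom_def)

lemma Over_iff: "x \<in> Over E S \<longleftrightarrow> x \<in> Obj E \<and> PObj E x = S"
  by (auto simp: Over_def)

locale fibred = base: category C + total: category E
  for C :: "('o, 'a) cat" and E :: "('o, 'a, 'x, 'e) fibcat" +
  assumes fibred: "fibred_in_groupoids C E"

lemma fibredI: "category C \<Longrightarrow> fibred_in_groupoids C E \<Longrightarrow> fibred C E"
  unfolding fibred_def fibred_axioms_def fibred_in_groupoids_def by blast

context fibred
begin

lemma projection_functor: "is_functor E C (PObj E) (PArr E)"
  using fibred unfolding fibred_in_groupoids_def by blast

lemma PObj_in [simp]: "x \<in> Obj E \<Longrightarrow> PObj E x \<in> Obj C"
  and PArr_ident [simp]: "x \<in> Obj E \<Longrightarrow> PArr E (Ident E x) = Ident C (PObj E x)"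
  using projection_functor unfolding is_functor_def by blast+

lemma PArr_simps [simp]:
  assumes "a \<in> Arr E"
  shows "PArr E a \<in> Arr C" "PObj E (Dom E a) = Dom C (PArr E a)"
    "PObj E (Cod E a) = Cod C (PArr E a)"
proof -
  have "PArr E a \<in> Hom C (PObj E (Dom E a)) (PObj E (Cod E a))"
    using projection_functor assms unfolding is_functor_def by blast
  then show "PArr E a \<in> Arr C" "PObj E (Dom E a) = Dom C (PArr E a)"
    "PObj E (Cod E a) = Cod C (PArr E a)" by (simp_all add: Hom_def)
qed

lemma PArr_comp [simp]:
  assumes "a \<in> Arr E" "b \<in> Arr E" "Cod E a = Dom E b"
  shows "PArr E (b \<cdot>\<^bsub>E\<^esub> a) = PArr E b \<cdot>\<^bsub>C\<^esub> PArr E a"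
  using projection_functor assms unfolding is_functor_def by simp

lemma HomOverD:
  assumes "a \<in> HomOver E f y x"
  shows "y \<in> Obj E" "x \<in> Obj E" "PObj E y = Dom C f" "PObj E x = Cod C f" "f \<in> Arr C"
proof -
  have "a \<in> Arr E" "Dom E a = y" "Cod E a = x" "PArr E a = f"
    using assms by (simp_all add: HomOver_iff)
  then show "y \<in> Obj E" "x \<in> Obj E" "PObj E y = Dom C f" "PObj E x = Cod C f" "f \<in> Arr C"
    using PArr_simps[of a] total.arr_ends[of a] by simp_all
qed

lemma lift:
  assumes "f \<in> Arr C" "x \<in> Obj E" "PObj E x = Cod C f"
  shows "\<exists>a. a \<in> Arr E \<and> Cod E a = x \<and> PArr E a = f"
proof -
  have "x \<in> Over E (Cod C f)" using assms by (simp add: Over_iff)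
  then have "\<exists>y \<in> Over E (Dom C f). \<exists>a. a \<in> HomOver E f y x"
    using fibred assms(1) unfolding fibred_in_groupoids_def by blast
  then show ?thesis by (auto simp: HomOver_iff)
qed

text \<open>Every arrow of a category fibred in groupoids is cartesian. In this form the objects are
  read off from the arrows, so that the side conditions can be left to the simplifier.\<close>

lemma factor:
  assumes "a \<in> Arr E" "b \<in> Arr E" "Cod E a = Cod E b" "h \<in> Arr C"
    "Cod C h = Dom C (PArr E a)" "PArr E b = PArr E a \<cdot>\<^bsub>C\<^esub> h"
  shows "\<exists>!c. c \<in> Arr E \<and> Dom E c = Dom E b \<and> Cod E c = Dom E a \<and> PArr E c = h \<and> a \<cdot>\<^bsub>E\<^esub> c = b"
proof -
  have "a \<in> HomOver E (PArr E a) (Dom E a) (Cod E a)"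
    "b \<in> HomOver E (PArr E a \<cdot>\<^bsub>C\<^esub> h) (Dom E b) (Cod E a)"
    "h \<in> Hom C (PObj E (Dom E b)) (PObj E (Dom E a))"
    using assms by (auto simp: HomOver_iff Hom_def)
  then have "\<exists>!c. c \<in> HomOver E h (Dom E b) (Dom E a) \<and> a \<cdot>\<^bsub>E\<^esub> c = b"
    using fibred unfolding fibred_in_groupoids_def by blast
  then show ?thesis by (simp add: HomOver_iff conj_assoc)
qed

lemma factor_ex:
  assumes "a \<in> HomOver E f y x" "b \<in> HomOver E (f \<cdot>\<^bsub>C\<^esub> h) z x" "h \<in> Arr C" "Cod C h = Dom C f"
  shows "\<exists>c \<in> HomOver E h z y. a \<cdot>\<^bsub>E\<^esub> c = b"
proof -
  have "\<exists>!c. c \<in> Arr E \<and> Dom E c = Dom E b \<and> Cod E c = Dom E a \<and> PArr E c = h \<and> a \<cdot>\<^bsub>E\<^esub> c = b"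
    by (rule factor) (use assms in \<open>simp_all add: HomOver_iff\<close>)
  then obtain c where "c \<in> Arr E \<and> Dom E c = Dom E b \<and> Cod E c = Dom E a \<and> PArr E c = h \<and> a \<cdot>\<^bsub>E\<^esub> c = b"
    by blast
  then show ?thesis using assms(1,2) by (intro bexI[of _ c]) (simp_all add: HomOver_iff)
qed

text \<open>A cartesian arrow is monic with respect to arrows over the same base arrow. This is how
  equations about the source of an arrow are deduced from equations about its target.\<close>

lemma cancel:
  assumes "a \<in> Arr E" "c \<in> Arr E" "c' \<in> Arr E" "Cod E c = Dom E a" "Cod E c' = Dom E a"
    "PArr E c = PArr E c'" "a \<cdot>\<^bsub>E\<^esub> c = a \<cdot>\<^bsub>E\<^esub> c'"
  shows "c = c'"
proof -
  have "Dom E c = Dom E c'"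
    using assms total.comp_simps(2)[of c a] total.comp_simps(2)[of c' a] by simp
  moreover have "Cod C (PArr E c) = Dom C (PArr E a)"
    using assms by (metis PArr_simps(2,3))
  moreover have "\<exists>!k. k \<in> Arr E \<and> Dom E k = Dom E (a \<cdot>\<^bsub>E\<^esub> c) \<and> Cod E k = Dom E a \<and>
      PArr E k = PArr E c \<and> a \<cdot>\<^bsub>E\<^esub> k = a \<cdot>\<^bsub>E\<^esub> c"
    by (rule factor) (use assms(1,2,4) calculation(2) in simp_all)
  moreover have "Dom E (a \<cdot>\<^bsub>E\<^esub> c) = Dom E c" using assms(1,2,4) by simp
  ultimately show ?thesis using assms by metis
qed

text \<open>Factoring the identity of the target through \<open>a\<close> gives a right inverse, and
  cancelling \<open>a\<close> makes it two-sided. Hence the fibres are groupoids.\<close>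

lemma vertical_inverse:
  assumes "a \<in> HomOver E (Ident C S) x y" "S \<in> Obj C"
  obtains b where "b \<in> HomOver E (Ident C S) y x" "a \<cdot>\<^bsub>E\<^esub> b = Ident E y" "b \<cdot>\<^bsub>E\<^esub> a = Ident E x"
proof -
  have a: "a \<in> Arr E" "Dom E a = x" "Cod E a = y" "PArr E a = Ident C S"
    using assms by (auto simp: HomOver_iff)
  then have xy: "x \<in> Obj E" "y \<in> Obj E" "PObj E x = S" "PObj E y = S"
    using assms(2) PArr_simps(2,3)[OF a(1)] by auto
  have "Ident E y \<in> HomOver E (Ident C S \<cdot>\<^bsub>C\<^esub> Ident C S) y y"
    using xy assms(2) by (simp add: HomOver_iff)
  from factor_ex[OF assms(1) this] obtain b
    where "b \<in> HomOver E (Ident C S) y x" and ab: "a \<cdot>\<^bsub>E\<^esub> b = Ident E y"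
    using assms(2) by auto
  then have b: "b \<in> Arr E" "Dom E b = y" "Cod E b = x" "PArr E b = Ident C S" "a \<cdot>\<^bsub>E\<^esub> b = Ident E y"
    by (simp_all add: HomOver_iff)
  have "a \<cdot>\<^bsub>E\<^esub> (b \<cdot>\<^bsub>E\<^esub> a) = a \<cdot>\<^bsub>E\<^esub> Ident E x"
    using a b xy total.assoc[of a b a] by simp
  then have "b \<cdot>\<^bsub>E\<^esub> a = Ident E x"
    using cancel[of a "b \<cdot>\<^bsub>E\<^esub> a" "Ident E x"] a b xy assms(2) by simp
  then show thesis using b by (intro that[of b]) (simp_all add: HomOver_iff)
qed

text \<open>Vertical arrows are invertible, so they can be cancelled on this side as well.\<close>

lemma cancel_right:
  assumes c: "c \<in> HomOver E (Ident C S) w x" and S: "S \<in> Obj C"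
    and a: "a \<in> HomOver E f x y" and b: "b \<in> HomOver E f' x y" and eq: "a \<cdot>\<^bsub>E\<^esub> c = b \<cdot>\<^bsub>E\<^esub> c"
  shows "a = b"
proof -
  obtain d where d: "d \<in> HomOver E (Ident C S) x w" "c \<cdot>\<^bsub>E\<^esub> d = Ident E x"
    using vertical_inverse[OF c S] by metis
  note t = a[unfolded HomOver_iff] b[unfolded HomOver_iff] c[unfolded HomOver_iff] d(1)[unfolded HomOver_iff]
  have "a = a \<cdot>\<^bsub>E\<^esub> c \<cdot>\<^bsub>E\<^esub> d" using t d(2) by (simp add: total.assoc)
  also have "\<dots> = b" unfolding eq using t d(2) by (simp add: total.assoc)
  finally show ?thesis .
qed

text \<open>The solution is \<open>d\<close> composed with the inverse of \<open>c\<close>. This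
  justifies the definite descriptions by which trivialisations are multiplied later.\<close>

lemma factor_vertical:
  assumes c: "c \<in> HomOver E (Ident C S) w x" and S: "S \<in> Obj C" and d: "d \<in> HomOver E (Ident C S) w y"
  shows "\<exists>!b. b \<in> HomOver E (Ident C S) x y \<and> b \<cdot>\<^bsub>E\<^esub> c = d"
proof -
  obtain c' where c': "c' \<in> HomOver E (Ident C S) x w" "c' \<cdot>\<^bsub>E\<^esub> c = Ident E w"
    using vertical_inverse[OF c S] by metis
  note t = c[unfolded HomOver_iff] d[unfolded HomOver_iff] c'(1)[unfolded HomOver_iff]
  show ?thesis
  proof (rule ex1I[of _ "d \<cdot>\<^bsub>E\<^esub> c'"])
    show "d \<cdot>\<^bsub>E\<^esub> c' \<in> HomOver E (Ident C S) x y \<and> d \<cdot>\<^bsub>E\<^esub> c' \<cdot>\<^bsub>E\<^esub> c = d"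
      using t c'(2) S by (simp add: HomOver_iff total.assoc)
    fix b assume "b \<in> HomOver E (Ident C S) x y \<and> b \<cdot>\<^bsub>E\<^esub> c = d"
    then show "b = d \<cdot>\<^bsub>E\<^esub> c'"
      using cancel_right[OF c S, of b _ y "d \<cdot>\<^bsub>E\<^esub> c'"] t c'(2) S
      by (simp add: HomOver_iff total.assoc)
  qed
qed

end

section \<open>Gluing and comparing arrows in a stack\<close>

locale fibred_stack = fibred C E for C :: "('o, 'a) cat" and E :: "('o, 'a, 'x, 'e) fibcat" +
  fixes Cov :: "'o \<Rightarrow> 'a set set"
  assumes topology: "grothendieck_topology C Cov" and stack: "stack C Cov E"
begin

lemma covering_arr: "U \<in> Obj C \<Longrightarrow> \<U> \<in> Cov U \<Longrightarrow> f \<in> \<U> \<Longrightarrow> f \<in> Arr C \<and> Cod C f = U"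
  using topology[unfolded grothendieck_topology_def, THEN conjunct1] by blast

lemma ident_covering: "U \<in> Obj C \<Longrightarrow> {Ident C U} \<in> Cov U"
  using topology[unfolded grothendieck_topology_def, THEN conjunct2, THEN conjunct1]
    base.is_iso_ident[of U] base.ident_simps(3)[of U] by metis

lemma compose_coverings:
  assumes "U \<in> Obj C" "\<U> \<in> Cov U" "\<And>f. f \<in> \<U> \<Longrightarrow> \<V> f \<in> Cov (Dom C f)"
  shows "{f \<cdot>\<^bsub>C\<^esub> g | f g. f \<in> \<U> \<and> g \<in> \<V> f} \<in> Cov U"
proof -
  have "\<forall>f \<in> \<U>. \<V> f \<in> Cov (Dom C f)" using assms(3) by blast
  then show ?thesis
    using topology[unfolded grothendieck_topology_def, THEN conjunct2, THEN conjunct2, THEN conjunct2]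
      assms(1,2) by blast
qed

lemma covering_sieve_arr:
  assumes "S \<in> Obj C" "\<U> \<in> Cov S" "f \<in> sieve C \<U>"
  shows "f \<in> Arr C" "Cod C f = S"
  using sieve_arr[OF base.category_axioms _ assms(3)] covering_arr[OF assms(1,2)] by blast+

lemma covering_comp_in_sieve:
  assumes "S \<in> Obj C" "\<U> \<in> Cov S" "f \<in> sieve C \<U>" "h \<in> Arr C" "Cod C h = Dom C f"
  shows "f \<cdot>\<^bsub>C\<^esub> h \<in> sieve C \<U>"
  using comp_in_sieve[OF base.category_axioms _ assms(3-5)] covering_arr[OF assms(1,2)] by blast

text \<open>Every arrow to \<open>x\<close> over a member \<open>f\<close> of the sieve factors through \<open>c f\<close> by a vertical arrow,
  so data on the chosen arrows \<open>c f\<close> determine data on all arrows.\<close>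

lemma glue_arrow:
  assumes S: "S \<in> Obj C" and U: "\<U> \<in> Cov S" and x: "x \<in> Over E S" and y: "y \<in> Over E S"
    and c: "\<And>f. f \<in> sieve C \<U> \<Longrightarrow> c f \<in> HomOver E f (z f) x"
    and d: "\<And>f. f \<in> sieve C \<U> \<Longrightarrow> d f \<in> HomOver E f (z f) y"
    and t: "\<And>f h. \<lbrakk>f \<in> sieve C \<U>; h \<in> Arr C; Cod C h = Dom C f\<rbrakk> \<Longrightarrow>
      \<exists>t \<in> HomOver E h (z (f \<cdot>\<^bsub>C\<^esub> h)) (z f).
        c f \<cdot>\<^bsub>E\<^esub> t = c (f \<cdot>\<^bsub>C\<^esub> h) \<and> d f \<cdot>\<^bsub>E\<^esub> t = d (f \<cdot>\<^bsub>C\<^esub> h)"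
  shows "\<exists>!b. b \<in> HomOver E (Ident C S) x y \<and> (\<forall>f \<in> sieve C \<U>. b \<cdot>\<^bsub>E\<^esub> c f = d f)"
proof -
  note R_arr = covering_sieve_arr[OF S U]
  note R_comp = covering_comp_in_sieve[OF S U]
  define t where "t = (\<lambda>k. THE t. t \<in> Arr E \<and> Dom E t = Dom E k \<and> Cod E t = z (PArr E k) \<and>
    PArr E t = Ident C (Dom C (PArr E k)) \<and> c (PArr E k) \<cdot>\<^bsub>E\<^esub> t = k)"
  have tt: "t k \<in> Arr E \<and> Dom E (t k) = Dom E k \<and> Cod E (t k) = z (PArr E k) \<and>
      PArr E (t k) = Ident C (Dom C (PArr E k)) \<and> c (PArr E k) \<cdot>\<^bsub>E\<^esub> (t k) = k"
    if k: "k \<in> Arr E" "Cod E k = x" "PArr E k \<in> sieve C \<U>" for k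
  proof -
    have "\<exists>!t. t \<in> Arr E \<and> Dom E t = Dom E k \<and> Cod E t = Dom E (c (PArr E k)) \<and>
        PArr E t = Ident C (Dom C (PArr E k)) \<and> c (PArr E k) \<cdot>\<^bsub>E\<^esub> t = k"
      by (rule factor) (use c[OF k(3)] k in \<open>auto simp: HomOver_iff\<close>)
    then have "\<exists>!t. t \<in> Arr E \<and> Dom E t = Dom E k \<and> Cod E t = z (PArr E k) \<and>
        PArr E t = Ident C (Dom C (PArr E k)) \<and> c (PArr E k) \<cdot>\<^bsub>E\<^esub> t = k"
      using c[OF k(3)] by (simp add: HomOver_iff)
    from theI'[OF this] show ?thesis unfolding t_def .
  qed
  define \<beta> where "\<beta> k = d (PArr E k) \<cdot>\<^bsub>E\<^esub> t k" for k
  have \<beta>: "\<beta> k \<in> HomOver E (PArr E k) (Dom E k) y"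
    if k: "k \<in> Arr E" "Cod E k = x" "PArr E k \<in> sieve C \<U>" for k
    using tt[OF k] d[OF k(3)] k unfolding \<beta>_def by (auto simp: HomOver_iff)
  have \<beta>_comp: "\<beta> (k \<cdot>\<^bsub>E\<^esub> l) = \<beta> k \<cdot>\<^bsub>E\<^esub> l"
    if k: "k \<in> Arr E" "Cod E k = x" "PArr E k \<in> sieve C \<U>"
      and l: "l \<in> Arr E" "Cod E l = Dom E k" for k l
  proof -
    let ?f = "PArr E k" and ?h = "PArr E l"
    have h: "?h \<in> Arr C" "Cod C ?h = Dom C ?f"
      using k l PArr_simps(3)[of l] PArr_simps(2)[of k] by auto
    have kl: "k \<cdot>\<^bsub>E\<^esub> l \<in> Arr E" "Cod E (k \<cdot>\<^bsub>E\<^esub> l) = x" "PArr E (k \<cdot>\<^bsub>E\<^esub> l) = ?f \<cdot>\<^bsub>C\<^esub> ?h"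
      using k l by simp_all
    have fh: "?f \<cdot>\<^bsub>C\<^esub> ?h \<in> sieve C \<U>" using R_comp[OF k(3) h] .
    obtain s where s: "s \<in> HomOver E ?h (z (?f \<cdot>\<^bsub>C\<^esub> ?h)) (z ?f)"
      "c ?f \<cdot>\<^bsub>E\<^esub> s = c (?f \<cdot>\<^bsub>C\<^esub> ?h)" "d ?f \<cdot>\<^bsub>E\<^esub> s = d (?f \<cdot>\<^bsub>C\<^esub> ?h)"
      using t[OF k(3) h] by blast
    note T = tt[OF k] tt[OF kl(1,2)] c[OF k(3)] c[OF fh] d[OF k(3)] d[OF fh] s
    have ty: "Cod E (t (k \<cdot>\<^bsub>E\<^esub> l)) = Dom E s" "PArr E (t (k \<cdot>\<^bsub>E\<^esub> l)) = Ident C (Dom C ?h)"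
      "t (k \<cdot>\<^bsub>E\<^esub> l) \<in> Arr E" "c (?f \<cdot>\<^bsub>C\<^esub> ?h) \<cdot>\<^bsub>E\<^esub> t (k \<cdot>\<^bsub>E\<^esub> l) = k \<cdot>\<^bsub>E\<^esub> l"
      "s \<in> Arr E" "Cod E s = z ?f" "Dom E s = z (?f \<cdot>\<^bsub>C\<^esub> ?h)" "PArr E s = ?h"
      using tt[OF kl(1,2)] fh kl(3) s(1) k h by (auto simp: HomOver_iff)
    \<comment> \<open>Both sides equal the composite of \<open>k\<close> and \<open>l\<close>, so
      \<open>c ?f\<close> can be cancelled. This is what makes \<beta> compatible with
      composition.\<close>
    have "c ?f \<cdot>\<^bsub>E\<^esub> (s \<cdot>\<^bsub>E\<^esub> t (k \<cdot>\<^bsub>E\<^esub> l)) = c ?f \<cdot>\<^bsub>E\<^esub> (t k \<cdot>\<^bsub>E\<^esub> l)"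
      using T(1,3) ty l s(2) by (simp add: HomOver_iff flip: total.assoc)
    then have eq: "s \<cdot>\<^bsub>E\<^esub> t (k \<cdot>\<^bsub>E\<^esub> l) = t k \<cdot>\<^bsub>E\<^esub> l"
      by (rule cancel[rotated -1]) (use T(1,3) ty l h in \<open>simp_all add: HomOver_iff\<close>)
    have "\<beta> (k \<cdot>\<^bsub>E\<^esub> l) = d ?f \<cdot>\<^bsub>E\<^esub> s \<cdot>\<^bsub>E\<^esub> t (k \<cdot>\<^bsub>E\<^esub> l)" unfolding \<beta>_def using s(3) kl(3) by simp
    also have "\<dots> = d ?f \<cdot>\<^bsub>E\<^esub> (s \<cdot>\<^bsub>E\<^esub> t (k \<cdot>\<^bsub>E\<^esub> l))"
      by (rule total.assoc) (use ty T(5) in \<open>simp_all add: HomOver_iff\<close>)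
    also have "\<dots> = d ?f \<cdot>\<^bsub>E\<^esub> t k \<cdot>\<^bsub>E\<^esub> l" unfolding eq
      by (rule total.assoc[symmetric]) (use T(1,5) l in \<open>simp_all add: HomOver_iff\<close>)
    finally show ?thesis unfolding \<beta>_def .
  qed
  have "arrows_glue C E S (sieve C \<U>)" using stack[unfolded stack_def, THEN conjunct2] S U by blast
  then have ex1: "\<exists>!b. b \<in> HomOver E (Ident C S) x y \<and>
      (\<forall>k \<in> Arr E. Cod E k = x \<and> PArr E k \<in> sieve C \<U> \<longrightarrow> b \<cdot>\<^bsub>E\<^esub> k = \<beta> k)"
    unfolding arrows_glue_def using x y \<beta> \<beta>_comp by simp
  \<comment> \<open>The stack axiom prescribes the composites of \<open>b\<close> with all arrows to
    \<open>x\<close> over the sieve. For vertical \<open>b\<close> this amounts to prescribing them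
    on the chosen arrows \<open>c f\<close>, so unique existence carries over.\<close>
  have "(\<forall>k \<in> Arr E. Cod E k = x \<and> PArr E k \<in> sieve C \<U> \<longrightarrow> b \<cdot>\<^bsub>E\<^esub> k = \<beta> k) \<longleftrightarrow>
      (\<forall>f \<in> sieve C \<U>. b \<cdot>\<^bsub>E\<^esub> c f = d f)" if b: "b \<in> HomOver E (Ident C S) x y" for b
  proof (intro iffI ballI impI)
    fix f assume all: "\<forall>k \<in> Arr E. Cod E k = x \<and> PArr E k \<in> sieve C \<U> \<longrightarrow> b \<cdot>\<^bsub>E\<^esub> k = \<beta> k"
      and f: "f \<in> sieve C \<U>"
    note cf = c[OF f, unfolded HomOver_iff] d[OF f, unfolded HomOver_iff]
    have zf: "z f \<in> Obj E" "PObj E (z f) = Dom C f" using HomOverD[OF c[OF f]] by auto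
    have "t (c f) = Ident E (z f)"
    proof (rule cancel[of "c f"])
      show "c f \<cdot>\<^bsub>E\<^esub> t (c f) = c f \<cdot>\<^bsub>E\<^esub> Ident E (z f)" using tt[of "c f"] cf f by simp
    qed (use tt[of "c f"] cf f zf in simp_all)
    then have "\<beta> (c f) = d f" unfolding \<beta>_def using cf zf by simp
    then show "b \<cdot>\<^bsub>E\<^esub> c f = d f" using all cf f by simp
  next
    fix k assume all: "\<forall>f \<in> sieve C \<U>. b \<cdot>\<^bsub>E\<^esub> c f = d f"
      and k: "k \<in> Arr E" "Cod E k = x \<and> PArr E k \<in> sieve C \<U>"
    let ?f = "PArr E k"
    have "b \<cdot>\<^bsub>E\<^esub> k = b \<cdot>\<^bsub>E\<^esub> (c ?f \<cdot>\<^bsub>E\<^esub> t k)" using tt[of k] k by simp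
    also have "\<dots> = b \<cdot>\<^bsub>E\<^esub> c ?f \<cdot>\<^bsub>E\<^esub> t k"
      by (rule total.assoc[symmetric])
        (use tt[of k] k c[of ?f] b in \<open>simp_all add: HomOver_iff\<close>)
    finally show "b \<cdot>\<^bsub>E\<^esub> k = \<beta> k" unfolding \<beta>_def using all k by simp
  qed
  with ex1 show ?thesis by (smt (verit))
qed

text \<open>This is the uniqueness half of gluing. A single test arrow over each member of the
  covering suffices, because every arrow to \<open>x\<close> over the sieve factors through one of
  them.\<close>

lemma eq_locally:
  assumes S: "S \<in> Obj C" and U: "\<U> \<in> Cov S"
    and b: "b \<in> HomOver E (Ident C S) x y" and b': "b' \<in> HomOver E (Ident C S) x y"
    and c: "\<And>f. f \<in> \<U> \<Longrightarrow> \<exists>z. \<exists>c \<in> HomOver E f z x. b \<cdot>\<^bsub>E\<^esub> c = b' \<cdot>\<^bsub>E\<^esub> c"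
  shows "b = b'"
proof -
  have xy: "x \<in> Obj E" "y \<in> Obj E" "PObj E x = S" "PObj E y = S"
    using HomOverD[OF b] S by auto
  have bx: "b \<in> Arr E" "Dom E b = x" "b' \<in> Arr E" "Dom E b' = x"
    using b b' by (auto simp: HomOver_iff)
  have eq: "b \<cdot>\<^bsub>E\<^esub> k = b' \<cdot>\<^bsub>E\<^esub> k" if k: "k \<in> Arr E" "Cod E k = x" "PArr E k \<in> sieve C \<U>" for k
  proof -
    obtain f h where fh: "PArr E k = f \<cdot>\<^bsub>C\<^esub> h" "f \<in> \<U>" "h \<in> Arr C" "Cod C h = Dom C f"
      using k(3) unfolding sieve_def by blast
    obtain z c where c: "c \<in> HomOver E f z x" "b \<cdot>\<^bsub>E\<^esub> c = b' \<cdot>\<^bsub>E\<^esub> c" using c[OF fh(2)] by blast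
    have "k \<in> HomOver E (f \<cdot>\<^bsub>C\<^esub> h) (Dom E k) x" using k fh(1) by (simp add: HomOver_iff)
    from factor_ex[OF c(1) this fh(3,4)] obtain t
      where "t \<in> HomOver E h (Dom E k) z" "c \<cdot>\<^bsub>E\<^esub> t = k" by blast
    then have t: "t \<in> Arr E" "Cod E t = Dom E c" "c \<cdot>\<^bsub>E\<^esub> t = k"
      using c(1) by (simp_all add: HomOver_iff)
    have "b \<cdot>\<^bsub>E\<^esub> k = b \<cdot>\<^bsub>E\<^esub> c \<cdot>\<^bsub>E\<^esub> t"
      using total.assoc[of t c b] c t bx by (simp add: HomOver_iff)
    also have "\<dots> = b' \<cdot>\<^bsub>E\<^esub> k"
      using total.assoc[of t c b'] c t bx by (simp add: HomOver_iff)
    finally show ?thesis .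
  qed
  have "arrows_glue C E S (sieve C \<U>)" using stack[unfolded stack_def, THEN conjunct2] S U by blast
  \<comment> \<open>Composition with \<open>b\<close> is a compatible family, and both
    \<open>b\<close> and \<open>b'\<close> glue it.\<close>
  moreover have "b \<cdot>\<^bsub>E\<^esub> k \<in> HomOver E (PArr E k) (Dom E k) y \<and>
      (\<forall>d \<in> Arr E. Cod E d = Dom E k \<longrightarrow> b \<cdot>\<^bsub>E\<^esub> (k \<cdot>\<^bsub>E\<^esub> d) = b \<cdot>\<^bsub>E\<^esub> k \<cdot>\<^bsub>E\<^esub> d)"
    if k: "k \<in> Arr E" "Cod E k = x" for k
    using k b xy total.assoc[of _ k b] PArr_simps(3)[of k] by (auto simp: HomOver_iff)
  ultimately have "\<exists>!b''. b'' \<in> HomOver E (Ident C S) x y \<and>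
      (\<forall>k \<in> Arr E. Cod E k = x \<and> PArr E k \<in> sieve C \<U> \<longrightarrow> b'' \<cdot>\<^bsub>E\<^esub> k = b \<cdot>\<^bsub>E\<^esub> k)"
    unfolding arrows_glue_def using xy by (simp add: Over_iff)
  then show ?thesis using b b' eq by metis
qed

end

section \<open>Symmetric monoidal fibred categories\<close>

lemma monoidal_constraints:
  assumes "symmetric_monoidal_category D M I"
  shows "x \<in> Obj D \<Longrightarrow> y \<in> Obj D \<Longrightarrow> z \<in> Obj D \<Longrightarrow>
      iso_in D (TObj M (TObj M x y) z) (TObj M x (TObj M y z)) (Assoc M x y z)"
    "x \<in> Obj D \<Longrightarrow> iso_in D (TObj M I x) x (LUnit M x)"
    "x \<in> Obj D \<Longrightarrow> iso_in D (TObj M x I) x (RUnit M x)"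
    "x \<in> Obj D \<Longrightarrow> y \<in> Obj D \<Longrightarrow> iso_in D (TObj M x y) (TObj M y x) (Braid M x y)"
  using assms unfolding symmetric_monoidal_category_def by simp_all

lemma symmetric_monoidal_functorD:
  assumes "symmetric_monoidal_functor D M I D' M' I' Fo Fa m e"
  shows "x \<in> Obj D \<Longrightarrow> y \<in> Obj D \<Longrightarrow> z \<in> Obj D \<Longrightarrow>
      Fa (Assoc M x y z) \<cdot>\<^bsub>D'\<^esub> m (TObj M x y) z \<cdot>\<^bsub>D'\<^esub> TArr M' (m x y) (Ident D' (Fo z)) =
      m x (TObj M y z) \<cdot>\<^bsub>D'\<^esub> TArr M' (Ident D' (Fo x)) (m y z)
        \<cdot>\<^bsub>D'\<^esub> Assoc M' (Fo x) (Fo y) (Fo z)"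
    "x \<in> Obj D \<Longrightarrow>
      Fa (LUnit M x) \<cdot>\<^bsub>D'\<^esub> m I x \<cdot>\<^bsub>D'\<^esub> TArr M' e (Ident D' (Fo x)) = LUnit M' (Fo x)"
    "x \<in> Obj D \<Longrightarrow>
      Fa (RUnit M x) \<cdot>\<^bsub>D'\<^esub> m x I \<cdot>\<^bsub>D'\<^esub> TArr M' (Ident D' (Fo x)) e = RUnit M' (Fo x)"
    "x \<in> Obj D \<Longrightarrow> y \<in> Obj D \<Longrightarrow>
      Fa (Braid M x y) \<cdot>\<^bsub>D'\<^esub> m x y = m y x \<cdot>\<^bsub>D'\<^esub> Braid M' (Fo x) (Fo y)"
    "is_functor D D' Fo Fa"
    "x \<in> Obj D \<Longrightarrow> y \<in> Obj D \<Longrightarrow> iso_in D' (TObj M' (Fo x) (Fo y)) (Fo (TObj M x y)) (m x y)"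
    "iso_in D' I' (Fo I) e"
  using assms unfolding symmetric_monoidal_functor_def by simp_all

locale sm_fibred = fibred C E for C :: "('o, 'a) cat" and E :: "('o, 'a, 'x, 'e) fibcat" +
  fixes M :: "('x, 'e) tensor" and Io :: "'o \<Rightarrow> 'x" and Ia :: "'a \<Rightarrow> 'e"
  assumes monoidal: "symmetric_monoidal_fibred C E M Io Ia"
begin

lemma fibre_simps [simp]:
  "Obj (fibre C E S) = Over E S" "Dom (fibre C E S) = Dom E" "Cod (fibre C E S) = Cod E"
  "Ident (fibre C E S) = Ident E" "Comp (fibre C E S) = Comp E"
  by (simp_all add: fibre_def)

lemma Hom_fibre:
  assumes "S \<in> Obj C" shows "Hom (fibre C E S) x y = HomOver E (Ident C S) x y"
proof -
  have "a \<in> Arr (fibre C E S) \<longleftrightarrow> a \<in> Arr E \<and> PArr E a = Ident C S" for a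
    using assms PArr_simps(2)[of a] by (auto simp: fibre_def)
  then show ?thesis unfolding Hom_def HomOver_iff by (intro Set.set_eqI) (simp add: HomOver_iff conj_ac)
qed

text \<open>The fibres are groupoids, so the invertibility demanded of all constraints and structure
  arrows holds by itself and only their typing has to be tracked.\<close>

lemma iso_in_fibre:
  assumes "S \<in> Obj C"
  shows "iso_in (fibre C E S) x y a \<longleftrightarrow> a \<in> HomOver E (Ident C S) x y"
proof
  assume "iso_in (fibre C E S) x y a"
  then show "a \<in> HomOver E (Ident C S) x y" using Hom_fibre[OF assms] by (simp add: iso_in_def)
next
  assume a: "a \<in> HomOver E (Ident C S) x y"
  obtain b where b: "b \<in> HomOver E (Ident C S) y x" "a \<cdot>\<^bsub>E\<^esub> b = Ident E y" "b \<cdot>\<^bsub>E\<^esub> a = Ident E x"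
    by (rule vertical_inverse[OF a assms])
  have aH: "a \<in> Hom (fibre C E S) x y" using a Hom_fibre[OF assms] by simp
  have "b \<in> Hom (fibre C E S) (Cod E a) (Dom E a)"
    using a b(1) Hom_fibre[OF assms] by (simp add: HomOver_iff)
  then have "is_iso (fibre C E S) a" unfolding is_iso_def
    using aH a b(2,3) by (intro conjI bexI[of _ b]) (simp_all add: Hom_def HomOver_iff)
  with aH show "iso_in (fibre C E S) x y a" by (simp add: iso_in_def)
qed

lemma fibre_monoidal: "S \<in> Obj C \<Longrightarrow> symmetric_monoidal_category (fibre C E S) M (Io S)"
  using monoidal[unfolded symmetric_monoidal_fibred_def, THEN conjunct2, THEN conjunct1] by blast

lemma unit_functor: "is_functor C E Io Ia"
  using monoidal[unfolded symmetric_monoidal_fibred_def, THEN conjunct2, THEN conjunct2, THEN conjunct1] .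

lemma Io_simps [simp]: assumes "S \<in> Obj C" shows "Io S \<in> Obj E" "PObj E (Io S) = S"
proof -
  show "Io S \<in> Obj E" using unit_functor assms unfolding is_functor_def by blast
  show "PObj E (Io S) = S" using assms
    monoidal[unfolded symmetric_monoidal_fibred_def, THEN conjunct2, THEN conjunct2, THEN conjunct2,
      THEN conjunct1] by blast
qed

lemma Ia_simps [simp]:
  assumes "f \<in> Arr C"
  shows "Ia f \<in> Arr E" "Dom E (Ia f) = Io (Dom C f)" "Cod E (Ia f) = Io (Cod C f)" "PArr E (Ia f) = f"
proof -
  have "Ia f \<in> Hom E (Io (Dom C f)) (Io (Cod C f))"
    using unit_functor assms unfolding is_functor_def by blast
  then show "Ia f \<in> Arr E" "Dom E (Ia f) = Io (Dom C f)" "Cod E (Ia f) = Io (Cod C f)"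
    by (simp_all add: Hom_def)
  show "PArr E (Ia f) = f" using assms
    monoidal[unfolded symmetric_monoidal_fibred_def, THEN conjunct2, THEN conjunct2, THEN conjunct2,
      THEN conjunct2, THEN conjunct1] by blast
qed

lemma Ia_ident: "S \<in> Obj C \<Longrightarrow> Ia (Ident C S) = Ident E (Io S)"
  using unit_functor unfolding is_functor_def by blast

lemma Ia_comp:
  "f \<in> Arr C \<Longrightarrow> g \<in> Arr C \<Longrightarrow> Cod C f = Dom C g \<Longrightarrow> Ia (g \<cdot>\<^bsub>C\<^esub> f) = Ia g \<cdot>\<^bsub>E\<^esub> Ia f"
  using unit_functor unfolding is_functor_def by simp

lemmas monoidal_rest = monoidal[unfolded symmetric_monoidal_fibred_def, THEN conjunct2,
  THEN conjunct2, THEN conjunct2, THEN conjunct2, THEN conjunct2]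

lemma TObj_simps [simp]:
  assumes "x \<in> Obj E" "y \<in> Obj E" "PObj E x = PObj E y"
  shows "TObj M x y \<in> Obj E" "PObj E (TObj M x y) = PObj E x"
proof -
  have "TObj M x y \<in> Over E (PObj E x)"
    using fibre_monoidal[of "PObj E x"] assms
    unfolding symmetric_monoidal_category_def by (simp add: Over_iff)
  then show "TObj M x y \<in> Obj E" "PObj E (TObj M x y) = PObj E x" by (simp_all add: Over_iff)
qed

lemma TArr_ident [simp]:
  assumes "x \<in> Obj E" "y \<in> Obj E" "PObj E x = PObj E y"
  shows "TArr M (Ident E x) (Ident E y) = Ident E (TObj M x y)"
  using fibre_monoidal[of "PObj E x"] assms
  unfolding symmetric_monoidal_category_def by (simp add: Over_iff)

lemma TArr_HomOver:
  "a \<in> HomOver E f x x' \<Longrightarrow> b \<in> HomOver E f y y' \<Longrightarrow>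
    TArr M a b \<in> HomOver E f (TObj M x y) (TObj M x' y')"
  using monoidal_rest[THEN conjunct1] by blast

lemma TArr_simps [simp]:
  assumes "a \<in> Arr E" "b \<in> Arr E" "PArr E a = PArr E b"
  shows "TArr M a b \<in> Arr E" "Dom E (TArr M a b) = TObj M (Dom E a) (Dom E b)"
    "Cod E (TArr M a b) = TObj M (Cod E a) (Cod E b)" "PArr E (TArr M a b) = PArr E a"
  using TArr_HomOver[of a "PArr E a" "Dom E a" "Cod E a" b "Dom E b" "Cod E b"] assms
  by (simp_all add: HomOver_iff)

lemma interchange:
  assumes "a \<in> Arr E" "a' \<in> Arr E" "b \<in> Arr E" "b' \<in> Arr E" "Cod E a = Dom E a'"
    "Cod E b = Dom E b'" "PArr E a = PArr E b" "PArr E a' = PArr E b'"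
  shows "TArr M a' b' \<cdot>\<^bsub>E\<^esub> TArr M a b = TArr M (a' \<cdot>\<^bsub>E\<^esub> a) (b' \<cdot>\<^bsub>E\<^esub> b)"
proof -
  have "a \<in> HomOver E (PArr E a) (Dom E a) (Cod E a)" "a' \<in> HomOver E (PArr E a') (Cod E a) (Cod E a')"
    "b \<in> HomOver E (PArr E a) (Dom E b) (Cod E b)" "b' \<in> HomOver E (PArr E a') (Cod E b) (Cod E b')"
    using assms by (simp_all add: HomOver_iff)
  then show ?thesis using monoidal_rest[THEN conjunct2, THEN conjunct1] by metis
qed

lemma Assoc_HomOver:
  assumes "x \<in> Obj E" "y \<in> Obj E" "z \<in> Obj E" "PObj E x = PObj E z" "PObj E y = PObj E z"
  shows "Assoc M x y z \<in>
    HomOver E (Ident C (PObj E z)) (TObj M (TObj M x y) z) (TObj M x (TObj M y z))"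
  using monoidal_constraints(1)[OF fibre_monoidal, of "PObj E z" x y z] assms
  by (simp add: Over_iff iso_in_fibre)

lemma Unit_HomOver:
  assumes "x \<in> Obj E"
  shows "LUnit M x \<in> HomOver E (Ident C (PObj E x)) (TObj M (Io (PObj E x)) x) x"
    "RUnit M x \<in> HomOver E (Ident C (PObj E x)) (TObj M x (Io (PObj E x))) x"
  using monoidal_constraints(2,3)[OF fibre_monoidal, of "PObj E x" x] assms
  by (simp_all add: Over_iff iso_in_fibre)

lemma Braid_HomOver:
  assumes "x \<in> Obj E" "y \<in> Obj E" "PObj E x = PObj E y"
  shows "Braid M x y \<in> HomOver E (Ident C (PObj E y)) (TObj M x y) (TObj M y x)"
  using monoidal_constraints(4)[OF fibre_monoidal, of "PObj E y" x y] assms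
  by (simp add: Over_iff iso_in_fibre)

lemmas constraint_simps [simp] = Assoc_HomOver[unfolded HomOver_iff, THEN conjunct1]
  Assoc_HomOver[unfolded HomOver_iff, THEN conjunct2, THEN conjunct1]
  Assoc_HomOver[unfolded HomOver_iff, THEN conjunct2, THEN conjunct2, THEN conjunct1]
  Assoc_HomOver[unfolded HomOver_iff, THEN conjunct2, THEN conjunct2, THEN conjunct2]
  Unit_HomOver[unfolded HomOver_iff, THEN conjunct1]
  Unit_HomOver[unfolded HomOver_iff, THEN conjunct2, THEN conjunct1]
  Unit_HomOver[unfolded HomOver_iff, THEN conjunct2, THEN conjunct2, THEN conjunct1]
  Unit_HomOver[unfolded HomOver_iff, THEN conjunct2, THEN conjunct2, THEN conjunct2]
  Braid_HomOver[unfolded HomOver_iff, THEN conjunct1]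
  Braid_HomOver[unfolded HomOver_iff, THEN conjunct2, THEN conjunct1]
  Braid_HomOver[unfolded HomOver_iff, THEN conjunct2, THEN conjunct2, THEN conjunct1]
  Braid_HomOver[unfolded HomOver_iff, THEN conjunct2, THEN conjunct2, THEN conjunct2]

lemma Braid_natural:
  "a \<in> HomOver E f x x' \<Longrightarrow> b \<in> HomOver E f y y' \<Longrightarrow>
    Braid M x' y' \<cdot>\<^bsub>E\<^esub> TArr M a b = TArr M b a \<cdot>\<^bsub>E\<^esub> Braid M x y"
  using monoidal_rest[THEN conjunct1] by blast

lemma Assoc_natural:
  "a \<in> HomOver E f x x' \<Longrightarrow> b \<in> HomOver E f y y' \<Longrightarrow> c \<in> HomOver E f z z' \<Longrightarrow>
    Assoc M x' y' z' \<cdot>\<^bsub>E\<^esub> TArr M (TArr M a b) c = TArr M a (TArr M b c) \<cdot>\<^bsub>E\<^esub> Assoc M x y z"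
  using monoidal_rest[THEN conjunct2, THEN conjunct2, THEN conjunct1] by blast

lemma Unit_natural:
  "a \<in> HomOver E f x x' \<Longrightarrow> LUnit M x' \<cdot>\<^bsub>E\<^esub> TArr M (Ia f) a = a \<cdot>\<^bsub>E\<^esub> LUnit M x"
  "a \<in> HomOver E f x x' \<Longrightarrow> RUnit M x' \<cdot>\<^bsub>E\<^esub> TArr M a (Ia f) = a \<cdot>\<^bsub>E\<^esub> RUnit M x"
  using monoidal_rest[THEN conjunct2, THEN conjunct2, THEN conjunct2] by blast+

end

section \<open>Symmetric monoidal functors from a monoid\<close>

locale sm_functors = sm_fibred C E M Io Ia + comm_monoid P
  for C :: "('o, 'a) cat" and E :: "('o, 'a, 'x, 'e) fibcat" and M Io Ia
    and P :: "('p, 'm) monoid_scheme" (structure)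
begin

abbreviation base_of :: "('o, 'p, 'x, 'e) smfun \<Rightarrow> 'o" where "base_of x \<equiv> fst x"
abbreviation fam :: "('o, 'p, 'x, 'e) smfun \<Rightarrow> 'p \<Rightarrow> 'x" where "fam x \<equiv> fst (snd x)"
abbreviation mu :: "('o, 'p, 'x, 'e) smfun \<Rightarrow> 'p \<Rightarrow> 'p \<Rightarrow> 'e" where "mu x \<equiv> fst (snd (snd x))"
abbreviation eps :: "('o, 'p, 'x, 'e) smfun \<Rightarrow> 'e" where "eps x \<equiv> snd (snd (snd x))"

text \<open>An object is split into its typing (\<open>sm_data\<close>), its equations
  (\<open>coherent\<close>) and the convention outside the carrier (\<open>ext_data\<close>),
  because data are constructed first, by pullback or gluing, and the equations are derived
  afterwards.\<close>

definition sm_data :: "('o, 'p, 'x, 'e) smfun \<Rightarrow> bool" where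
  "sm_data x \<longleftrightarrow> base_of x \<in> Obj C \<and> (\<forall>p \<in> carrier P. fam x p \<in> Over E (base_of x)) \<and>
    (\<forall>p \<in> carrier P. \<forall>q \<in> carrier P.
      mu x p q \<in> HomOver E (Ident C (base_of x)) (TObj M (fam x p) (fam x q)) (fam x (p \<otimes> q))) \<and>
    eps x \<in> HomOver E (Ident C (base_of x)) (Io (base_of x)) (fam x \<one>)"

definition coherent :: "('o, 'p, 'x, 'e) smfun \<Rightarrow> bool" where
  "coherent x \<longleftrightarrow>
    (\<forall>p \<in> carrier P. \<forall>q \<in> carrier P. \<forall>r \<in> carrier P.
      mu x (p \<otimes> q) r \<cdot>\<^bsub>E\<^esub> TArr M (mu x p q) (Ident E (fam x r)) =
      mu x p (q \<otimes> r) \<cdot>\<^bsub>E\<^esub> TArr M (Ident E (fam x p)) (mu x q r)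
        \<cdot>\<^bsub>E\<^esub> Assoc M (fam x p) (fam x q) (fam x r)) \<and>
    (\<forall>p \<in> carrier P.
      mu x \<one> p \<cdot>\<^bsub>E\<^esub> TArr M (eps x) (Ident E (fam x p)) = LUnit M (fam x p) \<and>
      mu x p \<one> \<cdot>\<^bsub>E\<^esub> TArr M (Ident E (fam x p)) (eps x) = RUnit M (fam x p)) \<and>
    (\<forall>p \<in> carrier P. \<forall>q \<in> carrier P. mu x p q = mu x q p \<cdot>\<^bsub>E\<^esub> Braid M (fam x p) (fam x q))"

text \<open>Coherence of the two ends is left out on purpose: such families are used to carry
  coherence from one end to the other.\<close>

definition sm_arrow ::
  "'a \<Rightarrow> ('o, 'p, 'x, 'e) smfun \<Rightarrow> ('o, 'p, 'x, 'e) smfun \<Rightarrow> ('p \<Rightarrow> 'e) \<Rightarrow> bool" where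
  "sm_arrow f y x a \<longleftrightarrow> (\<forall>p \<in> carrier P. a p \<in> HomOver E f (fam y p) (fam x p)) \<and>
    (\<forall>p \<in> carrier P. \<forall>q \<in> carrier P.
      a (p \<otimes> q) \<cdot>\<^bsub>E\<^esub> mu y p q = mu x p q \<cdot>\<^bsub>E\<^esub> TArr M (a p) (a q)) \<and>
    a \<one> \<cdot>\<^bsub>E\<^esub> eps y = eps x \<cdot>\<^bsub>E\<^esub> Ia f"

definition ext_data :: "('o, 'p, 'x, 'e) smfun \<Rightarrow> bool" where
  "ext_data x \<longleftrightarrow> fam x \<in> extensional (carrier P) \<and> mu x \<in> extensional (carrier P) \<and>
    (\<forall>p \<in> carrier P. mu x p \<in> extensional (carrier P))"

lemma sm_dataD [simp]:
  assumes "sm_data x"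
  shows "fst x \<in> Obj C"
    "p \<in> carrier P \<Longrightarrow> fam x p \<in> Obj E" "p \<in> carrier P \<Longrightarrow> PObj E (fam x p) = fst x"
    "p \<in> carrier P \<Longrightarrow> q \<in> carrier P \<Longrightarrow> mu x p q \<in> Arr E"
    "p \<in> carrier P \<Longrightarrow> q \<in> carrier P \<Longrightarrow> Dom E (mu x p q) = TObj M (fam x p) (fam x q)"
    "p \<in> carrier P \<Longrightarrow> q \<in> carrier P \<Longrightarrow> Cod E (mu x p q) = fam x (p \<otimes> q)"
    "p \<in> carrier P \<Longrightarrow> q \<in> carrier P \<Longrightarrow> PArr E (mu x p q) = Ident C (fst x)"
    "eps x \<in> Arr E" "Dom E (eps x) = Io (fst x)" "Cod E (eps x) = fam x \<one>"
    "PArr E (eps x) = Ident C (fst x)"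
  using assms unfolding sm_data_def by (simp_all add: HomOver_iff Over_iff)

lemma sm_arrowD:
  assumes "sm_arrow f y x a"
  shows "p \<in> carrier P \<Longrightarrow> a p \<in> Arr E" "p \<in> carrier P \<Longrightarrow> Dom E (a p) = fam y p"
    "p \<in> carrier P \<Longrightarrow> Cod E (a p) = fam x p" "p \<in> carrier P \<Longrightarrow> PArr E (a p) = f"
    "p \<in> carrier P \<Longrightarrow> q \<in> carrier P \<Longrightarrow>
      a (p \<otimes> q) \<cdot>\<^bsub>E\<^esub> mu y p q = mu x p q \<cdot>\<^bsub>E\<^esub> TArr M (a p) (a q)"
    "a \<one> \<cdot>\<^bsub>E\<^esub> eps y = eps x \<cdot>\<^bsub>E\<^esub> Ia f"
    "p \<in> carrier P \<Longrightarrow> a p \<in> HomOver E f (fam y p) (fam x p)"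
  using assms unfolding sm_arrow_def by (simp_all add: HomOver_iff)

lemma sm_arrow_base:
  assumes "sm_data x" "sm_data y" "sm_arrow f y x a"
  shows "f \<in> Arr C" "Dom C f = fst y" "Cod C f = fst x"
  using HomOverD[OF sm_arrowD(7)[OF assms(3) one_closed]] assms by simp_all

text \<open>In the category attached to \<open>P\<close> all arrows are identities, so functoriality
  and naturality are automatic and the axioms reduce to associativity, units and symmetry.\<close>

lemma smfun_objects_iff:
  "x \<in> smfun_objects C P E M Io \<longleftrightarrow> ext_data x \<and> sm_data x \<and> coherent x"
proof -
  obtain S L \<mu> \<epsilon> where x: "x = (S, L, \<mu>, \<epsilon>)" by (cases x)
  show ?thesis
  proof (cases "S \<in> Obj C")
    case True
    note hom = Hom_fibre[OF True] and iso = iso_in_fibre[OF True]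
    have dh: "Hom (discrete_cat P) p q = (if p = q \<and> p \<in> carrier P then {p} else {})" for p q
      unfolding Hom_def discrete_cat_def by auto
    have "symmetric_monoidal_functor (discrete_cat P) (discrete_tensor P) \<one>
       (fibre C E S) M (Io S) L (\<lambda>p. Ident E (L p)) \<mu> \<epsilon> \<longleftrightarrow> sm_data x \<and> coherent x"
    proof
      assume *: "symmetric_monoidal_functor (discrete_cat P) (discrete_tensor P) \<one>
       (fibre C E S) M (Io S) L (\<lambda>p. Ident E (L p)) \<mu> \<epsilon>"
      have d: "sm_data x"
        using * True unfolding symmetric_monoidal_functor_def iso sm_data_def is_functor_def x
        by (simp add: discrete_cat_def discrete_tensor_def)
      then have "\<And>p. p \<in> carrier P \<Longrightarrow> L p \<in> Obj E" "\<And>p. p \<in> carrier P \<Longrightarrow> PObj E (L p) = S"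
        "\<And>p q. p \<in> carrier P \<Longrightarrow> q \<in> carrier P \<Longrightarrow> \<mu> p q \<in> Arr E"
        "\<And>p q. p \<in> carrier P \<Longrightarrow> q \<in> carrier P \<Longrightarrow> Dom E (\<mu> p q) = TObj M (L p) (L q)"
        "\<And>p q. p \<in> carrier P \<Longrightarrow> q \<in> carrier P \<Longrightarrow> Cod E (\<mu> p q) = L (p \<otimes> q)"
        "\<And>p q. p \<in> carrier P \<Longrightarrow> q \<in> carrier P \<Longrightarrow> PArr E (\<mu> p q) = Ident C S"
        "\<epsilon> \<in> Arr E" "Dom E \<epsilon> = Io S" "Cod E \<epsilon> = L \<one>" "PArr E \<epsilon> = Ident C S"
        using sm_dataD[of x] by (simp_all add: x)
      note d' = this
      have "coherent x"
        unfolding coherent_def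
      proof (intro conjI ballI)
        fix p q r assume "p \<in> carrier P" "q \<in> carrier P" "r \<in> carrier P"
        then show "mu x (p \<otimes> q) r \<cdot>\<^bsub>E\<^esub> TArr M (mu x p q) (Ident E (fam x r)) =
            mu x p (q \<otimes> r) \<cdot>\<^bsub>E\<^esub> TArr M (Ident E (fam x p)) (mu x q r)
              \<cdot>\<^bsub>E\<^esub> Assoc M (fam x p) (fam x q) (fam x r)"
          using symmetric_monoidal_functorD(1)[OF *, of p q r] d' True
          by (simp add: discrete_cat_def discrete_tensor_def x)
      next
        fix p assume "p \<in> carrier P"
        then show "mu x \<one> p \<cdot>\<^bsub>E\<^esub> TArr M (eps x) (Ident E (fam x p)) = LUnit M (fam x p)"
          "mu x p \<one> \<cdot>\<^bsub>E\<^esub> TArr M (Ident E (fam x p)) (eps x) = RUnit M (fam x p)"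
          using symmetric_monoidal_functorD(2,3)[OF *, of p] d' True
          by (simp_all add: discrete_cat_def discrete_tensor_def x)
      next
        fix p q assume "p \<in> carrier P" "q \<in> carrier P"
        then show "mu x p q = mu x q p \<cdot>\<^bsub>E\<^esub> Braid M (fam x p) (fam x q)"
          using symmetric_monoidal_functorD(4)[OF *, of p q] d' True
          by (simp add: discrete_cat_def discrete_tensor_def x)
      qed
      then show "sm_data x \<and> coherent x" using d by blast
    next
      assume "sm_data x \<and> coherent x"
      then have d: "sm_data x" and c: "coherent x" by auto
      have d': "\<And>p. p \<in> carrier P \<Longrightarrow> L p \<in> Obj E" "\<And>p. p \<in> carrier P \<Longrightarrow> PObj E (L p) = S"
        "\<And>p q. p \<in> carrier P \<Longrightarrow> q \<in> carrier P \<Longrightarrow> \<mu> p q \<in> Arr E"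
        "\<And>p q. p \<in> carrier P \<Longrightarrow> q \<in> carrier P \<Longrightarrow> Dom E (\<mu> p q) = TObj M (L p) (L q)"
        "\<And>p q. p \<in> carrier P \<Longrightarrow> q \<in> carrier P \<Longrightarrow> Cod E (\<mu> p q) = L (p \<otimes> q)"
        "\<And>p q. p \<in> carrier P \<Longrightarrow> q \<in> carrier P \<Longrightarrow> PArr E (\<mu> p q) = Ident C S"
        "\<epsilon> \<in> Arr E" "Dom E \<epsilon> = Io S" "Cod E \<epsilon> = L \<one>" "PArr E \<epsilon> = Ident C S"
        using sm_dataD[OF d] by (simp_all add: x)
      have c': "mu x q p \<cdot>\<^bsub>E\<^esub> Braid M (fam x p) (fam x q) = mu x p q"
        if "p \<in> carrier P" "q \<in> carrier P" for p q
        using c[unfolded coherent_def, THEN conjunct2, THEN conjunct2] that by metis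
      show "symmetric_monoidal_functor (discrete_cat P) (discrete_tensor P) \<one>
       (fibre C E S) M (Io S) L (\<lambda>p. Ident E (L p)) \<mu> \<epsilon>"
        unfolding symmetric_monoidal_functor_def
      proof (intro conjI)
        show "is_functor (discrete_cat P) (fibre C E S) L (\<lambda>p. Ident E (L p))"
          unfolding is_functor_def hom
          using d' by (auto simp: discrete_cat_def Over_iff HomOver_iff)
        show "\<forall>p p' q q'. \<forall>a\<in>Hom (discrete_cat P) p p'. \<forall>b\<in>Hom (discrete_cat P) q q'.
          \<mu> p' q' \<cdot>\<^bsub>fibre C E S\<^esub> TArr M (Ident E (L a)) (Ident E (L b)) =
          Ident E (L (TArr (discrete_tensor P) a b)) \<cdot>\<^bsub>fibre C E S\<^esub> \<mu> p q"
          unfolding dh using d' by (auto simp: discrete_tensor_def)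
        show "\<forall>p\<in>Obj (discrete_cat P). \<forall>q\<in>Obj (discrete_cat P).
          Ident E (L (Braid (discrete_tensor P) p q)) \<cdot>\<^bsub>fibre C E S\<^esub> \<mu> p q =
          \<mu> q p \<cdot>\<^bsub>fibre C E S\<^esub> Braid M (L p) (L q)"
          using d' c' by (simp add: discrete_cat_def discrete_tensor_def x)
      qed (use d' c[unfolded coherent_def, THEN conjunct1]
          c[unfolded coherent_def, THEN conjunct2, THEN conjunct1]
        in \<open>simp_all add: iso discrete_cat_def discrete_tensor_def HomOver_iff x m_assoc\<close>)
    qed
    then show ?thesis using True unfolding smfun_objects_def ext_data_def x by auto
  next
    case False
    then show ?thesis by (simp add: smfun_objects_def x sm_data_def)
  qed
qed

lemma smfun_arrows_iff:
  "(f, y, x, a) \<in> smfun_arrows C P E M Io Ia \<longleftrightarrow> f \<in> Hom C (fst y) (fst x) \<and>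
    y \<in> smfun_objects C P E M Io \<and> x \<in> smfun_objects C P E M Io \<and> a \<in> extensional (carrier P) \<and>
    sm_arrow f y x a"
  unfolding smfun_arrows_def sm_arrow_def by (cases x, cases y) auto

end

section \<open>Transport of coherence along compatible families\<close>

context sm_functors
begin

text \<open>This lemma and the next four move \<open>a\<close> through one side of a coherence
  equation: the composite for \<open>y\<close> followed by \<open>a\<close> becomes the
  corresponding composite for \<open>x\<close> preceded by a tensor product of components. They hold
  before either end is known to be coherent, and so serve both to pass from \<open>x\<close> to
  \<open>y\<close> and from \<open>y\<close> to \<open>x\<close>.\<close>

lemma sm_arrow_assoc_left:
  assumes x: "sm_data x" and y: "sm_data y" and a: "sm_arrow f y x a"
    and [simp]: "p \<in> carrier P" "q \<in> carrier P" "r \<in> carrier P"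
  shows "a (p \<otimes> (q \<otimes> r)) \<cdot>\<^bsub>E\<^esub> (mu y (p \<otimes> q) r \<cdot>\<^bsub>E\<^esub> TArr M (mu y p q) (Ident E (fam y r))) =
    mu x (p \<otimes> q) r \<cdot>\<^bsub>E\<^esub> TArr M (mu x p q) (Ident E (fam x r)) \<cdot>\<^bsub>E\<^esub> TArr M (TArr M (a p) (a q)) (a r)"
proof -
  note [simp] = sm_dataD[OF x] sm_dataD[OF y] sm_arrowD(1-4)[OF a] sm_arrow_base[OF x y a]
  have "a (p \<otimes> (q \<otimes> r)) \<cdot>\<^bsub>E\<^esub> (mu y (p \<otimes> q) r \<cdot>\<^bsub>E\<^esub> TArr M (mu y p q) (Ident E (fam y r))) =
      a (p \<otimes> q \<otimes> r) \<cdot>\<^bsub>E\<^esub> mu y (p \<otimes> q) r \<cdot>\<^bsub>E\<^esub> TArr M (mu y p q) (Ident E (fam y r))"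
    by (simp add: total.assoc m_assoc)
  also have "\<dots> = mu x (p \<otimes> q) r \<cdot>\<^bsub>E\<^esub> TArr M (a (p \<otimes> q)) (a r) \<cdot>\<^bsub>E\<^esub> TArr M (mu y p q) (Ident E (fam y r))"
    using sm_arrowD(5)[OF a, of "p \<otimes> q" r] by simp
  also have "\<dots> = mu x (p \<otimes> q) r \<cdot>\<^bsub>E\<^esub> TArr M (a (p \<otimes> q) \<cdot>\<^bsub>E\<^esub> mu y p q) (a r)"
    by (simp add: total.assoc interchange)
  also have "\<dots> = mu x (p \<otimes> q) r \<cdot>\<^bsub>E\<^esub> TArr M (mu x p q \<cdot>\<^bsub>E\<^esub> TArr M (a p) (a q)) (a r)"
    using sm_arrowD(5)[OF a, of p q] by simp
  also have "\<dots> = mu x (p \<otimes> q) r \<cdot>\<^bsub>E\<^esub> TArr M (mu x p q) (Ident E (fam x r))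
      \<cdot>\<^bsub>E\<^esub> TArr M (TArr M (a p) (a q)) (a r)"
    by (simp add: total.assoc interchange)
  finally show ?thesis .
qed

lemma sm_arrow_assoc_right:
  assumes x: "sm_data x" and y: "sm_data y" and a: "sm_arrow f y x a"
    and [simp]: "p \<in> carrier P" "q \<in> carrier P" "r \<in> carrier P"
  shows "a (p \<otimes> (q \<otimes> r)) \<cdot>\<^bsub>E\<^esub> (mu y p (q \<otimes> r) \<cdot>\<^bsub>E\<^esub> TArr M (Ident E (fam y p)) (mu y q r)
      \<cdot>\<^bsub>E\<^esub> Assoc M (fam y p) (fam y q) (fam y r)) =
    mu x p (q \<otimes> r) \<cdot>\<^bsub>E\<^esub> TArr M (Ident E (fam x p)) (mu x q r)
      \<cdot>\<^bsub>E\<^esub> Assoc M (fam x p) (fam x q) (fam x r) \<cdot>\<^bsub>E\<^esub> TArr M (TArr M (a p) (a q)) (a r)"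
proof -
  note [simp] = sm_dataD[OF x] sm_dataD[OF y] sm_arrowD(1-4)[OF a] sm_arrow_base[OF x y a]
  have "a (p \<otimes> (q \<otimes> r)) \<cdot>\<^bsub>E\<^esub> (mu y p (q \<otimes> r) \<cdot>\<^bsub>E\<^esub> TArr M (Ident E (fam y p)) (mu y q r)
      \<cdot>\<^bsub>E\<^esub> Assoc M (fam y p) (fam y q) (fam y r)) =
      a (p \<otimes> (q \<otimes> r)) \<cdot>\<^bsub>E\<^esub> mu y p (q \<otimes> r) \<cdot>\<^bsub>E\<^esub> (TArr M (Ident E (fam y p)) (mu y q r)
      \<cdot>\<^bsub>E\<^esub> Assoc M (fam y p) (fam y q) (fam y r))"
    by (simp add: total.assoc)
  also have "\<dots> = mu x p (q \<otimes> r) \<cdot>\<^bsub>E\<^esub> TArr M (a p) (a (q \<otimes> r)) \<cdot>\<^bsub>E\<^esub>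
      (TArr M (Ident E (fam y p)) (mu y q r) \<cdot>\<^bsub>E\<^esub> Assoc M (fam y p) (fam y q) (fam y r))"
    using sm_arrowD(5)[OF a, of p "q \<otimes> r"] by simp
  also have "\<dots> = mu x p (q \<otimes> r) \<cdot>\<^bsub>E\<^esub> (TArr M (a p) (a (q \<otimes> r)) \<cdot>\<^bsub>E\<^esub>
      TArr M (Ident E (fam y p)) (mu y q r) \<cdot>\<^bsub>E\<^esub> Assoc M (fam y p) (fam y q) (fam y r))"
    by (simp add: total.assoc)
  also have "TArr M (a p) (a (q \<otimes> r)) \<cdot>\<^bsub>E\<^esub> TArr M (Ident E (fam y p)) (mu y q r) =
      TArr M (a p) (mu x q r \<cdot>\<^bsub>E\<^esub> TArr M (a q) (a r))"
    using sm_arrowD(5)[OF a, of q r] by (simp add: interchange)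
  also have "\<dots> = TArr M (Ident E (fam x p)) (mu x q r) \<cdot>\<^bsub>E\<^esub> TArr M (a p) (TArr M (a q) (a r))"
    by (simp add: interchange)
  also have "\<dots> \<cdot>\<^bsub>E\<^esub> Assoc M (fam y p) (fam y q) (fam y r) = TArr M (Ident E (fam x p)) (mu x q r)
      \<cdot>\<^bsub>E\<^esub> (Assoc M (fam x p) (fam x q) (fam x r) \<cdot>\<^bsub>E\<^esub> TArr M (TArr M (a p) (a q)) (a r))"
    using Assoc_natural[of "a p" f "fam y p" "fam x p" "a q" "fam y q" "fam x q" "a r" "fam y r" "fam x r"]
      sm_arrowD(7)[OF a] by (simp add: total.assoc)
  finally show ?thesis by (simp add: total.assoc)
qed

text \<open>The unit object is carried along by \<open>Ia f\<close>, which takes the place of a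
  component of \<open>a\<close> in the unit slot.\<close>

lemma sm_arrow_lunit:
  assumes x: "sm_data x" and y: "sm_data y" and a: "sm_arrow f y x a" and [simp]: "p \<in> carrier P"
  shows "a p \<cdot>\<^bsub>E\<^esub> (mu y \<one> p \<cdot>\<^bsub>E\<^esub> TArr M (eps y) (Ident E (fam y p))) =
    mu x \<one> p \<cdot>\<^bsub>E\<^esub> TArr M (eps x) (Ident E (fam x p)) \<cdot>\<^bsub>E\<^esub> TArr M (Ia f) (a p)"
proof -
  note [simp] = sm_dataD[OF x] sm_dataD[OF y] sm_arrowD(1-4)[OF a] sm_arrow_base[OF x y a]
  have "a p \<cdot>\<^bsub>E\<^esub> (mu y \<one> p \<cdot>\<^bsub>E\<^esub> TArr M (eps y) (Ident E (fam y p))) =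
      a (\<one> \<otimes> p) \<cdot>\<^bsub>E\<^esub> mu y \<one> p \<cdot>\<^bsub>E\<^esub> TArr M (eps y) (Ident E (fam y p))"
    by (simp add: total.assoc)
  also have "\<dots> = mu x \<one> p \<cdot>\<^bsub>E\<^esub> TArr M (a \<one> \<cdot>\<^bsub>E\<^esub> eps y) (a p)"
    unfolding sm_arrowD(5)[OF a one_closed \<open>p \<in> carrier P\<close>]
    by (simp add: total.assoc interchange)
  also have "\<dots> = mu x \<one> p \<cdot>\<^bsub>E\<^esub> TArr M (eps x) (Ident E (fam x p)) \<cdot>\<^bsub>E\<^esub> TArr M (Ia f) (a p)"
    unfolding sm_arrowD(6)[OF a] by (simp add: total.assoc interchange)
  finally show ?thesis .
qed

lemma sm_arrow_runit:
  assumes x: "sm_data x" and y: "sm_data y" and a: "sm_arrow f y x a" and [simp]: "p \<in> carrier P"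
  shows "a p \<cdot>\<^bsub>E\<^esub> (mu y p \<one> \<cdot>\<^bsub>E\<^esub> TArr M (Ident E (fam y p)) (eps y)) =
    mu x p \<one> \<cdot>\<^bsub>E\<^esub> TArr M (Ident E (fam x p)) (eps x) \<cdot>\<^bsub>E\<^esub> TArr M (a p) (Ia f)"
proof -
  note [simp] = sm_dataD[OF x] sm_dataD[OF y] sm_arrowD(1-4)[OF a] sm_arrow_base[OF x y a]
  have "a p \<cdot>\<^bsub>E\<^esub> (mu y p \<one> \<cdot>\<^bsub>E\<^esub> TArr M (Ident E (fam y p)) (eps y)) =
      a (p \<otimes> \<one>) \<cdot>\<^bsub>E\<^esub> mu y p \<one> \<cdot>\<^bsub>E\<^esub> TArr M (Ident E (fam y p)) (eps y)"
    by (simp add: total.assoc)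
  also have "\<dots> = mu x p \<one> \<cdot>\<^bsub>E\<^esub> TArr M (a p) (a \<one> \<cdot>\<^bsub>E\<^esub> eps y)"
    unfolding sm_arrowD(5)[OF a \<open>p \<in> carrier P\<close> one_closed]
    by (simp add: total.assoc interchange)
  also have "\<dots> = mu x p \<one> \<cdot>\<^bsub>E\<^esub> TArr M (Ident E (fam x p)) (eps x) \<cdot>\<^bsub>E\<^esub> TArr M (a p) (Ia f)"
    unfolding sm_arrowD(6)[OF a] by (simp add: total.assoc interchange)
  finally show ?thesis .
qed

lemma sm_arrow_braid:
  assumes x: "sm_data x" and y: "sm_data y" and a: "sm_arrow f y x a"
    and [simp]: "p \<in> carrier P" "q \<in> carrier P"
  shows "a (p \<otimes> q) \<cdot>\<^bsub>E\<^esub> (mu y q p \<cdot>\<^bsub>E\<^esub> Braid M (fam y p) (fam y q)) =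
    mu x q p \<cdot>\<^bsub>E\<^esub> Braid M (fam x p) (fam x q) \<cdot>\<^bsub>E\<^esub> TArr M (a p) (a q)"
proof -
  note [simp] = sm_dataD[OF x] sm_dataD[OF y] sm_arrowD(1-4)[OF a] sm_arrow_base[OF x y a]
  have pq: "p \<otimes> q = q \<otimes> p" by (simp add: m_comm)
  have "a (p \<otimes> q) \<cdot>\<^bsub>E\<^esub> (mu y q p \<cdot>\<^bsub>E\<^esub> Braid M (fam y p) (fam y q)) =
      a (q \<otimes> p) \<cdot>\<^bsub>E\<^esub> mu y q p \<cdot>\<^bsub>E\<^esub> Braid M (fam y p) (fam y q)"
    unfolding pq by (simp add: total.assoc)
  also have "\<dots> = mu x q p \<cdot>\<^bsub>E\<^esub> (TArr M (a q) (a p) \<cdot>\<^bsub>E\<^esub> Braid M (fam y p) (fam y q))"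
    using sm_arrowD(5)[OF a, of q p] by (simp add: total.assoc)
  also have "\<dots> = mu x q p \<cdot>\<^bsub>E\<^esub> (Braid M (fam x p) (fam x q) \<cdot>\<^bsub>E\<^esub> TArr M (a p) (a q))"
    using Braid_natural[of "a p" f "fam y p" "fam x p" "a q" "fam y q" "fam x q"]
      sm_arrowD(7)[OF a] by simp
  finally show ?thesis by (simp add: total.assoc)
qed

lemma coherentD:
  assumes "coherent x" "p \<in> carrier P"
  shows "q \<in> carrier P \<Longrightarrow> r \<in> carrier P \<Longrightarrow>
      mu x (p \<otimes> q) r \<cdot>\<^bsub>E\<^esub> TArr M (mu x p q) (Ident E (fam x r)) =
      mu x p (q \<otimes> r) \<cdot>\<^bsub>E\<^esub> TArr M (Ident E (fam x p)) (mu x q r)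
        \<cdot>\<^bsub>E\<^esub> Assoc M (fam x p) (fam x q) (fam x r)"
    "mu x \<one> p \<cdot>\<^bsub>E\<^esub> TArr M (eps x) (Ident E (fam x p)) = LUnit M (fam x p)"
    "mu x p \<one> \<cdot>\<^bsub>E\<^esub> TArr M (Ident E (fam x p)) (eps x) = RUnit M (fam x p)"
    "q \<in> carrier P \<Longrightarrow> mu x p q = mu x q p \<cdot>\<^bsub>E\<^esub> Braid M (fam x p) (fam x q)"
  using assms unfolding coherent_def by metis+

text \<open>Composed with a component of \<open>a\<close>, both sides of each equation for
  \<open>y\<close> turn into the two sides of the equation for \<open>x\<close>. The component is
  cartesian and can be cancelled.\<close>

lemma coherent_source:
  assumes x: "sm_data x" and y: "sm_data y" and a: "sm_arrow f y x a" and c: "coherent x"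
  shows "coherent y"
proof -
  note [simp] = sm_dataD[OF x] sm_dataD[OF y] sm_arrowD(1-4)[OF a] sm_arrow_base[OF x y a]
  show ?thesis unfolding coherent_def
  proof (intro conjI ballI)
    fix p q r assume pqr [simp]: "p \<in> carrier P" "q \<in> carrier P" "r \<in> carrier P"
    show "mu y (p \<otimes> q) r \<cdot>\<^bsub>E\<^esub> TArr M (mu y p q) (Ident E (fam y r)) =
      mu y p (q \<otimes> r) \<cdot>\<^bsub>E\<^esub> TArr M (Ident E (fam y p)) (mu y q r)
        \<cdot>\<^bsub>E\<^esub> Assoc M (fam y p) (fam y q) (fam y r)"
      by (rule cancel[of "a (p \<otimes> (q \<otimes> r))"])
        (simp_all add: m_assoc sm_arrow_assoc_left[OF x y a pqr] sm_arrow_assoc_right[OF x y a pqr]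
          coherentD(1)[OF c pqr])
  next
    fix p assume p [simp]: "p \<in> carrier P"
    have "a p \<cdot>\<^bsub>E\<^esub> LUnit M (fam y p) = LUnit M (fam x p) \<cdot>\<^bsub>E\<^esub> TArr M (Ia f) (a p)"
      "a p \<cdot>\<^bsub>E\<^esub> RUnit M (fam y p) = RUnit M (fam x p) \<cdot>\<^bsub>E\<^esub> TArr M (a p) (Ia f)"
      using Unit_natural[OF sm_arrowD(7)[OF a p]] by simp_all
    note u = this sm_arrow_lunit[OF x y a p] sm_arrow_runit[OF x y a p] coherentD(2,3)[OF c p]
    show "mu y \<one> p \<cdot>\<^bsub>E\<^esub> TArr M (eps y) (Ident E (fam y p)) = LUnit M (fam y p)"
      by (rule cancel[of "a p"]) (simp_all add: u)
    show "mu y p \<one> \<cdot>\<^bsub>E\<^esub> TArr M (Ident E (fam y p)) (eps y) = RUnit M (fam y p)"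
      by (rule cancel[of "a p"]) (simp_all add: u)
  next
    fix p q assume pq [simp]: "p \<in> carrier P" "q \<in> carrier P"
    have qp: "q \<otimes> p = p \<otimes> q" by (simp add: m_comm)
    have "a (p \<otimes> q) \<cdot>\<^bsub>E\<^esub> mu y p q = a (p \<otimes> q) \<cdot>\<^bsub>E\<^esub> (mu y q p \<cdot>\<^bsub>E\<^esub> Braid M (fam y p) (fam y q))"
      using sm_arrow_braid[OF x y a pq] sm_arrowD(5)[OF a pq] coherentD(4)[OF c pq] by metis
    then show "mu y p q = mu y q p \<cdot>\<^bsub>E\<^esub> Braid M (fam y p) (fam y q)"
      by (rule cancel[of "a (p \<otimes> q)", rotated -1]) (simp_all add: qp)
  qed
qed

section \<open>The fibred category of symmetric monoidal functors\<close>

abbreviation "SM \<equiv> smfun_stack C P E M Io Ia"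
abbreviation cmp :: "'a \<times> ('o, 'p, 'x, 'e) smfun \<times> ('o, 'p, 'x, 'e) smfun \<times> ('p \<Rightarrow> 'e) \<Rightarrow> 'p \<Rightarrow> 'e"
  where "cmp k \<equiv> snd (snd (snd k))"

lemma SM_simps [simp]:
  "Obj SM = smfun_objects C P E M Io" "Arr SM = smfun_arrows C P E M Io Ia"
  "Dom SM (f, y, x, a) = y" "Cod SM (f, y, x, a) = x" "PObj SM = fst" "PArr SM = fst"
  "Ident SM x = (Ident C (fst x), x, x, \<lambda>p \<in> carrier P. Ident E (fam x p))"
  "(f, y, x, a) \<cdot>\<^bsub>SM\<^esub> (h, z, w, b) = (f \<cdot>\<^bsub>C\<^esub> h, z, x, \<lambda>p \<in> carrier P. a p \<cdot>\<^bsub>E\<^esub> b p)"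
  by (simp_all add: smfun_stack_def)

lemma SM_HomOver:
  "k \<in> HomOver SM f y x \<longleftrightarrow> (\<exists>a. k = (f, y, x, a) \<and> (f, y, x, a) \<in> smfun_arrows C P E M Io Ia)"
  by (cases k) (auto simp: HomOver_iff)

lemma sm_arrow_ident:
  assumes x: "sm_data x"
  shows "sm_arrow (Ident C (fst x)) x x (\<lambda>p \<in> carrier P. Ident E (fam x p))"
  using sm_dataD[OF x] unfolding sm_arrow_def by (simp add: HomOver_iff Ia_ident)

lemma sm_arrow_comp:
  assumes x: "sm_data x" and y: "sm_data y" and z: "sm_data z"
    and a: "sm_arrow f y x a" and b: "sm_arrow h z y b"
  shows "sm_arrow (f \<cdot>\<^bsub>C\<^esub> h) z x (\<lambda>p \<in> carrier P. a p \<cdot>\<^bsub>E\<^esub> b p)"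
proof -
  note [simp] = sm_dataD[OF x] sm_dataD[OF y] sm_dataD[OF z] sm_arrowD(1-4)[OF a]
    sm_arrowD(1-4)[OF b] sm_arrow_base[OF x y a] sm_arrow_base[OF y z b]
  have "a (p \<otimes> q) \<cdot>\<^bsub>E\<^esub> b (p \<otimes> q) \<cdot>\<^bsub>E\<^esub> mu z p q =
      mu x p q \<cdot>\<^bsub>E\<^esub> TArr M (a p \<cdot>\<^bsub>E\<^esub> b p) (a q \<cdot>\<^bsub>E\<^esub> b q)"
    if pq [simp]: "p \<in> carrier P" "q \<in> carrier P" for p q
  proof -
    have "a (p \<otimes> q) \<cdot>\<^bsub>E\<^esub> b (p \<otimes> q) \<cdot>\<^bsub>E\<^esub> mu z p q = a (p \<otimes> q) \<cdot>\<^bsub>E\<^esub> (mu y p q \<cdot>\<^bsub>E\<^esub> TArr M (b p) (b q))"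
      using sm_arrowD(5)[OF b pq] by (simp add: total.assoc)
    also have "\<dots> = a (p \<otimes> q) \<cdot>\<^bsub>E\<^esub> mu y p q \<cdot>\<^bsub>E\<^esub> TArr M (b p) (b q)"
      by (simp add: total.assoc)
    also have "\<dots> = mu x p q \<cdot>\<^bsub>E\<^esub> (TArr M (a p) (a q) \<cdot>\<^bsub>E\<^esub> TArr M (b p) (b q))"
      unfolding sm_arrowD(5)[OF a pq] by (simp add: total.assoc)
    finally show ?thesis by (simp add: interchange)
  qed
  moreover have "a \<one> \<cdot>\<^bsub>E\<^esub> b \<one> \<cdot>\<^bsub>E\<^esub> eps z = eps x \<cdot>\<^bsub>E\<^esub> Ia (f \<cdot>\<^bsub>C\<^esub> h)"
  proof -
    have "a \<one> \<cdot>\<^bsub>E\<^esub> b \<one> \<cdot>\<^bsub>E\<^esub> eps z = a \<one> \<cdot>\<^bsub>E\<^esub> eps y \<cdot>\<^bsub>E\<^esub> Ia h"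
      using sm_arrowD(6)[OF b] by (simp add: total.assoc)
    also have "\<dots> = eps x \<cdot>\<^bsub>E\<^esub> Ia (f \<cdot>\<^bsub>C\<^esub> h)"
      unfolding sm_arrowD(6)[OF a] by (simp add: total.assoc Ia_comp)
    finally show ?thesis .
  qed
  ultimately show ?thesis unfolding sm_arrow_def by (simp add: HomOver_iff)
qed

lemma category_SM: "category SM"
proof
  fix f assume "f \<in> Arr SM"
  then show "Dom SM f \<in> Obj SM \<and> Cod SM f \<in> Obj SM" by (cases f) (auto simp: smfun_arrows_iff)
next
  fix X assume "X \<in> Obj SM"
  then show "Ident SM X \<in> Hom SM X X"
    using sm_arrow_ident[of X] sm_dataD(1)[of X]
    by (simp add: Hom_def smfun_arrows_iff smfun_objects_iff)
next
  fix f g X Y Z assume "f \<in> Hom SM X Y" "g \<in> Hom SM Y Z"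
  moreover obtain f1 y x a where f: "f = (f1, y, x, a)" by (cases f)
  moreover obtain g1 w z b where g: "g = (g1, w, z, b)" by (cases g)
  ultimately have w: "w = x" "X = y" "Z = z" "(f1, y, x, a) \<in> smfun_arrows C P E M Io Ia"
    "(g1, x, z, b) \<in> smfun_arrows C P E M Io Ia"
    by (auto simp: Hom_def)
  then show "g \<cdot>\<^bsub>SM\<^esub> f \<in> Hom SM X Z" unfolding f g
    using sm_arrow_comp[of z x y g1 b f1 a]
    by (simp add: Hom_def smfun_arrows_iff smfun_objects_iff)
next
  fix f X Y assume "f \<in> Hom SM X Y"
  moreover obtain f1 y x a where f: "f = (f1, y, x, a)" by (cases f)
  ultimately have w: "X = y" "Y = x" "(f1, y, x, a) \<in> smfun_arrows C P E M Io Ia"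
    by (auto simp: Hom_def)
  then have a: "sm_arrow f1 y x a" and x: "sm_data x" "sm_data y" and e: "a \<in> extensional (carrier P)"
    by (simp_all add: smfun_arrows_iff smfun_objects_iff)
  show "f \<cdot>\<^bsub>SM\<^esub> Ident SM X = f \<and> Ident SM Y \<cdot>\<^bsub>SM\<^esub> f = f"
    unfolding f w using sm_arrowD(1-4)[OF a] sm_arrow_base[OF x a] e
    by (auto intro!: extensionalityI[of _ "carrier P"])
next
  fix f g h W X Y Z assume "f \<in> Hom SM W X" "g \<in> Hom SM X Y" "h \<in> Hom SM Y Z"
  moreover obtain f1 x w a where f: "f = (f1, w, x, a)" by (cases f)
  moreover obtain g1 y x' b where g: "g = (g1, x', y, b)" by (cases g)
  moreover obtain h1 z y' c where h: "h = (h1, y', z, c)" by (cases h)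
  ultimately have w: "x' = x" "y' = y" "(f1, w, x, a) \<in> smfun_arrows C P E M Io Ia"
    "(g1, x, y, b) \<in> smfun_arrows C P E M Io Ia" "(h1, y, z, c) \<in> smfun_arrows C P E M Io Ia"
    by (auto simp: Hom_def)
  then have d: "sm_data w" "sm_data x" "sm_data y" "sm_data z"
    and a: "sm_arrow f1 w x a" "sm_arrow g1 x y b" "sm_arrow h1 y z c"
    by (simp_all add: smfun_arrows_iff smfun_objects_iff)
  note t = sm_arrowD(1-4)[OF a(1)] sm_arrowD(1-4)[OF a(2)] sm_arrowD(1-4)[OF a(3)]
    sm_arrow_base[OF d(2,1) a(1)] sm_arrow_base[OF d(3,2) a(2)] sm_arrow_base[OF d(4,3) a(3)]
  show "h \<cdot>\<^bsub>SM\<^esub> (g \<cdot>\<^bsub>SM\<^esub> f) = h \<cdot>\<^bsub>SM\<^esub> g \<cdot>\<^bsub>SM\<^esub> f"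
    unfolding f g h w using t
    by (auto simp: base.assoc total.assoc intro!: extensionalityI[of _ "carrier P"])
qed

text \<open>The base arrow is lifted separately at every element. The structure isomorphisms of the
  pullback are the factorisations through \<open>a (p \<otimes> q)\<close> and
  \<open>a \<one>\<close> that make \<open>a\<close> compatible, and their coherence is then
  inherited from \<open>x\<close>.\<close>

lemma pullback_exists:
  assumes x: "sm_data x" "coherent x" and f: "f \<in> Arr C" "Cod C f = fst x"
  shows "\<exists>y a. fst y = Dom C f \<and> y \<in> smfun_objects C P E M Io \<and> a \<in> extensional (carrier P) \<and>
    sm_arrow f y x a"
proof -
  note [simp] = sm_dataD[OF x(1)] f
  have "\<forall>p \<in> carrier P. \<exists>a. a \<in> Arr E \<and> Cod E a = fam x p \<and> PArr E a = f"
    using lift[OF f(1)] by simp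
  then obtain a where a: "\<And>p. p \<in> carrier P \<Longrightarrow> a p \<in> Arr E" "\<And>p. p \<in> carrier P \<Longrightarrow> Cod E (a p) = fam x p"
    "\<And>p. p \<in> carrier P \<Longrightarrow> PArr E (a p) = f" by metis
  define L where "L = (\<lambda>p \<in> carrier P. Dom E (a p))"
  have L: "L p \<in> Obj E" "PObj E (L p) = Dom C f" "a p \<in> HomOver E f (L p) (fam x p)"
    if "p \<in> carrier P" for p
    using that a[OF that] unfolding L_def by (simp_all add: HomOver_iff)
  \<comment> \<open>Reading \<open>f\<close> as its composite with an identity makes the
    factorisations below vertical.\<close>
  have fI: "f \<cdot>\<^bsub>C\<^esub> Ident C (Dom C f) = f" "Ident C (Dom C f) \<in> Arr C" "Cod C (Ident C (Dom C f)) = Dom C f"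
    by simp_all
  have "\<forall>p \<in> carrier P. \<forall>q \<in> carrier P. \<exists>m. m \<in> HomOver E (Ident C (Dom C f)) (TObj M (L p) (L q)) (L (p \<otimes> q))
      \<and> a (p \<otimes> q) \<cdot>\<^bsub>E\<^esub> m = mu x p q \<cdot>\<^bsub>E\<^esub> TArr M (a p) (a q)"
  proof (intro ballI)
    fix p q assume pq: "p \<in> carrier P" "q \<in> carrier P"
    have "mu x p q \<cdot>\<^bsub>E\<^esub> TArr M (a p) (a q) \<in>
        HomOver E (f \<cdot>\<^bsub>C\<^esub> Ident C (Dom C f)) (TObj M (L p) (L q)) (fam x (p \<otimes> q))"
      using pq a L_def by (simp add: HomOver_iff fI)
    from factor_ex[OF L(3)[OF m_closed[OF pq]] this fI(2,3)]
    show "\<exists>m. m \<in> HomOver E (Ident C (Dom C f)) (TObj M (L p) (L q)) (L (p \<otimes> q))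
      \<and> a (p \<otimes> q) \<cdot>\<^bsub>E\<^esub> m = mu x p q \<cdot>\<^bsub>E\<^esub> TArr M (a p) (a q)" by blast
  qed
  then obtain m where m: "\<And>p q. p \<in> carrier P \<Longrightarrow> q \<in> carrier P \<Longrightarrow>
      m p q \<in> HomOver E (Ident C (Dom C f)) (TObj M (L p) (L q)) (L (p \<otimes> q))"
    "\<And>p q. p \<in> carrier P \<Longrightarrow> q \<in> carrier P \<Longrightarrow> a (p \<otimes> q) \<cdot>\<^bsub>E\<^esub> m p q = mu x p q \<cdot>\<^bsub>E\<^esub> TArr M (a p) (a q)"
    by metis
  have "eps x \<cdot>\<^bsub>E\<^esub> Ia f \<in> HomOver E (f \<cdot>\<^bsub>C\<^esub> Ident C (Dom C f)) (Io (Dom C f)) (fam x \<one>)"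
    by (simp add: HomOver_iff fI)
  from factor_ex[OF L(3)[OF one_closed] this fI(2,3)]
  obtain e where e: "e \<in> HomOver E (Ident C (Dom C f)) (Io (Dom C f)) (L \<one>)"
    "a \<one> \<cdot>\<^bsub>E\<^esub> e = eps x \<cdot>\<^bsub>E\<^esub> Ia f" by blast
  define y where "y = (Dom C f, L, \<lambda>p \<in> carrier P. \<lambda>q \<in> carrier P. m p q, e)"
  have y: "sm_data y" unfolding sm_data_def y_def using L m e by (simp add: Over_iff)
  have "sm_arrow f y x a" unfolding sm_arrow_def y_def using L m e by simp
  then have a': "sm_arrow f y x (restrict a (carrier P))" unfolding sm_arrow_def by simp
  have "ext_data y" unfolding ext_data_def y_def L_def by simp
  with coherent_source[OF x(1) y a' x(2)] y have "y \<in> smfun_objects C P E M Io"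
    by (simp add: smfun_objects_iff)
  then show ?thesis using a'
    by (intro exI[of _ y] exI[of _ "restrict a (carrier P)"]) (simp add: y_def)
qed

text \<open>The components are the factorisations in \<open>E\<close>. Their compatibility with the
  structure isomorphisms can be checked after composing with \<open>a (p \<otimes> q)\<close> and
  \<open>a \<one>\<close>, where it follows from that of \<open>a\<close> and
  \<open>b\<close>.\<close>

lemma factor_sm:
  assumes x: "sm_data x" and y: "sm_data y" and z: "sm_data z"
    and a: "sm_arrow f y x a" and b: "sm_arrow (f \<cdot>\<^bsub>C\<^esub> h) z x b" and h: "h \<in> Hom C (fst z) (fst y)"
  shows "\<exists>c \<in> extensional (carrier P). sm_arrow h z y c \<and> (\<forall>p \<in> carrier P. a p \<cdot>\<^bsub>E\<^esub> c p = b p)"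
proof -
  have h': "h \<in> Arr C" "Dom C h = fst z" "Cod C h = fst y" using h by (simp_all add: Hom_def)
  note [simp] = sm_dataD[OF x] sm_dataD[OF y] sm_dataD[OF z] sm_arrowD(1-4)[OF a]
    sm_arrowD(1-4)[OF b] sm_arrow_base[OF x y a] h'
  have "\<forall>p \<in> carrier P. \<exists>c \<in> HomOver E h (fam z p) (fam y p). a p \<cdot>\<^bsub>E\<^esub> c = b p"
    using factor_ex[OF sm_arrowD(7)[OF a] sm_arrowD(7)[OF b]] by simp
  then obtain c where c: "\<And>p. p \<in> carrier P \<Longrightarrow> c p \<in> HomOver E h (fam z p) (fam y p)"
    "\<And>p. p \<in> carrier P \<Longrightarrow> a p \<cdot>\<^bsub>E\<^esub> c p = b p" by metis
  then have [simp]: "\<And>p. p \<in> carrier P \<Longrightarrow> c p \<in> Arr E" "\<And>p. p \<in> carrier P \<Longrightarrow> Dom E (c p) = fam z p"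
    "\<And>p. p \<in> carrier P \<Longrightarrow> Cod E (c p) = fam y p" "\<And>p. p \<in> carrier P \<Longrightarrow> PArr E (c p) = h"
    by (simp_all add: HomOver_iff)
  have "c (p \<otimes> q) \<cdot>\<^bsub>E\<^esub> mu z p q = mu y p q \<cdot>\<^bsub>E\<^esub> TArr M (c p) (c q)"
    if pq [simp]: "p \<in> carrier P" "q \<in> carrier P" for p q
  proof (rule cancel[of "a (p \<otimes> q)"])
    have "a (p \<otimes> q) \<cdot>\<^bsub>E\<^esub> (c (p \<otimes> q) \<cdot>\<^bsub>E\<^esub> mu z p q) = b (p \<otimes> q) \<cdot>\<^bsub>E\<^esub> mu z p q"
      using c(2)[of "p \<otimes> q"] by (simp flip: total.assoc)
    also have "\<dots> = mu x p q \<cdot>\<^bsub>E\<^esub> (TArr M (a p) (a q) \<cdot>\<^bsub>E\<^esub> TArr M (c p) (c q))"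
      using c(2) sm_arrowD(5)[OF b pq] by (simp add: interchange)
    also have "\<dots> = a (p \<otimes> q) \<cdot>\<^bsub>E\<^esub> mu y p q \<cdot>\<^bsub>E\<^esub> TArr M (c p) (c q)"
      unfolding sm_arrowD(5)[OF a pq] by (simp add: total.assoc)
    also have "\<dots> = a (p \<otimes> q) \<cdot>\<^bsub>E\<^esub> (mu y p q \<cdot>\<^bsub>E\<^esub> TArr M (c p) (c q))"
      by (simp add: total.assoc)
    finally show "a (p \<otimes> q) \<cdot>\<^bsub>E\<^esub> (c (p \<otimes> q) \<cdot>\<^bsub>E\<^esub> mu z p q) = a (p \<otimes> q) \<cdot>\<^bsub>E\<^esub> (mu y p q \<cdot>\<^bsub>E\<^esub> TArr M (c p) (c q))" .
  qed simp_all
  moreover have "c \<one> \<cdot>\<^bsub>E\<^esub> eps z = eps y \<cdot>\<^bsub>E\<^esub> Ia h"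
  proof (rule cancel[of "a \<one>"])
    have "a \<one> \<cdot>\<^bsub>E\<^esub> (c \<one> \<cdot>\<^bsub>E\<^esub> eps z) = b \<one> \<cdot>\<^bsub>E\<^esub> eps z"
      using c(2)[of "\<one>"] by (simp flip: total.assoc)
    also have "\<dots> = eps x \<cdot>\<^bsub>E\<^esub> Ia f \<cdot>\<^bsub>E\<^esub> Ia h"
      unfolding sm_arrowD(6)[OF b] by (simp add: Ia_comp total.assoc)
    also have "\<dots> = a \<one> \<cdot>\<^bsub>E\<^esub> (eps y \<cdot>\<^bsub>E\<^esub> Ia h)"
      unfolding sm_arrowD(6)[OF a, symmetric] by (simp add: total.assoc)
    finally show "a \<one> \<cdot>\<^bsub>E\<^esub> (c \<one> \<cdot>\<^bsub>E\<^esub> eps z) = a \<one> \<cdot>\<^bsub>E\<^esub> (eps y \<cdot>\<^bsub>E\<^esub> Ia h)" .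
  qed simp_all
  ultimately have "sm_arrow h z y (restrict c (carrier P))" unfolding sm_arrow_def using c(1) by simp
  with c(2) show ?thesis by (intro bexI[of _ "restrict c (carrier P)"]) simp_all
qed

lemma fibred_SM: "fibred_in_groupoids C SM"
  unfolding fibred_in_groupoids_def
proof (intro conjI allI ballI impI)
  show "category SM" by (rule category_SM)
  show "is_functor SM C (PObj SM) (PArr SM)"
    unfolding is_functor_def by (auto simp: smfun_arrows_iff smfun_objects_iff)
next
  fix f x assume f: "f \<in> Arr C" and "x \<in> Over SM (Cod C f)"
  then have x: "x \<in> smfun_objects C P E M Io" "Cod C f = fst x" by (simp_all add: Over_iff)
  then obtain y a where "fst y = Dom C f" "y \<in> smfun_objects C P E M Io"
    "a \<in> extensional (carrier P)" "sm_arrow f y x a"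
    using pullback_exists[of x f] f unfolding smfun_objects_iff by blast
  then show "\<exists>y\<in>Over SM (Dom C f). \<exists>a. a \<in> HomOver SM f y x" using x f
    by (intro bexI[of _ y] exI[of _ "(f, y, x, a)"])
      (simp_all add: Over_iff SM_HomOver smfun_arrows_iff Hom_def)
next
  fix f h x y z k l
  assume "k \<in> HomOver SM f y x" "l \<in> HomOver SM (f \<cdot>\<^bsub>C\<^esub> h) z x"
    and h: "h \<in> Hom C (PObj SM z) (PObj SM y)"
  then obtain a b where k: "k = (f, y, x, a)" "(f, y, x, a) \<in> smfun_arrows C P E M Io Ia"
    and l: "l = (f \<cdot>\<^bsub>C\<^esub> h, z, x, b)" "(f \<cdot>\<^bsub>C\<^esub> h, z, x, b) \<in> smfun_arrows C P E M Io Ia"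
    by (auto simp: SM_HomOver)
  have d: "sm_data x" "sm_data y" "sm_data z" and a: "sm_arrow f y x a" and b: "sm_arrow (f \<cdot>\<^bsub>C\<^esub> h) z x b"
    and b_ext: "b \<in> extensional (carrier P)"
    using k l by (simp_all add: smfun_arrows_iff smfun_objects_iff)
  have h': "h \<in> Hom C (fst z) (fst y)" using h by simp
  obtain c where c: "c \<in> extensional (carrier P)" "sm_arrow h z y c"
    "\<forall>p \<in> carrier P. a p \<cdot>\<^bsub>E\<^esub> c p = b p"
    using factor_sm[OF d a b h'] by blast
  show "\<exists>!c. c \<in> HomOver SM h z y \<and> k \<cdot>\<^bsub>SM\<^esub> c = l"
  proof (rule ex1I[of _ "(h, z, y, c)"])
    \<comment> \<open>Composition restricts families to the carrier, so it is the extensionality of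
      \<open>b\<close> that makes the composite equal to \<open>b\<close> itself.\<close>
    have "(\<lambda>p \<in> carrier P. a p \<cdot>\<^bsub>E\<^esub> c p) = b"
      using c(3) b_ext by (intro extensionalityI[of _ "carrier P"]) auto
    then show "(h, z, y, c) \<in> HomOver SM h z y \<and> k \<cdot>\<^bsub>SM\<^esub> (h, z, y, c) = l"
      using c h' k(2) l(2) unfolding k(1) l(1) by (simp add: SM_HomOver smfun_arrows_iff)
  next
    fix c' assume c': "c' \<in> HomOver SM h z y \<and> k \<cdot>\<^bsub>SM\<^esub> c' = l"
    then obtain c2 where c2: "c' = (h, z, y, c2)" "sm_arrow h z y c2" "c2 \<in> extensional (carrier P)"
      unfolding SM_HomOver smfun_arrows_iff by blast
    have eq: "(\<lambda>p \<in> carrier P. a p \<cdot>\<^bsub>E\<^esub> c2 p) = b" using c' unfolding c2(1) k(1) l(1) by simp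
    have "c2 = c"
    proof (rule extensionalityI[OF c2(3) c(1)])
      fix p assume p: "p \<in> carrier P"
      have "a p \<cdot>\<^bsub>E\<^esub> c2 p = a p \<cdot>\<^bsub>E\<^esub> c p" using fun_cong[OF eq, of p] c(3) p by simp
      then show "c2 p = c p"
        by (rule cancel[of "a p", rotated -1])
          (use sm_arrowD(1-4)[OF a p] sm_arrowD(1-4)[OF c2(2) p] sm_arrowD(1-4)[OF c(2) p] in simp_all)
    qed
    then show "c' = (h, z, y, c)" using c2 by simp
  qed
qed

end

section \<open>Descent for symmetric monoidal functors\<close>

locale sm_functor_stack = sm_functors C E M Io Ia P + fibred_stack C E Cov
  for C :: "('o, 'a) cat" and E :: "('o, 'a, 'x, 'e) fibcat" and M Io Ia
    and P :: "('p, 'm) monoid_scheme" (structure) and Cov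
begin

sublocale SM: fibred C SM
  by (rule fibredI[OF base.category_axioms fibred_SM])

text \<open>Each coherence condition is an equation of vertical arrows, so it may be tested on the
  covering. The test arrows are tensor products of components of the given families; along them the
  equations for the coherent objects \<open>y\<close> become the equations for
  \<open>x\<close>.\<close>

lemma coherent_locally:
  assumes x: "sm_data x" and U: "\<U> \<in> Cov (fst x)"
    and loc: "\<And>f. f \<in> \<U> \<Longrightarrow> \<exists>y a. sm_data y \<and> coherent y \<and> sm_arrow f y x a"
  shows "coherent x"
proof -
  note x_simps [simp] = sm_dataD[OF x]
  note eq = eq_locally[OF sm_dataD(1)[OF x] U]
  show ?thesis unfolding coherent_def
  proof (intro conjI ballI)
    fix p q r assume pqr [simp]: "p \<in> carrier P" "q \<in> carrier P" "r \<in> carrier P"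
    let ?l = "mu x (p \<otimes> q) r \<cdot>\<^bsub>E\<^esub> TArr M (mu x p q) (Ident E (fam x r))"
    let ?r = "mu x p (q \<otimes> r) \<cdot>\<^bsub>E\<^esub> TArr M (Ident E (fam x p)) (mu x q r)
        \<cdot>\<^bsub>E\<^esub> Assoc M (fam x p) (fam x q) (fam x r)"
    show "?l = ?r"
    proof (rule eq)
      show "?l \<in> HomOver E (Ident C (fst x)) (TObj M (TObj M (fam x p) (fam x q)) (fam x r)) (fam x (p \<otimes> (q \<otimes> r)))"
        "?r \<in> HomOver E (Ident C (fst x)) (TObj M (TObj M (fam x p) (fam x q)) (fam x r)) (fam x (p \<otimes> (q \<otimes> r)))"
        by (simp_all add: HomOver_iff m_assoc)
      fix f assume "f \<in> \<U>"
      then obtain y a where y: "sm_data y" "coherent y" and a: "sm_arrow f y x a" using loc by blast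
      have "?l \<cdot>\<^bsub>E\<^esub> TArr M (TArr M (a p) (a q)) (a r) = ?r \<cdot>\<^bsub>E\<^esub> TArr M (TArr M (a p) (a q)) (a r)"
        using sm_arrow_assoc_left[OF x y(1) a pqr] sm_arrow_assoc_right[OF x y(1) a pqr]
          coherentD(1)[OF y(2) pqr] by metis
      moreover have "TArr M (TArr M (a p) (a q)) (a r) \<in> HomOver E f
          (TObj M (TObj M (fam y p) (fam y q)) (fam y r)) (TObj M (TObj M (fam x p) (fam x q)) (fam x r))"
        using sm_arrowD(7)[OF a] by (intro TArr_HomOver) simp_all
      ultimately show "\<exists>z. \<exists>c \<in> HomOver E f z (TObj M (TObj M (fam x p) (fam x q)) (fam x r)).
          ?l \<cdot>\<^bsub>E\<^esub> c = ?r \<cdot>\<^bsub>E\<^esub> c" by blast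
    qed
  next
    fix p assume p [simp]: "p \<in> carrier P"
    let ?l = "mu x \<one> p \<cdot>\<^bsub>E\<^esub> TArr M (eps x) (Ident E (fam x p))"
    show "?l = LUnit M (fam x p)"
    proof (rule eq)
      show "?l \<in> HomOver E (Ident C (fst x)) (TObj M (Io (fst x)) (fam x p)) (fam x p)"
        "LUnit M (fam x p) \<in> HomOver E (Ident C (fst x)) (TObj M (Io (fst x)) (fam x p)) (fam x p)"
        by (simp_all add: HomOver_iff)
      fix f assume "f \<in> \<U>"
      then obtain y a where y: "sm_data y" "coherent y" and a: "sm_arrow f y x a" using loc by blast
      have "?l \<cdot>\<^bsub>E\<^esub> TArr M (Ia f) (a p) = LUnit M (fam x p) \<cdot>\<^bsub>E\<^esub> TArr M (Ia f) (a p)"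
        using sm_arrow_lunit[OF x y(1) a p] coherentD(2)[OF y(2) p]
          Unit_natural(1)[OF sm_arrowD(7)[OF a p]] by metis
      moreover have "TArr M (Ia f) (a p) \<in> HomOver E f (TObj M (Io (fst y)) (fam y p)) (TObj M (Io (fst x)) (fam x p))"
        using sm_arrowD(7)[OF a] sm_arrow_base[OF x y(1) a]
        by (intro TArr_HomOver) (simp_all add: HomOver_iff)
      ultimately show "\<exists>z. \<exists>c \<in> HomOver E f z (TObj M (Io (fst x)) (fam x p)).
          ?l \<cdot>\<^bsub>E\<^esub> c = LUnit M (fam x p) \<cdot>\<^bsub>E\<^esub> c" by blast
    qed
    let ?l = "mu x p \<one> \<cdot>\<^bsub>E\<^esub> TArr M (Ident E (fam x p)) (eps x)"
    show "?l = RUnit M (fam x p)"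
    proof (rule eq)
      show "?l \<in> HomOver E (Ident C (fst x)) (TObj M (fam x p) (Io (fst x))) (fam x p)"
        "RUnit M (fam x p) \<in> HomOver E (Ident C (fst x)) (TObj M (fam x p) (Io (fst x))) (fam x p)"
        by (simp_all add: HomOver_iff)
      fix f assume "f \<in> \<U>"
      then obtain y a where y: "sm_data y" "coherent y" and a: "sm_arrow f y x a" using loc by blast
      have "?l \<cdot>\<^bsub>E\<^esub> TArr M (a p) (Ia f) = RUnit M (fam x p) \<cdot>\<^bsub>E\<^esub> TArr M (a p) (Ia f)"
        using sm_arrow_runit[OF x y(1) a p] coherentD(3)[OF y(2) p]
          Unit_natural(2)[OF sm_arrowD(7)[OF a p]] by metis
      moreover have "TArr M (a p) (Ia f) \<in> HomOver E f (TObj M (fam y p) (Io (fst y))) (TObj M (fam x p) (Io (fst x)))"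
        using sm_arrowD(7)[OF a] sm_arrow_base[OF x y(1) a]
        by (intro TArr_HomOver) (simp_all add: HomOver_iff)
      ultimately show "\<exists>z. \<exists>c \<in> HomOver E f z (TObj M (fam x p) (Io (fst x))).
          ?l \<cdot>\<^bsub>E\<^esub> c = RUnit M (fam x p) \<cdot>\<^bsub>E\<^esub> c" by blast
    qed
  next
    fix p q assume pq [simp]: "p \<in> carrier P" "q \<in> carrier P"
    let ?r = "mu x q p \<cdot>\<^bsub>E\<^esub> Braid M (fam x p) (fam x q)"
    have qp: "q \<otimes> p = p \<otimes> q" by (simp add: m_comm)
    show "mu x p q = ?r"
    proof (rule eq)
      show "mu x p q \<in> HomOver E (Ident C (fst x)) (TObj M (fam x p) (fam x q)) (fam x (p \<otimes> q))"
        "?r \<in> HomOver E (Ident C (fst x)) (TObj M (fam x p) (fam x q)) (fam x (p \<otimes> q))"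
        by (simp_all add: HomOver_iff qp)
      fix f assume "f \<in> \<U>"
      then obtain y a where y: "sm_data y" "coherent y" and a: "sm_arrow f y x a" using loc by blast
      have "mu x p q \<cdot>\<^bsub>E\<^esub> TArr M (a p) (a q) = ?r \<cdot>\<^bsub>E\<^esub> TArr M (a p) (a q)"
        using sm_arrow_braid[OF x y(1) a pq] sm_arrowD(5)[OF a pq] coherentD(4)[OF y(2) pq] by metis
      moreover have "TArr M (a p) (a q) \<in> HomOver E f (TObj M (fam y p) (fam y q)) (TObj M (fam x p) (fam x q))"
        using sm_arrowD(7)[OF a] by (intro TArr_HomOver) simp_all
      ultimately show "\<exists>z. \<exists>c \<in> HomOver E f z (TObj M (fam x p) (fam x q)).
          mu x p q \<cdot>\<^bsub>E\<^esub> c = ?r \<cdot>\<^bsub>E\<^esub> c" by blast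
    qed
  qed
qed

lemma SM_HomOverD:
  assumes "k \<in> HomOver SM f y x"
  shows "k = (f, y, x, cmp k)" "sm_arrow f y x (cmp k)" "sm_data x" "sm_data y" "coherent y"
    "x \<in> smfun_objects C P E M Io" "y \<in> smfun_objects C P E M Io" "cmp k \<in> extensional (carrier P)"
    "f \<in> Hom C (fst y) (fst x)"
  using assms by (auto simp: SM_HomOver smfun_arrows_iff smfun_objects_iff)

lemma SM_HomOverI:
  "\<lbrakk>f \<in> Hom C (fst y) (fst x); y \<in> smfun_objects C P E M Io; x \<in> smfun_objects C P E M Io;
    a \<in> extensional (carrier P); sm_arrow f y x a\<rbrakk> \<Longrightarrow> (f, y, x, a) \<in> HomOver SM f y x"
  by (simp add: SM_HomOver smfun_arrows_iff)

lemma cmp_comp: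
  assumes "k \<in> HomOver SM f y x" "l \<in> HomOver SM h z y" "p \<in> carrier P"
  shows "cmp (k \<cdot>\<^bsub>SM\<^esub> l) p = cmp k p \<cdot>\<^bsub>E\<^esub> cmp l p"
  by (subst SM_HomOverD(1)[OF assms(1)], subst SM_HomOverD(1)[OF assms(2)]) (use assms(3) in simp)

lemma SM_HomOver_eqI:
  assumes "k \<in> HomOver SM f y x" "l \<in> HomOver SM f y x"
    "\<And>p. p \<in> carrier P \<Longrightarrow> cmp k p = cmp l p"
  shows "k = l"
proof -
  have "cmp k = cmp l"
    using extensionalityI[OF SM_HomOverD(8)[OF assms(1)] SM_HomOverD(8)[OF assms(2)]] assms(3) by blast
  then show ?thesis using SM_HomOverD(1)[OF assms(1)] SM_HomOverD(1)[OF assms(2)] by simp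
qed

lemma SM_comp_HomOver:
  assumes "k \<in> HomOver SM f y x" "l \<in> HomOver SM h z y"
  shows "k \<cdot>\<^bsub>SM\<^esub> l \<in> HomOver SM (f \<cdot>\<^bsub>C\<^esub> h) z x"
proof -
  have "k \<in> Arr SM" "l \<in> Arr SM" "Cod SM l = Dom SM k" using assms unfolding HomOver_iff by simp_all
  then show ?thesis using assms SM.total.comp_simps[of l k] SM.PArr_comp[of l k]
    unfolding HomOver_iff by simp
qed

text \<open>The components are glued in \<open>E\<close> one at a time. That the glued family
  respects the structure isomorphisms is again an equation of vertical arrows, hence local, and
  uniqueness holds in every component.\<close>

lemma arrows_glue_SM:
  assumes S: "S \<in> Obj C" and U: "\<U> \<in> Cov S"
  shows "arrows_glue C SM S (sieve C \<U>)"
  unfolding arrows_glue_def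
proof (intro ballI allI impI)
  let ?R = "sieve C \<U>"
  fix x y \<beta> assume "x \<in> Over SM S" "y \<in> Over SM S"
  then have x: "x \<in> smfun_objects C P E M Io" "fst x = S" "sm_data x" "coherent x"
    and y: "y \<in> smfun_objects C P E M Io" "fst y = S" "sm_data y" "coherent y"
    by (simp_all add: Over_iff smfun_objects_iff)
  note [simp] = sm_dataD[OF x(3)] sm_dataD[OF y(3)]
  assume \<beta>: "\<forall>c \<in> Arr SM. Cod SM c = x \<and> PArr SM c \<in> ?R \<longrightarrow>
    \<beta> c \<in> HomOver SM (PArr SM c) (Dom SM c) y \<and>
    (\<forall>d \<in> Arr SM. Cod SM d = Dom SM c \<longrightarrow> \<beta> (c \<cdot>\<^bsub>SM\<^esub> d) = \<beta> c \<cdot>\<^bsub>SM\<^esub> d)"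
  have \<beta>1: "\<beta> c \<in> HomOver SM f z y" if "c \<in> HomOver SM f z x" "f \<in> ?R" for c f z
    using \<beta> that unfolding HomOver_iff by blast
  have \<beta>2: "\<beta> (c \<cdot>\<^bsub>SM\<^esub> d) = \<beta> c \<cdot>\<^bsub>SM\<^esub> d"
    if "c \<in> HomOver SM f z x" "f \<in> ?R" "d \<in> HomOver SM h w z" for c d f h z w
    using \<beta> that unfolding HomOver_iff by blast
  \<comment> \<open>One lift of every member of the sieve is fixed. The arrow is glued along these
    lifts, and the remaining arrows to \<open>x\<close> are treated at the end.\<close>
  have "\<forall>f \<in> ?R. \<exists>k. \<exists>z. k \<in> HomOver SM f z x"
  proof
    fix f assume "f \<in> ?R"
    then have "f \<in> Arr C" "Cod C f = S" using covering_sieve_arr[OF S U] by auto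
    then have "\<exists>a. a \<in> Arr SM \<and> Cod SM a = x \<and> PArr SM a = f" using SM.lift[of f x] x by simp
    then show "\<exists>k. \<exists>z. k \<in> HomOver SM f z x" unfolding HomOver_iff by blast
  qed
  then obtain k z where k: "\<And>f. f \<in> ?R \<Longrightarrow> k f \<in> HomOver SM f (z f) x" by metis
  have \<beta>k: "\<And>f. f \<in> ?R \<Longrightarrow> \<beta> (k f) \<in> HomOver SM f (z f) y" using \<beta>1 k by blast
  have trans: "\<exists>t \<in> HomOver SM h (z (f \<cdot>\<^bsub>C\<^esub> h)) (z f).
      k f \<cdot>\<^bsub>SM\<^esub> t = k (f \<cdot>\<^bsub>C\<^esub> h) \<and> \<beta> (k f) \<cdot>\<^bsub>SM\<^esub> t = \<beta> (k (f \<cdot>\<^bsub>C\<^esub> h))"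
    if f: "f \<in> ?R" and h: "h \<in> Arr C" "Cod C h = Dom C f" for f h
    using SM.factor_ex[OF k[OF f] k[OF covering_comp_in_sieve[OF S U f h]] h] \<beta>2[OF k[OF f] f] by metis
  have comp_glue: "\<exists>!b. b \<in> HomOver E (Ident C S) (fam x p) (fam y p) \<and>
      (\<forall>f \<in> ?R. b \<cdot>\<^bsub>E\<^esub> cmp (k f) p = cmp (\<beta> (k f)) p)" if p: "p \<in> carrier P" for p
  proof (rule glue_arrow[OF S U, where z = "\<lambda>f. fam (z f) p"])
    show "fam x p \<in> Over E S" "fam y p \<in> Over E S" using p x y by (simp_all add: Over_iff)
    show "cmp (k f) p \<in> HomOver E f (fam (z f) p) (fam x p)" if "f \<in> ?R" for f
      using sm_arrowD(7)[OF SM_HomOverD(2)[OF k[OF that]] p] .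
    show "cmp (\<beta> (k f)) p \<in> HomOver E f (fam (z f) p) (fam y p)" if "f \<in> ?R" for f
      using sm_arrowD(7)[OF SM_HomOverD(2)[OF \<beta>k[OF that]] p] .
    fix f h assume f: "f \<in> ?R" and h: "h \<in> Arr C" "Cod C h = Dom C f"
    obtain t where t: "t \<in> HomOver SM h (z (f \<cdot>\<^bsub>C\<^esub> h)) (z f)"
      "k f \<cdot>\<^bsub>SM\<^esub> t = k (f \<cdot>\<^bsub>C\<^esub> h)" "\<beta> (k f) \<cdot>\<^bsub>SM\<^esub> t = \<beta> (k (f \<cdot>\<^bsub>C\<^esub> h))"
      using trans[OF f h] by blast
    show "\<exists>t \<in> HomOver E h (fam (z (f \<cdot>\<^bsub>C\<^esub> h)) p) (fam (z f) p).
      cmp (k f) p \<cdot>\<^bsub>E\<^esub> t = cmp (k (f \<cdot>\<^bsub>C\<^esub> h)) p \<and> cmp (\<beta> (k f)) p \<cdot>\<^bsub>E\<^esub> t = cmp (\<beta> (k (f \<cdot>\<^bsub>C\<^esub> h))) p"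
      using cmp_comp[OF k[OF f] t(1) p] cmp_comp[OF \<beta>k[OF f] t(1) p] t(2,3)
        sm_arrowD(7)[OF SM_HomOverD(2)[OF t(1)] p]
      by (intro bexI[of _ "cmp t p"]) simp_all
  qed
  then obtain b where b: "\<And>p. p \<in> carrier P \<Longrightarrow> b p \<in> HomOver E (Ident C S) (fam x p) (fam y p)"
    "\<And>p f. p \<in> carrier P \<Longrightarrow> f \<in> ?R \<Longrightarrow> b p \<cdot>\<^bsub>E\<^esub> cmp (k f) p = cmp (\<beta> (k f)) p" by metis
  then have bs [simp]: "\<And>p. p \<in> carrier P \<Longrightarrow> b p \<in> Arr E" "\<And>p. p \<in> carrier P \<Longrightarrow> Dom E (b p) = fam x p"
    "\<And>p. p \<in> carrier P \<Longrightarrow> Cod E (b p) = fam y p" "\<And>p. p \<in> carrier P \<Longrightarrow> PArr E (b p) = Ident C S"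
    by (simp_all add: HomOver_iff)
  have U_R: "f \<in> ?R" if "f \<in> \<U>" for f
    using covering_in_sieve[OF base.category_axioms that] covering_arr[OF S U that] by blast
  \<comment> \<open>The test arrow over \<open>f\<close> is the tensor product of two components of
    the chosen lift; there the equation combines the compatibility of \<open>k f\<close> with that
    of its image under \<beta>.\<close>
  have b_mu: "b (p \<otimes> q) \<cdot>\<^bsub>E\<^esub> mu x p q = mu y p q \<cdot>\<^bsub>E\<^esub> TArr M (b p) (b q)"
    if pq [simp]: "p \<in> carrier P" "q \<in> carrier P" for p q
  proof (rule eq_locally[OF S U])
    show "b (p \<otimes> q) \<cdot>\<^bsub>E\<^esub> mu x p q \<in> HomOver E (Ident C S) (TObj M (fam x p) (fam x q)) (fam y (p \<otimes> q))"
      "mu y p q \<cdot>\<^bsub>E\<^esub> TArr M (b p) (b q) \<in> HomOver E (Ident C S) (TObj M (fam x p) (fam x q)) (fam y (p \<otimes> q))"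
      using x(2) y(2) S by (simp_all add: HomOver_iff)
    fix f assume "f \<in> \<U>"
    then have f: "f \<in> ?R" by (rule U_R)
    note kf = SM_HomOverD[OF k[OF f]] and bf = SM_HomOverD[OF \<beta>k[OF f]]
    note t [simp] = sm_arrowD(1-4)[OF kf(2)] sm_arrowD(1-4)[OF bf(2)] sm_dataD[OF kf(4)]
      sm_arrow_base[OF kf(3,4,2)]
    have "b (p \<otimes> q) \<cdot>\<^bsub>E\<^esub> mu x p q \<cdot>\<^bsub>E\<^esub> TArr M (cmp (k f) p) (cmp (k f) q) =
        b (p \<otimes> q) \<cdot>\<^bsub>E\<^esub> (cmp (k f) (p \<otimes> q) \<cdot>\<^bsub>E\<^esub> mu (z f) p q)"
      unfolding sm_arrowD(5)[OF kf(2) pq] using x(2) by (simp add: total.assoc)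
    also have "\<dots> = b (p \<otimes> q) \<cdot>\<^bsub>E\<^esub> cmp (k f) (p \<otimes> q) \<cdot>\<^bsub>E\<^esub> mu (z f) p q"
      using x(2) by (simp add: total.assoc)
    also have "\<dots> = mu y p q \<cdot>\<^bsub>E\<^esub> TArr M (cmp (\<beta> (k f)) p) (cmp (\<beta> (k f)) q)"
      using b(2)[OF m_closed[OF pq] f] sm_arrowD(5)[OF bf(2) pq] by simp
    also have "\<dots> = mu y p q \<cdot>\<^bsub>E\<^esub> (TArr M (b p) (b q) \<cdot>\<^bsub>E\<^esub> TArr M (cmp (k f) p) (cmp (k f) q))"
      using b(2)[OF pq(1) f] b(2)[OF pq(2) f] by (simp add: interchange)
    also have "\<dots> = mu y p q \<cdot>\<^bsub>E\<^esub> TArr M (b p) (b q) \<cdot>\<^bsub>E\<^esub> TArr M (cmp (k f) p) (cmp (k f) q)"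
      using x(2) by (simp add: total.assoc)
    finally show "\<exists>z. \<exists>c \<in> HomOver E f z (TObj M (fam x p) (fam x q)).
        b (p \<otimes> q) \<cdot>\<^bsub>E\<^esub> mu x p q \<cdot>\<^bsub>E\<^esub> c = mu y p q \<cdot>\<^bsub>E\<^esub> TArr M (b p) (b q) \<cdot>\<^bsub>E\<^esub> c"
      using TArr_HomOver[OF sm_arrowD(7)[OF kf(2) pq(1)] sm_arrowD(7)[OF kf(2) pq(2)]] by blast
  qed
  have b_eps: "b \<one> \<cdot>\<^bsub>E\<^esub> eps x = eps y \<cdot>\<^bsub>E\<^esub> Ia (Ident C S)"
  proof (rule eq_locally[OF S U])
    show "b \<one> \<cdot>\<^bsub>E\<^esub> eps x \<in> HomOver E (Ident C S) (Io S) (fam y \<one>)"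
      "eps y \<cdot>\<^bsub>E\<^esub> Ia (Ident C S) \<in> HomOver E (Ident C S) (Io S) (fam y \<one>)"
      using x(2) y(2) S by (simp_all add: HomOver_iff)
    fix f assume "f \<in> \<U>"
    then have f: "f \<in> ?R" by (rule U_R)
    note kf = SM_HomOverD[OF k[OF f]] and bf = SM_HomOverD[OF \<beta>k[OF f]]
    note t [simp] = sm_arrowD(1-4)[OF kf(2)] sm_arrowD(1-4)[OF bf(2)] sm_dataD[OF kf(4)]
      sm_arrow_base[OF kf(3,4,2)]
    have "b \<one> \<cdot>\<^bsub>E\<^esub> eps x \<cdot>\<^bsub>E\<^esub> Ia f = b \<one> \<cdot>\<^bsub>E\<^esub> (cmp (k f) \<one> \<cdot>\<^bsub>E\<^esub> eps (z f))"
      unfolding sm_arrowD(6)[OF kf(2)] using x(2) S by (simp add: total.assoc)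
    also have "\<dots> = b \<one> \<cdot>\<^bsub>E\<^esub> cmp (k f) \<one> \<cdot>\<^bsub>E\<^esub> eps (z f)" by (simp add: total.assoc)
    also have "\<dots> = eps y \<cdot>\<^bsub>E\<^esub> Ia f"
      using b(2)[OF one_closed f] sm_arrowD(6)[OF bf(2)] by simp
    also have "\<dots> = eps y \<cdot>\<^bsub>E\<^esub> Ia (Ident C S) \<cdot>\<^bsub>E\<^esub> Ia f"
      using x(2) y(2) S by (simp add: Ia_ident)
    finally show "\<exists>z. \<exists>c \<in> HomOver E f z (Io S).
        b \<one> \<cdot>\<^bsub>E\<^esub> eps x \<cdot>\<^bsub>E\<^esub> c = eps y \<cdot>\<^bsub>E\<^esub> Ia (Ident C S) \<cdot>\<^bsub>E\<^esub> c"
      using t x(2) by (intro exI[of _ "Io (Dom C f)"] bexI[of _ "Ia f"]) (simp_all add: HomOver_iff)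
  qed
  define B where "B = (Ident C S, x, y, restrict b (carrier P))"
  have B: "B \<in> HomOver SM (Ident C S) x y"
    unfolding B_def
  proof (rule SM_HomOverI)
    show "sm_arrow (Ident C S) x y (restrict b (carrier P))"
      unfolding sm_arrow_def using b b_mu b_eps by simp
  qed (use x y S in \<open>simp_all add: Hom_def\<close>)
  have uniq: "B' = B" if B': "B' \<in> HomOver SM (Ident C S) x y"
    and B'k: "\<forall>f \<in> ?R. B' \<cdot>\<^bsub>SM\<^esub> k f = \<beta> (k f)" for B'
  proof (rule SM_HomOver_eqI[OF B' B])
    fix p assume p: "p \<in> carrier P"
    have "cmp B' p \<in> HomOver E (Ident C S) (fam x p) (fam y p)"
      using sm_arrowD(7)[OF SM_HomOverD(2)[OF B'] p] .
    moreover have "\<forall>f \<in> ?R. cmp B' p \<cdot>\<^bsub>E\<^esub> cmp (k f) p = cmp (\<beta> (k f)) p"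
      using cmp_comp[OF B' k p] B'k by metis
    ultimately have "cmp B' p = b p" using comp_glue[OF p] b(1)[OF p] b(2)[OF p] by blast
    then show "cmp B' p = cmp B p" using p by (simp add: B_def)
  qed
  have Bk: "B \<cdot>\<^bsub>SM\<^esub> k f = \<beta> (k f)" if f: "f \<in> ?R" for f
  proof (rule SM_HomOver_eqI)
    have "f \<in> Arr C" "Cod C f = S" using covering_sieve_arr[OF S U f] by auto
    then show "B \<cdot>\<^bsub>SM\<^esub> k f \<in> HomOver SM f (z f) y" using SM_comp_HomOver[OF B k[OF f]] by simp
    show "\<beta> (k f) \<in> HomOver SM f (z f) y" using \<beta>k[OF f] .
    fix p assume p: "p \<in> carrier P"
    show "cmp (B \<cdot>\<^bsub>SM\<^esub> k f) p = cmp (\<beta> (k f)) p"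
      using cmp_comp[OF B k[OF f] p] b(2)[OF p f] p by (simp add: B_def)
  qed
  \<comment> \<open>An arbitrary arrow over \<open>f\<close> is the chosen lift preceded by a
    vertical arrow, and \<beta> respects composition.\<close>
  have Bc: "B \<cdot>\<^bsub>SM\<^esub> c = \<beta> c" if c: "c \<in> Arr SM" "Cod SM c = x \<and> PArr SM c \<in> ?R" for c
  proof -
    define f where "f = PArr SM c"
    have f: "f \<in> ?R" using c by (simp add: f_def)
    have fC: "f \<in> Arr C" using covering_sieve_arr[OF S U f] by auto
    have cc: "c \<in> HomOver SM (f \<cdot>\<^bsub>C\<^esub> Ident C (Dom C f)) (Dom SM c) x"
      using c fC by (simp add: f_def HomOver_iff)
    have "Ident C (Dom C f) \<in> Arr C" "Cod C (Ident C (Dom C f)) = Dom C f" using fC by simp_all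
    from SM.factor_ex[OF k[OF f] cc this]
    obtain t where t: "t \<in> HomOver SM (Ident C (Dom C f)) (Dom SM c) (z f)" "k f \<cdot>\<^bsub>SM\<^esub> t = c"
      by blast
    have "B \<cdot>\<^bsub>SM\<^esub> c = B \<cdot>\<^bsub>SM\<^esub> k f \<cdot>\<^bsub>SM\<^esub> t"
      unfolding t(2)[symmetric]
      by (rule SM.total.assoc[symmetric]) (use B k[OF f] t(1) in \<open>unfold HomOver_iff, metis+\<close>)
    then show ?thesis unfolding Bk[OF f] \<beta>2[OF k[OF f] f t(1), symmetric] t(2) .
  qed
  show "\<exists>!b. b \<in> HomOver SM (Ident C S) x y \<and>
      (\<forall>c \<in> Arr SM. Cod SM c = x \<and> PArr SM c \<in> ?R \<longrightarrow> b \<cdot>\<^bsub>SM\<^esub> c = \<beta> c)"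
  proof (rule ex1I[of _ B])
    show "B \<in> HomOver SM (Ident C S) x y \<and>
        (\<forall>c \<in> Arr SM. Cod SM c = x \<and> PArr SM c \<in> ?R \<longrightarrow> B \<cdot>\<^bsub>SM\<^esub> c = \<beta> c)"
      using B Bc by blast
    fix B' assume B': "B' \<in> HomOver SM (Ident C S) x y \<and>
        (\<forall>c \<in> Arr SM. Cod SM c = x \<and> PArr SM c \<in> ?R \<longrightarrow> B' \<cdot>\<^bsub>SM\<^esub> c = \<beta> c)"
    show "B' = B"
    proof (rule uniq)
      show "B' \<in> HomOver SM (Ident C S) x y" using B' by blast
      show "\<forall>f \<in> ?R. B' \<cdot>\<^bsub>SM\<^esub> k f = \<beta> (k f)"
      proof
        fix f assume f: "f \<in> ?R"
        have "k f \<in> Arr SM" "Cod SM (k f) = x" "PArr SM (k f) = f"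
          using k[OF f] unfolding HomOver_iff by blast+
        then show "B' \<cdot>\<^bsub>SM\<^esub> k f = \<beta> (k f)" using B' f by metis
      qed
    qed
  qed
qed

text \<open>At a fixed element of \<open>P\<close> a descent datum of functors is a descent datum in
  \<open>E\<close>, which gives the glued objects \<open>L p\<close>. The structure isomorphisms are
  then glued as arrows between these objects, and coherence is local.\<close>

lemma objects_glue_SM:
  assumes S: "S \<in> Obj C" and U: "\<U> \<in> Cov S"
  shows "objects_glue C SM S (sieve C \<U>)"
  unfolding objects_glue_def
proof (intro allI impI)
  let ?R = "sieve C \<U>"
  fix X a assume dd: "descent_datum C SM ?R X a"
  note R_arr = covering_sieve_arr[OF S U] and R_comp = covering_comp_in_sieve[OF S U]
  have X: "X f \<in> smfun_objects C P E M Io" "fst (X f) = Dom C f" "sm_data (X f)" "coherent (X f)"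
    if "f \<in> ?R" for f
    using dd that unfolding descent_datum_def by (simp_all add: Over_iff smfun_objects_iff)
  have a_id: "a f (Ident C (Dom C f)) = Ident SM (X f)" if "f \<in> ?R" for f
    using dd that unfolding descent_datum_def by blast
  have a: "a f h \<in> HomOver SM h (X (f \<cdot>\<^bsub>C\<^esub> h)) (X f)"
    if "f \<in> ?R" "h \<in> Arr C" "Cod C h = Dom C f" for f h
    using dd that unfolding descent_datum_def by blast
  have a_comp: "a f (h \<cdot>\<^bsub>C\<^esub> l) = a f h \<cdot>\<^bsub>SM\<^esub> a (f \<cdot>\<^bsub>C\<^esub> h) l"
    if "f \<in> ?R" "h \<in> Arr C" "Cod C h = Dom C f" "l \<in> Arr C" "Cod C l = Dom C h" for f h l
    using dd that unfolding descent_datum_def by blast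
  have glue: "objects_glue C E S ?R" using stack[unfolded stack_def, THEN conjunct2] S U by blast
  have "\<forall>p \<in> carrier P. \<exists>x b. x \<in> Over E S \<and> (\<forall>f \<in> ?R. b f \<in> HomOver E f (fam (X f) p) x \<and>
      (\<forall>h \<in> Arr C. Cod C h = Dom C f \<longrightarrow> b f \<cdot>\<^bsub>E\<^esub> cmp (a f h) p = b (f \<cdot>\<^bsub>C\<^esub> h)))"
  proof
    fix p assume p: "p \<in> carrier P"
    have "descent_datum C E ?R (\<lambda>f. fam (X f) p) (\<lambda>f h. cmp (a f h) p)"
      unfolding descent_datum_def
    proof (intro ballI conjI impI)
      fix f assume f: "f \<in> ?R"
      show "fam (X f) p \<in> Over E (Dom C f)" using sm_dataD[OF X(3)[OF f]] X(2)[OF f] p by (simp add: Over_iff)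
      show "cmp (a f (Ident C (Dom C f))) p = Ident E (fam (X f) p)" using a_id[OF f] p by simp
      fix h assume h: "h \<in> Arr C" "Cod C h = Dom C f"
      show "cmp (a f h) p \<in> HomOver E h (fam (X (f \<cdot>\<^bsub>C\<^esub> h)) p) (fam (X f) p)"
        using sm_arrowD(7)[OF SM_HomOverD(2)[OF a[OF f h]] p] .
      fix l assume l: "l \<in> Arr C" "Cod C l = Dom C h"
      have l': "Cod C l = Dom C (f \<cdot>\<^bsub>C\<^esub> h)" using l h R_arr[OF f] by simp
      show "cmp (a f (h \<cdot>\<^bsub>C\<^esub> l)) p = cmp (a f h) p \<cdot>\<^bsub>E\<^esub> cmp (a (f \<cdot>\<^bsub>C\<^esub> h) l) p"
        unfolding a_comp[OF f h l] by (rule cmp_comp[OF a[OF f h] a[OF R_comp[OF f h] l(1) l'] p])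
    qed
    then show "\<exists>x b. x \<in> Over E S \<and> (\<forall>f \<in> ?R. b f \<in> HomOver E f (fam (X f) p) x \<and>
      (\<forall>h \<in> Arr C. Cod C h = Dom C f \<longrightarrow> b f \<cdot>\<^bsub>E\<^esub> cmp (a f h) p = b (f \<cdot>\<^bsub>C\<^esub> h)))"
      using glue unfolding objects_glue_def by blast
  qed
  from bchoice[OF this] obtain L0
    where "\<forall>p \<in> carrier P. \<exists>b. L0 p \<in> Over E S \<and>
      (\<forall>f \<in> ?R. b f \<in> HomOver E f (fam (X f) p) (L0 p) \<and>
      (\<forall>h \<in> Arr C. Cod C h = Dom C f \<longrightarrow> b f \<cdot>\<^bsub>E\<^esub> cmp (a f h) p = b (f \<cdot>\<^bsub>C\<^esub> h)))" by blast
  from bchoice[OF this] obtain b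
    where Lb: "\<forall>p \<in> carrier P. L0 p \<in> Over E S \<and>
      (\<forall>f \<in> ?R. b p f \<in> HomOver E f (fam (X f) p) (L0 p) \<and>
      (\<forall>h \<in> Arr C. Cod C h = Dom C f \<longrightarrow> b p f \<cdot>\<^bsub>E\<^esub> cmp (a f h) p = b p (f \<cdot>\<^bsub>C\<^esub> h)))" by blast
  define L where "L = restrict L0 (carrier P)"
  have L: "L p \<in> Over E S" if "p \<in> carrier P" for p using Lb that by (simp add: L_def)
  have b: "b p f \<in> HomOver E f (fam (X f) p) (L p)" if "p \<in> carrier P" "f \<in> ?R" for p f
    using Lb that by (simp add: L_def)
  have ba: "b p f \<cdot>\<^bsub>E\<^esub> cmp (a f h) p = b p (f \<cdot>\<^bsub>C\<^esub> h)"
    if "p \<in> carrier P" "f \<in> ?R" "h \<in> Arr C" "Cod C h = Dom C f" for p f h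
    using Lb that by blast
  have [simp]: "p \<in> carrier P \<Longrightarrow> L p \<in> Obj E" "p \<in> carrier P \<Longrightarrow> PObj E (L p) = S" for p
    using L by (simp_all add: Over_iff)
  have [simp]: "b p f \<in> Arr E" "Dom E (b p f) = fam (X f) p" "Cod E (b p f) = L p" "PArr E (b p f) = f"
    if "p \<in> carrier P" "f \<in> ?R" for p f
    using b[OF that] by (simp_all add: HomOver_iff)
  \<comment> \<open>Over \<open>f\<close> the structure isomorphism has to be that of
    \<open>X f\<close>, moved along the gluing arrows \<open>b p f\<close>. These local values fit
    together because the transition arrows \<open>a f h\<close> respect the structure
    isomorphisms.\<close>
  have "\<exists>m. m \<in> HomOver E (Ident C S) (TObj M (L p) (L q)) (L (p \<otimes> q)) \<and>
      (\<forall>f \<in> ?R. m \<cdot>\<^bsub>E\<^esub> TArr M (b p f) (b q f) = b (p \<otimes> q) f \<cdot>\<^bsub>E\<^esub> mu (X f) p q)"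
    if pq [simp]: "p \<in> carrier P" "q \<in> carrier P" for p q
  proof (rule ex1_implies_ex, rule glue_arrow[OF S U, where z = "\<lambda>f. TObj M (fam (X f) p) (fam (X f) q)"])
    show "TObj M (L p) (L q) \<in> Over E S" "L (p \<otimes> q) \<in> Over E S" by (simp_all add: Over_iff)
    fix f assume f: "f \<in> ?R"
    note [simp] = sm_dataD[OF X(3)[OF f]] X(2)[OF f] R_arr[OF f]
    show "TArr M (b p f) (b q f) \<in> HomOver E f (TObj M (fam (X f) p) (fam (X f) q)) (TObj M (L p) (L q))"
      using b f by (intro TArr_HomOver) simp_all
    show "b (p \<otimes> q) f \<cdot>\<^bsub>E\<^esub> mu (X f) p q \<in> HomOver E f (TObj M (fam (X f) p) (fam (X f) q)) (L (p \<otimes> q))"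
      using f by (simp add: HomOver_iff)
    fix h assume h: "h \<in> Arr C" "Cod C h = Dom C f"
    let ?t = "TArr M (cmp (a f h) p) (cmp (a f h) q)"
    note A = SM_HomOverD[OF a[OF f h]]
    note [simp] = sm_arrowD(1-4)[OF A(2)] sm_dataD[OF A(4)] h
    have fh: "f \<cdot>\<^bsub>C\<^esub> h \<in> ?R" "fst (X (f \<cdot>\<^bsub>C\<^esub> h)) = Dom C h"
      using R_comp[OF f h] X(2)[OF R_comp[OF f h]] by simp_all
    have "?t \<in> HomOver E h (TObj M (fam (X (f \<cdot>\<^bsub>C\<^esub> h)) p) (fam (X (f \<cdot>\<^bsub>C\<^esub> h)) q))
        (TObj M (fam (X f) p) (fam (X f) q))"
      using sm_arrowD(7)[OF A(2)] by (intro TArr_HomOver) simp_all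
    moreover have "TArr M (b p f) (b q f) \<cdot>\<^bsub>E\<^esub> ?t = TArr M (b p (f \<cdot>\<^bsub>C\<^esub> h)) (b q (f \<cdot>\<^bsub>C\<^esub> h))"
      using ba[OF pq(1) f h] ba[OF pq(2) f h] f by (simp add: interchange)
    moreover have "b (p \<otimes> q) f \<cdot>\<^bsub>E\<^esub> mu (X f) p q \<cdot>\<^bsub>E\<^esub> ?t =
        b (p \<otimes> q) (f \<cdot>\<^bsub>C\<^esub> h) \<cdot>\<^bsub>E\<^esub> mu (X (f \<cdot>\<^bsub>C\<^esub> h)) p q"
    proof -
      have "b (p \<otimes> q) f \<cdot>\<^bsub>E\<^esub> mu (X f) p q \<cdot>\<^bsub>E\<^esub> ?t = b (p \<otimes> q) f \<cdot>\<^bsub>E\<^esub> (mu (X f) p q \<cdot>\<^bsub>E\<^esub> ?t)"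
        using f by (simp add: total.assoc)
      also have "\<dots> = b (p \<otimes> q) f \<cdot>\<^bsub>E\<^esub> cmp (a f h) (p \<otimes> q) \<cdot>\<^bsub>E\<^esub> mu (X (f \<cdot>\<^bsub>C\<^esub> h)) p q"
        unfolding sm_arrowD(5)[OF A(2) pq, symmetric] using f by (simp add: total.assoc)
      finally show ?thesis using ba[OF m_closed[OF pq] f h] by simp
    qed
    ultimately show "\<exists>t \<in> HomOver E h (TObj M (fam (X (f \<cdot>\<^bsub>C\<^esub> h)) p) (fam (X (f \<cdot>\<^bsub>C\<^esub> h)) q))
        (TObj M (fam (X f) p) (fam (X f) q)).
        TArr M (b p f) (b q f) \<cdot>\<^bsub>E\<^esub> t = TArr M (b p (f \<cdot>\<^bsub>C\<^esub> h)) (b q (f \<cdot>\<^bsub>C\<^esub> h)) \<and>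
        b (p \<otimes> q) f \<cdot>\<^bsub>E\<^esub> mu (X f) p q \<cdot>\<^bsub>E\<^esub> t = b (p \<otimes> q) (f \<cdot>\<^bsub>C\<^esub> h) \<cdot>\<^bsub>E\<^esub> mu (X (f \<cdot>\<^bsub>C\<^esub> h)) p q"
      by blast
  qed
  then obtain m where m: "\<And>p q. p \<in> carrier P \<Longrightarrow> q \<in> carrier P \<Longrightarrow>
      m p q \<in> HomOver E (Ident C S) (TObj M (L p) (L q)) (L (p \<otimes> q))"
    "\<And>p q f. p \<in> carrier P \<Longrightarrow> q \<in> carrier P \<Longrightarrow> f \<in> ?R \<Longrightarrow>
      m p q \<cdot>\<^bsub>E\<^esub> TArr M (b p f) (b q f) = b (p \<otimes> q) f \<cdot>\<^bsub>E\<^esub> mu (X f) p q" by metis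
  have "\<exists>e. e \<in> HomOver E (Ident C S) (Io S) (L \<one>) \<and>
      (\<forall>f \<in> ?R. e \<cdot>\<^bsub>E\<^esub> Ia f = b \<one> f \<cdot>\<^bsub>E\<^esub> eps (X f))"
  proof (rule ex1_implies_ex, rule glue_arrow[OF S U, where z = "\<lambda>f. Io (Dom C f)"])
    show "Io S \<in> Over E S" "L \<one> \<in> Over E S" using S by (simp_all add: Over_iff)
    fix f assume f: "f \<in> ?R"
    note [simp] = sm_dataD[OF X(3)[OF f]] X(2)[OF f] R_arr[OF f]
    show "Ia f \<in> HomOver E f (Io (Dom C f)) (Io S)" by (simp add: HomOver_iff)
    show "b \<one> f \<cdot>\<^bsub>E\<^esub> eps (X f) \<in> HomOver E f (Io (Dom C f)) (L \<one>)"
      using f by (simp add: HomOver_iff)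
    fix h assume h: "h \<in> Arr C" "Cod C h = Dom C f"
    note A = SM_HomOverD[OF a[OF f h]]
    note [simp] = sm_arrowD(1-4)[OF A(2)] sm_dataD[OF A(4)] h
    have fh: "fst (X (f \<cdot>\<^bsub>C\<^esub> h)) = Dom C h"
      using X(2)[OF R_comp[OF f h]] by simp
    have "b \<one> f \<cdot>\<^bsub>E\<^esub> eps (X f) \<cdot>\<^bsub>E\<^esub> Ia h = b \<one> f \<cdot>\<^bsub>E\<^esub> (eps (X f) \<cdot>\<^bsub>E\<^esub> Ia h)"
      using f by (simp add: total.assoc)
    also have "\<dots> = b \<one> f \<cdot>\<^bsub>E\<^esub> cmp (a f h) \<one> \<cdot>\<^bsub>E\<^esub> eps (X (f \<cdot>\<^bsub>C\<^esub> h))"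
      unfolding sm_arrowD(6)[OF A(2), symmetric] using f by (simp add: total.assoc)
    finally have "b \<one> f \<cdot>\<^bsub>E\<^esub> eps (X f) \<cdot>\<^bsub>E\<^esub> Ia h = b \<one> (f \<cdot>\<^bsub>C\<^esub> h) \<cdot>\<^bsub>E\<^esub> eps (X (f \<cdot>\<^bsub>C\<^esub> h))"
      using ba[OF one_closed f h] by simp
    then show "\<exists>t \<in> HomOver E h (Io (Dom C (f \<cdot>\<^bsub>C\<^esub> h))) (Io (Dom C f)). Ia f \<cdot>\<^bsub>E\<^esub> t = Ia (f \<cdot>\<^bsub>C\<^esub> h) \<and>
        b \<one> f \<cdot>\<^bsub>E\<^esub> eps (X f) \<cdot>\<^bsub>E\<^esub> t = b \<one> (f \<cdot>\<^bsub>C\<^esub> h) \<cdot>\<^bsub>E\<^esub> eps (X (f \<cdot>\<^bsub>C\<^esub> h))"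
      by (intro bexI[of _ "Ia h"]) (simp_all add: HomOver_iff Ia_comp)
  qed
  then obtain e where e: "e \<in> HomOver E (Ident C S) (Io S) (L \<one>)"
    "\<And>f. f \<in> ?R \<Longrightarrow> e \<cdot>\<^bsub>E\<^esub> Ia f = b \<one> f \<cdot>\<^bsub>E\<^esub> eps (X f)" by blast
  define x where "x = (S, L, \<lambda>p \<in> carrier P. \<lambda>q \<in> carrier P. m p q, e)"
  define k where "k f = (\<lambda>p \<in> carrier P. b p f)" for f
  have x: "sm_data x" unfolding sm_data_def x_def using S m(1) e(1) L by simp
  have k: "sm_arrow f (X f) x (k f)" if f: "f \<in> ?R" for f
    unfolding sm_arrow_def x_def k_def using b m(2) e(2) f by simp
  \<comment> \<open>The gluing arrows form compatible families from the coherent objects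
    \<open>X f\<close> to \<open>x\<close>.\<close>
  have "coherent x"
  proof (rule coherent_locally[OF x])
    show "\<U> \<in> Cov (fst x)" using U by (simp add: x_def)
    fix f assume "f \<in> \<U>"
    then have f: "f \<in> ?R"
      using covering_in_sieve[OF base.category_axioms] covering_arr[OF S U] by blast
    then show "\<exists>y a. sm_data y \<and> coherent y \<and> sm_arrow f y x a" using X(3,4) k by blast
  qed
  moreover have "ext_data x" unfolding ext_data_def x_def L_def by simp
  ultimately have xo: "x \<in> smfun_objects C P E M Io" using x by (simp add: smfun_objects_iff)
  have K: "(f, X f, x, k f) \<in> HomOver SM f (X f) x" if f: "f \<in> ?R" for f
  proof (rule SM_HomOverI)
    show "f \<in> Hom C (fst (X f)) (fst x)" using R_arr[OF f] X(2)[OF f] by (simp add: Hom_def x_def)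
  qed (use X(1)[OF f] xo k[OF f] in \<open>simp_all add: k_def\<close>)
  have "(f, X f, x, k f) \<cdot>\<^bsub>SM\<^esub> a f h = (f \<cdot>\<^bsub>C\<^esub> h, X (f \<cdot>\<^bsub>C\<^esub> h), x, k (f \<cdot>\<^bsub>C\<^esub> h))"
    if f: "f \<in> ?R" and h: "h \<in> Arr C" "Cod C h = Dom C f" for f h
  proof (rule SM_HomOver_eqI)
    show "(f, X f, x, k f) \<cdot>\<^bsub>SM\<^esub> a f h \<in> HomOver SM (f \<cdot>\<^bsub>C\<^esub> h) (X (f \<cdot>\<^bsub>C\<^esub> h)) x"
      by (rule SM_comp_HomOver[OF K[OF f] a[OF f h]])
    show "(f \<cdot>\<^bsub>C\<^esub> h, X (f \<cdot>\<^bsub>C\<^esub> h), x, k (f \<cdot>\<^bsub>C\<^esub> h)) \<in> HomOver SM (f \<cdot>\<^bsub>C\<^esub> h) (X (f \<cdot>\<^bsub>C\<^esub> h)) x"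
      by (rule K[OF R_comp[OF f h]])
    fix p assume p: "p \<in> carrier P"
    show "cmp ((f, X f, x, k f) \<cdot>\<^bsub>SM\<^esub> a f h) p = cmp (f \<cdot>\<^bsub>C\<^esub> h, X (f \<cdot>\<^bsub>C\<^esub> h), x, k (f \<cdot>\<^bsub>C\<^esub> h)) p"
      using cmp_comp[OF K[OF f] a[OF f h] p] ba[OF p f h] p by (simp add: k_def)
  qed
  moreover have "x \<in> Over SM S" using xo by (simp add: Over_iff x_def)
  ultimately show "\<exists>x \<in> Over SM S. \<exists>b. \<forall>f \<in> ?R. b f \<in> HomOver SM f (X f) x \<and>
      (\<forall>h \<in> Arr C. Cod C h = Dom C f \<longrightarrow> b f \<cdot>\<^bsub>SM\<^esub> a f h = b (f \<cdot>\<^bsub>C\<^esub> h))"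
    using K by (intro bexI[of _ x] exI[of _ "\<lambda>f. (f, X f, x, k f)"]) auto
qed

lemma stack_SM: "stack C Cov SM"
  unfolding stack_def using fibred_SM arrows_glue_SM objects_glue_SM by blast

end

section \<open>Splitting torsors over fine torsion-free monoids\<close>

text \<open>A homomorphism to \<open>G\<close> from a saturated subgroup of the free abelian group
  on \<open>I\<close>; the elements of that group are written as integer functions that vanish
  outside \<open>I\<close>.\<close>

definition lattice_character ::
  "('g, 'n) monoid_scheme \<Rightarrow> 'i set \<Rightarrow> ('i \<Rightarrow> int) set \<Rightarrow> (('i \<Rightarrow> int) \<Rightarrow> 'g) \<Rightarrow> bool" where
  "lattice_character G I K \<phi> \<longleftrightarrow> (\<lambda>i. 0) \<in> K \<and> (\<forall>c \<in> K. \<forall>i. i \<notin> I \<longrightarrow> c i = 0) \<and>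
    (\<forall>c \<in> K. (\<lambda>i. - c i) \<in> K) \<and>
    (\<forall>c \<in> K. \<forall>d \<in> K. (\<lambda>i. c i + d i) \<in> K \<and> \<phi> (\<lambda>i. c i + d i) = \<phi> c \<otimes>\<^bsub>G\<^esub> \<phi> d) \<and>
    (\<forall>c. \<forall>n::nat. n > 0 \<and> (\<lambda>i. int n * c i) \<in> K \<longrightarrow> c \<in> K) \<and> (\<forall>c \<in> K. \<phi> c \<in> carrier G)"

context comm_group
begin

lemma lattice_character_zero:
  assumes "lattice_character G I K \<phi>" shows "\<phi> (\<lambda>i. 0) = \<one>"
proof -
  have z: "(\<lambda>i. 0) \<in> K" using assms unfolding lattice_character_def by blast
  have "\<forall>c \<in> K. \<forall>d \<in> K. (\<lambda>i. c i + d i) \<in> K \<and> \<phi> (\<lambda>i. c i + d i) = \<phi> c \<otimes> \<phi> d"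
    "\<forall>c \<in> K. \<phi> c \<in> carrier G"
    using assms unfolding lattice_character_def by simp_all
  from this(1)[rule_format, OF z z] this(2)[rule_format, OF z]
  have "\<phi> (\<lambda>i. 0) = \<phi> (\<lambda>i. 0) \<otimes> \<phi> (\<lambda>i. 0)" "\<phi> (\<lambda>i. 0) \<in> carrier G" by simp_all
  then show ?thesis using l_cancel_one' by metis
qed

lemma lattice_character_mult:
  assumes lc: "lattice_character G I K \<phi>" and c: "c \<in> K"
  shows "(\<lambda>i. n * c i) \<in> K \<and> \<phi> (\<lambda>i. n * c i) = \<phi> c [^] (n::int)"
proof -
  have add: "\<And>c d. c \<in> K \<Longrightarrow> d \<in> K \<Longrightarrow> (\<lambda>i. c i + d i) \<in> K \<and> \<phi> (\<lambda>i. c i + d i) = \<phi> c \<otimes> \<phi> d"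
    and neg: "\<And>c. c \<in> K \<Longrightarrow> (\<lambda>i. - c i) \<in> K" and z: "(\<lambda>i. 0) \<in> K"
    and cl: "\<And>c. c \<in> K \<Longrightarrow> \<phi> c \<in> carrier G"
    using lc unfolding lattice_character_def by simp_all
  have pc: "\<phi> c \<in> carrier G" using cl[OF c] .
  have "\<phi> (\<lambda>i. - c i) \<otimes> \<phi> c = \<one>"
    using add[OF neg[OF c] c] lattice_character_zero[OF lc] by simp
  then have inv: "\<phi> (\<lambda>i. - c i) = inv (\<phi> c)" using cl neg c by (simp add: inv_equality)
  have nat: "(\<lambda>i. int m * d i) \<in> K \<and> \<phi> (\<lambda>i. int m * d i) = \<phi> d [^] m" if d: "d \<in> K" for m d
  proof (induction m)
    case 0 then show ?case using z lattice_character_zero[OF lc] by simp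
  next
    case (Suc m)
    then show ?case using add[of "\<lambda>i. int m * d i" d] d by (simp add: algebra_simps)
  qed
  show ?thesis
  proof (cases "n \<ge> 0")
    case True
    then obtain m where "n = int m" using nonneg_int_cases by blast
    then show ?thesis using nat[OF c, of m] by (simp add: int_pow_int)
  next
    case False
    then obtain m where m: "n = - int m" by (metis linear zle_iff_zadd nonpos_int_cases)
    show ?thesis unfolding m using nat[OF neg[OF c], of m] inv pc
      by (simp add: int_pow_neg_int nat_pow_inv)
  qed
qed

text \<open>A saturated subgroup of a free abelian group of finite rank is a direct summand, so every
  character of it extends. Elementary coordinate changes shorten a nonzero vector of the subgroup
  until a single coordinate is left; saturation then puts the basis vector into the subgroup.\<close>

lemma extend_lattice_character:
  fixes I :: "'i set"
  assumes "finite I" "lattice_character G I K \<phi>"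
  shows "\<exists>g. (\<forall>i \<in> I. g i \<in> carrier G) \<and> (\<forall>c \<in> K. \<phi> c = finprod G (\<lambda>i. g i [^] (c i :: int)) I)"
  using assms
proof (induction "card I" arbitrary: I K \<phi> rule: less_induct)
  case less
  note fin = \<open>finite I\<close> and outer = less.hyps
  let ?concl = "\<lambda>K \<phi>. \<exists>g. (\<forall>i \<in> I. g i \<in> carrier G) \<and> (\<forall>c \<in> K. \<phi> c = finprod G (\<lambda>i. g i [^] (c i :: int)) I)"
  \<comment> \<open>The outer induction removes coordinates. The inner one decreases the sum of the
    absolute values of a nonzero vector of the subgroup. A coordinate change replaces
    \<open>K\<close> and \<phi>, so both remain arbitrary.\<close>
  have inner: "?concl K \<phi>"
    if "lattice_character G I K \<phi>" "c \<in> K" "c k \<noteq> 0" for K \<phi> c k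
    using that
  proof (induction "\<Sum>i \<in> I. nat \<bar>c i\<bar>" arbitrary: K \<phi> c k rule: less_induct)
    case (less c K \<phi> k)
    note lc = less.prems(1)
    have add: "\<And>c d. c \<in> K \<Longrightarrow> d \<in> K \<Longrightarrow> (\<lambda>i. c i + d i) \<in> K \<and> \<phi> (\<lambda>i. c i + d i) = \<phi> c \<otimes> \<phi> d"
      and neg: "\<And>c. c \<in> K \<Longrightarrow> (\<lambda>i. - c i) \<in> K" and z: "(\<lambda>i. 0) \<in> K"
      and cl: "\<And>c. c \<in> K \<Longrightarrow> \<phi> c \<in> carrier G"
      and supp: "\<And>c i. c \<in> K \<Longrightarrow> i \<notin> I \<Longrightarrow> c i = 0"
      using lc unfolding lattice_character_def by simp_all
    have sat: "\<And>c n. n > 0 \<Longrightarrow> (\<lambda>i. int n * c i) \<in> K \<Longrightarrow> c \<in> K"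
      using lc unfolding lattice_character_def by blast
    have kI: "k \<in> I" using supp[OF less.prems(2)] less.prems(3) by blast
    show ?case
    proof (cases "\<exists>j. j \<noteq> k \<and> c j \<noteq> 0")
      case False
      define e where "e = (\<lambda>j. if j = k then 1 else 0 :: int)"
      \<comment> \<open>Only the coordinate \<open>k\<close> is left, so \<open>c\<close> is a
        multiple of the basis vector. The saturation clause speaks of positive multiples, hence the
        absolute value and the possible change of sign of \<open>c\<close>.\<close>
      have "(\<lambda>i. int (nat \<bar>c k\<bar>) * e i) = (if c k > 0 then c else (\<lambda>i. - c i))"
        using False by (auto simp: e_def fun_eq_iff)
      then have "(\<lambda>i. int (nat \<bar>c k\<bar>) * e i) \<in> K" using less.prems(2) neg by simp
      then have e: "e \<in> K" using sat[of "nat \<bar>c k\<bar>" e] less.prems(3) by simp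
      \<comment> \<open>As \<open>e\<close> lies in \<open>K\<close>, the subgroup is the direct sum
        of \<open>K'\<close> and the multiples of \<open>e\<close>. The part \<open>K'\<close> has
        one coordinate less, and the coordinate \<open>k\<close> receives the value of \<phi> at
        \<open>e\<close>.\<close>
      define K' where "K' = {c \<in> K. c k = 0}"
      have "\<And>c n. n > 0 \<Longrightarrow> (\<lambda>i. int n * c i) \<in> K' \<Longrightarrow> c \<in> K'"
        using sat by (simp add: K'_def)
      then have lc': "lattice_character G (I - {k}) K' \<phi>"
        unfolding lattice_character_def using z neg add supp cl
        by (auto simp: K'_def)
      have "card (I - {k}) < card I" by (rule card_Diff1_less[OF fin kI])
      from outer[OF this _ lc'] fin
      obtain g where g: "\<forall>i \<in> I - {k}. g i \<in> carrier G"
        "\<forall>c \<in> K'. \<phi> c = finprod G (\<lambda>i. g i [^] c i) (I - {k})" by auto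
      show ?thesis
      proof (intro exI[of _ "g(k := \<phi> e)"] conjI ballI)
        fix i assume "i \<in> I" then show "(g(k := \<phi> e)) i \<in> carrier G" using g(1) cl e by simp
      next
        fix d assume d: "d \<in> K"
        define d' where "d' = (\<lambda>i. d i + (- d k) * e i)"
        have "d' \<in> K" unfolding d'_def
          using add[OF d conjunct1[OF lattice_character_mult[OF lc e, of "- d k"]]] by simp
        then have d': "d' \<in> K'" by (simp add: K'_def d'_def e_def)
        have "(\<lambda>i. d' i + d k * e i) = d" by (simp add: d'_def)
        then have "\<phi> d = \<phi> d' \<otimes> \<phi> e [^] d k"
          using add[OF \<open>d' \<in> K\<close>, of "\<lambda>i. d k * e i"] lattice_character_mult[OF lc e, of "d k"] by simp
        also have "\<phi> d' = finprod G (\<lambda>i. g i [^] d' i) (I - {k})" using g(2) d' by blast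
        also have "\<dots> = finprod G (\<lambda>i. (g(k := \<phi> e)) i [^] d i) (I - {k})"
        proof (rule finprod_cong')
          fix i assume "i \<in> I - {k}"
          then have "i \<noteq> k" by blast
          then show "g i [^] d' i = (g(k := \<phi> e)) i [^] d i" by (simp add: d'_def e_def)
        qed (use g(1) in auto)
        also have "\<dots> \<otimes> \<phi> e [^] d k = finprod G (\<lambda>i. (g(k := \<phi> e)) i [^] d i) (insert k (I - {k}))"
          using fin g cl[OF e] by (subst finprod_insert) (auto simp: m_comm)
        also have "insert k (I - {k}) = I" using kI by blast
        finally show "\<phi> d = finprod G (\<lambda>i. (g(k := \<phi> e)) i [^] d i) I" .
      qed
    next
      case True
      then obtain i j where ij: "i \<noteq> j" "c i \<noteq> 0" "c j \<noteq> 0" "\<bar>c i\<bar> \<ge> \<bar>c j\<bar>"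
        using less.prems(3) by (metis linear)
      have IJ: "i \<in> I" "j \<in> I" using supp[OF less.prems(2)] ij by blast+
      \<comment> \<open>With this choice \<open>s * c j\<close> has the sign of \<open>c i\<close>
        and the size of \<open>c j\<close>, so subtracting it from \<open>c i\<close> shortens the
        vector, while the nonzero entry at \<open>j\<close> is kept.\<close>
      define s where "s = sgn (c i) * sgn (c j)"
      define T where "T = (\<lambda>d::'i \<Rightarrow> int. d(i := d i - s * d j))"
      define T' where "T' = (\<lambda>d::'i \<Rightarrow> int. d(i := d i + s * d j))"
      have T'T: "T' (T d) = d" for d using ij(1) by (auto simp: T_def T'_def)
      have T'_lin: "T' (\<lambda>l. d l + d' l) = (\<lambda>l. T' d l + T' d' l)" "T' (\<lambda>l. - d l) = (\<lambda>l. - T' d l)"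
        "T' (\<lambda>l. m * d l) = (\<lambda>l. m * T' d l)" "T' (\<lambda>l. 0) = (\<lambda>l. 0)" for d d' m
        using ij(1) by (auto simp: T'_def fun_eq_iff algebra_simps)
      \<comment> \<open>\<open>T\<close> and \<open>T'\<close> are inverse automorphisms of the
        group of integer functions, so this preimage is the image of \<open>K\<close> under
        \<open>T\<close>, and it is saturated again.\<close>
      define K' where "K' = {d. T' d \<in> K}"
      have K'_sat: "\<And>c n. n > 0 \<Longrightarrow> (\<lambda>i. int n * c i) \<in> K' \<Longrightarrow> c \<in> K'"
        using sat by (simp add: K'_def T'_lin)
      have "d l = 0" if "d \<in> K'" "l \<notin> I" for d l
        using supp[of "T' d" l] that IJ by (auto simp: K'_def T'_def split: if_splits)
      then have lc': "lattice_character G I K' (\<phi> \<circ> T')"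
        unfolding lattice_character_def using z neg add cl K'_sat
        by (auto simp: K'_def T'_lin)
      have "\<bar>c i - s * c j\<bar> < \<bar>c i\<bar>" using ij unfolding s_def
        by (cases "c i > 0"; cases "c j > 0") (auto simp: sgn_if)
      then have "(\<Sum>l \<in> I. nat \<bar>T c l\<bar>) < (\<Sum>l \<in> I. nat \<bar>c l\<bar>)"
        using fin IJ(1) ij(1) by (intro sum_strict_mono_ex1) (auto simp: T_def)
      moreover have "T c \<in> K'" using less.prems(2) by (simp add: K'_def T'T)
      moreover have "T c j \<noteq> 0" using ij by (simp add: T_def)
      ultimately obtain g where g: "\<forall>i \<in> I. g i \<in> carrier G"
        "\<forall>c \<in> K'. (\<phi> \<circ> T') c = finprod G (\<lambda>i. g i [^] c i) I"
        using less.hyps[of "T c" K' "\<phi> \<circ> T'" j] lc' by blast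
      \<comment> \<open>Since \<open>T d\<close> has the entry \<open>d i - s * d j\<close> at
        \<open>i\<close>, the extra power of \<open>g i\<close> depends on \<open>d j\<close> only
        and is absorbed into the value at \<open>j\<close>.\<close>
      define g' where "g' = g(j := g j \<otimes> g i [^] (- s))"
      have g': "\<forall>i \<in> I. g' i \<in> carrier G" using g(1) IJ by (simp add: g'_def)
      have "\<phi> d = finprod G (\<lambda>i. g' i [^] d i) I" if d: "d \<in> K" for d
      proof -
        let ?R = "I - {i, j}"
        have I: "I = insert i (insert j ?R)" using IJ by blast
        have "\<phi> d = finprod G (\<lambda>l. g l [^] T d l) I"
          using g(2)[rule_format, of "T d"] d by (simp add: K'_def T'T)
        also have "\<dots> = g i [^] T d i \<otimes> (g j [^] T d j \<otimes> finprod G (\<lambda>l. g l [^] T d l) ?R)"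
          using fin g(1) IJ ij(1) by (subst I) (simp add: Pi_def)
        also have "finprod G (\<lambda>l. g l [^] T d l) ?R = finprod G (\<lambda>l. g' l [^] d l) ?R"
          using g(1) by (intro finprod_cong') (auto simp: T_def g'_def)
        also have "g i [^] T d i \<otimes> (g j [^] T d j \<otimes> finprod G (\<lambda>l. g' l [^] d l) ?R) =
            g' i [^] d i \<otimes> (g' j [^] d j \<otimes> finprod G (\<lambda>l. g' l [^] d l) ?R)"
        proof -
          have R: "finprod G (\<lambda>l. g' l [^] d l) ?R \<in> carrier G" using g' by (auto intro!: finprod_closed)
          have gij: "g i \<in> carrier G" "g j \<in> carrier G" using g(1) IJ by auto
          have "g i [^] T d i = g i [^] d i \<otimes> g i [^] (- s * d j)"
            using gij(1) by (simp add: T_def flip: int_pow_mult)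
          moreover have "g' j [^] d j = g j [^] d j \<otimes> g i [^] (- s * d j)"
            using gij by (simp add: g'_def int_pow_distrib int_pow_pow)
          ultimately show ?thesis using gij R ij(1)
            by (simp add: T_def g'_def m_ac)
        qed
        also have "\<dots> = finprod G (\<lambda>l. g' l [^] d l) I"
          using fin g' IJ ij(1) by (subst (2) I) (simp add: Pi_def)
        finally show ?thesis .
      qed
      with g' show ?thesis by blast
    qed
  qed
  show ?case
  proof (cases "\<exists>c \<in> K. \<exists>k. c k \<noteq> 0")
    case True
    then show ?thesis using inner[OF less.prems(2)] by blast
  next
    case False
    then have "c = (\<lambda>i. 0)" if "c \<in> K" for c using that by blast
    then have "\<forall>c \<in> K. \<phi> c = finprod G (\<lambda>i. \<one> [^] c i) I"
      using lattice_character_zero[OF less.prems(2)] by auto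
    then show ?thesis by (intro exI[of _ "\<lambda>i. \<one>"]) simp
  qed
qed

end


section \<open>Monomials in a commutative monoid\<close>

definition monomial :: "('g, 'n) monoid_scheme \<Rightarrow> ('i \<Rightarrow> 'g) \<Rightarrow> 'i set \<Rightarrow> ('i \<Rightarrow> nat) \<Rightarrow> 'g" where
  "monomial G f X a = finprod G (\<lambda>x. f x [^]\<^bsub>G\<^esub> a x) X"

context comm_monoid
begin

lemma monomial_closed: "f \<in> X \<rightarrow> carrier G \<Longrightarrow> monomial G f X a \<in> carrier G"
  unfolding monomial_def by (rule finprod_closed) auto

lemma monomial_zero: "monomial G f X (\<lambda>x. 0) = \<one>"
  by (simp add: monomial_def)

lemma monomial_add:
  assumes "f \<in> X \<rightarrow> carrier G"
  shows "monomial G f X (\<lambda>x. a x + b x) = monomial G f X a \<otimes> monomial G f X b"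
proof -
  have "monomial G f X (\<lambda>x. a x + b x) = finprod G (\<lambda>x. f x [^] a x \<otimes> f x [^] b x) X"
    unfolding monomial_def using assms by (intro finprod_cong') (auto simp: nat_pow_mult Pi_iff)
  then show ?thesis unfolding monomial_def using assms by (subst (asm) finprod_multf) auto
qed

lemma monomial_mult:
  assumes "f \<in> X \<rightarrow> carrier G"
  shows "monomial G f X (\<lambda>x. n * a x) = monomial G f X a [^] n"
proof (induction n)
  case 0 then show ?case by (simp add: monomial_zero)
next
  case (Suc n)
  have "monomial G f X (\<lambda>x. Suc n * a x) = monomial G f X (\<lambda>x. n * a x + a x)"
    by (simp add: add.commute)
  then show ?case using Suc monomial_add[OF assms] by simp
qed

lemma monomial_unit:
  assumes "f \<in> X \<rightarrow> carrier G" "finite X" "y \<in> X"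
  shows "monomial G f X (\<lambda>x. if x = y then 1 else 0) = f y"
proof -
  have "monomial G f X (\<lambda>x. if x = y then 1 else 0) = finprod G (\<lambda>x. if y = x then f x else \<one>) X"
    unfolding monomial_def using assms by (intro finprod_cong') (auto simp: Pi_iff)
  then show ?thesis using finprod_singleton[OF assms(3,2,1)] by simp
qed

text \<open>The values of the monomials form a submonoid that contains \<open>X\<close>.\<close>

lemma generated_by_monomials:
  assumes "finite X" "X \<subseteq> carrier G" "\<forall>H. submonoid H G \<and> X \<subseteq> H \<longrightarrow> H = carrier G" "p \<in> carrier G"
  shows "\<exists>a. monomial G (\<lambda>x. x) X a = p"
proof -
  have X: "(\<lambda>x. x) \<in> X \<rightarrow> carrier G" using assms(2) by auto
  have "submonoid (range (monomial G (\<lambda>x. x) X)) G"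
  proof
    show "range (monomial G (\<lambda>x. x) X) \<subseteq> carrier G" using monomial_closed[OF X] by auto
    show "\<one> \<in> range (monomial G (\<lambda>x. x) X)" using monomial_zero[of "\<lambda>x. x" X] by (metis rangeI)
    fix p q assume "p \<in> range (monomial G (\<lambda>x. x) X)" "q \<in> range (monomial G (\<lambda>x. x) X)"
    then obtain a b where "p = monomial G (\<lambda>x. x) X a" "q = monomial G (\<lambda>x. x) X b" by auto
    then have "p \<otimes> q = monomial G (\<lambda>x. x) X (\<lambda>x. a x + b x)" by (simp add: monomial_add[OF X])
    then show "p \<otimes> q \<in> range (monomial G (\<lambda>x. x) X)" by (metis rangeI)
  qed
  moreover have "X \<subseteq> range (monomial G (\<lambda>x. x) X)"
  proof
    fix y assume "y \<in> X"
    then show "y \<in> range (monomial G (\<lambda>x. x) X)" using monomial_unit[OF X assms(1)] by (metis rangeI)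
  qed
  ultimately have "range (monomial G (\<lambda>x. x) X) = carrier G" using assms(3) by blast
  then show ?thesis using assms(4) by (metis imageE)
qed

end

section \<open>Fractions of an integral monoid\<close>

lemma integral_monoidD:
  assumes "integral_monoid P"
  shows "comm_monoid P"
    "\<lbrakk>x \<in> carrier P; y \<in> carrier P; z \<in> carrier P; x \<otimes>\<^bsub>P\<^esub> z = y \<otimes>\<^bsub>P\<^esub> z\<rbrakk> \<Longrightarrow> x = y"
  using assms unfolding integral_monoid_def by blast+

text \<open>Integrality cancels the auxiliary factor \<open>k\<close> in the definition; conversely
  the unit serves as \<open>k\<close>.\<close>

lemma gp_rel_iff:
  assumes P: "integral_monoid P"
  shows "((a, b), (c, d)) \<in> gp_rel P \<longleftrightarrow>
    {a, b, c, d} \<subseteq> carrier P \<and> a \<otimes>\<^bsub>P\<^esub> d = c \<otimes>\<^bsub>P\<^esub> b"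
proof -
  interpret comm_monoid P by (rule integral_monoidD(1)[OF P])
  show ?thesis
  proof
    assume "((a, b), (c, d)) \<in> gp_rel P"
    then obtain k where "{a, b, c, d} \<subseteq> carrier P" "k \<in> carrier P"
      "a \<otimes>\<^bsub>P\<^esub> d \<otimes>\<^bsub>P\<^esub> k = c \<otimes>\<^bsub>P\<^esub> b \<otimes>\<^bsub>P\<^esub> k" by (auto simp: gp_rel_def)
    then show "{a, b, c, d} \<subseteq> carrier P \<and> a \<otimes>\<^bsub>P\<^esub> d = c \<otimes>\<^bsub>P\<^esub> b"
      using integral_monoidD(2)[OF P, of "a \<otimes>\<^bsub>P\<^esub> d" "c \<otimes>\<^bsub>P\<^esub> b" k] by simp
  next
    assume "{a, b, c, d} \<subseteq> carrier P \<and> a \<otimes>\<^bsub>P\<^esub> d = c \<otimes>\<^bsub>P\<^esub> b"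
    then show "((a, b), (c, d)) \<in> gp_rel P"
      by (auto simp: gp_rel_def intro!: bexI[of _ "\<one>\<^bsub>P\<^esub>"])
  qed
qed

text \<open>The product is defined through all representatives at once. Any two of them give the
  same class: multiply the two equations of fractions and cancel the auxiliary denominators.\<close>

lemma gp_mult:
  assumes P: "integral_monoid P" and abcd: "a \<in> carrier P" "b \<in> carrier P" "c \<in> carrier P" "d \<in> carrier P"
  shows "gp_rel P `` {(a, b)} \<otimes>\<^bsub>gp P\<^esub> gp_rel P `` {(c, d)} =
    gp_rel P `` {(a \<otimes>\<^bsub>P\<^esub> c, b \<otimes>\<^bsub>P\<^esub> d)}"
proof -
  interpret comm_monoid P by (rule integral_monoidD(1)[OF P])
  let ?Z = "{(a' \<otimes>\<^bsub>P\<^esub> c', b' \<otimes>\<^bsub>P\<^esub> d') | a' c' b' d'.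
    (a', b') \<in> gp_rel P `` {(a, b)} \<and> (c', d') \<in> gp_rel P `` {(c, d)}}"
  have "gp_rel P `` ?Z = gp_rel P `` {(a \<otimes>\<^bsub>P\<^esub> c, b \<otimes>\<^bsub>P\<^esub> d)}"
  proof (intro subset_antisym subsetI)
    fix z assume "z \<in> gp_rel P `` ?Z"
    then obtain x y a' b' c' d' where z: "z = (x, y)"
      and r: "((a' \<otimes>\<^bsub>P\<^esub> c', b' \<otimes>\<^bsub>P\<^esub> d'), (x, y)) \<in> gp_rel P"
        "((a, b), (a', b')) \<in> gp_rel P" "((c, d), (c', d')) \<in> gp_rel P"
      by (cases z) auto
    then have xy: "x \<in> carrier P" "y \<in> carrier P" "a' \<in> carrier P" "b' \<in> carrier P" "c' \<in> carrier P" "d' \<in> carrier P"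
      and e: "a' \<otimes>\<^bsub>P\<^esub> c' \<otimes>\<^bsub>P\<^esub> y = x \<otimes>\<^bsub>P\<^esub> (b' \<otimes>\<^bsub>P\<^esub> d')" "a \<otimes>\<^bsub>P\<^esub> b' = a' \<otimes>\<^bsub>P\<^esub> b" "c \<otimes>\<^bsub>P\<^esub> d' = c' \<otimes>\<^bsub>P\<^esub> d"
      by (simp_all add: gp_rel_iff[OF P])
    have "(a \<otimes>\<^bsub>P\<^esub> c \<otimes>\<^bsub>P\<^esub> y) \<otimes>\<^bsub>P\<^esub> (b' \<otimes>\<^bsub>P\<^esub> d') = (a \<otimes>\<^bsub>P\<^esub> b') \<otimes>\<^bsub>P\<^esub> (c \<otimes>\<^bsub>P\<^esub> d') \<otimes>\<^bsub>P\<^esub> y"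
      using abcd xy by (simp add: m_ac)
    also have "\<dots> = (a' \<otimes>\<^bsub>P\<^esub> c' \<otimes>\<^bsub>P\<^esub> y) \<otimes>\<^bsub>P\<^esub> (b \<otimes>\<^bsub>P\<^esub> d)"
      unfolding e(2,3) using abcd xy by (simp add: m_ac)
    also have "\<dots> = (x \<otimes>\<^bsub>P\<^esub> (b \<otimes>\<^bsub>P\<^esub> d)) \<otimes>\<^bsub>P\<^esub> (b' \<otimes>\<^bsub>P\<^esub> d')"
      unfolding e(1) using abcd xy by (simp add: m_ac)
    finally have "a \<otimes>\<^bsub>P\<^esub> c \<otimes>\<^bsub>P\<^esub> y = x \<otimes>\<^bsub>P\<^esub> (b \<otimes>\<^bsub>P\<^esub> d)"
      by (rule integral_monoidD(2)[OF P, rotated -1]) (use abcd xy in simp_all)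
    then show "z \<in> gp_rel P `` {(a \<otimes>\<^bsub>P\<^esub> c, b \<otimes>\<^bsub>P\<^esub> d)}"
      using abcd xy by (simp add: z gp_rel_iff[OF P])
  next
    fix z assume z: "z \<in> gp_rel P `` {(a \<otimes>\<^bsub>P\<^esub> c, b \<otimes>\<^bsub>P\<^esub> d)}"
    have "((a, b), (a, b)) \<in> gp_rel P" "((c, d), (c, d)) \<in> gp_rel P"
      using abcd by (simp_all add: gp_rel_iff[OF P])
    then have "(a \<otimes>\<^bsub>P\<^esub> c, b \<otimes>\<^bsub>P\<^esub> d) \<in> ?Z" by blast
    then show "z \<in> gp_rel P `` ?Z" using z by blast
  qed
  moreover have "?Z = {(a' \<otimes>\<^bsub>P\<^esub> c', b' \<otimes>\<^bsub>P\<^esub> d') | a' b' c' d'.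
    (a', b') \<in> gp_rel P `` {(a, b)} \<and> (c', d') \<in> gp_rel P `` {(c, d)}}" by blast
  ultimately show ?thesis by (simp add: gp_def)
qed

text \<open>The fraction \<open>p / q\<close> has trivial power \<open>n\<close> in the group
  completion, hence is trivial, and cancellation turns this into an equation in \<open>P\<close>.
  Torsion-freeness enters the splitting in this form.\<close>

lemma torsion_free_power_inj:
  assumes P: "integral_monoid P" and tf: "torsion_free_monoid P"
    and pq: "p \<in> carrier P" "q \<in> carrier P" and n: "n > 0" "p [^]\<^bsub>P\<^esub> (n::nat) = q [^]\<^bsub>P\<^esub> n"
  shows "p = q"
proof -
  interpret comm_monoid P by (rule integral_monoidD(1)[OF P])
  have pow: "(gp_rel P `` {(p, q)}) [^]\<^bsub>gp P\<^esub> m = gp_rel P `` {(p [^]\<^bsub>P\<^esub> m, q [^]\<^bsub>P\<^esub> m)}" for m :: nat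
  proof (induction m)
    case 0 then show ?case by (simp add: nat_pow_def gp_def)
  next
    case (Suc m)
    have "(gp_rel P `` {(p, q)}) [^]\<^bsub>gp P\<^esub> Suc m =
        (gp_rel P `` {(p, q)}) [^]\<^bsub>gp P\<^esub> m \<otimes>\<^bsub>gp P\<^esub> gp_rel P `` {(p, q)}"
      by (simp add: nat_pow_def)
    then show ?case using Suc gp_mult[OF P, of "p [^]\<^bsub>P\<^esub> m" "q [^]\<^bsub>P\<^esub> m" p q] pq by simp
  qed
  have one: "gp_rel P `` {(\<one>\<^bsub>P\<^esub>, \<one>\<^bsub>P\<^esub>)} = \<one>\<^bsub>gp P\<^esub>" by (simp add: gp_def)
  have diag: "gp_rel P `` {(r, r)} = gp_rel P `` {(\<one>\<^bsub>P\<^esub>, \<one>\<^bsub>P\<^esub>)}" if r: "r \<in> carrier P" for r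
  proof (intro subset_antisym subsetI)
    fix z assume "z \<in> gp_rel P `` {(r, r)}"
    then obtain x y where z: "z = (x, y)" "x \<in> carrier P" "y \<in> carrier P" "r \<otimes>\<^bsub>P\<^esub> y = x \<otimes>\<^bsub>P\<^esub> r"
      by (cases z) (auto simp: gp_rel_iff[OF P])
    then have "y = x" using integral_monoidD(2)[OF P, of y x r] r by (simp add: m_comm)
    then show "z \<in> gp_rel P `` {(\<one>\<^bsub>P\<^esub>, \<one>\<^bsub>P\<^esub>)}" using z by (simp add: gp_rel_iff[OF P])
  next
    fix z assume "z \<in> gp_rel P `` {(\<one>\<^bsub>P\<^esub>, \<one>\<^bsub>P\<^esub>)}"
    then obtain x where "z = (x, x)" "x \<in> carrier P"
      by (cases z) (auto simp: gp_rel_iff[OF P])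
    then show "z \<in> gp_rel P `` {(r, r)}" using r by (simp add: gp_rel_iff[OF P] m_comm)
  qed
  have "gp_rel P `` {(p, q)} \<in> carrier (gp P)"
    using pq by (simp add: gp_def quotientI)
  moreover have "(gp_rel P `` {(p, q)}) [^]\<^bsub>gp P\<^esub> n = \<one>\<^bsub>gp P\<^esub>"
    using pow[of n] n(2) diag[of "q [^]\<^bsub>P\<^esub> n"] one pq by simp
  ultimately have "gp_rel P `` {(p, q)} = \<one>\<^bsub>gp P\<^esub>"
    using tf n(1) unfolding torsion_free_monoid_def by blast
  then have "gp_rel P `` {(p, q)} = gp_rel P `` {(\<one>\<^bsub>P\<^esub>, \<one>\<^bsub>P\<^esub>)}" using one by simp
  moreover have "(\<one>\<^bsub>P\<^esub>, \<one>\<^bsub>P\<^esub>) \<in> gp_rel P `` {(\<one>\<^bsub>P\<^esub>, \<one>\<^bsub>P\<^esub>)}"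
    by (simp add: gp_rel_iff[OF P])
  ultimately have "((p, q), (\<one>\<^bsub>P\<^esub>, \<one>\<^bsub>P\<^esub>)) \<in> gp_rel P" by blast
  then show "p = q" using pq by (simp add: gp_rel_iff[OF P])
qed

text \<open>Let \<open>G\<close> act simply transitively on the fibres of \<open>\<pi> : E \<rightarrow> P\<close>. Lifts of generators of \<open>P\<close> fail to
  satisfy the relations of \<open>P\<close> by a character of the lattice of relations, which is saturated
  because \<open>P\<close> is torsion-free; an extension of this character corrects the lifts.\<close>

lemma torsor_section:
  fixes P :: "('p, 'm) monoid_scheme" and E :: "('e, 'n) monoid_scheme" and G :: "('g, 'k) monoid_scheme"
  assumes fine: "fine_monoid P" and tf: "torsion_free_monoid P"
    and "comm_monoid E" "comm_group G"
    and \<pi>: "\<pi> \<in> monoid_hom E P" and surj: "carrier P \<subseteq> \<pi> ` carrier E"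
    and act_closed: "\<And>g e. g \<in> carrier G \<Longrightarrow> e \<in> carrier E \<Longrightarrow> act g e \<in> carrier E"
    and act_fibre: "\<And>g e. g \<in> carrier G \<Longrightarrow> e \<in> carrier E \<Longrightarrow> \<pi> (act g e) = \<pi> e"
    and act_one: "\<And>e. e \<in> carrier E \<Longrightarrow> act \<one>\<^bsub>G\<^esub> e = e"
    and act_act: "\<And>g h e. g \<in> carrier G \<Longrightarrow> h \<in> carrier G \<Longrightarrow> e \<in> carrier E \<Longrightarrow>
      act g (act h e) = act (g \<otimes>\<^bsub>G\<^esub> h) e"
    and act_mult: "\<And>g e f. g \<in> carrier G \<Longrightarrow> e \<in> carrier E \<Longrightarrow> f \<in> carrier E \<Longrightarrow>
      act g e \<otimes>\<^bsub>E\<^esub> f = act g (e \<otimes>\<^bsub>E\<^esub> f)"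
    and free: "\<And>g h e. g \<in> carrier G \<Longrightarrow> h \<in> carrier G \<Longrightarrow> e \<in> carrier E \<Longrightarrow> act g e = act h e \<Longrightarrow> g = h"
    and trans: "\<And>e f. e \<in> carrier E \<Longrightarrow> f \<in> carrier E \<Longrightarrow> \<pi> e = \<pi> f \<Longrightarrow> \<exists>g \<in> carrier G. e = act g f"
  shows "\<exists>\<sigma> \<in> monoid_hom P E. \<forall>p \<in> carrier P. \<pi> (\<sigma> p) = p"
proof -
  have int: "integral_monoid P" using fine by (simp add: fine_monoid_def)
  interpret P: comm_monoid P by (rule integral_monoidD(1)[OF int])
  interpret E: comm_monoid E by fact
  interpret G: comm_group G by fact
  note P_cancel = integral_monoidD(2)[OF int]
  obtain X where X: "finite X" "X \<subseteq> carrier P" "\<forall>H. submonoid H P \<and> X \<subseteq> H \<longrightarrow> H = carrier P"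
    using fine unfolding fine_monoid_def finitely_generated_monoid_def by blast
  define wP where "wP = monomial P (\<lambda>x. x) X"
  have X_Pi: "(\<lambda>x. x) \<in> X \<rightarrow> carrier P" using X(2) by auto
  have wP_closed: "wP a \<in> carrier P" for a unfolding wP_def by (rule P.monomial_closed[OF X_Pi])
  have wP_surj: "\<exists>a. wP a = p" if "p \<in> carrier P" for p
    unfolding wP_def by (rule P.generated_by_monomials[OF X that])
  have wP_add: "wP (\<lambda>x. a x + b x) = wP a \<otimes>\<^bsub>P\<^esub> wP b" for a b
    unfolding wP_def by (rule P.monomial_add[OF X_Pi])
  have wP_mult: "wP (\<lambda>x. n * a x) = wP a [^]\<^bsub>P\<^esub> n" for a n
    unfolding wP_def by (rule P.monomial_mult[OF X_Pi])
  have wP_cong: "wP a = wP b" if "\<And>x. x \<in> X \<Longrightarrow> a x = b x" for a b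
    unfolding wP_def monomial_def using X(2) that by (intro P.finprod_cong') auto
  have \<pi>_hom: "\<pi> e \<in> carrier P" "\<pi> (e \<otimes>\<^bsub>E\<^esub> f) = \<pi> e \<otimes>\<^bsub>P\<^esub> \<pi> f" "\<pi> \<one>\<^bsub>E\<^esub> = \<one>\<^bsub>P\<^esub>"
    if "e \<in> carrier E" "f \<in> carrier E" for e f
    using \<pi> that unfolding monoid_hom_def hom_def by auto
  have \<pi>_pow: "\<pi> (e [^]\<^bsub>E\<^esub> n) = \<pi> e [^]\<^bsub>P\<^esub> (n::nat)" if "e \<in> carrier E" for e n
    by (induction n) (use that \<pi>_hom in auto)
  have \<pi>_monomial: "\<pi> (monomial E e X a) = wP a"
    if e: "\<And>x. x \<in> X \<Longrightarrow> e x \<in> carrier E" "\<And>x. x \<in> X \<Longrightarrow> \<pi> (e x) = x" for e a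
  proof -
    have "Y \<subseteq> X \<Longrightarrow> \<pi> (monomial E e Y a) = monomial P (\<lambda>x. x) Y a" if "finite Y" for Y
      using that
    proof (induction Y)
      case empty then show ?case using \<pi>_hom(3)[OF E.one_closed E.one_closed] by (simp add: monomial_def)
    next
      case (insert y Y)
      then have eY: "e \<in> Y \<rightarrow> carrier E" "e y \<in> carrier E" "\<pi> (e y) = y" "(\<lambda>x. x) \<in> Y \<rightarrow> carrier P" "y \<in> carrier P"
        using e X(2) by auto
      have "monomial E e (insert y Y) a = e y [^]\<^bsub>E\<^esub> a y \<otimes>\<^bsub>E\<^esub> monomial E e Y a"
        unfolding monomial_def using insert eY by (intro E.finprod_insert) auto
      moreover have "monomial P (\<lambda>x. x) (insert y Y) a = y [^]\<^bsub>P\<^esub> a y \<otimes>\<^bsub>P\<^esub> monomial P (\<lambda>x. x) Y a"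
        unfolding monomial_def using insert eY by (intro P.finprod_insert) auto
      ultimately show ?case
        using insert eY \<pi>_hom(2)[OF E.nat_pow_closed[OF eY(2)] E.monomial_closed[OF eY(1)]] \<pi>_pow[OF eY(2)]
        by simp
    qed
    then show ?thesis using X(1) unfolding wP_def by blast
  qed
  \<comment> \<open>The compatibility of the action with products is assumed for the first factor;
    commutativity of \<open>E\<close> supplies the second.\<close>
  have act_mult2: "act g e \<otimes>\<^bsub>E\<^esub> act h f = act (g \<otimes>\<^bsub>G\<^esub> h) (e \<otimes>\<^bsub>E\<^esub> f)"
    if "g \<in> carrier G" "h \<in> carrier G" "e \<in> carrier E" "f \<in> carrier E" for g h e f
  proof -
    have "act g e \<otimes>\<^bsub>E\<^esub> act h f = act g (e \<otimes>\<^bsub>E\<^esub> act h f)"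
      by (rule act_mult) (use that act_closed in auto)
    also have "e \<otimes>\<^bsub>E\<^esub> act h f = act h f \<otimes>\<^bsub>E\<^esub> e"
      by (rule E.m_comm) (use that act_closed in auto)
    also have "\<dots> = act h (f \<otimes>\<^bsub>E\<^esub> e)" by (rule act_mult) (use that in auto)
    also have "f \<otimes>\<^bsub>E\<^esub> e = e \<otimes>\<^bsub>E\<^esub> f" by (rule E.m_comm) (use that in auto)
    also have "act g (act h (e \<otimes>\<^bsub>E\<^esub> f)) = act (g \<otimes>\<^bsub>G\<^esub> h) (e \<otimes>\<^bsub>E\<^esub> f)"
      by (rule act_act) (use that in auto)
    finally show ?thesis .
  qed
  have act_pow: "act g e [^]\<^bsub>E\<^esub> n = act (g [^]\<^bsub>G\<^esub> n) (e [^]\<^bsub>E\<^esub> n)"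
    if "g \<in> carrier G" "e \<in> carrier E" for g e and n :: nat
    by (induction n) (use that act_mult2 act_one in auto)
  have act_monomial: "monomial E (\<lambda>x. act (k x) (e x)) X a =
      act (finprod G (\<lambda>x. k x [^]\<^bsub>G\<^esub> a x) X) (monomial E e X a)"
    if ke: "\<And>x. x \<in> X \<Longrightarrow> e x \<in> carrier E" "\<And>x. x \<in> X \<Longrightarrow> k x \<in> carrier G" for e k and a :: "'p \<Rightarrow> nat"
  proof -
    have "Y \<subseteq> X \<Longrightarrow> monomial E (\<lambda>x. act (k x) (e x)) Y a =
        act (finprod G (\<lambda>x. k x [^]\<^bsub>G\<^esub> a x) Y) (monomial E e Y a)" if "finite Y" for Y
      using that
    proof (induction Y)
      case empty then show ?case by (simp add: monomial_def act_one)
    next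
      case (insert y Y)
      then have eY: "e \<in> Y \<rightarrow> carrier E" "e y \<in> carrier E" "k \<in> Y \<rightarrow> carrier G" "k y \<in> carrier G"
        "(\<lambda>x. act (k x) (e x)) \<in> Y \<rightarrow> carrier E" "act (k y) (e y) \<in> carrier E"
        using ke act_closed by auto
      have "monomial E (\<lambda>x. act (k x) (e x)) (insert y Y) a =
          act (k y) (e y) [^]\<^bsub>E\<^esub> a y \<otimes>\<^bsub>E\<^esub> monomial E (\<lambda>x. act (k x) (e x)) Y a"
        unfolding monomial_def using insert eY by (intro E.finprod_insert) auto
      also have "\<dots> = act (k y [^]\<^bsub>G\<^esub> a y) (e y [^]\<^bsub>E\<^esub> a y) \<otimes>\<^bsub>E\<^esub>
          act (finprod G (\<lambda>x. k x [^]\<^bsub>G\<^esub> a x) Y) (monomial E e Y a)"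
        using insert act_pow eY by simp
      also have "\<dots> = act (k y [^]\<^bsub>G\<^esub> a y \<otimes>\<^bsub>G\<^esub> finprod G (\<lambda>x. k x [^]\<^bsub>G\<^esub> a x) Y)
          (e y [^]\<^bsub>E\<^esub> a y \<otimes>\<^bsub>E\<^esub> monomial E e Y a)"
        by (rule act_mult2) (use eY in \<open>auto intro!: G.finprod_closed E.monomial_closed\<close>)
      also have "k y [^]\<^bsub>G\<^esub> a y \<otimes>\<^bsub>G\<^esub> finprod G (\<lambda>x. k x [^]\<^bsub>G\<^esub> a x) Y = finprod G (\<lambda>x. k x [^]\<^bsub>G\<^esub> a x) (insert y Y)"
        using insert eY by (intro G.finprod_insert[symmetric]) auto
      also have "e y [^]\<^bsub>E\<^esub> a y \<otimes>\<^bsub>E\<^esub> monomial E e Y a = monomial E e (insert y Y) a"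
        unfolding monomial_def using insert eY by (intro E.finprod_insert[symmetric]) auto
      finally show ?case .
    qed
    then show ?thesis using X(1) by blast
  qed
  have "\<forall>x \<in> X. \<exists>e. e \<in> carrier E \<and> \<pi> e = x" using surj X(2) by auto
  then obtain e where e: "\<And>x. x \<in> X \<Longrightarrow> e x \<in> carrier E" "\<And>x. x \<in> X \<Longrightarrow> \<pi> (e x) = x" by metis
  then have e_Pi: "e \<in> X \<rightarrow> carrier E" by blast
  define wE where "wE = monomial E e X"
  have wE_closed: "wE a \<in> carrier E" for a unfolding wE_def by (rule E.monomial_closed[OF e_Pi])
  have wE_add: "wE (\<lambda>x. a x + b x) = wE a \<otimes>\<^bsub>E\<^esub> wE b" for a b
    unfolding wE_def by (rule E.monomial_add[OF e_Pi])
  have wE_cong: "wE a = wE b" if "\<And>x. x \<in> X \<Longrightarrow> a x = b x" for a b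
    unfolding wE_def monomial_def using e that by (intro E.finprod_cong') auto
  have \<pi>_wE: "\<pi> (wE a) = wP a" for a unfolding wE_def using \<pi>_monomial e by blast
  \<comment> \<open>\<open>P\<close> and \<open>E\<close> are only monoids, so an integer vector
    cannot be used as an exponent. It is read as the relation between the monomials of its positive
    and its negative part; \<open>K\<close> below is the kernel of the map from integer vectors to
    the group completion of \<open>P\<close>.\<close>
  define pos where "pos = (\<lambda>c :: 'p \<Rightarrow> int. \<lambda>x. nat (c x))"
  define neg where "neg = (\<lambda>c :: 'p \<Rightarrow> int. \<lambda>x. nat (- c x))"
  define K where "K = {c. (\<forall>x. x \<notin> X \<longrightarrow> c x = 0) \<and> wP (pos c) = wP (neg c)}"
  \<comment> \<open>Whether two exponents give the same element depends only on their difference, by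
    cancellation in \<open>P\<close>. So every presentation of a vector as a difference may be used
    to test membership in \<open>K\<close>.\<close>
  have shift: "wP a' = wP b'" if "\<And>x. x \<in> X \<Longrightarrow> a x + b' x = a' x + b x" "wP a = wP b" for a b a' b'
  proof -
    have "wP a' \<otimes>\<^bsub>P\<^esub> wP b = wP b' \<otimes>\<^bsub>P\<^esub> wP b"
      using wP_cong[of "\<lambda>x. a x + b' x" "\<lambda>x. a' x + b x"] that wP_add wP_closed by (simp add: P.m_comm)
    then show ?thesis by (rule P_cancel[OF wP_closed wP_closed wP_closed])
  qed
  have K_iff: "c \<in> K \<longleftrightarrow> wP a = wP b"
    if "\<And>x. x \<notin> X \<Longrightarrow> c x = 0" "\<And>x. x \<in> X \<Longrightarrow> c x = int (a x) - int (b x)" for c a b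
  proof -
    have "a x + neg c x = pos c x + b x" "pos c x + b x = a x + neg c x" if "x \<in> X" for x
      using \<open>\<And>x. x \<in> X \<Longrightarrow> c x = int (a x) - int (b x)\<close>[OF that] by (auto simp: pos_def neg_def)
    then show ?thesis using shift[of a "neg c" "pos c" b] shift[of "pos c" b a "neg c"] that(1)
      unfolding K_def by auto
  qed
  \<comment> \<open>The scalar by which the chosen lifts violate the relation \<open>c\<close>. It
    exists because both monomials lie over the same element of \<open>P\<close>, and it is unique
    because the action is free.\<close>
  define \<phi> where "\<phi> c = (SOME g. g \<in> carrier G \<and> wE (pos c) = act g (wE (neg c)))" for c
  have \<phi>0: "\<phi> c \<in> carrier G \<and> wE (pos c) = act (\<phi> c) (wE (neg c))" if "c \<in> K" for c
  proof -
    have "\<pi> (wE (pos c)) = \<pi> (wE (neg c))" using that \<pi>_wE unfolding K_def by simp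
    then have "\<exists>g. g \<in> carrier G \<and> wE (pos c) = act g (wE (neg c))"
      using trans[OF wE_closed wE_closed] by blast
    then show ?thesis unfolding \<phi>_def by (rule someI_ex)
  qed
  have \<phi>_closed: "\<phi> c \<in> carrier G" if "c \<in> K" for c using \<phi>0[OF that] by simp
  \<comment> \<open>The defect can be read off from any presentation of \<open>c\<close> as a
    difference. Freeness of the action replaces cancellation in \<open>E\<close>: both relations are
    multiplied up to the same element, where the two scalars must agree.\<close>
  have \<phi>_eq: "wE a = act (\<phi> c) (wE b)"
    if c: "c \<in> K" and ab: "\<And>x. x \<in> X \<Longrightarrow> c x = int (a x) - int (b x)" for c a b
  proof -
    have "wP a = wP b" using K_iff[of c a b] c ab unfolding K_def by blast
    then obtain h where h: "h \<in> carrier G" "wE a = act h (wE b)"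
      using trans[OF wE_closed wE_closed] \<pi>_wE by metis
    have "pos c x + b x = a x + neg c x" if "x \<in> X" for x
      using ab[OF that] by (auto simp: pos_def neg_def)
    then have "wE (pos c) \<otimes>\<^bsub>E\<^esub> wE b = wE a \<otimes>\<^bsub>E\<^esub> wE (neg c)"
      using wE_cong[of "\<lambda>x. pos c x + b x" "\<lambda>x. a x + neg c x"] wE_add by simp
    then have "act (\<phi> c) (wE (neg c) \<otimes>\<^bsub>E\<^esub> wE b) = act h (wE (neg c) \<otimes>\<^bsub>E\<^esub> wE b)"
      using \<phi>0[OF c] h act_mult wE_closed by (simp add: E.m_comm)
    then have "\<phi> c = h" using free \<phi>_closed[OF c] h(1) wE_closed by blast
    then show ?thesis using h by simp
  qed
  have K0: "(\<lambda>x. 0) \<in> K" using K_iff[of "\<lambda>x. 0" "\<lambda>x. 0" "\<lambda>x. 0"] by simp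
  have K_supp: "\<And>c x. c \<in> K \<Longrightarrow> x \<notin> X \<Longrightarrow> c x = 0" unfolding K_def by blast
  have K_neg: "(\<lambda>x. - c x) \<in> K" if "c \<in> K" for c
    using that unfolding K_def pos_def neg_def by auto
  have K_add: "(\<lambda>x. c x + d x) \<in> K \<and> \<phi> (\<lambda>x. c x + d x) = \<phi> c \<otimes>\<^bsub>G\<^esub> \<phi> d"
    if cd: "c \<in> K" "d \<in> K" for c d
  proof
    let ?a = "\<lambda>x. pos c x + pos d x" and ?b = "\<lambda>x. neg c x + neg d x"
    have ab: "c x + d x = int (?a x) - int (?b x)" for x by (simp add: pos_def neg_def)
    have supp: "c x + d x = 0" if "x \<notin> X" for x
      using K_supp[OF cd(1) that] K_supp[OF cd(2) that] by simp
    have "wP ?a = wP ?b" using cd wP_add by (simp add: K_def)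
    then show in_K: "(\<lambda>x. c x + d x) \<in> K"
      using K_iff[of "\<lambda>x. c x + d x" ?a ?b, OF supp ab] by blast
    have "act (\<phi> (\<lambda>x. c x + d x)) (wE ?b) = wE ?a" using \<phi>_eq[OF in_K ab] by (rule sym)
    also have "\<dots> = act (\<phi> c) (wE (neg c)) \<otimes>\<^bsub>E\<^esub> act (\<phi> d) (wE (neg d))"
      using wE_add \<phi>0 cd by simp
    also have "\<dots> = act (\<phi> c \<otimes>\<^bsub>G\<^esub> \<phi> d) (wE ?b)"
      using act_mult2 \<phi>_closed cd wE_closed wE_add by simp
    finally show "\<phi> (\<lambda>x. c x + d x) = \<phi> c \<otimes>\<^bsub>G\<^esub> \<phi> d"
      using free \<phi>_closed in_K cd wE_closed G.m_closed by blast
  qed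
  have K_sat: "c \<in> K" if n: "n > 0" and nc: "(\<lambda>x. int n * c x) \<in> K" for c and n :: nat
  proof -
    have supp: "c x = 0" if "x \<notin> X" for x using K_supp[OF nc that] n by simp
    have "wP (\<lambda>x. n * pos c x) = wP (\<lambda>x. n * neg c x)"
      using K_iff[of "\<lambda>x. int n * c x" "\<lambda>x. n * pos c x" "\<lambda>x. n * neg c x"] nc supp
      by (simp add: pos_def neg_def flip: right_diff_distrib)
    then have "wP (pos c) = wP (neg c)"
      using torsion_free_power_inj[OF int tf wP_closed wP_closed n] wP_mult by simp
    then show ?thesis using supp by (simp add: K_def)
  qed
  have "lattice_character G X K \<phi>"
    unfolding lattice_character_def using K0 K_supp K_neg K_add K_sat \<phi>_closed by blast
  from G.extend_lattice_character[OF X(1) this] obtain g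
    where g: "\<And>x. x \<in> X \<Longrightarrow> g x \<in> carrier G"
      "\<And>c. c \<in> K \<Longrightarrow> \<phi> c = finprod G (\<lambda>x. g x [^]\<^bsub>G\<^esub> c x) X" by blast
  \<comment> \<open>Dividing the lifts by \<open>g\<close> changes the two sides of a relation
    \<open>c\<close> by scalars whose quotient is the inverse of the extended character at
    \<open>c\<close>, which is exactly its defect.\<close>
  define k where "k x = inv\<^bsub>G\<^esub> (g x)" for x
  define e' where "e' x = act (k x) (e x)" for x
  have k: "k x \<in> carrier G" if "x \<in> X" for x using g(1)[OF that] by (simp add: k_def)
  have e': "e' x \<in> carrier E" "\<pi> (e' x) = x" if "x \<in> X" for x
    using k e that act_closed act_fibre by (simp_all add: e'_def)
  then have e'_Pi: "e' \<in> X \<rightarrow> carrier E" by blast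
  define w' where "w' = monomial E e' X"
  have w'_closed: "w' a \<in> carrier E" for a unfolding w'_def by (rule E.monomial_closed[OF e'_Pi])
  have w'_eq: "w' a = act (finprod G (\<lambda>x. k x [^]\<^bsub>G\<^esub> a x) X) (wE a)" for a
    unfolding w'_def e'_def wE_def using act_monomial e(1) k by blast
  have w'_wd: "w' a = w' b" if ab: "wP a = wP b" for a b
  proof -
    define c where "c x = (if x \<in> X then int (a x) - int (b x) else 0)" for x
    have c: "c \<in> K" using K_iff[of c a b] ab by (simp add: c_def)
    have kc: "finprod G (\<lambda>x. k x [^]\<^bsub>G\<^esub> a x) X \<in> carrier G" using k by (intro G.finprod_closed) auto
    have "w' a = act (finprod G (\<lambda>x. k x [^]\<^bsub>G\<^esub> a x) X) (act (\<phi> c) (wE b))"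
      using w'_eq \<phi>_eq[OF c, of a b] by (simp add: c_def)
    also have "\<dots> = act (finprod G (\<lambda>x. k x [^]\<^bsub>G\<^esub> a x) X \<otimes>\<^bsub>G\<^esub> \<phi> c) (wE b)"
      using act_act kc \<phi>_closed[OF c] wE_closed by blast
    also have "finprod G (\<lambda>x. k x [^]\<^bsub>G\<^esub> a x) X \<otimes>\<^bsub>G\<^esub> \<phi> c =
        finprod G (\<lambda>x. k x [^]\<^bsub>G\<^esub> a x \<otimes>\<^bsub>G\<^esub> g x [^]\<^bsub>G\<^esub> c x) X"
      unfolding g(2)[OF c] using k g(1) by (intro G.finprod_multf[symmetric]) auto
    also have "\<dots> = finprod G (\<lambda>x. k x [^]\<^bsub>G\<^esub> b x) X"
    proof (rule G.finprod_cong')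
      fix x assume x: "x \<in> X"
      have "k x [^]\<^bsub>G\<^esub> a x = g x [^]\<^bsub>G\<^esub> (- int (a x))" "k x [^]\<^bsub>G\<^esub> b x = g x [^]\<^bsub>G\<^esub> (- int (b x))"
        using g(1)[OF x] by (simp_all add: k_def G.int_pow_neg_int G.nat_pow_inv)
      then show "k x [^]\<^bsub>G\<^esub> a x \<otimes>\<^bsub>G\<^esub> g x [^]\<^bsub>G\<^esub> c x = k x [^]\<^bsub>G\<^esub> b x"
        using g(1)[OF x] x by (simp add: c_def flip: G.int_pow_mult)
    qed (use k in auto)
    finally show ?thesis using w'_eq by simp
  qed
  \<comment> \<open>Any exponent that represents \<open>p\<close> may be taken, since the corrected
    monomials depend only on their image in \<open>P\<close>.\<close>
  define \<sigma> where "\<sigma> p = w' (SOME a. wP a = p)" for p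
  have \<sigma>: "\<sigma> (wP a) = w' a" for a
  proof -
    have "wP (SOME b. wP b = wP a) = wP a" by (rule someI[of _ a]) simp
    then show ?thesis unfolding \<sigma>_def by (rule w'_wd)
  qed
  have \<sigma>_closed: "\<sigma> p \<in> carrier E" for p unfolding \<sigma>_def by (rule w'_closed)
  show ?thesis
  proof (intro bexI[of _ \<sigma>] ballI)
    fix p assume "p \<in> carrier P"
    then obtain a where a: "wP a = p" using wP_surj by blast
    show "\<pi> (\<sigma> p) = p" using \<sigma>[of a] \<pi>_monomial[of e' a] e' unfolding a w'_def by simp
  next
    have "\<sigma> (p \<otimes>\<^bsub>P\<^esub> q) = \<sigma> p \<otimes>\<^bsub>E\<^esub> \<sigma> q" if pq: "p \<in> carrier P" "q \<in> carrier P" for p q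
    proof -
      obtain a where a: "wP a = p" using wP_surj[OF pq(1)] by blast
      obtain b where b: "wP b = q" using wP_surj[OF pq(2)] by blast
      show ?thesis unfolding a[symmetric] b[symmetric] wP_add[symmetric] \<sigma>
        unfolding w'_def by (rule E.monomial_add[OF e'_Pi])
    qed
    moreover have "\<sigma> \<one>\<^bsub>P\<^esub> = \<one>\<^bsub>E\<^esub>"
      using \<sigma>[of "\<lambda>x. 0"] P.monomial_zero[of "\<lambda>x. x" X] E.monomial_zero[of e' X]
      unfolding wP_def w'_def by simp
    ultimately show "\<sigma> \<in> monoid_hom P E"
      using \<sigma>_closed unfolding monoid_hom_def hom_def by auto
  qed
qed

section \<open>Presheaves of monoids and actions\<close>

text \<open>\<open>Y\<close> is merely a common target for the elements of the groups as arrows,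
  which makes the laws of composition available for restrictions. It is \<open>mcar A\<close> for
  the units of \<O> and \<open>GP\<close> for the group of homomorphisms.\<close>

locale presheaf_action = category C for C :: "('o, 'a) cat" +
  fixes X :: 'o and G :: "'o \<Rightarrow> 'a monoid" and act :: "'o \<Rightarrow> 'a \<Rightarrow> 'a \<Rightarrow> 'a" and Y :: 'o
  assumes X: "X \<in> Obj C" and group: "S \<in> Obj C \<Longrightarrow> group (G S)"
    and G_Hom: "S \<in> Obj C \<Longrightarrow> g \<in> carrier (G S) \<Longrightarrow> g \<in> Hom C S Y"
    and res_closed: "f \<in> Hom C T S \<Longrightarrow> g \<in> carrier (G S) \<Longrightarrow> g \<cdot>\<^bsub>C\<^esub> f \<in> carrier (G T)"
    and res_mult: "f \<in> Hom C T S \<Longrightarrow> g \<in> carrier (G S) \<Longrightarrow> h \<in> carrier (G S) \<Longrightarrow>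
      (g \<otimes>\<^bsub>G S\<^esub> h) \<cdot>\<^bsub>C\<^esub> f = (g \<cdot>\<^bsub>C\<^esub> f) \<otimes>\<^bsub>G T\<^esub> (h \<cdot>\<^bsub>C\<^esub> f)"
    and act_closed: "S \<in> Obj C \<Longrightarrow> g \<in> carrier (G S) \<Longrightarrow> x \<in> Hom C S X \<Longrightarrow> act S g x \<in> Hom C S X"
    and act_one: "S \<in> Obj C \<Longrightarrow> x \<in> Hom C S X \<Longrightarrow> act S \<one>\<^bsub>G S\<^esub> x = x"
    and act_mult: "S \<in> Obj C \<Longrightarrow> g \<in> carrier (G S) \<Longrightarrow> h \<in> carrier (G S) \<Longrightarrow> x \<in> Hom C S X \<Longrightarrow>
      act S (g \<otimes>\<^bsub>G S\<^esub> h) x = act S g (act S h x)"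
    and act_res: "f \<in> Hom C T S \<Longrightarrow> g \<in> carrier (G S) \<Longrightarrow> x \<in> Hom C S X \<Longrightarrow>
      act S g x \<cdot>\<^bsub>C\<^esub> f = act T (g \<cdot>\<^bsub>C\<^esub> f) (x \<cdot>\<^bsub>C\<^esub> f)"
begin

abbreviation "AG \<equiv> action_groupoid C X G act"

lemma AG_simps [simp]:
  "(S, x) \<in> Obj AG \<longleftrightarrow> S \<in> Obj C \<and> x \<in> Hom C S X"
  "(f, g, y, x) \<in> Arr AG \<longleftrightarrow> f \<in> Arr C \<and> g \<in> carrier (G (Dom C f)) \<and>
    y \<in> Hom C (Dom C f) X \<and> x \<in> Hom C (Cod C f) X \<and> act (Dom C f) g y = x \<cdot>\<^bsub>C\<^esub> f"
  "Dom AG (f, g, y, x) = (Dom C f, y)" "Cod AG (f, g, y, x) = (Cod C f, x)"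
  "Ident AG (S, x) = (Ident C S, \<one>\<^bsub>G S\<^esub>, x, x)" "PObj AG = fst" "PArr AG = fst"
  "(f, g, y, x) \<cdot>\<^bsub>AG\<^esub> (h, k, z, w) = (f \<cdot>\<^bsub>C\<^esub> h, (g \<cdot>\<^bsub>C\<^esub> h) \<otimes>\<^bsub>G (Dom C h)\<^esub> k, z, x)"
  by (simp_all add: action_groupoid_def)

text \<open>Restriction is assumed to be multiplicative, and the only idempotent of a group is its
  unit.\<close>

lemma res_one: assumes f: "f \<in> Hom C T S" shows "\<one>\<^bsub>G S\<^esub> \<cdot>\<^bsub>C\<^esub> f = \<one>\<^bsub>G T\<^esub>"
proof -
  interpret S: group "G S" using group HomD[OF f] by blast
  interpret T: group "G T" using group HomD[OF f] by blast
  have "\<one>\<^bsub>G S\<^esub> \<cdot>\<^bsub>C\<^esub> f = (\<one>\<^bsub>G S\<^esub> \<cdot>\<^bsub>C\<^esub> f) \<otimes>\<^bsub>G T\<^esub> (\<one>\<^bsub>G S\<^esub> \<cdot>\<^bsub>C\<^esub> f)"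
    using res_mult[OF f S.one_closed S.one_closed] by simp
  then show ?thesis using res_closed[OF f S.one_closed] T.l_cancel_one' by metis
qed

lemma AG_comp_arr:
  assumes "(h, k, z, w) \<in> Arr AG" "(f, g, w, x) \<in> Arr AG" "Cod C h = Dom C f"
  shows "(f, g, w, x) \<cdot>\<^bsub>AG\<^esub> (h, k, z, w) \<in> Arr AG"
proof -
  let ?T = "Dom C h" and ?S = "Dom C f"
  have h: "h \<in> Hom C ?T ?S" "h \<in> Arr C" "f \<in> Arr C" "?T \<in> Obj C"
    and g: "g \<in> carrier (G ?S)" "k \<in> carrier (G ?T)"
    and x: "z \<in> Hom C ?T X" "w \<in> Hom C ?S X" "x \<in> Hom C (Cod C f) X"
    and e: "act ?T k z = w \<cdot>\<^bsub>C\<^esub> h" "act ?S g w = x \<cdot>\<^bsub>C\<^esub> f"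
    using assms by (auto simp: Hom_def)
  interpret T: group "G ?T" using group h(4) by blast
  have "act ?T ((g \<cdot>\<^bsub>C\<^esub> h) \<otimes>\<^bsub>G ?T\<^esub> k) z = act ?T (g \<cdot>\<^bsub>C\<^esub> h) (w \<cdot>\<^bsub>C\<^esub> h)"
    using act_mult[OF h(4) res_closed[OF h(1) g(1)] g(2) x(1)] e(1) by simp
  also have "\<dots> = x \<cdot>\<^bsub>C\<^esub> f \<cdot>\<^bsub>C\<^esub> h" using act_res[OF h(1) g(1) x(2)] e(2) by simp
  also have "\<dots> = x \<cdot>\<^bsub>C\<^esub> (f \<cdot>\<^bsub>C\<^esub> h)"
    by (rule assoc) (use h assms(3) HomD[OF x(3)] in simp_all)
  finally show ?thesis using h x g res_closed[OF h(1) g(1)] assms(3) by simp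
qed

lemma category_AG: "category AG"
proof
  fix k assume "k \<in> Arr AG"
  then show "Dom AG k \<in> Obj AG \<and> Cod AG k \<in> Obj AG" by (cases k) auto
next
  fix x assume "x \<in> Obj AG"
  moreover obtain S s where x: "x = (S, s)" by (cases x)
  ultimately have S: "S \<in> Obj C" "s \<in> Hom C S X" by auto
  interpret S: group "G S" using group S(1) by blast
  show "Ident AG x \<in> Hom AG x x" unfolding x Hom_def using S act_one[OF S] HomD[OF S(2)] by simp
next
  fix k l x y z assume "k \<in> Hom AG x y" "l \<in> Hom AG y z"
  moreover obtain f g u s where k: "k = (f, g, u, s)" by (cases k)
  moreover obtain f' g' u' s' where l: "l = (f', g', u', s')" by (cases l)
  ultimately have *: "(f, g, u, s) \<in> Arr AG" "(f', g', s, s') \<in> Arr AG" "Cod C f = Dom C f'"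
    "u' = s" "x = (Dom C f, u)" "y = (Cod C f, s)" "z = (Cod C f', s')"
    unfolding Hom_def by auto
  then show "l \<cdot>\<^bsub>AG\<^esub> k \<in> Hom AG x z" using AG_comp_arr[OF *(1-3)]
    unfolding Hom_def k l *(4-7) by simp
next
  fix k x y assume "k \<in> Hom AG x y"
  moreover obtain f g u s where k: "k = (f, g, u, s)" by (cases k)
  ultimately have *: "f \<in> Arr C" "g \<in> carrier (G (Dom C f))" "x = (Dom C f, u)" "y = (Cod C f, s)"
    unfolding Hom_def by auto
  interpret T: group "G (Dom C f)" using group * by simp
  have gY: "g \<in> Hom C (Dom C f) Y" using G_Hom * by simp
  show "k \<cdot>\<^bsub>AG\<^esub> Ident AG x = k \<and> Ident AG y \<cdot>\<^bsub>AG\<^esub> k = k"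
    using * res_one[of f "Dom C f" "Cod C f"] HomD(1,2)[OF gY] by (simp add: k Hom_def)
next
  fix k l m w x y z assume "k \<in> Hom AG w x" "l \<in> Hom AG x y" "m \<in> Hom AG y z"
  moreover obtain f g u s where k: "k = (f, g, u, s)" by (cases k)
  moreover obtain f' g' u' s' where l: "l = (f', g', u', s')" by (cases l)
  moreover obtain f'' g'' u'' s'' where m: "m = (f'', g'', u'', s'')" by (cases m)
  ultimately have *: "f \<in> Arr C" "f' \<in> Arr C" "f'' \<in> Arr C" "Cod C f = Dom C f'" "Cod C f' = Dom C f''"
    "g \<in> carrier (G (Dom C f))" "g' \<in> carrier (G (Dom C f'))" "g'' \<in> carrier (G (Dom C f''))"
    unfolding Hom_def by auto
  have h: "f \<in> Hom C (Dom C f) (Dom C f')" "f' \<in> Hom C (Dom C f') (Dom C f'')"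
    using * by (simp_all add: Hom_def)
  interpret T: group "G (Dom C f)" using group * by simp
  have gY: "g'' \<in> Hom C (Dom C f'') Y" using G_Hom * by simp
  have g'': "g'' \<cdot>\<^bsub>C\<^esub> f' \<cdot>\<^bsub>C\<^esub> f = g'' \<cdot>\<^bsub>C\<^esub> (f' \<cdot>\<^bsub>C\<^esub> f)"
    using * HomD(1,2)[OF gY] by (intro assoc) simp_all
  have r: "g'' \<cdot>\<^bsub>C\<^esub> f' \<in> carrier (G (Dom C f'))" "g'' \<cdot>\<^bsub>C\<^esub> f' \<cdot>\<^bsub>C\<^esub> f \<in> carrier (G (Dom C f))"
    "g' \<cdot>\<^bsub>C\<^esub> f \<in> carrier (G (Dom C f))"
    using res_closed[OF h(2) *(8)] res_closed[OF h(1)] *(7) by blast+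
  show "m \<cdot>\<^bsub>AG\<^esub> (l \<cdot>\<^bsub>AG\<^esub> k) = m \<cdot>\<^bsub>AG\<^esub> l \<cdot>\<^bsub>AG\<^esub> k"
    unfolding k l m using * r res_mult[OF h(1) r(1) *(7)] g''
    by (simp add: assoc T.m_assoc)
qed

text \<open>The group component one gives lifts. Factorisations are unique because the equation for
  the missing group component can be solved in the group.\<close>

lemma fibred_AG: "fibred_in_groupoids C AG"
  unfolding fibred_in_groupoids_def
proof (intro conjI allI ballI impI)
  show "category AG" by (rule category_AG)
  show "is_functor AG C (PObj AG) (PArr AG)"
    unfolding is_functor_def by (auto simp: Hom_def)
next
  fix f x assume f: "f \<in> Arr C" and "x \<in> Over AG (Cod C f)"
  then obtain s where s: "x = (Cod C f, s)" "s \<in> Hom C (Cod C f) X" by (cases x) (auto simp: Over_iff)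
  have f': "f \<in> Hom C (Dom C f) (Cod C f)" using f by (simp add: Hom_def)
  have sf: "s \<cdot>\<^bsub>C\<^esub> f \<in> Hom C (Dom C f) X" using comp_Hom[OF s(2) f'] .
  interpret T: group "G (Dom C f)" using group f by simp
  show "\<exists>y\<in>Over AG (Dom C f). \<exists>a. a \<in> HomOver AG f y x"
  proof (intro bexI exI)
    show "(f, \<one>\<^bsub>G (Dom C f)\<^esub>, s \<cdot>\<^bsub>C\<^esub> f, s) \<in> HomOver AG f (Dom C f, s \<cdot>\<^bsub>C\<^esub> f) x"
      using f s sf act_one[OF _ sf] by (simp add: HomOver_iff)
  qed (use f sf in \<open>simp add: Over_iff\<close>)
next
  fix f h x y z k l
  assume k0: "k \<in> HomOver AG f y x" and l0: "l \<in> HomOver AG (f \<cdot>\<^bsub>C\<^esub> h) z x"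
    and h0: "h \<in> Hom C (PObj AG z) (PObj AG y)"
  obtain f1 g u s where k: "k = (f1, g, u, s)" by (cases k)
  obtain f2 g' u' s' where l: "l = (f2, g', u', s')" by (cases l)
  have k1: "f1 = f" "y = (Dom C f, u)" "x = (Cod C f, s)" "f \<in> Arr C" "g \<in> carrier (G (Dom C f))"
    "u \<in> Hom C (Dom C f) X" "s \<in> Hom C (Cod C f) X" "act (Dom C f) g u = s \<cdot>\<^bsub>C\<^esub> f"
    using k0 unfolding k HomOver_iff by auto
  have l1: "f2 = f \<cdot>\<^bsub>C\<^esub> h" "z = (Dom C f2, u')" "s' = s" "g' \<in> carrier (G (Dom C f2))"
    "u' \<in> Hom C (Dom C f2) X" "act (Dom C f2) g' u' = s' \<cdot>\<^bsub>C\<^esub> f2"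
    using l0 k1(3) unfolding l HomOver_iff by auto
  have "h \<in> Hom C (Dom C f2) (Dom C f)" using h0 k1(2) l1(2) by simp
  note h1 = HomD[OF this]
  note l2 = l1(2,4-)[folded h1(2)]
  have *: "f1 = f" "f2 = f \<cdot>\<^bsub>C\<^esub> h" "s' = s" "y = (Dom C f, u)" "z = (Dom C h, u')" "x = (Cod C f, s)"
    "h \<in> Hom C (Dom C h) (Dom C f)" "h \<in> Arr C" "Cod C h = Dom C f"
    using k1(1-3) l1(1,3) l2(1) h1(1,3) by (simp_all add: Hom_def)
  have f: "f \<in> Arr C" "g \<in> carrier (G (Dom C f))" "u \<in> Hom C (Dom C f) X" "s \<in> Hom C (Cod C f) X"
      "act (Dom C f) g u = s \<cdot>\<^bsub>C\<^esub> f" "g' \<in> carrier (G (Dom C h))" "u' \<in> Hom C (Dom C h) X"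
      "act (Dom C h) g' u' = s \<cdot>\<^bsub>C\<^esub> (f \<cdot>\<^bsub>C\<^esub> h)"
    using k1(4-) l2(2-) unfolding l1(1,3) by simp_all
  interpret T: group "G (Dom C h)" using group * by simp
  have T: "Dom C h \<in> Obj C" using * by simp
  have gh: "g \<cdot>\<^bsub>C\<^esub> h \<in> carrier (G (Dom C h))" by (rule res_closed[OF *(7) f(2)])
  have uh: "u \<cdot>\<^bsub>C\<^esub> h \<in> Hom C (Dom C h) X" by (rule comp_Hom[OF f(3) *(7)])
  \<comment> \<open>The only solution of the equation that composition with \<open>k\<close> imposes
    on the group component.\<close>
  let ?c = "inv\<^bsub>G (Dom C h)\<^esub> (g \<cdot>\<^bsub>C\<^esub> h) \<otimes>\<^bsub>G (Dom C h)\<^esub> g'"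
  have c: "?c \<in> carrier (G (Dom C h))" using gh f(6) by simp
  have e: "act (Dom C h) g' u' = act (Dom C h) (g \<cdot>\<^bsub>C\<^esub> h) (u \<cdot>\<^bsub>C\<^esub> h)"
    using f(8) act_res[OF *(7) f(2,3)] f(5) assoc[of h f s] f(1) * HomD[OF f(4)] by simp
  have "act (Dom C h) ?c u' = act (Dom C h) (inv\<^bsub>G (Dom C h)\<^esub> (g \<cdot>\<^bsub>C\<^esub> h)) (act (Dom C h) (g \<cdot>\<^bsub>C\<^esub> h) (u \<cdot>\<^bsub>C\<^esub> h))"
    using act_mult[OF T T.inv_closed[OF gh] f(6,7)] e by simp
  also have "\<dots> = u \<cdot>\<^bsub>C\<^esub> h"
    using act_mult[OF T T.inv_closed[OF gh] gh uh, symmetric] gh act_one[OF T uh] by simp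
  finally have act_c: "act (Dom C h) ?c u' = u \<cdot>\<^bsub>C\<^esub> h" .
  show "\<exists>!c. c \<in> HomOver AG h z y \<and> k \<cdot>\<^bsub>AG\<^esub> c = l"
  proof (rule ex1I[of _ "(h, ?c, u', u)"])
    have "(g \<cdot>\<^bsub>C\<^esub> h) \<otimes>\<^bsub>G (Dom C h)\<^esub> ?c = g'" using gh f(6) by (simp flip: T.m_assoc)
    then show "(h, ?c, u', u) \<in> HomOver AG h z y \<and> k \<cdot>\<^bsub>AG\<^esub> (h, ?c, u', u) = l"
      using * f c act_c by (simp add: HomOver_iff k l)
    fix c' assume "c' \<in> HomOver AG h z y \<and> k \<cdot>\<^bsub>AG\<^esub> c' = l"
    moreover obtain h' d a b where c': "c' = (h', d, a, b)" by (cases c')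
    ultimately have **: "h' = h" "a = u'" "b = u" "d \<in> carrier (G (Dom C h))" "(g \<cdot>\<^bsub>C\<^esub> h) \<otimes>\<^bsub>G (Dom C h)\<^esub> d = g'"
      using * by (auto simp: HomOver_iff k l)
    then have "d = ?c" using gh by (simp flip: T.m_assoc **(5))
    then show "c' = (h, ?c, u', u)" using ** c' by simp
  qed
qed

end

section \<open>Objects representing homomorphisms into a presheaf of monoids\<close>

locale monoid_presheaf = category C for C :: "('o, 'a) cat" +
  fixes N :: "'o \<Rightarrow> 'a monoid" and Y :: 'o
  assumes comm: "S \<in> Obj C \<Longrightarrow> comm_monoid (N S)"
    and N_Hom: "S \<in> Obj C \<Longrightarrow> s \<in> carrier (N S) \<Longrightarrow> s \<in> Hom C S Y"
    and N_res: "f \<in> Hom C T S \<Longrightarrow> s \<in> carrier (N S) \<Longrightarrow> s \<cdot>\<^bsub>C\<^esub> f \<in> carrier (N T)"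
    and N_res_mult: "f \<in> Hom C T S \<Longrightarrow> s \<in> carrier (N S) \<Longrightarrow> t \<in> carrier (N S) \<Longrightarrow>
      (s \<otimes>\<^bsub>N S\<^esub> t) \<cdot>\<^bsub>C\<^esub> f = (s \<cdot>\<^bsub>C\<^esub> f) \<otimes>\<^bsub>N T\<^esub> (t \<cdot>\<^bsub>C\<^esub> f)"
    and N_res_one: "f \<in> Hom C T S \<Longrightarrow> \<one>\<^bsub>N S\<^esub> \<cdot>\<^bsub>C\<^esub> f = \<one>\<^bsub>N T\<^esub>"

locale representation = monoid_presheaf C N Y for C :: "('o, 'a) cat" and N Y +
  fixes P :: "'p monoid" and R :: 'o and u :: "'p \<Rightarrow> 'a"
  assumes rep: "represents_homs C N P R u"
begin

lemma R_Obj: "R \<in> Obj C" and u_hom: "u \<in> monoid_hom P (N R)"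
  using rep unfolding represents_homs_def by blast+

lemma represent:
  "S \<in> Obj C \<Longrightarrow> \<phi> \<in> monoid_hom P (N S) \<Longrightarrow>
    \<exists>!s. s \<in> Hom C S R \<and> (\<forall>p \<in> carrier P. u p \<cdot>\<^bsub>C\<^esub> s = \<phi> p)"
  using rep unfolding represents_homs_def by blast

lemma ev_hom: assumes s: "s \<in> Hom C S R" shows "(\<lambda>p. u p \<cdot>\<^bsub>C\<^esub> s) \<in> monoid_hom P (N S)"
  using u_hom N_res[OF s] N_res_mult[OF s] N_res_one[OF s]
  unfolding monoid_hom_def hom_def by auto

lemma ev_closed: "s \<in> Hom C S R \<Longrightarrow> p \<in> carrier P \<Longrightarrow> u p \<cdot>\<^bsub>C\<^esub> s \<in> carrier (N S)"
  using ev_hom[of s S] unfolding monoid_hom_def hom_def by (auto simp: Pi_iff)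

lemma u_Hom: "p \<in> carrier P \<Longrightarrow> u p \<in> Hom C R Y"
  using u_hom N_Hom[OF R_Obj] unfolding monoid_hom_def hom_def by (auto simp: Pi_iff)

lemma ev_comp:
  assumes "s \<in> Hom C S R" "f \<in> Hom C T S" "p \<in> carrier P"
  shows "u p \<cdot>\<^bsub>C\<^esub> (s \<cdot>\<^bsub>C\<^esub> f) = u p \<cdot>\<^bsub>C\<^esub> s \<cdot>\<^bsub>C\<^esub> f"
  by (rule assoc[symmetric]) (use HomD[OF assms(1)] HomD[OF assms(2)] HomD[OF u_Hom[OF assms(3)]] in simp_all)

text \<open>Sections of the representing object are determined by their coordinates at the elements
  of \<open>P\<close>. All laws for pointwise operations are checked in this way.\<close>

lemma ev_inj:
  assumes "s \<in> Hom C S R" "t \<in> Hom C S R" "\<And>p. p \<in> carrier P \<Longrightarrow> u p \<cdot>\<^bsub>C\<^esub> s = u p \<cdot>\<^bsub>C\<^esub> t"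
  shows "s = t"
proof -
  have "\<exists>!r. r \<in> Hom C S R \<and> (\<forall>p \<in> carrier P. u p \<cdot>\<^bsub>C\<^esub> r = u p \<cdot>\<^bsub>C\<^esub> t)"
    using represent[OF _ ev_hom[OF assms(2)]] HomD[OF assms(1)] by simp
  then show ?thesis using assms by metis
qed

text \<open>A pointwise product of homomorphisms is a homomorphism because the target is
  commutative.\<close>

lemma hom_mult:
  assumes "S \<in> Obj C" "\<phi> \<in> monoid_hom P (N S)" "\<psi> \<in> monoid_hom P (N S)"
  shows "(\<lambda>p. \<phi> p \<otimes>\<^bsub>N S\<^esub> \<psi> p) \<in> monoid_hom P (N S)"
proof -
  interpret comm_monoid "N S" using comm assms(1) .
  show ?thesis using assms(2,3) unfolding monoid_hom_def hom_def
    by (auto simp: Pi_iff m_ac)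
qed

lemma the_rep:
  assumes "S \<in> Obj C" "\<phi> \<in> monoid_hom P (N S)"
  shows "(THE s. s \<in> Hom C S R \<and> (\<forall>p \<in> carrier P. u p \<cdot>\<^bsub>C\<^esub> s = \<phi> p)) \<in> Hom C S R"
    "p \<in> carrier P \<Longrightarrow>
      u p \<cdot>\<^bsub>C\<^esub> (THE s. s \<in> Hom C S R \<and> (\<forall>p \<in> carrier P. u p \<cdot>\<^bsub>C\<^esub> s = \<phi> p)) = \<phi> p"
  using theI'[OF represent[OF assms]] by blast+

abbreviation "PM \<equiv> pointwise_monoid C N P R u"

lemma PM_carrier [simp]: "carrier (PM S) = Hom C S R" by (simp add: pointwise_monoid_def)

lemma PM_mult:
  assumes st: "s \<in> Hom C S R" "t \<in> Hom C S R"
  shows "s \<otimes>\<^bsub>PM S\<^esub> t \<in> Hom C S R"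
    "p \<in> carrier P \<Longrightarrow> u p \<cdot>\<^bsub>C\<^esub> (s \<otimes>\<^bsub>PM S\<^esub> t) = (u p \<cdot>\<^bsub>C\<^esub> s) \<otimes>\<^bsub>N S\<^esub> (u p \<cdot>\<^bsub>C\<^esub> t)"
  using the_rep[OF HomD(4)[OF st(1)] hom_mult[OF HomD(4)[OF st(1)] ev_hom[OF st(1)] ev_hom[OF st(2)]]]
  by (simp_all add: pointwise_monoid_def)

lemma PM_one:
  assumes "S \<in> Obj C"
  shows "\<one>\<^bsub>PM S\<^esub> \<in> Hom C S R" "p \<in> carrier P \<Longrightarrow> u p \<cdot>\<^bsub>C\<^esub> \<one>\<^bsub>PM S\<^esub> = \<one>\<^bsub>N S\<^esub>"
proof -
  interpret comm_monoid "N S" using comm assms .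
  have "(\<lambda>p. \<one>\<^bsub>N S\<^esub>) \<in> monoid_hom P (N S)" unfolding monoid_hom_def hom_def by auto
  from the_rep[OF assms this]
  show "\<one>\<^bsub>PM S\<^esub> \<in> Hom C S R" "p \<in> carrier P \<Longrightarrow> u p \<cdot>\<^bsub>C\<^esub> \<one>\<^bsub>PM S\<^esub> = \<one>\<^bsub>N S\<^esub>"
    by (simp_all add: pointwise_monoid_def)
qed

lemma PM_res_mult:
  assumes f: "f \<in> Hom C T S" and st: "s \<in> Hom C S R" "t \<in> Hom C S R"
  shows "(s \<otimes>\<^bsub>PM S\<^esub> t) \<cdot>\<^bsub>C\<^esub> f = (s \<cdot>\<^bsub>C\<^esub> f) \<otimes>\<^bsub>PM T\<^esub> (t \<cdot>\<^bsub>C\<^esub> f)"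
  by (rule ev_inj[of _ T])
    (use PM_mult[OF st] PM_mult[OF comp_Hom[OF st(1) f] comp_Hom[OF st(2) f]]
      in \<open>simp_all add: comp_Hom[OF _ f] ev_comp[OF _ f] st N_res_mult[OF f] ev_closed\<close>)

lemma PM_group:
  assumes S: "S \<in> Obj C" and grp: "group (N S)"
  shows "comm_group (PM S)"
proof -
  interpret N: comm_monoid "N S" using comm S .
  interpret N: group "N S" by (rule grp)
  show ?thesis
  proof (rule comm_groupI)
    fix x y z assume xyz: "x \<in> carrier (PM S)" "y \<in> carrier (PM S)" "z \<in> carrier (PM S)"
    then have h: "x \<in> Hom C S R" "y \<in> Hom C S R" "z \<in> Hom C S R" by simp_all
    show "x \<otimes>\<^bsub>PM S\<^esub> y \<otimes>\<^bsub>PM S\<^esub> z = x \<otimes>\<^bsub>PM S\<^esub> (y \<otimes>\<^bsub>PM S\<^esub> z)"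
      by (rule ev_inj[of _ S]) (use h in \<open>simp_all add: PM_mult N.m_assoc ev_closed\<close>)
  next
    fix x y assume "x \<in> carrier (PM S)" "y \<in> carrier (PM S)"
    then have h: "x \<in> Hom C S R" "y \<in> Hom C S R" by simp_all
    show "x \<otimes>\<^bsub>PM S\<^esub> y \<in> carrier (PM S)" using PM_mult(1)[OF h] by simp
    show "x \<otimes>\<^bsub>PM S\<^esub> y = y \<otimes>\<^bsub>PM S\<^esub> x"
      by (rule ev_inj[of _ S]) (use h in \<open>simp_all add: PM_mult N.m_comm ev_closed\<close>)
  next
    fix x assume "x \<in> carrier (PM S)"
    then have h: "x \<in> Hom C S R" by simp
    show "\<one>\<^bsub>PM S\<^esub> \<otimes>\<^bsub>PM S\<^esub> x = x"
      by (rule ev_inj[of _ S]) (use h in \<open>simp_all add: PM_mult PM_one[OF S] ev_closed\<close>)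
    \<comment> \<open>Commutativity also makes the pointwise inverse a homomorphism, and its
      representing arrow is the inverse of \<open>x\<close>.\<close>
    have "(\<lambda>p. inv\<^bsub>N S\<^esub> (u p \<cdot>\<^bsub>C\<^esub> x)) \<in> monoid_hom P (N S)"
      using ev_hom[OF h] unfolding monoid_hom_def hom_def
      by (auto simp: Pi_iff N.inv_mult_group N.m_comm)
    from represent[OF S this] obtain y where y: "y \<in> Hom C S R"
      "\<And>p. p \<in> carrier P \<Longrightarrow> u p \<cdot>\<^bsub>C\<^esub> y = inv\<^bsub>N S\<^esub> (u p \<cdot>\<^bsub>C\<^esub> x)" by blast
    have "y \<otimes>\<^bsub>PM S\<^esub> x = \<one>\<^bsub>PM S\<^esub>"
      by (rule ev_inj[of _ S]) (use h y in \<open>simp_all add: PM_mult PM_one[OF S] ev_closed\<close>)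
    then show "\<exists>y \<in> carrier (PM S). y \<otimes>\<^bsub>PM S\<^esub> x = \<one>\<^bsub>PM S\<^esub>" using y(1) by auto
  qed (use PM_one[OF S] in simp)
qed

end

section \<open>The sheaf of sections of a monoid object\<close>

locale monoid_site = category C for C :: "('o, 'a) cat" +
  fixes Cov :: "'o \<Rightarrow> 'a set set" and A :: "('o, 'a) monoid_data"
  assumes site_topology: "grothendieck_topology C Cov" and subcan: "subcanonical C Cov"
    and monoid_object: "monoid_object C A"
begin

abbreviation "Sec \<equiv> sections C A"
abbreviation "Unt S \<equiv> units_of (sections C A S)"

lemma Sec_carrier [simp]: "carrier (Sec S) = Hom C S (mcar A)" by (simp add: sections_def)

lemma Sec_comm: "S \<in> Obj C \<Longrightarrow> comm_monoid (Sec S)"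
  using monoid_object unfolding monoid_object_def by blast

lemma A_Hom: "mmul A \<in> Hom C (msq A) (mcar A)" "munit A \<in> Hom C (mterm A) (mcar A)"
    "mfst A \<in> Hom C (msq A) (mcar A)" "msnd A \<in> Hom C (msq A) (mcar A)" "mcar A \<in> Obj C"
  using monoid_object unfolding monoid_object_def is_product_def by simp_all

lemma pairing:
  assumes "s \<in> Hom C S (mcar A)" "t \<in> Hom C S (mcar A)"
  shows "\<exists>!h. h \<in> Hom C S (msq A) \<and> mfst A \<cdot>\<^bsub>C\<^esub> h = s \<and> msnd A \<cdot>\<^bsub>C\<^esub> h = t"
proof -
  have "is_product C (mcar A) (mcar A) (msq A) (mfst A) (msnd A)"
    using monoid_object unfolding monoid_object_def by simp
  then show ?thesis using assms HomD(4)[OF assms(1)] unfolding is_product_def by simp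
qed

text \<open>The product of two sections is a definite description. Presenting the pair by one arrow
  to the square evaluates it, and compatibility with restriction becomes associativity of
  composition.\<close>

lemma Sec_mult:
  assumes "h \<in> Hom C S (msq A)"
  shows "(mfst A \<cdot>\<^bsub>C\<^esub> h) \<otimes>\<^bsub>Sec S\<^esub> (msnd A \<cdot>\<^bsub>C\<^esub> h) = mmul A \<cdot>\<^bsub>C\<^esub> h"
proof -
  have "(THE k. k \<in> Hom C S (msq A) \<and> mfst A \<cdot>\<^bsub>C\<^esub> k = mfst A \<cdot>\<^bsub>C\<^esub> h \<and> msnd A \<cdot>\<^bsub>C\<^esub> k = msnd A \<cdot>\<^bsub>C\<^esub> h) = h"
    using pairing[OF comp_Hom[OF A_Hom(3) assms] comp_Hom[OF A_Hom(4) assms]] assms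
    by (intro the1_equality) auto
  then show ?thesis by (simp add: sections_def)
qed

lemma comp_assoc': "h \<in> Hom C Y Z \<Longrightarrow> g \<in> Hom C X Y \<Longrightarrow> f \<in> Hom C W X \<Longrightarrow>
    h \<cdot>\<^bsub>C\<^esub> g \<cdot>\<^bsub>C\<^esub> f = h \<cdot>\<^bsub>C\<^esub> (g \<cdot>\<^bsub>C\<^esub> f)"
  using comp_assoc by metis

lemma Sec_res_mult:
  assumes f: "f \<in> Hom C T S" and st: "s \<in> Hom C S (mcar A)" "t \<in> Hom C S (mcar A)"
  shows "(s \<otimes>\<^bsub>Sec S\<^esub> t) \<cdot>\<^bsub>C\<^esub> f = (s \<cdot>\<^bsub>C\<^esub> f) \<otimes>\<^bsub>Sec T\<^esub> (t \<cdot>\<^bsub>C\<^esub> f)"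
proof -
  obtain h where h: "h \<in> Hom C S (msq A)" "mfst A \<cdot>\<^bsub>C\<^esub> h = s" "msnd A \<cdot>\<^bsub>C\<^esub> h = t"
    using pairing[OF st] by blast
  have hf: "h \<cdot>\<^bsub>C\<^esub> f \<in> Hom C T (msq A)" by (rule comp_Hom[OF h(1) f])
  show ?thesis
    using Sec_mult[OF h(1)] Sec_mult[OF hf] h f A_Hom by (simp flip: comp_assoc'[OF _ h(1) f])
qed

lemma Sec_res_one: assumes f: "f \<in> Hom C T S" shows "\<one>\<^bsub>Sec S\<^esub> \<cdot>\<^bsub>C\<^esub> f = \<one>\<^bsub>Sec T\<^esub>"
proof -
  have terminal: "\<exists>!h. h \<in> Hom C S' (mterm A)" if "S' \<in> Obj C" for S'
    using monoid_object that unfolding monoid_object_def is_terminal_def by simp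
  let ?h = "\<lambda>S'. THE h. h \<in> Hom C S' (mterm A)"
  have h: "?h S \<in> Hom C S (mterm A)" using theI'[OF terminal[of S]] HomD[OF f] by blast
  have "?h T = ?h S \<cdot>\<^bsub>C\<^esub> f"
    using terminal[of T] comp_Hom[OF h f] HomD(4)[OF f] by (intro the1_equality) auto
  then show ?thesis using comp_assoc'[OF A_Hom(2) h f] by (simp add: sections_def)
qed

sublocale Sec: monoid_presheaf C Sec "mcar A"
  by (intro monoid_presheaf.intro monoid_presheaf_axioms.intro category_axioms Sec_comm)
    (simp_all add: Sec_res_mult Sec_res_one comp_Hom)

lemma Sec_unit_res:
  assumes f: "f \<in> Hom C T S" and s: "s \<in> Units (Sec S)" shows "s \<cdot>\<^bsub>C\<^esub> f \<in> Units (Sec T)"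
proof -
  interpret S: comm_monoid "Sec S" using Sec_comm HomD[OF f] by blast
  interpret T: comm_monoid "Sec T" using Sec_comm HomD[OF f] by blast
  have st: "s \<in> carrier (Sec S)" "inv\<^bsub>Sec S\<^esub> s \<in> carrier (Sec S)"
    by (rule S.Units_closed[OF s], rule S.Units_inv_closed[OF s])
  then have "(s \<cdot>\<^bsub>C\<^esub> f) \<otimes>\<^bsub>Sec T\<^esub> (inv\<^bsub>Sec S\<^esub> s \<cdot>\<^bsub>C\<^esub> f) = \<one>\<^bsub>Sec T\<^esub>"
    using Sec.N_res_mult[OF f st] Sec.N_res_one[OF f] S.Units_r_inv[OF s] by simp
  moreover note r = Sec.N_res[OF f st(1)] Sec.N_res[OF f st(2)]
  ultimately have "(inv\<^bsub>Sec S\<^esub> s \<cdot>\<^bsub>C\<^esub> f) \<otimes>\<^bsub>Sec T\<^esub> (s \<cdot>\<^bsub>C\<^esub> f) = \<one>\<^bsub>Sec T\<^esub>"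
    "(s \<cdot>\<^bsub>C\<^esub> f) \<otimes>\<^bsub>Sec T\<^esub> (inv\<^bsub>Sec S\<^esub> s \<cdot>\<^bsub>C\<^esub> f) = \<one>\<^bsub>Sec T\<^esub>"
    using T.m_comm[OF r] by simp_all
  then show ?thesis using r unfolding Units_def by blast
qed

lemma Unt_group: assumes "S \<in> Obj C" shows "comm_group (Unt S)"
proof -
  interpret comm_monoid "Sec S" using Sec_comm assms .
  show ?thesis by (rule units_comm_group)
qed

lemma Unt_simps [simp]: "carrier (Unt S) = Units (Sec S)" "monoid.mult (Unt S) = monoid.mult (Sec S)"
  "\<one>\<^bsub>Unt S\<^esub> = \<one>\<^bsub>Sec S\<^esub>"
  by (simp_all add: units_of_def)

lemma Units_Hom: "s \<in> Units (Sec S) \<Longrightarrow> s \<in> Hom C S (mcar A)"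
  unfolding Units_def by simp

sublocale Unt: monoid_presheaf C Unt "mcar A"
proof (intro monoid_presheaf.intro monoid_presheaf_axioms.intro category_axioms)
  fix S assume "S \<in> Obj C"
  then interpret comm_group "Unt S" by (rule Unt_group)
  show "comm_monoid (Unt S)" by (rule comm_monoid_axioms)
qed (simp_all add: Sec_unit_res Units_Hom Sec_res_mult Sec_res_one)

lemma glue_section:
  assumes "S \<in> Obj C" "\<U> \<in> Cov S" "Z \<in> Obj C" "\<And>f. f \<in> \<U> \<Longrightarrow> s f \<in> Hom C (Dom C f) Z"
    "\<And>f f' W a b. f \<in> \<U> \<Longrightarrow> f' \<in> \<U> \<Longrightarrow> a \<in> Hom C W (Dom C f) \<Longrightarrow> b \<in> Hom C W (Dom C f') \<Longrightarrow>
      f \<cdot>\<^bsub>C\<^esub> a = f' \<cdot>\<^bsub>C\<^esub> b \<Longrightarrow> s f \<cdot>\<^bsub>C\<^esub> a = s f' \<cdot>\<^bsub>C\<^esub> b"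
  shows "\<exists>!t. t \<in> Hom C S Z \<and> (\<forall>f \<in> \<U>. t \<cdot>\<^bsub>C\<^esub> f = s f)"
  using subcan[unfolded subcanonical_def, rule_format, OF assms(3,1,2), of s] assms(4,5) by blast

text \<open>Both \<open>s\<close> and \<open>t\<close> glue the restrictions of \<open>t\<close>, so
  the uniqueness in subcanonicity applies.\<close>

lemma section_eq_locally:
  assumes S: "S \<in> Obj C" "\<U> \<in> Cov S" and st: "s \<in> Hom C S Z" "t \<in> Hom C S Z"
    and eq: "\<And>f. f \<in> \<U> \<Longrightarrow> s \<cdot>\<^bsub>C\<^esub> f = t \<cdot>\<^bsub>C\<^esub> f"
  shows "s = t"
proof -
  have arr: "f \<in> Hom C (Dom C f) S" if "f \<in> \<U>" for f
    using site_topology[unfolded grothendieck_topology_def, THEN conjunct1] S that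
    by (simp add: Hom_def)
  have "\<exists>!r. r \<in> Hom C S Z \<and> (\<forall>f \<in> \<U>. r \<cdot>\<^bsub>C\<^esub> f = t \<cdot>\<^bsub>C\<^esub> f)"
  proof (rule glue_section[OF S HomD(5)[OF st(1)]])
    fix f assume "f \<in> \<U>" then show "t \<cdot>\<^bsub>C\<^esub> f \<in> Hom C (Dom C f) Z" using comp_Hom[OF st(2) arr] by blast
  next
    fix f f' W a b assume *: "f \<in> \<U>" "f' \<in> \<U>" "a \<in> Hom C W (Dom C f)" "b \<in> Hom C W (Dom C f')" "f \<cdot>\<^bsub>C\<^esub> a = f' \<cdot>\<^bsub>C\<^esub> b"
    show "t \<cdot>\<^bsub>C\<^esub> f \<cdot>\<^bsub>C\<^esub> a = t \<cdot>\<^bsub>C\<^esub> f' \<cdot>\<^bsub>C\<^esub> b"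
      using comp_assoc'[OF st(2) arr[OF *(1)] *(3)] comp_assoc'[OF st(2) arr[OF *(2)] *(4)] *(5) by simp
  qed
  then show ?thesis using st eq by metis
qed

end

section \<open>The projection to Div is fully faithful\<close>

locale div_stack = monoid_site C Cov A
  for C :: "('o, 'a) cat" and Cov and A :: "('o, 'a) monoid_data" +
  fixes D :: "('o, 'a, 'x, 'e) fibcat" and M Io Ia qo qa m e
  assumes is_Div: "is_Div C Cov A D M Io Ia qo qa m e"
begin

sublocale OG: presheaf_action C "mcar A" Unt "\<lambda>S. monoid.mult (Sec S)" "mcar A"
proof (intro presheaf_action.intro presheaf_action_axioms.intro category_axioms)
  fix S assume S: "S \<in> Obj C"
  then interpret U: comm_group "Unt S" by (rule Unt_group)
  interpret Sec: comm_monoid "Sec S" by (rule Sec_comm[OF S])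
  show "group (Unt S)" by (rule U.group_axioms)
  fix x assume x: "x \<in> Hom C S (mcar A)"
  then show "\<one>\<^bsub>Unt S\<^esub> \<otimes>\<^bsub>Sec S\<^esub> x = x" by simp
  fix g assume g: "g \<in> carrier (Unt S)"
  then have g': "g \<in> Hom C S (mcar A)" using Units_Hom by simp
  show "g \<otimes>\<^bsub>Sec S\<^esub> x \<in> Hom C S (mcar A)" using Sec.m_closed[of g x] g' x by simp
  fix h assume "h \<in> carrier (Unt S)"
  then have h': "h \<in> Hom C S (mcar A)" using Units_Hom by simp
  show "(g \<otimes>\<^bsub>Unt S\<^esub> h) \<otimes>\<^bsub>Sec S\<^esub> x = g \<otimes>\<^bsub>Sec S\<^esub> (h \<otimes>\<^bsub>Sec S\<^esub> x)"
    using Sec.m_assoc[of g h x] x g' h' by simp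
qed (simp_all add: A_Hom Units_Hom Sec_unit_res Sec_res_mult)

lemma OG_eq: "O_groupoid C A = OG.AG" by (simp add: O_groupoid_def)

lemma stackification: "stackification C Cov OG.AG D qo qa"
  using is_Div[unfolded is_Div_def quotient_stack_def, THEN conjunct1] .

lemma monoidal_Div: "symmetric_monoidal_fibred C D M Io Ia"
  using is_Div[unfolded is_Div_def, THEN conjunct2, THEN conjunct1] .

lemma monoidal_projection:
  "symmetric_monoidal_fibred_functor C OG.AG (O_tensor C A) (O_unit_obj C A) (O_unit_arr C A) D M Io Ia qo qa m e"
  using is_Div[unfolded is_Div_def, THEN conjunct2, THEN conjunct2] unfolding OG_eq .

lemma stack_Div: "stack C Cov D"
  using stackification[unfolded stackification_def, THEN conjunct2, THEN conjunct1] .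

lemma fibred_Div: "fibred C D"
  using stack_Div unfolding stack_def by (intro fibredI category_axioms) (rule conjunct1)

sublocale D: fibred_stack C D Cov
  by (rule fibred_stack.intro[OF fibred_Div fibred_stack_axioms.intro[OF site_topology stack_Div]])

sublocale D: sm_fibred C D M Io Ia
  by (rule sm_fibred.intro[OF fibred_Div sm_fibred_axioms.intro[OF monoidal_Div]])

lemma projection_fibred: "fibred_functor OG.AG D qo qa"
  using stackification[unfolded stackification_def, THEN conjunct2, THEN conjunct2, THEN conjunct1] .

lemma projection_functor: "is_functor OG.AG D qo qa"
  using projection_fibred[unfolded fibred_functor_def, THEN conjunct1] .

lemma q_obj [simp]:
  assumes "S \<in> Obj C" "s \<in> Hom C S (mcar A)" shows "qo (S, s) \<in> Obj D" "PObj D (qo (S, s)) = S"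
proof -
  have o: "(S, s) \<in> Obj OG.AG" using assms by simp
  show "qo (S, s) \<in> Obj D" using projection_functor o unfolding is_functor_def by blast
  show "PObj D (qo (S, s)) = S"
    using projection_fibred[unfolded fibred_functor_def, THEN conjunct2, THEN conjunct1, rule_format, OF o] by simp
qed

lemma q_arr:
  assumes "(f, g, y, x) \<in> Arr OG.AG"
  shows "qa (f, g, y, x) \<in> HomOver D f (qo (Dom C f, y)) (qo (Cod C f, x))"
proof -
  have "qa (f, g, y, x) \<in> Hom D (qo (Dom OG.AG (f, g, y, x))) (qo (Cod OG.AG (f, g, y, x)))"
    using projection_functor assms unfolding is_functor_def by blast
  moreover have "PArr D (qa (f, g, y, x)) = f"
    using projection_fibred[unfolded fibred_functor_def, THEN conjunct2, THEN conjunct2, rule_format, OF assms] by simp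
  ultimately show ?thesis by (simp add: HomOver_def)
qed

lemma q_ident:
  assumes "S \<in> Obj C" "s \<in> Hom C S (mcar A)"
  shows "qa (Ident C S, \<one>\<^bsub>Sec S\<^esub>, s, s) = Ident D (qo (S, s))"
proof -
  have "(S, s) \<in> Obj OG.AG" using assms by simp
  then have "qa (Ident OG.AG (S, s)) = Ident D (qo (S, s))"
    using projection_functor unfolding is_functor_def by blast
  then show ?thesis by simp
qed

lemma q_comp:
  assumes "(f, g, y, x) \<in> Arr OG.AG" "(h, k, z, y) \<in> Arr OG.AG" "Cod C h = Dom C f"
  shows "qa (f \<cdot>\<^bsub>C\<^esub> h, (g \<cdot>\<^bsub>C\<^esub> h) \<otimes>\<^bsub>Sec (Dom C h)\<^esub> k, z, x) = qa (f, g, y, x) \<cdot>\<^bsub>D\<^esub> qa (h, k, z, y)"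
proof -
  have "Dom OG.AG (f, g, y, x) = Cod OG.AG (h, k, z, y)" using assms(3) by simp
  then have "qa ((f, g, y, x) \<cdot>\<^bsub>OG.AG\<^esub> (h, k, z, y)) = qa (f, g, y, x) \<cdot>\<^bsub>D\<^esub> qa (h, k, z, y)"
    using projection_functor assms(1,2) unfolding is_functor_def by blast
  then show ?thesis by simp
qed

section \<open>The monoidal structure of the projection\<close>

lemma tensor_simps [simp]:
  "TObj (O_tensor C A) (S, s) (T, t) = (S, s \<otimes>\<^bsub>Sec S\<^esub> t)"
  "TArr (O_tensor C A) (f, g, y, x) (f', g', y', x') = (f, g \<otimes>\<^bsub>Sec (Dom C f)\<^esub> g',
         y \<otimes>\<^bsub>Sec (Dom C f)\<^esub> y', x \<otimes>\<^bsub>Sec (Cod C f)\<^esub> x')"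
  "Assoc (O_tensor C A) (S, s) (T, t) (W, w) = Ident OG.AG (S, s \<otimes>\<^bsub>Sec S\<^esub> t \<otimes>\<^bsub>Sec S\<^esub> w)"
  "LUnit (O_tensor C A) = Ident OG.AG" "RUnit (O_tensor C A) = Ident OG.AG"
  "Braid (O_tensor C A) (S, s) (T, t) = Ident OG.AG (S, s \<otimes>\<^bsub>Sec S\<^esub> t)"
  by (simp_all add: O_tensor_def Let_def OG_eq)

lemma Sec_m_closed:
  "S \<in> Obj C \<Longrightarrow> s \<in> Hom C S (mcar A) \<Longrightarrow> t \<in> Hom C S (mcar A) \<Longrightarrow> s \<otimes>\<^bsub>Sec S\<^esub> t \<in> Hom C S (mcar A)"
  "S \<in> Obj C \<Longrightarrow> \<one>\<^bsub>Sec S\<^esub> \<in> Hom C S (mcar A)"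
proof -
  show "s \<otimes>\<^bsub>Sec S\<^esub> t \<in> Hom C S (mcar A)"
    if "S \<in> Obj C" "s \<in> Hom C S (mcar A)" "t \<in> Hom C S (mcar A)"
  proof -
    interpret comm_monoid "Sec S" using Sec_comm that(1) .
    show ?thesis using m_closed[of s t] that by simp
  qed
  show "\<one>\<^bsub>Sec S\<^esub> \<in> Hom C S (mcar A)" if "S \<in> Obj C"
  proof -
    interpret comm_monoid "Sec S" using Sec_comm that .
    show ?thesis using one_closed by simp
  qed
qed

lemma fibre_functor:
  "S \<in> Obj C \<Longrightarrow> symmetric_monoidal_functor (fibre C OG.AG S) (O_tensor C A) (S, \<one>\<^bsub>Sec S\<^esub>)
    (fibre C D S) M (Io S) qo qa m (e S)"
  using monoidal_projection[unfolded symmetric_monoidal_fibred_functor_def, THEN conjunct2, THEN conjunct1]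
  unfolding O_unit_obj_def by blast

lemma fibre_obj: "S \<in> Obj C \<Longrightarrow> s \<in> Hom C S (mcar A) \<Longrightarrow> (S, s) \<in> Obj (fibre C OG.AG S)"
  by (simp add: fibre_def Over_iff)

lemma m_HomOver:
  assumes "S \<in> Obj C" "s \<in> Hom C S (mcar A)" "t \<in> Hom C S (mcar A)"
  shows "m (S, s) (S, t) \<in> HomOver D (Ident C S) (TObj M (qo (S, s)) (qo (S, t))) (qo (S, s \<otimes>\<^bsub>Sec S\<^esub> t))"
  using symmetric_monoidal_functorD(6)[OF fibre_functor[OF assms(1)] fibre_obj[OF assms(1,2)] fibre_obj[OF assms(1,3)]]
    D.iso_in_fibre[OF assms(1)] by simp

lemma e_HomOver: "S \<in> Obj C \<Longrightarrow> e S \<in> HomOver D (Ident C S) (Io S) (qo (S, \<one>\<^bsub>Sec S\<^esub>))"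
  using symmetric_monoidal_functorD(7)[OF fibre_functor] D.iso_in_fibre by simp

lemma m_simps [simp]:
  assumes "S \<in> Obj C" "s \<in> Hom C S (mcar A)" "t \<in> Hom C S (mcar A)"
  shows "m (S, s) (S, t) \<in> Arr D" "Dom D (m (S, s) (S, t)) = TObj M (qo (S, s)) (qo (S, t))"
    "Cod D (m (S, s) (S, t)) = qo (S, s \<otimes>\<^bsub>Sec S\<^esub> t)" "PArr D (m (S, s) (S, t)) = Ident C S"
  using m_HomOver[OF assms] by (simp_all add: HomOver_iff)

lemma e_simps [simp]:
  assumes "S \<in> Obj C"
  shows "e S \<in> Arr D" "Dom D (e S) = Io S" "Cod D (e S) = qo (S, \<one>\<^bsub>Sec S\<^esub>)" "PArr D (e S) = Ident C S"
  using e_HomOver[OF assms] by (simp_all add: HomOver_iff)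

text \<open>The constraints in the groupoid of sections are identities, and the projection preserves
  identities, so one factor drops out of each axiom of a symmetric monoidal functor.\<close>

lemma m_coherence:
  assumes S: "S \<in> Obj C" and s: "s \<in> Hom C S (mcar A)"
  shows "t \<in> Hom C S (mcar A) \<Longrightarrow> w \<in> Hom C S (mcar A) \<Longrightarrow>
      m (S, s \<otimes>\<^bsub>Sec S\<^esub> t) (S, w) \<cdot>\<^bsub>D\<^esub> TArr M (m (S, s) (S, t)) (Ident D (qo (S, w))) =
      m (S, s) (S, t \<otimes>\<^bsub>Sec S\<^esub> w) \<cdot>\<^bsub>D\<^esub> TArr M (Ident D (qo (S, s))) (m (S, t) (S, w))
        \<cdot>\<^bsub>D\<^esub> Assoc M (qo (S, s)) (qo (S, t)) (qo (S, w))" (is "_ \<Longrightarrow> _ \<Longrightarrow> ?assoc")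
    "m (S, \<one>\<^bsub>Sec S\<^esub>) (S, s) \<cdot>\<^bsub>D\<^esub> TArr M (e S) (Ident D (qo (S, s))) = LUnit M (qo (S, s))"
    "m (S, s) (S, \<one>\<^bsub>Sec S\<^esub>) \<cdot>\<^bsub>D\<^esub> TArr M (Ident D (qo (S, s))) (e S) = RUnit M (qo (S, s))"
    "t \<in> Hom C S (mcar A) \<Longrightarrow>
      m (S, s) (S, t) = m (S, t) (S, s) \<cdot>\<^bsub>D\<^esub> Braid M (qo (S, s)) (qo (S, t))"
proof -
  interpret N: comm_monoid "Sec S" by (rule Sec_comm[OF S])
  note F = symmetric_monoidal_functorD[OF fibre_functor[OF S]]
  note so = fibre_obj[OF S s]
  note cl [simp] = Sec_m_closed[OF S] S s
  note qi = q_ident[OF S]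
  { assume t: "t \<in> Hom C S (mcar A)" and w: "w \<in> Hom C S (mcar A)"
    have a: "s \<otimes>\<^bsub>Sec S\<^esub> t \<otimes>\<^bsub>Sec S\<^esub> w = s \<otimes>\<^bsub>Sec S\<^esub> (t \<otimes>\<^bsub>Sec S\<^esub> w)" using N.m_assoc s t w by simp
    show ?assoc using F(1)[OF so fibre_obj[OF S t] fibre_obj[OF S w]] t w
      by (simp add: fibre_def qi a) }
  show "m (S, \<one>\<^bsub>Sec S\<^esub>) (S, s) \<cdot>\<^bsub>D\<^esub> TArr M (e S) (Ident D (qo (S, s))) = LUnit M (qo (S, s))"
    "m (S, s) (S, \<one>\<^bsub>Sec S\<^esub>) \<cdot>\<^bsub>D\<^esub> TArr M (Ident D (qo (S, s))) (e S) = RUnit M (qo (S, s))"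
    using F(2)[OF so] F(3)[OF so] N.l_one[of s] N.r_one[of s] by (simp_all add: fibre_def qi)
  { assume t: "t \<in> Hom C S (mcar A)"
    show "m (S, s) (S, t) = m (S, t) (S, s) \<cdot>\<^bsub>D\<^esub> Braid M (qo (S, s)) (qo (S, t))"
      using F(4)[OF so fibre_obj[OF S t]] t by (simp add: fibre_def qi) }
qed

lemma m_natural:
  assumes "(f, g, y, x) \<in> Arr OG.AG" "(f, g', y', x') \<in> Arr OG.AG"
  shows "m (Cod C f, x) (Cod C f, x') \<cdot>\<^bsub>D\<^esub> TArr M (qa (f, g, y, x)) (qa (f, g', y', x')) =
    qa (f, g \<otimes>\<^bsub>Sec (Dom C f)\<^esub> g', y \<otimes>\<^bsub>Sec (Dom C f)\<^esub> y', x \<otimes>\<^bsub>Sec (Cod C f)\<^esub> x')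
      \<cdot>\<^bsub>D\<^esub> m (Dom C f, y) (Dom C f, y')"
proof -
  have "(f, g, y, x) \<in> HomOver OG.AG f (Dom C f, y) (Cod C f, x)"
    "(f, g', y', x') \<in> HomOver OG.AG f (Dom C f, y') (Cod C f, x')"
    using assms by (simp_all add: HomOver_iff)
  from monoidal_projection[unfolded symmetric_monoidal_fibred_functor_def, THEN conjunct2, THEN conjunct2,
    THEN conjunct1, rule_format, OF this] show ?thesis by simp
qed

lemma e_natural:
  assumes "f \<in> Arr C"
  shows "e (Cod C f) \<cdot>\<^bsub>D\<^esub> Ia f =
    qa (f, \<one>\<^bsub>Sec (Dom C f)\<^esub>, \<one>\<^bsub>Sec (Dom C f)\<^esub>, \<one>\<^bsub>Sec (Cod C f)\<^esub>) \<cdot>\<^bsub>D\<^esub> e (Dom C f)"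
  using monoidal_projection[unfolded symmetric_monoidal_fibred_functor_def, THEN conjunct2, THEN conjunct2,
    THEN conjunct2, rule_format, OF assms] by (simp add: O_unit_arr_def)

section \<open>Arrows between objects in the image of the projection\<close>

lemma covering_Hom: "S \<in> Obj C \<Longrightarrow> \<U> \<in> Cov S \<Longrightarrow> f \<in> \<U> \<Longrightarrow> f \<in> Hom C (Dom C f) S"
  using D.covering_arr by (simp add: Hom_def)

text \<open>The canonical lift of \<open>f\<close>, with group component one. It is the test arrow
  for comparisons over the members of a covering.\<close>

lemma restriction_arr:
  assumes f: "f \<in> Arr C" and s: "s \<in> Hom C (Cod C f) (mcar A)"
  shows "(f, \<one>\<^bsub>Sec (Dom C f)\<^esub>, s \<cdot>\<^bsub>C\<^esub> f, s) \<in> Arr OG.AG"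
proof -
  have T: "Dom C f \<in> Obj C" using f by simp
  interpret N: comm_monoid "Sec (Dom C f)" by (rule Sec_comm[OF T])
  have "s \<cdot>\<^bsub>C\<^esub> f \<in> Hom C (Dom C f) (mcar A)" using comp_Hom[OF s] f by (simp add: Hom_def)
  then show ?thesis using f s N.l_one[of "s \<cdot>\<^bsub>C\<^esub> f"] N.Units_one_closed by simp
qed

text \<open>By local injectivity the two units have equal restrictions on a covering. They are
  arrows to \<open>mcar A\<close>, so they agree because the topology is subcanonical.\<close>

lemma q_faithful_vertical:
  assumes S: "S \<in> Obj C" and ab: "(Ident C S, g, s, t) \<in> Arr OG.AG" "(Ident C S, g', s, t) \<in> Arr OG.AG"
    and eq: "qa (Ident C S, g, s, t) = qa (Ident C S, g', s, t)"
  shows "g = g'"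
proof -
  have st: "s \<in> Hom C S (mcar A)" "t \<in> Hom C S (mcar A)" "g \<in> Units (Sec S)" "g' \<in> Units (Sec S)"
    using ab S by simp_all
  note gH = Units_Hom[OF st(3)] Units_Hom[OF st(4)]
  have "(S, s) \<in> Over OG.AG S" "(S, t) \<in> Over OG.AG S" using S st by (simp_all add: Over_iff)
  moreover have "(Ident C S, g, s, t) \<in> HomOver OG.AG (Ident C S) (S, s) (S, t)"
    "(Ident C S, g', s, t) \<in> HomOver OG.AG (Ident C S) (S, s) (S, t)"
    using ab S by (simp_all add: HomOver_iff)
  ultimately have "\<exists>\<U> \<in> Cov S. \<forall>f \<in> \<U>. \<forall>z. \<forall>c \<in> HomOver OG.AG f z (S, s).
      (Ident C S, g, s, t) \<cdot>\<^bsub>OG.AG\<^esub> c = (Ident C S, g', s, t) \<cdot>\<^bsub>OG.AG\<^esub> c"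
    using stackification[unfolded stackification_def, THEN conjunct2, THEN conjunct2, THEN conjunct2,
      THEN conjunct1] S eq by metis
  then obtain \<U> where U: "\<U> \<in> Cov S" "\<And>f z c. f \<in> \<U> \<Longrightarrow> c \<in> HomOver OG.AG f z (S, s) \<Longrightarrow>
      (Ident C S, g, s, t) \<cdot>\<^bsub>OG.AG\<^esub> c = (Ident C S, g', s, t) \<cdot>\<^bsub>OG.AG\<^esub> c" by blast
  show ?thesis
  proof (rule section_eq_locally[OF S U(1) gH])
    fix f assume f: "f \<in> \<U>"
    have fH: "f \<in> Hom C (Dom C f) S" by (rule covering_Hom[OF S U(1) f])
    note fD = HomD[OF fH]
    interpret N: comm_monoid "Sec (Dom C f)" by (rule Sec_comm[OF fD(4)])
    have "(f, \<one>\<^bsub>Sec (Dom C f)\<^esub>, s \<cdot>\<^bsub>C\<^esub> f, s) \<in> HomOver OG.AG f (Dom C f, s \<cdot>\<^bsub>C\<^esub> f) (S, s)"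
      using restriction_arr[OF fD(1), of s] fD(3) st(1) unfolding HomOver_iff by simp
    from U(2)[OF f this] have "(g \<cdot>\<^bsub>C\<^esub> f) \<otimes>\<^bsub>Sec (Dom C f)\<^esub> \<one>\<^bsub>Sec (Dom C f)\<^esub> =
        (g' \<cdot>\<^bsub>C\<^esub> f) \<otimes>\<^bsub>Sec (Dom C f)\<^esub> \<one>\<^bsub>Sec (Dom C f)\<^esub>" by simp
    then show "g \<cdot>\<^bsub>C\<^esub> f = g' \<cdot>\<^bsub>C\<^esub> f"
      using N.r_one[of "g \<cdot>\<^bsub>C\<^esub> f"] N.r_one[of "g' \<cdot>\<^bsub>C\<^esub> f"] comp_Hom[OF gH(1) fH] comp_Hom[OF gH(2) fH] by simp
  qed
qed

text \<open>Splitting off the canonical lift reduces arrows over \<open>f\<close> to vertical ones,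
  for which stackification provides local injectivity.\<close>

lemma q_factor:
  assumes a: "(f, g, y, x) \<in> Arr OG.AG"
  shows "(Ident C (Dom C f), g, y, x \<cdot>\<^bsub>C\<^esub> f) \<in> Arr OG.AG"
    "qa (f, g, y, x) = qa (f, \<one>\<^bsub>Sec (Dom C f)\<^esub>, x \<cdot>\<^bsub>C\<^esub> f, x) \<cdot>\<^bsub>D\<^esub> qa (Ident C (Dom C f), g, y, x \<cdot>\<^bsub>C\<^esub> f)"
proof -
  have f: "f \<in> Arr C" "Dom C f \<in> Obj C" "x \<in> Hom C (Cod C f) (mcar A)" "g \<in> Units (Sec (Dom C f))"
    using a by simp_all
  interpret N: comm_monoid "Sec (Dom C f)" by (rule Sec_comm[OF f(2)])
  have xf: "x \<cdot>\<^bsub>C\<^esub> f \<in> Hom C (Dom C f) (mcar A)" using comp_Hom[OF f(3)] f(1) by (simp add: Hom_def)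
  show v: "(Ident C (Dom C f), g, y, x \<cdot>\<^bsub>C\<^esub> f) \<in> Arr OG.AG"
    using a xf HomD[OF xf] by simp
  have "\<one>\<^bsub>Sec (Dom C f)\<^esub> \<cdot>\<^bsub>C\<^esub> Ident C (Dom C f) \<otimes>\<^bsub>Sec (Dom C f)\<^esub> g = g"
    using Sec_res_one[OF ident[OF f(2)]] N.l_one[OF N.Units_closed[OF f(4)]] by simp
  then show "qa (f, g, y, x) = qa (f, \<one>\<^bsub>Sec (Dom C f)\<^esub>, x \<cdot>\<^bsub>C\<^esub> f, x) \<cdot>\<^bsub>D\<^esub> qa (Ident C (Dom C f), g, y, x \<cdot>\<^bsub>C\<^esub> f)"
    using q_comp[OF restriction_arr[OF f(1,3)] v] f(1,2) by simp
qed

lemma q_faithful: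
  assumes ab: "(f, g, y, x) \<in> Arr OG.AG" "(f, g', y, x) \<in> Arr OG.AG"
    and eq: "qa (f, g, y, x) = qa (f, g', y, x)"
  shows "g = g'"
proof -
  have f: "f \<in> Arr C" "Dom C f \<in> Obj C" "x \<in> Hom C (Cod C f) (mcar A)" using ab by simp_all
  note fa = q_factor[OF ab(1)] and fb = q_factor[OF ab(2)]
  show ?thesis
  proof (rule q_faithful_vertical[OF f(2) fa(1) fb(1)])
    have r: "qa (f, \<one>\<^bsub>Sec (Dom C f)\<^esub>, x \<cdot>\<^bsub>C\<^esub> f, x) \<in> HomOver D f (qo (Dom C f, x \<cdot>\<^bsub>C\<^esub> f)) (qo (Cod C f, x))"
      by (rule q_arr[OF restriction_arr[OF f(1,3)]])
    show "qa (Ident C (Dom C f), g, y, x \<cdot>\<^bsub>C\<^esub> f) = qa (Ident C (Dom C f), g', y, x \<cdot>\<^bsub>C\<^esub> f)"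
      by (rule D.cancel[of "qa (f, \<one>\<^bsub>Sec (Dom C f)\<^esub>, x \<cdot>\<^bsub>C\<^esub> f, x)"])
        (use r q_arr[OF fa(1)] q_arr[OF fb(1)] f eq fa(2) fb(2) in \<open>simp_all add: HomOver_iff\<close>)
  qed
qed

text \<open>Locally \<open>b\<close> is the image of units. Faithfulness forces these to agree on
  overlaps, so they glue to a section \<gamma>; that \<gamma> is a unit, carries \<open>s\<close> to
  \<open>t\<close> and induces \<open>b\<close> can all be verified with the help of the
  covering.\<close>

lemma q_full:
  assumes S: "S \<in> Obj C" and s: "s \<in> Hom C S (mcar A)" and t: "t \<in> Hom C S (mcar A)"
    and b: "b \<in> HomOver D (Ident C S) (qo (S, s)) (qo (S, t))"
  shows "\<exists>g. (Ident C S, g, s, t) \<in> Arr OG.AG \<and> qa (Ident C S, g, s, t) = b"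
proof -
  interpret N: comm_monoid "Sec S" by (rule Sec_comm[OF S])
  have "(S, s) \<in> Over OG.AG S" "(S, t) \<in> Over OG.AG S" using S s t by (simp_all add: Over_iff)
  then have "\<exists>\<U> \<in> Cov S. \<forall>f \<in> \<U>. \<forall>z. \<forall>c \<in> HomOver OG.AG f z (S, s).
      \<exists>a \<in> HomOver OG.AG f z (S, t). qa a = b \<cdot>\<^bsub>D\<^esub> qa c"
    using stackification[unfolded stackification_def, THEN conjunct2, THEN conjunct2, THEN conjunct2,
      THEN conjunct2, THEN conjunct1] S b by metis
  then obtain \<U> where U: "\<U> \<in> Cov S" "\<And>f z c. f \<in> \<U> \<Longrightarrow> c \<in> HomOver OG.AG f z (S, s) \<Longrightarrow>
      \<exists>a \<in> HomOver OG.AG f z (S, t). qa a = b \<cdot>\<^bsub>D\<^esub> qa c" by blast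
  have fH: "f \<in> Hom C (Dom C f) S" if "f \<in> \<U>" for f by (rule covering_Hom[OF S U(1) that])
  have r: "(f, \<one>\<^bsub>Sec (Dom C f)\<^esub>, s \<cdot>\<^bsub>C\<^esub> f, s) \<in> Arr OG.AG" if "f \<in> Hom C T S" for f T
    using restriction_arr[of f s] HomD[OF that] s by blast
  have "\<exists>g. (f, g, s \<cdot>\<^bsub>C\<^esub> f, t) \<in> Arr OG.AG \<and>
      qa (f, g, s \<cdot>\<^bsub>C\<^esub> f, t) = b \<cdot>\<^bsub>D\<^esub> qa (f, \<one>\<^bsub>Sec (Dom C f)\<^esub>, s \<cdot>\<^bsub>C\<^esub> f, s)" if f: "f \<in> \<U>" for f
  proof -
    have "(f, \<one>\<^bsub>Sec (Dom C f)\<^esub>, s \<cdot>\<^bsub>C\<^esub> f, s) \<in> HomOver OG.AG f (Dom C f, s \<cdot>\<^bsub>C\<^esub> f) (S, s)"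
      using r[OF fH[OF f]] HomD[OF fH[OF f]] unfolding HomOver_iff by simp
    from U(2)[OF f this] obtain a where a: "a \<in> HomOver OG.AG f (Dom C f, s \<cdot>\<^bsub>C\<^esub> f) (S, t)"
      "qa a = b \<cdot>\<^bsub>D\<^esub> qa (f, \<one>\<^bsub>Sec (Dom C f)\<^esub>, s \<cdot>\<^bsub>C\<^esub> f, s)" by blast
    obtain f' g y x where a': "a = (f', g, y, x)" by (cases a)
    have "f' = f" "y = s \<cdot>\<^bsub>C\<^esub> f" "x = t" "a \<in> Arr OG.AG" using a(1) unfolding a' HomOver_iff by auto
    then show ?thesis using a(2) unfolding a' by blast
  qed
  then obtain g where g: "\<And>f. f \<in> \<U> \<Longrightarrow> (f, g f, s \<cdot>\<^bsub>C\<^esub> f, t) \<in> Arr OG.AG"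
    "\<And>f. f \<in> \<U> \<Longrightarrow> qa (f, g f, s \<cdot>\<^bsub>C\<^esub> f, t) = b \<cdot>\<^bsub>D\<^esub> qa (f, \<one>\<^bsub>Sec (Dom C f)\<^esub>, s \<cdot>\<^bsub>C\<^esub> f, s)" by metis
  have gU: "g f \<in> Units (Sec (Dom C f))" "g f \<otimes>\<^bsub>Sec (Dom C f)\<^esub> (s \<cdot>\<^bsub>C\<^esub> f) = t \<cdot>\<^bsub>C\<^esub> f" if "f \<in> \<U>" for f
    using g(1)[OF that] by simp_all
  \<comment> \<open>Overlaps are not represented by chosen fibre products: they are arbitrary
    objects \<open>W\<close> with arrows to two members of the covering. So the local preimages are
    restricted along an arbitrary \<open>h\<close>, in a form that depends on \<open>b\<close> and
    the composite base arrow only.\<close>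
  have pull: "(f \<cdot>\<^bsub>C\<^esub> h, g f \<cdot>\<^bsub>C\<^esub> h, s \<cdot>\<^bsub>C\<^esub> (f \<cdot>\<^bsub>C\<^esub> h), t) \<in> Arr OG.AG"
    "qa (f \<cdot>\<^bsub>C\<^esub> h, g f \<cdot>\<^bsub>C\<^esub> h, s \<cdot>\<^bsub>C\<^esub> (f \<cdot>\<^bsub>C\<^esub> h), t) =
      b \<cdot>\<^bsub>D\<^esub> qa (f \<cdot>\<^bsub>C\<^esub> h, \<one>\<^bsub>Sec W\<^esub>, s \<cdot>\<^bsub>C\<^esub> (f \<cdot>\<^bsub>C\<^esub> h), s)"
    if f: "f \<in> \<U>" and h: "h \<in> Hom C W (Dom C f)" for f h W
  proof -
    note hD = HomD[OF h] and fD = HomD[OF fH[OF f]]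
    interpret W: comm_monoid "Sec W" by (rule Sec_comm[OF hD(4)])
    have sf: "s \<cdot>\<^bsub>C\<^esub> f \<cdot>\<^bsub>C\<^esub> h = s \<cdot>\<^bsub>C\<^esub> (f \<cdot>\<^bsub>C\<^esub> h)" by (rule comp_assoc'[OF s fH[OF f] h])
    have sfH: "s \<cdot>\<^bsub>C\<^esub> f \<in> Hom C (Cod C h) (mcar A)" using comp_Hom[OF s fH[OF f]] hD by simp
    have rh: "(h, \<one>\<^bsub>Sec W\<^esub>, s \<cdot>\<^bsub>C\<^esub> (f \<cdot>\<^bsub>C\<^esub> h), s \<cdot>\<^bsub>C\<^esub> f) \<in> Arr OG.AG"
      using restriction_arr[OF hD(1) sfH] unfolding sf hD(2) .
    have gh: "g f \<cdot>\<^bsub>C\<^esub> h \<in> Units (Sec W)" by (rule Sec_unit_res[OF h gU(1)[OF f]])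
    have one: "(g f \<cdot>\<^bsub>C\<^esub> h) \<otimes>\<^bsub>Sec W\<^esub> \<one>\<^bsub>Sec W\<^esub> = g f \<cdot>\<^bsub>C\<^esub> h"
      "(\<one>\<^bsub>Sec (Dom C f)\<^esub> \<cdot>\<^bsub>C\<^esub> h) \<otimes>\<^bsub>Sec W\<^esub> \<one>\<^bsub>Sec W\<^esub> = \<one>\<^bsub>Sec W\<^esub>"
      using W.r_one[OF W.Units_closed[OF gh]] W.r_one[OF W.one_closed] Sec_res_one[OF h] by simp_all
    have c1: "qa (f \<cdot>\<^bsub>C\<^esub> h, g f \<cdot>\<^bsub>C\<^esub> h, s \<cdot>\<^bsub>C\<^esub> (f \<cdot>\<^bsub>C\<^esub> h), t) =
        qa (f, g f, s \<cdot>\<^bsub>C\<^esub> f, t) \<cdot>\<^bsub>D\<^esub> qa (h, \<one>\<^bsub>Sec W\<^esub>, s \<cdot>\<^bsub>C\<^esub> (f \<cdot>\<^bsub>C\<^esub> h), s \<cdot>\<^bsub>C\<^esub> f)"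
      using q_comp[OF g(1)[OF f] rh hD(3)] unfolding hD(2) one .
    have c2: "qa (f \<cdot>\<^bsub>C\<^esub> h, \<one>\<^bsub>Sec W\<^esub>, s \<cdot>\<^bsub>C\<^esub> (f \<cdot>\<^bsub>C\<^esub> h), s) =
        qa (f, \<one>\<^bsub>Sec (Dom C f)\<^esub>, s \<cdot>\<^bsub>C\<^esub> f, s) \<cdot>\<^bsub>D\<^esub> qa (h, \<one>\<^bsub>Sec W\<^esub>, s \<cdot>\<^bsub>C\<^esub> (f \<cdot>\<^bsub>C\<^esub> h), s \<cdot>\<^bsub>C\<^esub> f)"
      using q_comp[OF r[OF fH[OF f]] rh hD(3)] unfolding hD(2) one .
    show "(f \<cdot>\<^bsub>C\<^esub> h, g f \<cdot>\<^bsub>C\<^esub> h, s \<cdot>\<^bsub>C\<^esub> (f \<cdot>\<^bsub>C\<^esub> h), t) \<in> Arr OG.AG"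
      using OG.AG_comp_arr[OF rh g(1)[OF f] hD(3)] by (simp add: hD(2) one)
    show "qa (f \<cdot>\<^bsub>C\<^esub> h, g f \<cdot>\<^bsub>C\<^esub> h, s \<cdot>\<^bsub>C\<^esub> (f \<cdot>\<^bsub>C\<^esub> h), t) =
      b \<cdot>\<^bsub>D\<^esub> qa (f \<cdot>\<^bsub>C\<^esub> h, \<one>\<^bsub>Sec W\<^esub>, s \<cdot>\<^bsub>C\<^esub> (f \<cdot>\<^bsub>C\<^esub> h), s)"
      unfolding c1 c2 g(2)[OF f]
      by (rule D.total.assoc) (use b q_arr[OF r[OF fH[OF f]]] q_arr[OF rh] fD hD in \<open>simp_all add: HomOver_iff\<close>)
  qed
  have g_comp: "g f \<cdot>\<^bsub>C\<^esub> h = g f' \<cdot>\<^bsub>C\<^esub> k"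
    if "f \<in> \<U>" "f' \<in> \<U>" "h \<in> Hom C W (Dom C f)" "k \<in> Hom C W (Dom C f')" "f \<cdot>\<^bsub>C\<^esub> h = f' \<cdot>\<^bsub>C\<^esub> k" for f f' W h k
    using pull[OF that(1,3)] pull[OF that(2,4)] that(5) q_faithful[of "f' \<cdot>\<^bsub>C\<^esub> k"] by metis
  have "\<exists>!\<gamma>. \<gamma> \<in> Hom C S (mcar A) \<and> (\<forall>f \<in> \<U>. \<gamma> \<cdot>\<^bsub>C\<^esub> f = g f)"
    by (rule glue_section[OF S U(1) A_Hom(5)]) (use Units_Hom gU(1) g_comp in blast)+
  then obtain \<gamma> where \<gamma>: "\<gamma> \<in> Hom C S (mcar A)" "\<And>f. f \<in> \<U> \<Longrightarrow> \<gamma> \<cdot>\<^bsub>C\<^esub> f = g f" by blast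
  have inv_res: "inv\<^bsub>Sec T\<^esub> a \<cdot>\<^bsub>C\<^esub> h = inv\<^bsub>Sec W\<^esub> (a \<cdot>\<^bsub>C\<^esub> h)"
    if a: "a \<in> Units (Sec T)" and h: "h \<in> Hom C W T" for a h T W
  proof -
    interpret T: comm_monoid "Sec T" using Sec_comm HomD[OF h] by blast
    interpret W: comm_monoid "Sec W" using Sec_comm HomD[OF h] by blast
    have ia: "inv\<^bsub>Sec T\<^esub> a \<in> Units (Sec T)" using T.Units_inv_Units[OF a] .
    note u = Sec_unit_res[OF h a] Sec_unit_res[OF h ia]
    have "(inv\<^bsub>Sec T\<^esub> a \<cdot>\<^bsub>C\<^esub> h) \<otimes>\<^bsub>Sec W\<^esub> (a \<cdot>\<^bsub>C\<^esub> h) = \<one>\<^bsub>Sec W\<^esub>"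
      using Sec_res_mult[OF h Units_Hom[OF ia] Units_Hom[OF a]] T.Units_l_inv[OF a] Sec_res_one[OF h] by simp
    then show ?thesis
      by (rule W.inv_unique[OF _ W.Units_r_inv[OF u(1)] W.Units_closed[OF u(1)] W.Units_closed[OF u(2)]
        W.Units_closed[OF W.Units_inv_Units[OF u(1)]]])
  qed
  \<comment> \<open>Subcanonicity glues arrows to \<open>mcar A\<close> and says nothing about
    invertibility. The inverses are therefore glued as well, and the product of the two glued
    sections is compared with one on the covering.\<close>
  have "\<exists>!\<delta>. \<delta> \<in> Hom C S (mcar A) \<and> (\<forall>f \<in> \<U>. \<delta> \<cdot>\<^bsub>C\<^esub> f = inv\<^bsub>Sec (Dom C f)\<^esub> (g f))"
  proof (rule glue_section[OF S U(1) A_Hom(5)])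
    fix f assume f: "f \<in> \<U>"
    interpret W: comm_monoid "Sec (Dom C f)" by (rule Sec_comm[OF HomD(4)[OF fH[OF f]]])
    show "inv\<^bsub>Sec (Dom C f)\<^esub> (g f) \<in> Hom C (Dom C f) (mcar A)"
      using Units_Hom[OF W.Units_inv_Units[OF gU(1)[OF f]]] .
  next
    fix f f' W h k assume *: "f \<in> \<U>" "f' \<in> \<U>" "h \<in> Hom C W (Dom C f)" "k \<in> Hom C W (Dom C f')" "f \<cdot>\<^bsub>C\<^esub> h = f' \<cdot>\<^bsub>C\<^esub> k"
    show "inv\<^bsub>Sec (Dom C f)\<^esub> (g f) \<cdot>\<^bsub>C\<^esub> h = inv\<^bsub>Sec (Dom C f')\<^esub> (g f') \<cdot>\<^bsub>C\<^esub> k"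
      using inv_res[OF gU(1)[OF *(1)] *(3)] inv_res[OF gU(1)[OF *(2)] *(4)] g_comp[OF *] by simp
  qed
  then obtain \<delta> where \<delta>: "\<delta> \<in> Hom C S (mcar A)" "\<And>f. f \<in> \<U> \<Longrightarrow> \<delta> \<cdot>\<^bsub>C\<^esub> f = inv\<^bsub>Sec (Dom C f)\<^esub> (g f)" by blast
  have "\<gamma> \<otimes>\<^bsub>Sec S\<^esub> \<delta> = \<one>\<^bsub>Sec S\<^esub>"
  proof (rule section_eq_locally[OF S U(1) Sec_m_closed(1)[OF S \<gamma>(1) \<delta>(1)] Sec_m_closed(2)[OF S]])
    fix f assume f: "f \<in> \<U>"
    interpret W: comm_monoid "Sec (Dom C f)" by (rule Sec_comm[OF HomD(4)[OF fH[OF f]]])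
    show "(\<gamma> \<otimes>\<^bsub>Sec S\<^esub> \<delta>) \<cdot>\<^bsub>C\<^esub> f = \<one>\<^bsub>Sec S\<^esub> \<cdot>\<^bsub>C\<^esub> f"
      using Sec_res_mult[OF fH[OF f] \<gamma>(1) \<delta>(1)] Sec_res_one[OF fH[OF f]] \<gamma>(2)[OF f] \<delta>(2)[OF f]
        W.Units_r_inv[OF gU(1)[OF f]] by simp
  qed
  then have \<gamma>U: "\<gamma> \<in> Units (Sec S)" using N.m_comm[of \<gamma> \<delta>] \<gamma>(1) \<delta>(1) unfolding Units_def by auto
  have "\<gamma> \<otimes>\<^bsub>Sec S\<^esub> s = t"
  proof (rule section_eq_locally[OF S U(1) Sec_m_closed(1)[OF S \<gamma>(1) s] t])
    fix f assume f: "f \<in> \<U>"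
    show "(\<gamma> \<otimes>\<^bsub>Sec S\<^esub> s) \<cdot>\<^bsub>C\<^esub> f = t \<cdot>\<^bsub>C\<^esub> f"
      using Sec_res_mult[OF fH[OF f] \<gamma>(1) s] \<gamma>(2)[OF f] gU(2)[OF f] by simp
  qed
  then have arr: "(Ident C S, \<gamma>, s, t) \<in> Arr OG.AG" using S s t \<gamma>U HomD[OF t] by simp
  have "qa (Ident C S, \<gamma>, s, t) = b"
  proof (rule D.eq_locally[OF S U(1) _ b])
    show "qa (Ident C S, \<gamma>, s, t) \<in> HomOver D (Ident C S) (qo (S, s)) (qo (S, t))"
      using q_arr[OF arr] S by simp
    fix f assume f: "f \<in> \<U>"
    note fD = HomD[OF fH[OF f]]
    interpret W: comm_monoid "Sec (Dom C f)" by (rule Sec_comm[OF fD(4)])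
    have "\<gamma> \<cdot>\<^bsub>C\<^esub> f \<otimes>\<^bsub>Sec (Dom C f)\<^esub> \<one>\<^bsub>Sec (Dom C f)\<^esub> = g f"
      using \<gamma>(2)[OF f] W.r_one[OF W.Units_closed[OF gU(1)[OF f]]] by simp
    then have "qa (Ident C S, \<gamma>, s, t) \<cdot>\<^bsub>D\<^esub> qa (f, \<one>\<^bsub>Sec (Dom C f)\<^esub>, s \<cdot>\<^bsub>C\<^esub> f, s) =
        b \<cdot>\<^bsub>D\<^esub> qa (f, \<one>\<^bsub>Sec (Dom C f)\<^esub>, s \<cdot>\<^bsub>C\<^esub> f, s)"
      using q_comp[OF arr r[OF fH[OF f]]] S fD g(2)[OF f] by simp
    moreover have "qa (f, \<one>\<^bsub>Sec (Dom C f)\<^esub>, s \<cdot>\<^bsub>C\<^esub> f, s) \<in> HomOver D f (qo (Dom C f, s \<cdot>\<^bsub>C\<^esub> f)) (qo (S, s))"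
      using q_arr[OF r[OF fH[OF f]]] fD by simp
    ultimately show "\<exists>z. \<exists>c \<in> HomOver D f z (qo (S, s)). qa (Ident C S, \<gamma>, s, t) \<cdot>\<^bsub>D\<^esub> c = b \<cdot>\<^bsub>D\<^esub> c"
      by blast
  qed
  with arr show ?thesis by blast
qed

end

section \<open>Trivialisations of a symmetric monoidal functor\<close>

locale div_functors = div_stack C Cov A D M Io Ia qo qa m e
  for C :: "('o, 'a) cat" and Cov and A :: "('o, 'a) monoid_data"
    and D :: "('o, 'a, 'x, 'e) fibcat" and M Io Ia qo qa m e +
  fixes P :: "'p monoid"
  assumes P_comm: "comm_monoid P"
begin

sublocale F: sm_functor_stack C D M Io Ia P Cov
  by (intro sm_functor_stack.intro sm_functors.intro P_comm D.sm_fibred_axioms D.fibred_stack_axioms)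

text \<open>The natural map in terms of the homomorphism itself instead of the section of
  \<open>AP\<close> that represents it, so that functors can be trivialised before a representing
  object is brought in.\<close>

definition triv :: "'o \<Rightarrow> ('p \<Rightarrow> 'a) \<Rightarrow> ('o, 'p, 'x, 'e) smfun" where
  "triv S \<phi> = (S, \<lambda>p \<in> carrier P. qo (S, \<phi> p),
    \<lambda>p \<in> carrier P. \<lambda>q \<in> carrier P. m (S, \<phi> p) (S, \<phi> q), e S)"

lemma homD:
  assumes "\<phi> \<in> monoid_hom P (Sec S)"
  shows "p \<in> carrier P \<Longrightarrow> \<phi> p \<in> Hom C S (mcar A)"
    "p \<in> carrier P \<Longrightarrow> q \<in> carrier P \<Longrightarrow> \<phi> (p \<otimes>\<^bsub>P\<^esub> q) = \<phi> p \<otimes>\<^bsub>Sec S\<^esub> \<phi> q"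
    "\<phi> \<one>\<^bsub>P\<^esub> = \<one>\<^bsub>Sec S\<^esub>"
  using assms unfolding monoid_hom_def hom_def by (auto simp: Pi_iff)

lemma triv_in_smfun:
  assumes S: "S \<in> Obj C" and \<phi>: "\<phi> \<in> monoid_hom P (Sec S)"
  shows "triv S \<phi> \<in> smfun_objects C P D M Io"
proof -
  note h = homD[OF \<phi>]
  have "F.sm_data (triv S \<phi>)"
    unfolding F.sm_data_def triv_def using S h m_HomOver[OF S] e_HomOver[OF S]
    by (simp add: Over_iff)
  moreover have "F.coherent (triv S \<phi>)"
    unfolding F.coherent_def
  proof (intro conjI ballI)
    fix p q assume "p \<in> carrier P" "q \<in> carrier P"
    then show "F.mu (triv S \<phi>) p q =
        F.mu (triv S \<phi>) q p \<cdot>\<^bsub>D\<^esub> Braid M (F.fam (triv S \<phi>) p) (F.fam (triv S \<phi>) q)"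
      unfolding triv_def fst_conv snd_conv restrict_def if_P
      using m_coherence(4)[OF S h(1)[of p] h(1)[of q]] by simp
  qed (use h m_coherence(1-3)[OF S] F.one_closed in \<open>simp_all add: triv_def\<close>)
  moreover have "F.ext_data (triv S \<phi>)" unfolding F.ext_data_def triv_def by simp
  ultimately show ?thesis by (simp add: F.smfun_objects_iff)
qed

lemma triv_arrow:
  assumes f: "f \<in> Hom C T S" and \<phi>: "\<phi> \<in> monoid_hom P (Sec T)" and \<psi>: "\<psi> \<in> monoid_hom P (Sec S)"
    and \<gamma>: "\<gamma> \<in> monoid_hom P (Sec T)" and arr: "\<And>p. p \<in> carrier P \<Longrightarrow> (f, \<gamma> p, \<phi> p, \<psi> p) \<in> Arr OG.AG"
  shows "F.sm_arrow f (triv T \<phi>) (triv S \<psi>) (\<lambda>p \<in> carrier P. qa (f, \<gamma> p, \<phi> p, \<psi> p))"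
proof -
  note fD [simp] = HomD[OF f]
  note h = homD[OF \<phi>] homD[OF \<psi>] homD[OF \<gamma>]
  show ?thesis unfolding F.sm_arrow_def triv_def
    using q_arr[OF arr] m_natural[OF arr arr] e_natural[of f] h
    by simp
qed

end

locale trivialisations = div_functors C Cov A D M Io Ia qo qa m e P
  for C :: "('o, 'a) cat" and Cov and A :: "('o, 'a) monoid_data"
    and D :: "('o, 'a, 'x, 'e) fibcat" and M Io Ia qo qa m e and P :: "'p monoid" +
  fixes x :: "('o, 'p, 'x, 'e) smfun"
  assumes data: "F.sm_data x" and coh: "F.coherent x"
begin

abbreviation "T \<equiv> fst x"
abbreviation "L \<equiv> F.fam x"
abbreviation "\<mu> \<equiv> F.mu x"
abbreviation "\<epsilon> \<equiv> F.eps x"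

definition triple :: "'p \<Rightarrow> 'a \<Rightarrow> 'e \<Rightarrow> bool" where
  "triple p s \<alpha> \<longleftrightarrow> p \<in> carrier P \<and> s \<in> Hom C T (mcar A) \<and> \<alpha> \<in> HomOver D (Ident C T) (L p) (qo (T, s))"

text \<open>This is the tensor product of \<alpha> and \<beta>, transported along the structure
  isomorphisms \<open>m\<close> of the projection and \<mu> of the functor. Characterising it by an
  equation instead of by an inverse of \<mu> turns all later identities into cancellations.\<close>

definition third :: "'p \<Rightarrow> 'a \<Rightarrow> 'e \<Rightarrow> 'p \<Rightarrow> 'a \<Rightarrow> 'e \<Rightarrow> 'e" where
  "third p s \<alpha> q t \<beta> = (THE \<gamma>. \<gamma> \<in> HomOver D (Ident C T) (L (p \<otimes>\<^bsub>P\<^esub> q)) (qo (T, s \<otimes>\<^bsub>Sec T\<^esub> t)) \<and>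
    \<gamma> \<cdot>\<^bsub>D\<^esub> \<mu> p q = m (T, s) (T, t) \<cdot>\<^bsub>D\<^esub> TArr M \<alpha> \<beta>)"

definition unit_third :: 'e where
  "unit_third = (THE \<gamma>. \<gamma> \<in> HomOver D (Ident C T) (L \<one>\<^bsub>P\<^esub>) (qo (T, \<one>\<^bsub>Sec T\<^esub>)) \<and> \<gamma> \<cdot>\<^bsub>D\<^esub> \<epsilon> = e T)"

text \<open>The pairs of a section \<open>s\<close> and an isomorphism \<open>L p \<cong> q(s)\<close>, for all \<open>p\<close>. A section of the
  projection to \<open>P\<close> that is a homomorphism is the same as an isomorphism of \<open>L\<close> with a functor in the
  image of the natural map.\<close>

definition torsor :: "('p \<times> 'a \<times> 'e) monoid" where
  "torsor = \<lparr>carrier = {(p, s, \<alpha>). triple p s \<alpha>},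
    monoid.mult = (\<lambda>(p, s, \<alpha>) (q, t, \<beta>). (p \<otimes>\<^bsub>P\<^esub> q, s \<otimes>\<^bsub>Sec T\<^esub> t, third p s \<alpha> q t \<beta>)),
    one = (\<one>\<^bsub>P\<^esub>, \<one>\<^bsub>Sec T\<^esub>, unit_third)\<rparr>"

lemma torsor_simps [simp]:
  "(p, s, \<alpha>) \<in> carrier torsor \<longleftrightarrow> triple p s \<alpha>"
  "(p, s, \<alpha>) \<otimes>\<^bsub>torsor\<^esub> (q, t, \<beta>) = (p \<otimes>\<^bsub>P\<^esub> q, s \<otimes>\<^bsub>Sec T\<^esub> t, third p s \<alpha> q t \<beta>)"
  "\<one>\<^bsub>torsor\<^esub> = (\<one>\<^bsub>P\<^esub>, \<one>\<^bsub>Sec T\<^esub>, unit_third)"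
  by (simp_all add: torsor_def)

lemmas x_simps = F.sm_dataD[OF data]

lemma T: "T \<in> Obj C" by (rule x_simps(1))

lemma tripleD:
  assumes "triple p s \<alpha>"
  shows "p \<in> carrier P" "s \<in> Hom C T (mcar A)" "\<alpha> \<in> Arr D" "Dom D \<alpha> = L p" "Cod D \<alpha> = qo (T, s)"
    "PArr D \<alpha> = Ident C T"
  using assms by (simp_all add: triple_def HomOver_iff)

lemmas Sec_closed = Sec_m_closed[OF T]

lemma mu_HomOver: "p \<in> carrier P \<Longrightarrow> q \<in> carrier P \<Longrightarrow>
    \<mu> p q \<in> HomOver D (Ident C T) (TObj M (L p) (L q)) (L (p \<otimes>\<^bsub>P\<^esub> q))"
  using data unfolding F.sm_data_def by blast

lemma third:
  assumes "triple p s \<alpha>" "triple q t \<beta>"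
  shows "triple (p \<otimes>\<^bsub>P\<^esub> q) (s \<otimes>\<^bsub>Sec T\<^esub> t) (third p s \<alpha> q t \<beta>)"
    "third p s \<alpha> q t \<beta> \<cdot>\<^bsub>D\<^esub> \<mu> p q = m (T, s) (T, t) \<cdot>\<^bsub>D\<^esub> TArr M \<alpha> \<beta>"
proof -
  note [simp] = tripleD[OF assms(1)] tripleD[OF assms(2)] x_simps Sec_closed
  have "m (T, s) (T, t) \<cdot>\<^bsub>D\<^esub> TArr M \<alpha> \<beta> \<in> HomOver D (Ident C T) (TObj M (L p) (L q)) (qo (T, s \<otimes>\<^bsub>Sec T\<^esub> t))"
    by (simp add: HomOver_iff)
  from theI'[OF D.factor_vertical[OF mu_HomOver[OF tripleD(1)[OF assms(1)] tripleD(1)[OF assms(2)]] T this]]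
  show "triple (p \<otimes>\<^bsub>P\<^esub> q) (s \<otimes>\<^bsub>Sec T\<^esub> t) (third p s \<alpha> q t \<beta>)"
    "third p s \<alpha> q t \<beta> \<cdot>\<^bsub>D\<^esub> \<mu> p q = m (T, s) (T, t) \<cdot>\<^bsub>D\<^esub> TArr M \<alpha> \<beta>"
    unfolding third_def triple_def by simp_all
qed

lemma third_unique:
  assumes "triple p s \<alpha>" "triple q t \<beta>" "triple (p \<otimes>\<^bsub>P\<^esub> q) (s \<otimes>\<^bsub>Sec T\<^esub> t) \<gamma>"
    "\<gamma> \<cdot>\<^bsub>D\<^esub> \<mu> p q = m (T, s) (T, t) \<cdot>\<^bsub>D\<^esub> TArr M \<alpha> \<beta>"
  shows "third p s \<alpha> q t \<beta> = \<gamma>"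
  by (rule D.cancel_right[OF mu_HomOver[OF tripleD(1)[OF assms(1)] tripleD(1)[OF assms(2)]] T,
      where f = "Ident C T" and f' = "Ident C T" and y = "qo (T, s \<otimes>\<^bsub>Sec T\<^esub> t)"])
    (use third[OF assms(1,2)] assms(3,4) in \<open>simp_all add: triple_def\<close>)

lemma eps_HomOver: "\<epsilon> \<in> HomOver D (Ident C T) (Io T) (L \<one>\<^bsub>P\<^esub>)"
  using data unfolding F.sm_data_def by blast

lemma unit_third:
  "triple \<one>\<^bsub>P\<^esub> \<one>\<^bsub>Sec T\<^esub> unit_third" "unit_third \<cdot>\<^bsub>D\<^esub> \<epsilon> = e T"
  using theI'[OF D.factor_vertical[OF eps_HomOver T e_HomOver[OF T]]] Sec_closed
  unfolding unit_third_def triple_def by simp_all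

text \<open>The coherence of \<open>m\<close> on one side matches the coherence of \<mu> on the
  other, and naturality of the associator links them. The two candidates agree after composition
  with an isomorphism built from \<mu>.\<close>

lemma third_assoc:
  assumes a: "triple p s \<alpha>" and b: "triple q t \<beta>" and c: "triple r w \<gamma>"
  shows "third (p \<otimes>\<^bsub>P\<^esub> q) (s \<otimes>\<^bsub>Sec T\<^esub> t) (third p s \<alpha> q t \<beta>) r w \<gamma> =
    third p s \<alpha> (q \<otimes>\<^bsub>P\<^esub> r) (t \<otimes>\<^bsub>Sec T\<^esub> w) (third q t \<beta> r w \<gamma>)"
proof -
  interpret N: comm_monoid "Sec T" by (rule Sec_comm[OF T])
  define Y1 where "Y1 = third p s \<alpha> q t \<beta>"
  define Y2 where "Y2 = third q t \<beta> r w \<gamma>"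
  define X1 where "X1 = third (p \<otimes>\<^bsub>P\<^esub> q) (s \<otimes>\<^bsub>Sec T\<^esub> t) Y1 r w \<gamma>"
  define X2 where "X2 = third p s \<alpha> (q \<otimes>\<^bsub>P\<^esub> r) (t \<otimes>\<^bsub>Sec T\<^esub> w) Y2"
  note Y1 = third[OF a b, folded Y1_def] and Y2 = third[OF b c, folded Y2_def]
  note X1 = third[OF Y1(1) c, folded X1_def] and X2 = third[OF a Y2(1), folded X2_def]
  note pqr [simp] = tripleD(1)[OF a] tripleD(1)[OF b] tripleD(1)[OF c]
  note stw [simp] = tripleD(2)[OF a] tripleD(2)[OF b] tripleD(2)[OF c]
  have as: "p \<otimes>\<^bsub>P\<^esub> q \<otimes>\<^bsub>P\<^esub> r = p \<otimes>\<^bsub>P\<^esub> (q \<otimes>\<^bsub>P\<^esub> r)" "s \<otimes>\<^bsub>Sec T\<^esub> t \<otimes>\<^bsub>Sec T\<^esub> w = s \<otimes>\<^bsub>Sec T\<^esub> (t \<otimes>\<^bsub>Sec T\<^esub> w)"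
    using F.m_assoc N.m_assoc[of s t w] by simp_all
  note [simp] = tripleD[OF a] tripleD[OF b] tripleD[OF c] tripleD[OF Y1(1)] tripleD[OF Y2(1)]
    tripleD[OF X1(1), unfolded as] tripleD[OF X2(1)] x_simps Sec_closed as
  \<comment> \<open>The isomorphism from the threefold tensor product to the value of
    \<open>L\<close> at the product, bracketed to the left. Coherence of the functor replaces it by
    the other bracketing at the end of the computation.\<close>
  let ?K = "\<mu> (p \<otimes>\<^bsub>P\<^esub> q) r \<cdot>\<^bsub>D\<^esub> TArr M (\<mu> p q) (Ident D (L r))"
  have "X1 \<cdot>\<^bsub>D\<^esub> ?K = X1 \<cdot>\<^bsub>D\<^esub> \<mu> (p \<otimes>\<^bsub>P\<^esub> q) r \<cdot>\<^bsub>D\<^esub> TArr M (\<mu> p q) (Ident D (L r))"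
    by (simp add: D.total.assoc)
  also have "\<dots> = m (T, s \<otimes>\<^bsub>Sec T\<^esub> t) (T, w) \<cdot>\<^bsub>D\<^esub> TArr M (Y1 \<cdot>\<^bsub>D\<^esub> \<mu> p q) \<gamma>"
    unfolding X1(2) by (simp add: D.total.assoc D.interchange)
  also have "\<dots> = m (T, s \<otimes>\<^bsub>Sec T\<^esub> t) (T, w) \<cdot>\<^bsub>D\<^esub> TArr M (m (T, s) (T, t)) (Ident D (qo (T, w)))
      \<cdot>\<^bsub>D\<^esub> TArr M (TArr M \<alpha> \<beta>) \<gamma>"
    unfolding Y1(2) by (simp add: D.total.assoc D.interchange)
  also have "\<dots> = m (T, s) (T, t \<otimes>\<^bsub>Sec T\<^esub> w) \<cdot>\<^bsub>D\<^esub> TArr M (Ident D (qo (T, s))) (m (T, t) (T, w))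
      \<cdot>\<^bsub>D\<^esub> Assoc M (qo (T, s)) (qo (T, t)) (qo (T, w)) \<cdot>\<^bsub>D\<^esub> TArr M (TArr M \<alpha> \<beta>) \<gamma>"
    unfolding m_coherence(1)[OF T stw] ..
  also have "\<dots> = m (T, s) (T, t \<otimes>\<^bsub>Sec T\<^esub> w) \<cdot>\<^bsub>D\<^esub> (TArr M (Ident D (qo (T, s))) (m (T, t) (T, w))
      \<cdot>\<^bsub>D\<^esub> (TArr M \<alpha> (TArr M \<beta> \<gamma>) \<cdot>\<^bsub>D\<^esub> Assoc M (L p) (L q) (L r)))"
    using D.Assoc_natural[of \<alpha> "Ident C T" "L p" "qo (T, s)" \<beta> "L q" "qo (T, t)" \<gamma> "L r" "qo (T, w)"]
    by (simp add: D.total.assoc HomOver_iff)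
  also have "\<dots> = m (T, s) (T, t \<otimes>\<^bsub>Sec T\<^esub> w) \<cdot>\<^bsub>D\<^esub> (TArr M (Ident D (qo (T, s))) (m (T, t) (T, w))
      \<cdot>\<^bsub>D\<^esub> TArr M \<alpha> (TArr M \<beta> \<gamma>) \<cdot>\<^bsub>D\<^esub> Assoc M (L p) (L q) (L r))"
    by (simp add: D.total.assoc)
  also have "TArr M (Ident D (qo (T, s))) (m (T, t) (T, w)) \<cdot>\<^bsub>D\<^esub> TArr M \<alpha> (TArr M \<beta> \<gamma>) =
      TArr M \<alpha> (Y2 \<cdot>\<^bsub>D\<^esub> \<mu> q r)"
    unfolding Y2(2) by (simp add: D.interchange)
  also have "\<dots> = TArr M \<alpha> Y2 \<cdot>\<^bsub>D\<^esub> TArr M (Ident D (L p)) (\<mu> q r)"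
    by (simp add: D.interchange)
  also have "m (T, s) (T, t \<otimes>\<^bsub>Sec T\<^esub> w) \<cdot>\<^bsub>D\<^esub>
      (TArr M \<alpha> Y2 \<cdot>\<^bsub>D\<^esub> TArr M (Ident D (L p)) (\<mu> q r) \<cdot>\<^bsub>D\<^esub> Assoc M (L p) (L q) (L r)) =
      m (T, s) (T, t \<otimes>\<^bsub>Sec T\<^esub> w) \<cdot>\<^bsub>D\<^esub> TArr M \<alpha> Y2 \<cdot>\<^bsub>D\<^esub> (TArr M (Ident D (L p)) (\<mu> q r) \<cdot>\<^bsub>D\<^esub> Assoc M (L p) (L q) (L r))"
    by (simp add: D.total.assoc)
  also have "\<dots> = X2 \<cdot>\<^bsub>D\<^esub> (\<mu> p (q \<otimes>\<^bsub>P\<^esub> r) \<cdot>\<^bsub>D\<^esub> TArr M (Ident D (L p)) (\<mu> q r) \<cdot>\<^bsub>D\<^esub> Assoc M (L p) (L q) (L r))"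
    unfolding X2(2)[symmetric] by (simp add: D.total.assoc)
  also have "\<dots> = X2 \<cdot>\<^bsub>D\<^esub> ?K" unfolding F.coherentD(1)[OF coh pqr] ..
  finally have eq: "X1 \<cdot>\<^bsub>D\<^esub> ?K = X2 \<cdot>\<^bsub>D\<^esub> ?K" .
  have K: "?K \<in> HomOver D (Ident C T) (TObj M (TObj M (L p) (L q)) (L r)) (L (p \<otimes>\<^bsub>P\<^esub> (q \<otimes>\<^bsub>P\<^esub> r)))"
    by (simp add: HomOver_iff)
  have "X1 = X2"
    by (rule D.cancel_right[OF K T _ _ eq, where f = "Ident C T" and f' = "Ident C T"
      and y = "qo (T, s \<otimes>\<^bsub>Sec T\<^esub> (t \<otimes>\<^bsub>Sec T\<^esub> w))"])
      (simp_all add: HomOver_iff)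
  then show ?thesis unfolding X1_def X2_def Y1_def Y2_def .
qed

text \<open>The symmetry of \<open>m\<close> and that of \<mu> are exchanged by naturality of the
  braiding. Hence the other product satisfies the defining equation of this one.\<close>

lemma third_comm:
  assumes a: "triple p s \<alpha>" and b: "triple q t \<beta>"
  shows "third p s \<alpha> q t \<beta> = third q t \<beta> p s \<alpha>"
proof (rule third_unique[OF a b])
  interpret N: comm_monoid "Sec T" by (rule Sec_comm[OF T])
  note pq [simp] = tripleD(1)[OF a] tripleD(1)[OF b] and st [simp] = tripleD(2)[OF a] tripleD(2)[OF b]
  have c: "p \<otimes>\<^bsub>P\<^esub> q = q \<otimes>\<^bsub>P\<^esub> p" "s \<otimes>\<^bsub>Sec T\<^esub> t = t \<otimes>\<^bsub>Sec T\<^esub> s"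
    using F.m_comm[OF pq] N.m_comm[of s t] by simp_all
  show "triple (p \<otimes>\<^bsub>P\<^esub> q) (s \<otimes>\<^bsub>Sec T\<^esub> t) (third q t \<beta> p s \<alpha>)" unfolding c by (rule third(1)[OF b a])
  note [simp] = tripleD[OF a] tripleD[OF b] tripleD[OF third(1)[OF b a]] x_simps Sec_closed
  have "third q t \<beta> p s \<alpha> \<cdot>\<^bsub>D\<^esub> \<mu> p q = third q t \<beta> p s \<alpha> \<cdot>\<^bsub>D\<^esub> (\<mu> q p \<cdot>\<^bsub>D\<^esub> Braid M (L p) (L q))"
    using F.coherentD(4)[OF coh pq] by metis
  also have "\<dots> = third q t \<beta> p s \<alpha> \<cdot>\<^bsub>D\<^esub> \<mu> q p \<cdot>\<^bsub>D\<^esub> Braid M (L p) (L q)" by (simp add: D.total.assoc)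
  also have "\<dots> = m (T, t) (T, s) \<cdot>\<^bsub>D\<^esub> (TArr M \<beta> \<alpha> \<cdot>\<^bsub>D\<^esub> Braid M (L p) (L q))"
    unfolding third(2)[OF b a] by (simp add: D.total.assoc)
  also have "TArr M \<beta> \<alpha> \<cdot>\<^bsub>D\<^esub> Braid M (L p) (L q) = Braid M (qo (T, s)) (qo (T, t)) \<cdot>\<^bsub>D\<^esub> TArr M \<alpha> \<beta>"
    using D.Braid_natural[of \<alpha> "Ident C T" "L p" "qo (T, s)" \<beta> "L q" "qo (T, t)"]
    by (simp add: HomOver_iff)
  also have "m (T, t) (T, s) \<cdot>\<^bsub>D\<^esub> (Braid M (qo (T, s)) (qo (T, t)) \<cdot>\<^bsub>D\<^esub> TArr M \<alpha> \<beta>) =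
      m (T, t) (T, s) \<cdot>\<^bsub>D\<^esub> Braid M (qo (T, s)) (qo (T, t)) \<cdot>\<^bsub>D\<^esub> TArr M \<alpha> \<beta>"
    by (simp add: D.total.assoc)
  also have "\<dots> = m (T, s) (T, t) \<cdot>\<^bsub>D\<^esub> TArr M \<alpha> \<beta>"
    unfolding m_coherence(4)[OF T st, symmetric] ..
  finally show "third q t \<beta> p s \<alpha> \<cdot>\<^bsub>D\<^esub> \<mu> p q = m (T, s) (T, t) \<cdot>\<^bsub>D\<^esub> TArr M \<alpha> \<beta>" .
qed

text \<open>The defining equation is verified after composing with \<epsilon> tensored with an
  identity, which is an isomorphism; there the unit axioms of the functor and of the projection
  apply.\<close>

lemma third_unit:
  assumes a: "triple p s \<alpha>"
  shows "third \<one>\<^bsub>P\<^esub> \<one>\<^bsub>Sec T\<^esub> unit_third p s \<alpha> = \<alpha>"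
proof (rule third_unique[OF unit_third(1) a])
  interpret N: comm_monoid "Sec T" by (rule Sec_comm[OF T])
  note p [simp] = tripleD(1)[OF a] and s [simp] = tripleD(2)[OF a]
  note [simp] = tripleD[OF a] tripleD[OF unit_third(1)] x_simps Sec_closed
  have u: "\<one>\<^bsub>P\<^esub> \<otimes>\<^bsub>P\<^esub> p = p" "\<one>\<^bsub>Sec T\<^esub> \<otimes>\<^bsub>Sec T\<^esub> s = s" using N.l_one[of s] by simp_all
  show "triple (\<one>\<^bsub>P\<^esub> \<otimes>\<^bsub>P\<^esub> p) (\<one>\<^bsub>Sec T\<^esub> \<otimes>\<^bsub>Sec T\<^esub> s) \<alpha>" unfolding u by (rule a)
  let ?K = "TArr M \<epsilon> (Ident D (L p))"
  have "m (T, \<one>\<^bsub>Sec T\<^esub>) (T, s) \<cdot>\<^bsub>D\<^esub> TArr M unit_third \<alpha> \<cdot>\<^bsub>D\<^esub> ?K =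
      m (T, \<one>\<^bsub>Sec T\<^esub>) (T, s) \<cdot>\<^bsub>D\<^esub> TArr M (unit_third \<cdot>\<^bsub>D\<^esub> \<epsilon>) \<alpha>"
    by (simp add: D.total.assoc D.interchange)
  also have "\<dots> = m (T, \<one>\<^bsub>Sec T\<^esub>) (T, s) \<cdot>\<^bsub>D\<^esub> (TArr M (e T) (Ident D (qo (T, s))) \<cdot>\<^bsub>D\<^esub> TArr M (Ia (Ident C T)) \<alpha>)"
    unfolding unit_third(2) by (simp add: D.interchange D.Ia_ident)
  also have "\<dots> = LUnit M (qo (T, s)) \<cdot>\<^bsub>D\<^esub> TArr M (Ia (Ident C T)) \<alpha>"
    unfolding m_coherence(2)[OF T s, symmetric] by (simp add: D.total.assoc D.Ia_ident)
  also have "\<dots> = \<alpha> \<cdot>\<^bsub>D\<^esub> LUnit M (L p)"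
    by (rule D.Unit_natural(1)) (simp add: HomOver_iff)
  also have "\<dots> = \<alpha> \<cdot>\<^bsub>D\<^esub> \<mu> \<one>\<^bsub>P\<^esub> p \<cdot>\<^bsub>D\<^esub> ?K"
    unfolding F.coherentD(2)[OF coh p, symmetric] by (simp add: D.total.assoc)
  finally have eq: "\<alpha> \<cdot>\<^bsub>D\<^esub> \<mu> \<one>\<^bsub>P\<^esub> p \<cdot>\<^bsub>D\<^esub> ?K = m (T, \<one>\<^bsub>Sec T\<^esub>) (T, s) \<cdot>\<^bsub>D\<^esub> TArr M unit_third \<alpha> \<cdot>\<^bsub>D\<^esub> ?K" ..
  have K: "?K \<in> HomOver D (Ident C T) (TObj M (Io T) (L p)) (TObj M (L \<one>\<^bsub>P\<^esub>) (L p))"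
    by (simp add: HomOver_iff)
  show "\<alpha> \<cdot>\<^bsub>D\<^esub> \<mu> \<one>\<^bsub>P\<^esub> p = m (T, \<one>\<^bsub>Sec T\<^esub>) (T, s) \<cdot>\<^bsub>D\<^esub> TArr M unit_third \<alpha>"
    by (rule D.cancel_right[OF K T _ _ eq, where f = "Ident C T" and f' = "Ident C T" and y = "qo (T, s)"])
      (simp_all add: HomOver_iff u)
qed

lemma comm_monoid_torsor: "comm_monoid torsor"
proof (rule comm_monoidI)
  interpret N: comm_monoid "Sec T" by (rule Sec_comm[OF T])
  have N_assoc: "s \<otimes>\<^bsub>Sec T\<^esub> t \<otimes>\<^bsub>Sec T\<^esub> w = s \<otimes>\<^bsub>Sec T\<^esub> (t \<otimes>\<^bsub>Sec T\<^esub> w)"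
    and N_comm: "s \<otimes>\<^bsub>Sec T\<^esub> t = t \<otimes>\<^bsub>Sec T\<^esub> s" and N_one: "\<one>\<^bsub>Sec T\<^esub> \<otimes>\<^bsub>Sec T\<^esub> s = s"
    if "s \<in> Hom C T (mcar A)" "t \<in> Hom C T (mcar A)" "w \<in> Hom C T (mcar A)" for s t w
    using N.m_assoc[of s t w] N.m_comm[of s t] N.l_one[of s] that by simp_all
  fix a b assume "a \<in> carrier torsor" "b \<in> carrier torsor"
  moreover obtain p s \<alpha> q t \<beta> where ab: "a = (p, s, \<alpha>)" "b = (q, t, \<beta>)" by (cases a, cases b)
  ultimately have h: "triple p s \<alpha>" "triple q t \<beta>" by simp_all
  show "a \<otimes>\<^bsub>torsor\<^esub> b \<in> carrier torsor" unfolding ab using third(1)[OF h] by simp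
  show "a \<otimes>\<^bsub>torsor\<^esub> b = b \<otimes>\<^bsub>torsor\<^esub> a" unfolding ab
    using third_comm[OF h] F.m_comm[OF tripleD(1)[OF h(1)] tripleD(1)[OF h(2)]]
      N_comm[OF tripleD(2)[OF h(1)] tripleD(2)[OF h(2)] tripleD(2)[OF h(2)]] by simp
  show "\<one>\<^bsub>torsor\<^esub> \<otimes>\<^bsub>torsor\<^esub> a = a" unfolding ab
    using third_unit[OF h(1)] F.l_one[OF tripleD(1)[OF h(1)]]
      N_one[OF tripleD(2)[OF h(1)] tripleD(2)[OF h(1)] tripleD(2)[OF h(1)]] by simp
  fix c assume "c \<in> carrier torsor"
  moreover obtain r w \<gamma> where c: "c = (r, w, \<gamma>)" by (cases c)
  ultimately have h3: "triple r w \<gamma>" by simp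
  show "a \<otimes>\<^bsub>torsor\<^esub> b \<otimes>\<^bsub>torsor\<^esub> c = a \<otimes>\<^bsub>torsor\<^esub> (b \<otimes>\<^bsub>torsor\<^esub> c)" unfolding ab c
    using third_assoc[OF h h3] F.m_assoc[OF tripleD(1)[OF h(1)] tripleD(1)[OF h(2)] tripleD(1)[OF h3]]
      N_assoc[OF tripleD(2)[OF h(1)] tripleD(2)[OF h(2)] tripleD(2)[OF h3]] by simp
qed (use unit_third in simp)

section \<open>The action of the units on trivialisations\<close>

definition gact :: "'a \<Rightarrow> 'p \<times> 'a \<times> 'e \<Rightarrow> 'p \<times> 'a \<times> 'e" where
  "gact g = (\<lambda>(p, s, \<alpha>). (p, g \<otimes>\<^bsub>Sec T\<^esub> s, qa (Ident C T, g, s, g \<otimes>\<^bsub>Sec T\<^esub> s) \<cdot>\<^bsub>D\<^esub> \<alpha>))"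

lemma gact_arr:
  assumes "g \<in> Units (Sec T)" "s \<in> Hom C T (mcar A)"
  shows "(Ident C T, g, s, g \<otimes>\<^bsub>Sec T\<^esub> s) \<in> Arr OG.AG"
    "qa (Ident C T, g, s, g \<otimes>\<^bsub>Sec T\<^esub> s) \<in> HomOver D (Ident C T) (qo (T, s)) (qo (T, g \<otimes>\<^bsub>Sec T\<^esub> s))"
    "g \<otimes>\<^bsub>Sec T\<^esub> s \<in> Hom C T (mcar A)"
proof -
  show gs: "g \<otimes>\<^bsub>Sec T\<^esub> s \<in> Hom C T (mcar A)" using Sec_closed(1)[OF Units_Hom[OF assms(1)] assms(2)] .
  show a: "(Ident C T, g, s, g \<otimes>\<^bsub>Sec T\<^esub> s) \<in> Arr OG.AG" using assms T gs HomD[OF gs] by simp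
  show "qa (Ident C T, g, s, g \<otimes>\<^bsub>Sec T\<^esub> s) \<in> HomOver D (Ident C T) (qo (T, s)) (qo (T, g \<otimes>\<^bsub>Sec T\<^esub> s))"
    using q_arr[OF a] T by simp
qed

lemma gact_triple:
  assumes g: "g \<in> Units (Sec T)" and a: "triple p s \<alpha>"
  shows "triple p (g \<otimes>\<^bsub>Sec T\<^esub> s) (qa (Ident C T, g, s, g \<otimes>\<^bsub>Sec T\<^esub> s) \<cdot>\<^bsub>D\<^esub> \<alpha>)"
  using gact_arr[OF g tripleD(2)[OF a]] tripleD[OF a] T
  unfolding triple_def by (simp add: HomOver_iff)

text \<open>This is naturality of \<open>m\<close>, applied to the arrow given by \<open>g\<close>
  in the first variable and to an identity in the second.\<close>

lemma gact_mult:
  assumes g: "g \<in> Units (Sec T)" and a: "triple p s \<alpha>" and b: "triple q t \<beta>"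
  shows "gact g (p, s, \<alpha>) \<otimes>\<^bsub>torsor\<^esub> (q, t, \<beta>) = gact g ((p, s, \<alpha>) \<otimes>\<^bsub>torsor\<^esub> (q, t, \<beta>))"
proof -
  interpret N: comm_monoid "Sec T" by (rule Sec_comm[OF T])
  note st = tripleD(2)[OF a] tripleD(2)[OF b] and Y = third[OF a b]
  have gs: "g \<otimes>\<^bsub>Sec T\<^esub> s \<otimes>\<^bsub>Sec T\<^esub> t = g \<otimes>\<^bsub>Sec T\<^esub> (s \<otimes>\<^bsub>Sec T\<^esub> t)"
    using N.m_assoc[of g s t] st Units_Hom[OF g] by simp
  note gA = gact_arr[OF g st(1)] and gB = gact_arr[OF g tripleD(2)[OF Y(1)]]
  have tt: "(Ident C T, \<one>\<^bsub>Sec T\<^esub>, t, t) \<in> Arr OG.AG"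
    using restriction_arr[of "Ident C T" t] st(2) T HomD[OF st(2)] by simp
  have qt: "qa (Ident C T, \<one>\<^bsub>Sec T\<^esub>, t, t) = Ident D (qo (T, t))" by (rule q_ident[OF T st(2)])
  have g1: "g \<otimes>\<^bsub>Sec T\<^esub> \<one>\<^bsub>Sec T\<^esub> = g" using N.r_one[OF N.Units_closed[OF g]] .
  let ?q = "qa (Ident C T, g, s, g \<otimes>\<^bsub>Sec T\<^esub> s)"
  let ?q' = "qa (Ident C T, g, s \<otimes>\<^bsub>Sec T\<^esub> t, g \<otimes>\<^bsub>Sec T\<^esub> (s \<otimes>\<^bsub>Sec T\<^esub> t))"
  have nat: "m (T, g \<otimes>\<^bsub>Sec T\<^esub> s) (T, t) \<cdot>\<^bsub>D\<^esub> TArr M ?q (Ident D (qo (T, t))) = ?q' \<cdot>\<^bsub>D\<^esub> m (T, s) (T, t)"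
    using m_natural[OF gA(1) tt] T by (simp add: qt g1 gs)
  note [simp] = tripleD[OF a] tripleD[OF b] tripleD[OF Y(1)] x_simps Sec_closed gA(3) gB(3)
    gA(2)[unfolded HomOver_iff] gB(2)[unfolded HomOver_iff]
  have "third p (g \<otimes>\<^bsub>Sec T\<^esub> s) (?q \<cdot>\<^bsub>D\<^esub> \<alpha>) q t \<beta> = ?q' \<cdot>\<^bsub>D\<^esub> third p s \<alpha> q t \<beta>"
  proof (rule third_unique[OF gact_triple[OF g a] b])
    show "triple (p \<otimes>\<^bsub>P\<^esub> q) (g \<otimes>\<^bsub>Sec T\<^esub> s \<otimes>\<^bsub>Sec T\<^esub> t) (?q' \<cdot>\<^bsub>D\<^esub> third p s \<alpha> q t \<beta>)"
      using gact_triple[OF g Y(1)] gs by simp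
    have "?q' \<cdot>\<^bsub>D\<^esub> third p s \<alpha> q t \<beta> \<cdot>\<^bsub>D\<^esub> \<mu> p q = ?q' \<cdot>\<^bsub>D\<^esub> (m (T, s) (T, t) \<cdot>\<^bsub>D\<^esub> TArr M \<alpha> \<beta>)"
      using Y(2) by (simp add: D.total.assoc)
    also have "\<dots> = ?q' \<cdot>\<^bsub>D\<^esub> m (T, s) (T, t) \<cdot>\<^bsub>D\<^esub> TArr M \<alpha> \<beta>" by (simp add: D.total.assoc)
    also have "\<dots> = m (T, g \<otimes>\<^bsub>Sec T\<^esub> s) (T, t) \<cdot>\<^bsub>D\<^esub> TArr M (?q \<cdot>\<^bsub>D\<^esub> \<alpha>) \<beta>"
      unfolding nat[symmetric] by (simp add: D.total.assoc D.interchange)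
    finally show "?q' \<cdot>\<^bsub>D\<^esub> third p s \<alpha> q t \<beta> \<cdot>\<^bsub>D\<^esub> \<mu> p q =
      m (T, g \<otimes>\<^bsub>Sec T\<^esub> s) (T, t) \<cdot>\<^bsub>D\<^esub> TArr M (?q \<cdot>\<^bsub>D\<^esub> \<alpha>) \<beta>" .
  qed
  then show ?thesis by (simp add: gact_def gs)
qed

lemma trivialisation_exists:
  assumes fine: "fine_monoid P" and tf: "torsion_free_monoid P"
    and X: "X \<subseteq> carrier P" "\<forall>H. submonoid H P \<and> X \<subseteq> H \<longrightarrow> H = carrier P"
    and loc: "\<And>p. p \<in> X \<Longrightarrow> \<exists>s \<alpha>. triple p s \<alpha>"
  shows "\<exists>\<phi> \<in> monoid_hom P (Sec T). \<exists>a. F.sm_arrow (Ident C T) x (triv T \<phi>) a"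
proof -
  interpret N: comm_monoid "Sec T" by (rule Sec_comm[OF T])
  interpret U: comm_group "Unt T" by (rule Unt_group[OF T])
  interpret K: comm_monoid torsor by (rule comm_monoid_torsor)
  have fst_mult: "fst (a \<otimes>\<^bsub>torsor\<^esub> b) = fst a \<otimes>\<^bsub>P\<^esub> fst b" for a b by (cases a, cases b) simp
  have fst_closed: "fst a \<in> carrier P" if "a \<in> carrier torsor" for a
    using that by (cases a) (auto dest: tripleD(1))
  \<comment> \<open>Trivialisations are given at generators only. The elements of \<open>P\<close>
    over which one exists form a submonoid, because trivialisations can be multiplied.\<close>
  have "submonoid (fst ` carrier torsor) P"
  proof
    show "fst ` carrier torsor \<subseteq> carrier P" using fst_closed by blast
    show "\<one>\<^bsub>P\<^esub> \<in> fst ` carrier torsor" using K.one_closed by (auto intro: rev_image_eqI)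
    fix p q assume "p \<in> fst ` carrier torsor" "q \<in> fst ` carrier torsor"
    then obtain a b where "p = fst a" "q = fst b" "a \<in> carrier torsor" "b \<in> carrier torsor" by blast
    then show "p \<otimes>\<^bsub>P\<^esub> q \<in> fst ` carrier torsor"
      using K.m_closed[of a b] fst_mult[of a b] by (metis imageI)
  qed
  moreover have "X \<subseteq> fst ` carrier torsor"
  proof
    fix p assume "p \<in> X"
    then obtain s \<alpha> where "triple p s \<alpha>" using loc by blast
    then show "p \<in> fst ` carrier torsor" by (intro image_eqI[of _ _ "(p, s, \<alpha>)"]) simp_all
  qed
  ultimately have surj: "carrier P \<subseteq> fst ` carrier torsor" using X(2) by blast
  have "\<exists>\<sigma> \<in> monoid_hom P torsor. \<forall>p \<in> carrier P. fst (\<sigma> p) = p"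
  proof (rule torsor_section[OF fine tf comm_monoid_torsor Unt_group[OF T] _ surj, where act = gact])
    show "fst \<in> monoid_hom torsor P"
      unfolding monoid_hom_def hom_def using fst_closed fst_mult by simp
  next
    fix g a assume "g \<in> carrier (Unt T)" "a \<in> carrier torsor"
    moreover obtain p s \<alpha> where a: "a = (p, s, \<alpha>)" by (cases a)
    ultimately have g: "g \<in> Units (Sec T)" and h: "triple p s \<alpha>" by simp_all
    show "gact g a \<in> carrier torsor" using gact_triple[OF g h] by (simp add: a gact_def)
    show "fst (gact g a) = fst a" by (simp add: a gact_def)
    { fix f assume "f \<in> carrier torsor"
      moreover obtain q t \<beta> where f: "f = (q, t, \<beta>)" by (cases f)
      ultimately have "triple q t \<beta>" by simp
      from gact_mult[OF g h this] show "gact g a \<otimes>\<^bsub>torsor\<^esub> f = gact g (a \<otimes>\<^bsub>torsor\<^esub> f)"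
        unfolding a f . }
    note gA = gact_arr[OF g tripleD(2)[OF h]]
    fix k assume "k \<in> carrier (Unt T)"
    then have k: "k \<in> Units (Sec T)" by simp
    note kA = gact_arr[OF k tripleD(2)[OF h]]
    note st = tripleD(2)[OF h]
    { assume "gact g a = gact k a"
      then have "(p, g \<otimes>\<^bsub>Sec T\<^esub> s, qa (Ident C T, g, s, g \<otimes>\<^bsub>Sec T\<^esub> s) \<cdot>\<^bsub>D\<^esub> \<alpha>) =
          (p, k \<otimes>\<^bsub>Sec T\<^esub> s, qa (Ident C T, k, s, k \<otimes>\<^bsub>Sec T\<^esub> s) \<cdot>\<^bsub>D\<^esub> \<alpha>)"
        by (simp only: a gact_def prod.case)
      then have e: "g \<otimes>\<^bsub>Sec T\<^esub> s = k \<otimes>\<^bsub>Sec T\<^esub> s"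
        "qa (Ident C T, g, s, g \<otimes>\<^bsub>Sec T\<^esub> s) \<cdot>\<^bsub>D\<^esub> \<alpha> = qa (Ident C T, k, s, k \<otimes>\<^bsub>Sec T\<^esub> s) \<cdot>\<^bsub>D\<^esub> \<alpha>"
        by blast+
      \<comment> \<open>Freeness of the action: \<alpha> is invertible and can be cancelled, and
        then faithfulness of the projection identifies the two units.\<close>
      have "\<alpha> \<in> HomOver D (Ident C T) (L p) (qo (T, s))" using h by (simp add: triple_def)
      from D.cancel_right[OF this T gA(2) _ e(2)] kA(2) e(1)
      have "qa (Ident C T, g, s, g \<otimes>\<^bsub>Sec T\<^esub> s) = qa (Ident C T, k, s, g \<otimes>\<^bsub>Sec T\<^esub> s)" by simp
      then show "g = k" using q_faithful_vertical[OF T gA(1)] kA(1) e(1) by simp }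
    note gkA = gact_arr[OF g kA(3)]
    have as: "g \<otimes>\<^bsub>Sec T\<^esub> k \<otimes>\<^bsub>Sec T\<^esub> s = g \<otimes>\<^bsub>Sec T\<^esub> (k \<otimes>\<^bsub>Sec T\<^esub> s)"
      using N.m_assoc[of g k s] st Units_Hom[OF g] Units_Hom[OF k] by simp
    have "qa (Ident C T, g \<otimes>\<^bsub>Sec T\<^esub> k, s, g \<otimes>\<^bsub>Sec T\<^esub> (k \<otimes>\<^bsub>Sec T\<^esub> s)) =
        qa (Ident C T, g, k \<otimes>\<^bsub>Sec T\<^esub> s, g \<otimes>\<^bsub>Sec T\<^esub> (k \<otimes>\<^bsub>Sec T\<^esub> s)) \<cdot>\<^bsub>D\<^esub> qa (Ident C T, k, s, k \<otimes>\<^bsub>Sec T\<^esub> s)"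
      using q_comp[OF gkA(1) kA(1)] T HomD[OF Units_Hom[OF g]] by simp
    then show "gact g (gact k a) = gact (g \<otimes>\<^bsub>Unt T\<^esub> k) a"
      using gkA(2) kA(2) tripleD[OF h] by (simp add: a gact_def as D.total.assoc HomOver_iff)
  next
    fix a assume "a \<in> carrier torsor"
    moreover obtain p s \<alpha> where a: "a = (p, s, \<alpha>)" by (cases a)
    ultimately have h: "triple p s \<alpha>" by simp
    show "gact \<one>\<^bsub>Unt T\<^esub> a = a"
      using q_ident[OF T tripleD(2)[OF h]] tripleD[OF h] N.l_one[of s] by (simp add: a gact_def)
    fix b assume "b \<in> carrier torsor" and eq: "fst a = fst b"
    moreover obtain q t \<beta> where b: "b = (q, t, \<beta>)" by (cases b)
    ultimately have h': "triple p t \<beta>" "q = p" by (simp_all add: a)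
    have \<beta>: "\<beta> \<in> HomOver D (Ident C T) (L p) (qo (T, t))" using h' by (simp add: triple_def)
    obtain \<beta>' where \<beta>': "\<beta>' \<in> HomOver D (Ident C T) (qo (T, t)) (L p)" "\<beta>' \<cdot>\<^bsub>D\<^esub> \<beta> = Ident D (L p)"
      using D.vertical_inverse[OF \<beta> T] by metis
    note ty = tripleD[OF h] tripleD[OF h'(1)] \<beta>'(1)[unfolded HomOver_iff]
    \<comment> \<open>Transitivity of the action: the difference of two trivialisations is a
      vertical arrow between images of sections, so by fullness it comes from a unit.\<close>
    have "\<alpha> \<cdot>\<^bsub>D\<^esub> \<beta>' \<in> HomOver D (Ident C T) (qo (T, t)) (qo (T, s))"
      using ty T by (simp add: HomOver_iff)
    from q_full[OF T tripleD(2)[OF h'(1)] tripleD(2)[OF h] this] obtain g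
      where g: "(Ident C T, g, t, s) \<in> Arr OG.AG" "qa (Ident C T, g, t, s) = \<alpha> \<cdot>\<^bsub>D\<^esub> \<beta>'" by blast
    have gs: "g \<in> Units (Sec T)" "g \<otimes>\<^bsub>Sec T\<^esub> t = s" using g(1) T HomD[OF tripleD(2)[OF h]] by simp_all
    have "\<alpha> \<cdot>\<^bsub>D\<^esub> \<beta>' \<cdot>\<^bsub>D\<^esub> \<beta> = \<alpha>" using ty \<beta>'(2) by (simp add: D.total.assoc)
    then have "a = gact g b" using g(2) gs(2) h'(2) by (simp add: a b gact_def)
    then show "\<exists>g \<in> carrier (Unt T). a = gact g b" using gs(1) by auto
  qed
  then obtain \<sigma> where \<sigma>: "\<sigma> \<in> monoid_hom P torsor" "\<And>p. p \<in> carrier P \<Longrightarrow> fst (\<sigma> p) = p" by blast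
  define \<phi> where "\<phi> p = fst (snd (\<sigma> p))" for p
  define a where "a p = snd (snd (\<sigma> p))" for p
  have \<sigma>_eq: "\<sigma> p = (p, \<phi> p, a p)" if "p \<in> carrier P" for p
    using \<sigma>(2)[OF that] by (simp add: \<phi>_def a_def prod_eq_iff)
  have tr: "triple p (\<phi> p) (a p)" if "p \<in> carrier P" for p
  proof -
    have "\<sigma> p \<in> carrier torsor" using \<sigma>(1) that unfolding monoid_hom_def hom_def by auto
    then show ?thesis using \<sigma>_eq[OF that] by simp
  qed
  have mult: "\<phi> (p \<otimes>\<^bsub>P\<^esub> q) = \<phi> p \<otimes>\<^bsub>Sec T\<^esub> \<phi> q" "a (p \<otimes>\<^bsub>P\<^esub> q) = third p (\<phi> p) (a p) q (\<phi> q) (a q)"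
    if "p \<in> carrier P" "q \<in> carrier P" for p q
  proof -
    have "\<sigma> (p \<otimes>\<^bsub>P\<^esub> q) = \<sigma> p \<otimes>\<^bsub>torsor\<^esub> \<sigma> q" using \<sigma>(1) that unfolding monoid_hom_def hom_def by auto
    then show "\<phi> (p \<otimes>\<^bsub>P\<^esub> q) = \<phi> p \<otimes>\<^bsub>Sec T\<^esub> \<phi> q" "a (p \<otimes>\<^bsub>P\<^esub> q) = third p (\<phi> p) (a p) q (\<phi> q) (a q)"
      using \<sigma>_eq that F.m_closed[OF that] by simp_all
  qed
  have "\<sigma> \<one>\<^bsub>P\<^esub> = \<one>\<^bsub>torsor\<^esub>" using \<sigma>(1) unfolding monoid_hom_def by blast
  then have one: "\<phi> \<one>\<^bsub>P\<^esub> = \<one>\<^bsub>Sec T\<^esub>" "a \<one>\<^bsub>P\<^esub> = unit_third"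
    using \<sigma>_eq[OF F.one_closed] by simp_all
  have \<phi>: "\<phi> \<in> monoid_hom P (Sec T)"
    unfolding monoid_hom_def hom_def using tripleD(2)[OF tr] mult(1) one(1) by auto
  \<comment> \<open>Multiplicativity of the section, read through the equations that characterise
    \<open>third\<close> and \<open>unit_third\<close>, is the compatibility required of a monoidal
    transformation.\<close>
  have "F.sm_arrow (Ident C T) x (triv T \<phi>) a"
    unfolding F.sm_arrow_def triv_def
    using tr third(2)[OF tr tr] mult(2) one(2) unit_third(2) T
    by (simp add: triple_def D.Ia_ident)
  with \<phi> show ?thesis by blast
qed

end

section \<open>The natural map\<close>

locale natural_map = div_functors C Cov A D M Io Ia qo qa m e P
  for C :: "('o, 'a) cat" and Cov and A :: "('o, 'a) monoid_data"
    and D :: "('o, 'a, 'x, 'e) fibcat" and M Io Ia qo qa m e and P :: "'p monoid" +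
  fixes AP :: 'o and u :: "'p \<Rightarrow> 'a" and GP :: 'o and v :: "'p \<Rightarrow> 'a"
  assumes fine: "fine_monoid P" and torsion_free: "torsion_free_monoid P"
    and rep_AP: "represents_homs C Sec P AP u" and rep_GP: "represents_homs C Unt P GP v"
begin

sublocale AP: representation C Sec "mcar A" P AP u
  by (intro representation.intro representation_axioms.intro Sec.monoid_presheaf_axioms rep_AP)

sublocale GP: representation C Unt "mcar A" P GP v
  by (intro representation.intro representation_axioms.intro Unt.monoid_presheaf_axioms rep_GP)

lemma unit_hom: "\<gamma> \<in> monoid_hom P (Unt S) \<Longrightarrow> \<gamma> \<in> monoid_hom P (Sec S)"
  unfolding monoid_hom_def hom_def using Units_Hom by (auto simp: Pi_iff)

abbreviation "act \<equiv> pointwise_action C A P AP u v"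

lemma act:
  assumes g: "g \<in> Hom C S GP" and s: "s \<in> Hom C S AP"
  shows "act S g s \<in> Hom C S AP"
    "p \<in> carrier P \<Longrightarrow> u p \<cdot>\<^bsub>C\<^esub> act S g s = (v p \<cdot>\<^bsub>C\<^esub> g) \<otimes>\<^bsub>Sec S\<^esub> (u p \<cdot>\<^bsub>C\<^esub> s)"
  using AP.the_rep[OF HomD(4)[OF g] AP.hom_mult[OF HomD(4)[OF g] unit_hom[OF GP.ev_hom[OF g]] AP.ev_hom[OF s]]]
  unfolding pointwise_action_def by simp_all

lemma v_closed: "g \<in> Hom C S GP \<Longrightarrow> p \<in> carrier P \<Longrightarrow> v p \<cdot>\<^bsub>C\<^esub> g \<in> Units (Sec S)"
  using GP.ev_closed by simp

lemma u_closed: "s \<in> Hom C S AP \<Longrightarrow> p \<in> carrier P \<Longrightarrow> u p \<cdot>\<^bsub>C\<^esub> s \<in> Hom C S (mcar A)"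
  using AP.ev_closed by simp

text \<open>Sections of \<open>AP\<close> and \<open>GP\<close> are compared in coordinates, where
  the axioms become laws of multiplication in \<O> and its compatibility with restriction.\<close>

sublocale PA: presheaf_action C AP GP.PM act GP
proof (intro presheaf_action.intro presheaf_action_axioms.intro category_axioms)
  show "AP \<in> Obj C" by (rule AP.R_Obj)
next
  fix S assume S: "S \<in> Obj C"
  interpret U: comm_group "Unt S" by (rule Unt_group[OF S])
  interpret N: comm_monoid "Sec S" by (rule Sec_comm[OF S])
  interpret PM: comm_group "GP.PM S" by (rule GP.PM_group[OF S U.group_axioms])
  show "group (GP.PM S)" by (rule PM.group_axioms)
  show "g \<in> Hom C S GP" if "g \<in> carrier (GP.PM S)" for g using that by simp
  fix x assume x: "x \<in> Hom C S AP"
  have one: "\<one>\<^bsub>GP.PM S\<^esub> \<in> Hom C S GP" using PM.one_closed by simp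
  show "act S \<one>\<^bsub>GP.PM S\<^esub> x = x"
  proof (rule AP.ev_inj[OF act(1)[OF one x] x])
    fix p assume p: "p \<in> carrier P"
    show "u p \<cdot>\<^bsub>C\<^esub> act S \<one>\<^bsub>GP.PM S\<^esub> x = u p \<cdot>\<^bsub>C\<^esub> x"
      using act(2)[OF one x p] GP.PM_one(2)[OF S p] N.l_one[of "u p \<cdot>\<^bsub>C\<^esub> x"] u_closed[OF x p] by simp
  qed
  fix g assume "g \<in> carrier (GP.PM S)"
  then have g: "g \<in> Hom C S GP" by simp
  show "act S g x \<in> Hom C S AP" by (rule act(1)[OF g x])
  fix h assume "h \<in> carrier (GP.PM S)"
  then have h: "h \<in> Hom C S GP" by simp
  note gh = GP.PM_mult[OF g h] and hx = act[OF h x]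
  show "act S (g \<otimes>\<^bsub>GP.PM S\<^esub> h) x = act S g (act S h x)"
  proof (rule AP.ev_inj[OF act(1)[OF gh(1) x] act(1)[OF g hx(1)]])
    fix p assume p: "p \<in> carrier P"
    show "u p \<cdot>\<^bsub>C\<^esub> act S (g \<otimes>\<^bsub>GP.PM S\<^esub> h) x = u p \<cdot>\<^bsub>C\<^esub> act S g (act S h x)"
      using act(2)[OF gh(1) x p] act(2)[OF g hx(1) p] hx(2)[OF p] gh(2)[OF p]
        N.m_assoc[of "v p \<cdot>\<^bsub>C\<^esub> g" "v p \<cdot>\<^bsub>C\<^esub> h" "u p \<cdot>\<^bsub>C\<^esub> x"] u_closed[OF x p]
        Units_Hom[OF v_closed[OF g p]] Units_Hom[OF v_closed[OF h p]] by simp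
  qed
next
  fix f T S g assume f: "f \<in> Hom C T S" and "g \<in> carrier (GP.PM S)"
  then have g: "g \<in> Hom C S GP" by simp
  show "g \<cdot>\<^bsub>C\<^esub> f \<in> carrier (GP.PM T)" using comp_Hom[OF g f] by simp
  { fix h assume "h \<in> carrier (GP.PM S)"
    then show "(g \<otimes>\<^bsub>GP.PM S\<^esub> h) \<cdot>\<^bsub>C\<^esub> f = (g \<cdot>\<^bsub>C\<^esub> f) \<otimes>\<^bsub>GP.PM T\<^esub> (h \<cdot>\<^bsub>C\<^esub> f)"
      using GP.PM_res_mult[OF f g] by simp }
  fix x assume x: "x \<in> Hom C S AP"
  note gf = comp_Hom[OF g f] and xf = comp_Hom[OF x f]
  show "act S g x \<cdot>\<^bsub>C\<^esub> f = act T (g \<cdot>\<^bsub>C\<^esub> f) (x \<cdot>\<^bsub>C\<^esub> f)"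
  proof (rule AP.ev_inj[OF comp_Hom[OF act(1)[OF g x] f] act(1)[OF gf xf]])
    fix p assume p: "p \<in> carrier P"
    show "u p \<cdot>\<^bsub>C\<^esub> (act S g x \<cdot>\<^bsub>C\<^esub> f) = u p \<cdot>\<^bsub>C\<^esub> act T (g \<cdot>\<^bsub>C\<^esub> f) (x \<cdot>\<^bsub>C\<^esub> f)"
      using AP.ev_comp[OF act(1)[OF g x] f p] act(2)[OF g x p] act(2)[OF gf xf p] AP.ev_comp[OF x f p]
        GP.ev_comp[OF g f p] Sec_res_mult[OF f Units_Hom[OF v_closed[OF g p]] u_closed[OF x p]]
      by simp
  qed
qed

section \<open>Functoriality of the natural map\<close>

abbreviation "no \<equiv> natural_map_obj C P u qo m e"
abbreviation "na \<equiv> natural_map_arr C P u v qo qa m e"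

lemma no_eq: "no (S, s) = triv S (\<lambda>p. u p \<cdot>\<^bsub>C\<^esub> s)"
  by (simp add: natural_map_obj_def triv_def)

lemma na_eq: "na (f, g, t, s) = (f, no (Dom C f, t), no (Cod C f, s),
    \<lambda>p \<in> carrier P. qa (f, v p \<cdot>\<^bsub>C\<^esub> g, u p \<cdot>\<^bsub>C\<^esub> t, u p \<cdot>\<^bsub>C\<^esub> s))"
  by (simp add: natural_map_arr_def)

lemma no_in_smfun: "s \<in> Hom C S AP \<Longrightarrow> no (S, s) \<in> smfun_objects C P D M Io"
  unfolding no_eq using triv_in_smfun AP.ev_hom HomD(4) by blast

lemma fst_no [simp]: "fst (no (S, s)) = S"
  by (simp add: no_eq triv_def)

text \<open>Evaluation at \<open>p\<close> carries the action on \<open>AP\<close> to the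
  multiplication action of \<open>\<O>\<^sup>\<times>\<close> on \<O>. In this way the natural map
  is studied through the projection to \<open>Div\<close>, one element at a time.\<close>

lemma component_arr:
  assumes a: "(f, g, t, s) \<in> Arr PA.AG" and p: "p \<in> carrier P"
  shows "(f, v p \<cdot>\<^bsub>C\<^esub> g, u p \<cdot>\<^bsub>C\<^esub> t, u p \<cdot>\<^bsub>C\<^esub> s) \<in> Arr OG.AG"
proof -
  have *: "f \<in> Arr C" "g \<in> Hom C (Dom C f) GP" "t \<in> Hom C (Dom C f) AP" "s \<in> Hom C (Cod C f) AP"
    "act (Dom C f) g t = s \<cdot>\<^bsub>C\<^esub> f" using a by simp_all
  have f: "f \<in> Hom C (Dom C f) (Cod C f)" using *(1) by (simp add: Hom_def)
  show ?thesis
    using *(1) v_closed[OF *(2) p] u_closed[OF *(3) p] u_closed[OF *(4) p] act(2)[OF *(2,3) p] *(5)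
      AP.ev_comp[OF *(4) f p] by simp
qed

lemma na_HomOver:
  assumes a: "(f, g, t, s) \<in> Arr PA.AG"
  shows "na (f, g, t, s) \<in> HomOver F.SM f (no (Dom C f, t)) (no (Cod C f, s))"
proof -
  have *: "f \<in> Hom C (Dom C f) (Cod C f)" "g \<in> Hom C (Dom C f) GP" "t \<in> Hom C (Dom C f) AP" "s \<in> Hom C (Cod C f) AP"
    using a by (simp_all add: Hom_def)
  show ?thesis unfolding na_eq
  proof (rule F.SM_HomOverI)
    show "f \<in> Hom C (fst (no (Dom C f, t))) (fst (no (Cod C f, s)))" using *(1) by simp
    show "F.sm_arrow f (no (Dom C f, t)) (no (Cod C f, s))
        (\<lambda>p \<in> carrier P. qa (f, v p \<cdot>\<^bsub>C\<^esub> g, u p \<cdot>\<^bsub>C\<^esub> t, u p \<cdot>\<^bsub>C\<^esub> s))"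
      unfolding no_eq
      by (rule triv_arrow[OF *(1) AP.ev_hom[OF *(3)] AP.ev_hom[OF *(4)] unit_hom[OF GP.ev_hom[OF *(2)]]
        component_arr[OF a]])
  qed (use no_in_smfun * in simp_all)
qed

lemma na_comp:
  assumes a: "(f, g, t, s) \<in> Arr PA.AG" and b: "(h, k, w, t) \<in> Arr PA.AG" and fh: "Cod C h = Dom C f"
  shows "na ((f, g, t, s) \<cdot>\<^bsub>PA.AG\<^esub> (h, k, w, t)) = na (f, g, t, s) \<cdot>\<^bsub>F.SM\<^esub> na (h, k, w, t)"
proof (rule F.SM_HomOver_eqI)
  have *: "f \<in> Arr C" "h \<in> Arr C" "g \<in> Hom C (Dom C f) GP" "k \<in> Hom C (Dom C h) GP"
    using a b by simp_all
  have h: "h \<in> Hom C (Dom C h) (Dom C f)" using * fh by (simp add: Hom_def)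
  note gh = comp_Hom[OF *(3) h]
  have c: "(f \<cdot>\<^bsub>C\<^esub> h, (g \<cdot>\<^bsub>C\<^esub> h) \<otimes>\<^bsub>GP.PM (Dom C h)\<^esub> k, w, s) \<in> Arr PA.AG"
    using PA.AG_comp_arr[OF b a fh] unfolding PA.AG_simps(8) .
  have d: "Dom C (f \<cdot>\<^bsub>C\<^esub> h) = Dom C h" "Cod C (f \<cdot>\<^bsub>C\<^esub> h) = Cod C f" using * fh by simp_all
  show "na ((f, g, t, s) \<cdot>\<^bsub>PA.AG\<^esub> (h, k, w, t)) \<in> HomOver F.SM (f \<cdot>\<^bsub>C\<^esub> h) (no (Dom C h, w)) (no (Cod C f, s))"
    using na_HomOver[OF c] unfolding PA.AG_simps(8) d .
  show "na (f, g, t, s) \<cdot>\<^bsub>F.SM\<^esub> na (h, k, w, t) \<in> HomOver F.SM (f \<cdot>\<^bsub>C\<^esub> h) (no (Dom C h, w)) (no (Cod C f, s))"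
    by (rule F.SM_comp_HomOver[OF na_HomOver[OF a] na_HomOver[OF b, unfolded fh]])
  fix p assume p: "p \<in> carrier P"
  have "v p \<cdot>\<^bsub>C\<^esub> ((g \<cdot>\<^bsub>C\<^esub> h) \<otimes>\<^bsub>GP.PM (Dom C h)\<^esub> k) =
      (v p \<cdot>\<^bsub>C\<^esub> g \<cdot>\<^bsub>C\<^esub> h) \<otimes>\<^bsub>Sec (Dom C h)\<^esub> (v p \<cdot>\<^bsub>C\<^esub> k)"
    using GP.PM_mult(2)[OF gh *(4) p] GP.ev_comp[OF *(3) h p] by simp
  then have "qa (f \<cdot>\<^bsub>C\<^esub> h, v p \<cdot>\<^bsub>C\<^esub> ((g \<cdot>\<^bsub>C\<^esub> h) \<otimes>\<^bsub>GP.PM (Dom C h)\<^esub> k), u p \<cdot>\<^bsub>C\<^esub> w, u p \<cdot>\<^bsub>C\<^esub> s) =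
      qa (f, v p \<cdot>\<^bsub>C\<^esub> g, u p \<cdot>\<^bsub>C\<^esub> t, u p \<cdot>\<^bsub>C\<^esub> s) \<cdot>\<^bsub>D\<^esub> qa (h, v p \<cdot>\<^bsub>C\<^esub> k, u p \<cdot>\<^bsub>C\<^esub> w, u p \<cdot>\<^bsub>C\<^esub> t)"
    using q_comp[OF component_arr[OF a p] component_arr[OF b p] fh] by simp
  then show "F.cmp (na ((f, g, t, s) \<cdot>\<^bsub>PA.AG\<^esub> (h, k, w, t))) p =
      F.cmp (na (f, g, t, s) \<cdot>\<^bsub>F.SM\<^esub> na (h, k, w, t)) p"
    unfolding PA.AG_simps(8) na_eq using p by simp
qed

lemma na_ident:
  assumes S: "S \<in> Obj C" and s: "s \<in> Hom C S AP"
  shows "na (Ident PA.AG (S, s)) = Ident F.SM (no (S, s))"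
proof -
  have "qa (Ident C S, v p \<cdot>\<^bsub>C\<^esub> \<one>\<^bsub>GP.PM S\<^esub>, u p \<cdot>\<^bsub>C\<^esub> s, u p \<cdot>\<^bsub>C\<^esub> s) = Ident D (F.fam (no (S, s)) p)"
    if p: "p \<in> carrier P" for p
    using GP.PM_one(2)[OF S p] q_ident[OF S u_closed[OF s p]] p by (simp add: no_eq triv_def)
  then show ?thesis using S unfolding PA.AG_simps(5) na_eq F.SM_simps
    by (auto intro!: extensionalityI[of _ "carrier P"])
qed

lemma natural_functor: "fibred_functor PA.AG F.SM no na"
  unfolding fibred_functor_def is_functor_def
proof (intro conjI ballI impI)
  fix x assume "x \<in> Obj PA.AG"
  moreover obtain S s where x: "x = (S, s)" by (cases x)
  ultimately have S: "S \<in> Obj C" "s \<in> Hom C S AP" by simp_all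
  show "no x \<in> Obj F.SM" unfolding x using no_in_smfun[OF S(2)] by simp
  show "na (Ident PA.AG x) = Ident F.SM (no x)" unfolding x by (rule na_ident[OF S])
  show "PObj F.SM (no x) = PObj PA.AG x" by (simp add: x)
next
  fix k assume k: "k \<in> Arr PA.AG"
  obtain f g t s where keq: "k = (f, g, t, s)" by (cases k)
  note H = na_HomOver[OF k[unfolded keq]]
  show "na k \<in> Hom F.SM (no (Dom PA.AG k)) (no (Cod PA.AG k))"
    using H unfolding keq PA.AG_simps HomOver_def by simp
  show "PArr F.SM (na k) = PArr PA.AG k" by (simp add: keq na_eq)
next
  fix k l assume k: "k \<in> Arr PA.AG" and l: "l \<in> Arr PA.AG" and kl: "Dom PA.AG l = Cod PA.AG k"
  obtain f g t s where leq: "l = (f, g, t, s)" by (cases l)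
  obtain h k' w t' where keq: "k = (h, k', w, t')" by (cases k)
  have t: "t' = t" "Cod C h = Dom C f" using kl by (simp_all add: leq keq)
  show "na (l \<cdot>\<^bsub>PA.AG\<^esub> k) = na l \<cdot>\<^bsub>F.SM\<^esub> na k"
    using na_comp[OF l[unfolded leq] k[unfolded keq t(1)] t(2)] by (simp only: leq keq t(1))
qed

section \<open>Full faithfulness and local surjectivity of the natural map\<close>

lemma na_faithful:
  assumes a: "(f, g, t, s) \<in> Arr PA.AG" and b: "(f, g', t, s) \<in> Arr PA.AG"
    and eq: "na (f, g, t, s) = na (f, g', t, s)"
  shows "g = g'"
proof (rule GP.ev_inj)
  show "g \<in> Hom C (Dom C f) GP" "g' \<in> Hom C (Dom C f) GP" using a b by simp_all
  fix p assume p: "p \<in> carrier P"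
  have "F.cmp (na (f, g, t, s)) p = F.cmp (na (f, g', t, s)) p" by (simp only: eq)
  then have "qa (f, v p \<cdot>\<^bsub>C\<^esub> g, u p \<cdot>\<^bsub>C\<^esub> t, u p \<cdot>\<^bsub>C\<^esub> s) = qa (f, v p \<cdot>\<^bsub>C\<^esub> g', u p \<cdot>\<^bsub>C\<^esub> t, u p \<cdot>\<^bsub>C\<^esub> s)"
    using p by (simp add: na_eq)
  then show "v p \<cdot>\<^bsub>C\<^esub> g = v p \<cdot>\<^bsub>C\<^esub> g'"
    by (rule q_faithful[OF component_arr[OF a p] component_arr[OF b p]])
qed

text \<open>Fullness of the projection gives a unit for every element of \<open>P\<close>. These
  units form a homomorphism by faithfulness: the components of \<open>b\<close> are compatible with
  \<open>m\<close>, which is invertible and can be cancelled.\<close>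

lemma na_full:
  assumes S: "S \<in> Obj C" and s: "s \<in> Hom C S AP" and t: "t \<in> Hom C S AP"
    and b: "b \<in> HomOver F.SM (Ident C S) (no (S, s)) (no (S, t))"
  shows "\<exists>g. (Ident C S, g, s, t) \<in> Arr PA.AG \<and> na (Ident C S, g, s, t) = b"
proof -
  interpret N: comm_monoid "Sec S" by (rule Sec_comm[OF S])
  note sp = u_closed[OF s] and tp = u_closed[OF t]
  note B = F.SM_HomOverD[OF b]
  have fam [simp]: "F.fam (no (S, s)) p = qo (S, u p \<cdot>\<^bsub>C\<^esub> s)" "F.mu (no (S, s)) p q = m (S, u p \<cdot>\<^bsub>C\<^esub> s) (S, u q \<cdot>\<^bsub>C\<^esub> s)"
    "F.eps (no (S, s)) = e S" if "p \<in> carrier P" "q \<in> carrier P" for p q s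
    using that by (simp_all add: no_eq triv_def)
  have "\<forall>p \<in> carrier P. \<exists>g. (Ident C S, g, u p \<cdot>\<^bsub>C\<^esub> s, u p \<cdot>\<^bsub>C\<^esub> t) \<in> Arr OG.AG \<and>
      qa (Ident C S, g, u p \<cdot>\<^bsub>C\<^esub> s, u p \<cdot>\<^bsub>C\<^esub> t) = F.cmp b p"
  proof
    fix p assume p: "p \<in> carrier P"
    have "F.cmp b p \<in> HomOver D (Ident C S) (qo (S, u p \<cdot>\<^bsub>C\<^esub> s)) (qo (S, u p \<cdot>\<^bsub>C\<^esub> t))"
      using F.sm_arrowD(7)[OF B(2) p] p by simp
    then show "\<exists>g. (Ident C S, g, u p \<cdot>\<^bsub>C\<^esub> s, u p \<cdot>\<^bsub>C\<^esub> t) \<in> Arr OG.AG \<and>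
      qa (Ident C S, g, u p \<cdot>\<^bsub>C\<^esub> s, u p \<cdot>\<^bsub>C\<^esub> t) = F.cmp b p" by (rule q_full[OF S sp[OF p] tp[OF p]])
  qed
  then obtain \<gamma> where \<gamma>: "\<And>p. p \<in> carrier P \<Longrightarrow> (Ident C S, \<gamma> p, u p \<cdot>\<^bsub>C\<^esub> s, u p \<cdot>\<^bsub>C\<^esub> t) \<in> Arr OG.AG"
    "\<And>p. p \<in> carrier P \<Longrightarrow> qa (Ident C S, \<gamma> p, u p \<cdot>\<^bsub>C\<^esub> s, u p \<cdot>\<^bsub>C\<^esub> t) = F.cmp b p" by metis
  have \<gamma>U: "\<gamma> p \<in> Units (Sec S)" "\<gamma> p \<otimes>\<^bsub>Sec S\<^esub> (u p \<cdot>\<^bsub>C\<^esub> s) = u p \<cdot>\<^bsub>C\<^esub> t" if "p \<in> carrier P" for p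
    using \<gamma>(1)[OF that] S HomD[OF tp[OF that]] by simp_all
  note us = homD[OF AP.ev_hom[OF s]] and ut = homD[OF AP.ev_hom[OF t]]
  have mult: "\<gamma> (p \<otimes>\<^bsub>P\<^esub> q) = \<gamma> p \<otimes>\<^bsub>Sec S\<^esub> \<gamma> q" if p: "p \<in> carrier P" and q: "q \<in> carrier P" for p q
  proof -
    note pq = F.m_closed[OF p q]
    have "\<gamma> p \<otimes>\<^bsub>Sec S\<^esub> \<gamma> q \<in> Units (Sec S)" using N.Units_m_closed \<gamma>U(1) p q by simp
    moreover have "\<gamma> p \<otimes>\<^bsub>Sec S\<^esub> \<gamma> q \<otimes>\<^bsub>Sec S\<^esub> (u (p \<otimes>\<^bsub>P\<^esub> q) \<cdot>\<^bsub>C\<^esub> s) = u (p \<otimes>\<^bsub>P\<^esub> q) \<cdot>\<^bsub>C\<^esub> t"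
    proof -
      have "\<gamma> p \<otimes>\<^bsub>Sec S\<^esub> \<gamma> q \<otimes>\<^bsub>Sec S\<^esub> ((u p \<cdot>\<^bsub>C\<^esub> s) \<otimes>\<^bsub>Sec S\<^esub> (u q \<cdot>\<^bsub>C\<^esub> s)) =
          (\<gamma> p \<otimes>\<^bsub>Sec S\<^esub> (u p \<cdot>\<^bsub>C\<^esub> s)) \<otimes>\<^bsub>Sec S\<^esub> (\<gamma> q \<otimes>\<^bsub>Sec S\<^esub> (u q \<cdot>\<^bsub>C\<^esub> s))"
        using Units_Hom[OF \<gamma>U(1)[OF p]] Units_Hom[OF \<gamma>U(1)[OF q]] sp[OF p] sp[OF q]
          Sec_m_closed(1)[OF S] by (simp add: N.m_ac)
      then show ?thesis using \<gamma>U(2) p q us(2)[OF p q] ut(2)[OF p q] by simp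
    qed
    ultimately have arr: "(Ident C S, \<gamma> p \<otimes>\<^bsub>Sec S\<^esub> \<gamma> q, u (p \<otimes>\<^bsub>P\<^esub> q) \<cdot>\<^bsub>C\<^esub> s, u (p \<otimes>\<^bsub>P\<^esub> q) \<cdot>\<^bsub>C\<^esub> t) \<in> Arr OG.AG"
      using S sp[OF pq] tp[OF pq] HomD[OF tp[OF pq]] by simp
    have "F.cmp b (p \<otimes>\<^bsub>P\<^esub> q) \<cdot>\<^bsub>D\<^esub> m (S, u p \<cdot>\<^bsub>C\<^esub> s) (S, u q \<cdot>\<^bsub>C\<^esub> s) =
        m (S, u p \<cdot>\<^bsub>C\<^esub> t) (S, u q \<cdot>\<^bsub>C\<^esub> t) \<cdot>\<^bsub>D\<^esub> TArr M (F.cmp b p) (F.cmp b q)"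
      using F.sm_arrowD(5)[OF B(2) p q] p q by simp
    also have "\<dots> = qa (Ident C S, \<gamma> p \<otimes>\<^bsub>Sec S\<^esub> \<gamma> q, u (p \<otimes>\<^bsub>P\<^esub> q) \<cdot>\<^bsub>C\<^esub> s, u (p \<otimes>\<^bsub>P\<^esub> q) \<cdot>\<^bsub>C\<^esub> t)
        \<cdot>\<^bsub>D\<^esub> m (S, u p \<cdot>\<^bsub>C\<^esub> s) (S, u q \<cdot>\<^bsub>C\<^esub> s)"
      using m_natural[OF \<gamma>(1)[OF p] \<gamma>(1)[OF q]] \<gamma>(2)[OF p] \<gamma>(2)[OF q] S us(2)[OF p q] ut(2)[OF p q] by simp
    finally have eq: "qa (Ident C S, \<gamma> (p \<otimes>\<^bsub>P\<^esub> q), u (p \<otimes>\<^bsub>P\<^esub> q) \<cdot>\<^bsub>C\<^esub> s, u (p \<otimes>\<^bsub>P\<^esub> q) \<cdot>\<^bsub>C\<^esub> t)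
          \<cdot>\<^bsub>D\<^esub> m (S, u p \<cdot>\<^bsub>C\<^esub> s) (S, u q \<cdot>\<^bsub>C\<^esub> s) =
        qa (Ident C S, \<gamma> p \<otimes>\<^bsub>Sec S\<^esub> \<gamma> q, u (p \<otimes>\<^bsub>P\<^esub> q) \<cdot>\<^bsub>C\<^esub> s, u (p \<otimes>\<^bsub>P\<^esub> q) \<cdot>\<^bsub>C\<^esub> t)
          \<cdot>\<^bsub>D\<^esub> m (S, u p \<cdot>\<^bsub>C\<^esub> s) (S, u q \<cdot>\<^bsub>C\<^esub> s)"
      using \<gamma>(2)[OF pq] by simp
    have mH: "m (S, u p \<cdot>\<^bsub>C\<^esub> s) (S, u q \<cdot>\<^bsub>C\<^esub> s) \<in> HomOver D (Ident C S)
        (TObj M (qo (S, u p \<cdot>\<^bsub>C\<^esub> s)) (qo (S, u q \<cdot>\<^bsub>C\<^esub> s))) (qo (S, u (p \<otimes>\<^bsub>P\<^esub> q) \<cdot>\<^bsub>C\<^esub> s))"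
      using m_HomOver[OF S sp[OF p] sp[OF q]] us(2)[OF p q] by simp
    have "qa (Ident C S, \<gamma> (p \<otimes>\<^bsub>P\<^esub> q), u (p \<otimes>\<^bsub>P\<^esub> q) \<cdot>\<^bsub>C\<^esub> s, u (p \<otimes>\<^bsub>P\<^esub> q) \<cdot>\<^bsub>C\<^esub> t) =
        qa (Ident C S, \<gamma> p \<otimes>\<^bsub>Sec S\<^esub> \<gamma> q, u (p \<otimes>\<^bsub>P\<^esub> q) \<cdot>\<^bsub>C\<^esub> s, u (p \<otimes>\<^bsub>P\<^esub> q) \<cdot>\<^bsub>C\<^esub> t)"
      by (rule D.cancel_right[OF mH S _ _ eq, where f = "Ident C S" and f' = "Ident C S"
          and y = "qo (S, u (p \<otimes>\<^bsub>P\<^esub> q) \<cdot>\<^bsub>C\<^esub> t)"])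
        (use q_arr[OF \<gamma>(1)[OF pq]] q_arr[OF arr] S in simp_all)
    then show ?thesis by (rule q_faithful_vertical[OF S \<gamma>(1)[OF pq] arr])
  qed
  \<comment> \<open>At the unit of \<open>P\<close> both sections have coordinate one, so the unit
    carrying the first to the second is one itself.\<close>
  have one: "\<gamma> \<one>\<^bsub>P\<^esub> = \<one>\<^bsub>Sec S\<^esub>"
    using \<gamma>U[OF F.one_closed] us(3) ut(3) N.r_one[OF N.Units_closed[OF \<gamma>U(1)[OF F.one_closed]]] by simp
  have "\<gamma> \<in> monoid_hom P (Unt S)"
    unfolding monoid_hom_def hom_def using \<gamma>U(1) mult one by auto
  from GP.represent[OF S this] obtain g where g: "g \<in> Hom C S GP" "\<And>p. p \<in> carrier P \<Longrightarrow> v p \<cdot>\<^bsub>C\<^esub> g = \<gamma> p"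
    by blast
  have "act S g s = t"
    by (rule AP.ev_inj[OF act(1)[OF g(1) s] t]) (use act(2)[OF g(1) s] g(2) \<gamma>U(2) in simp)
  then have arr: "(Ident C S, g, s, t) \<in> Arr PA.AG" using S s t g(1) HomD[OF t] by simp
  have "na (Ident C S, g, s, t) = b"
  proof (rule F.SM_HomOver_eqI[OF _ b])
    show "na (Ident C S, g, s, t) \<in> HomOver F.SM (Ident C S) (no (S, s)) (no (S, t))"
      using na_HomOver[OF arr] S by simp
    fix p assume "p \<in> carrier P"
    then show "F.cmp (na (Ident C S, g, s, t)) p = F.cmp b p" using g(2) \<gamma>(2) by (simp add: na_eq)
  qed
  with arr show ?thesis by blast
qed

text \<open>A covering is refined for one element of the finite set at a time. The lifts already
  found for the other elements are restricted to the refinement along canonical lifts.\<close>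

lemma locally_in_image:
  assumes "finite X" "S \<in> Obj C" "\<And>p. p \<in> X \<Longrightarrow> L p \<in> Over D S"
  shows "\<exists>\<U> \<in> Cov S. \<forall>f \<in> \<U>. \<forall>p \<in> X. \<exists>s \<in> Hom C (Dom C f) (mcar A). \<exists>b. b \<in> HomOver D f (qo (Dom C f, s)) (L p)"
  using assms(1,3)
proof (induction X)
  case empty
  show ?case using D.ident_covering[OF assms(2)] by blast
next
  case (insert q X)
  then obtain \<U> where U: "\<U> \<in> Cov S" "\<And>f p. f \<in> \<U> \<Longrightarrow> p \<in> X \<Longrightarrow>
      \<exists>s \<in> Hom C (Dom C f) (mcar A). \<exists>b. b \<in> HomOver D f (qo (Dom C f, s)) (L p)" by (metis insertCI)
  have ess: "\<forall>S \<in> Obj C. \<forall>y \<in> Over D S. \<exists>\<U> \<in> Cov S. \<forall>f \<in> \<U>.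
      \<exists>x \<in> Over OG.AG (Dom C f). \<exists>b. b \<in> HomOver D f (qo x) y"
    using stackification[unfolded stackification_def, THEN conjunct2, THEN conjunct2, THEN conjunct2,
      THEN conjunct2, THEN conjunct2] .
  \<comment> \<open>Local surjectivity of the projection is applied over each member of the
    covering, so \<open>L q\<close> is first pulled back along \<open>f\<close>.\<close>
  have "\<forall>f \<in> \<U>. \<exists>\<V> \<in> Cov (Dom C f). \<forall>h \<in> \<V>. \<exists>s \<in> Hom C (Dom C h) (mcar A).
      \<exists>b. b \<in> HomOver D (f \<cdot>\<^bsub>C\<^esub> h) (qo (Dom C h, s)) (L q)"
  proof
    fix f assume f: "f \<in> \<U>"
    note fD = HomD[OF covering_Hom[OF assms(2) U(1) f]]
    have Lq: "L q \<in> Obj D" "PObj D (L q) = S" using insert.prems by (simp_all add: Over_iff)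
    have "\<exists>a. a \<in> Arr D \<and> Cod D a = L q \<and> PArr D a = f" using D.lift[OF fD(1) Lq(1)] Lq(2) fD(3) by simp
    then obtain a where a: "a \<in> Arr D" "Cod D a = L q" "PArr D a = f" by blast
    have "Dom D a \<in> Over D (Dom C f)" using a D.PArr_simps(2)[OF a(1)] by (simp add: Over_iff)
    from ess[rule_format, OF fD(4) this] obtain \<V> where V: "\<V> \<in> Cov (Dom C f)"
      "\<And>h. h \<in> \<V> \<Longrightarrow> \<exists>x \<in> Over OG.AG (Dom C h). \<exists>b. b \<in> HomOver D h (qo x) (Dom D a)" by blast
    show "\<exists>\<V> \<in> Cov (Dom C f). \<forall>h \<in> \<V>. \<exists>s \<in> Hom C (Dom C h) (mcar A).
      \<exists>b. b \<in> HomOver D (f \<cdot>\<^bsub>C\<^esub> h) (qo (Dom C h, s)) (L q)"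
    proof (intro bexI[OF _ V(1)] ballI)
      fix h assume h: "h \<in> \<V>"
      obtain x b where x: "x \<in> Over OG.AG (Dom C h)" and b: "b \<in> HomOver D h (qo x) (Dom D a)"
        using V(2)[OF h] by blast
      obtain s where s: "x = (Dom C h, s)" "s \<in> Hom C (Dom C h) (mcar A)"
        using x by (cases x) (auto simp: Over_iff)
      have "a \<cdot>\<^bsub>D\<^esub> b \<in> HomOver D (f \<cdot>\<^bsub>C\<^esub> h) (qo (Dom C h, s)) (L q)"
        using a b unfolding s(1) by (simp add: HomOver_iff)
      then show "\<exists>s \<in> Hom C (Dom C h) (mcar A). \<exists>b. b \<in> HomOver D (f \<cdot>\<^bsub>C\<^esub> h) (qo (Dom C h, s)) (L q)"
        using s(2) by blast
    qed
  qed
  from bchoice[OF this[unfolded Bex_def]] obtain \<V> where V: "\<And>f. f \<in> \<U> \<Longrightarrow> \<V> f \<in> Cov (Dom C f)"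
    "\<And>f h. f \<in> \<U> \<Longrightarrow> h \<in> \<V> f \<Longrightarrow> \<exists>s \<in> Hom C (Dom C h) (mcar A).
      \<exists>b. b \<in> HomOver D (f \<cdot>\<^bsub>C\<^esub> h) (qo (Dom C h, s)) (L q)" by blast
  have "\<exists>s \<in> Hom C (Dom C k) (mcar A). \<exists>b. b \<in> HomOver D k (qo (Dom C k, s)) (L p)"
    if k: "k = f \<cdot>\<^bsub>C\<^esub> h" "f \<in> \<U>" "h \<in> \<V> f" and p: "p \<in> insert q X" for k f h p
  proof -
    note fD = HomD[OF covering_Hom[OF assms(2) U(1) k(2)]]
    note hH = covering_Hom[OF fD(4) V(1)[OF k(2)] k(3)]
    note hD = HomD[OF hH]
    have d: "Dom C k = Dom C h" unfolding k(1) using fD hD by simp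
    show ?thesis
    proof (cases "p = q")
      case True then show ?thesis unfolding d using V(2)[OF k(2,3)] k(1) by simp
    next
      case False
      then obtain s b where s: "s \<in> Hom C (Dom C f) (mcar A)" and b: "b \<in> HomOver D f (qo (Dom C f, s)) (L p)"
        using U(2)[OF k(2)] p by blast
      have sh: "s \<cdot>\<^bsub>C\<^esub> h \<in> Hom C (Dom C h) (mcar A)" by (rule comp_Hom[OF s hH])
      have "qa (h, \<one>\<^bsub>Sec (Dom C h)\<^esub>, s \<cdot>\<^bsub>C\<^esub> h, s) \<in> HomOver D h (qo (Dom C h, s \<cdot>\<^bsub>C\<^esub> h)) (qo (Dom C f, s))"
        using q_arr[OF restriction_arr[OF hD(1), of s]] s hD(3) by simp
      then have "b \<cdot>\<^bsub>D\<^esub> qa (h, \<one>\<^bsub>Sec (Dom C h)\<^esub>, s \<cdot>\<^bsub>C\<^esub> h, s) \<in> HomOver D k (qo (Dom C h, s \<cdot>\<^bsub>C\<^esub> h)) (L p)"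
        using b unfolding k(1) by (simp add: HomOver_iff)
      then show ?thesis using sh unfolding d by blast
    qed
  qed
  then have "\<forall>k \<in> {f \<cdot>\<^bsub>C\<^esub> h | f h. f \<in> \<U> \<and> h \<in> \<V> f}. \<forall>p \<in> insert q X.
      \<exists>s \<in> Hom C (Dom C k) (mcar A). \<exists>b. b \<in> HomOver D k (qo (Dom C k, s)) (L p)" by blast
  then show ?case using D.compose_coverings[OF assms(2) U(1) V(1)] by blast
qed

text \<open>Over a member of the covering the pullback of \<open>y\<close> is trivialised at the
  generators, hence as a whole, over that same member. The homomorphism so obtained is represented
  by a section of \<open>AP\<close>.\<close>

lemma na_essentially_surjective:
  assumes S: "S \<in> Obj C" and y: "y \<in> Over F.SM S"
  shows "\<exists>\<U> \<in> Cov S. \<forall>f \<in> \<U>. \<exists>x \<in> Over PA.AG (Dom C f). \<exists>b. b \<in> HomOver F.SM f (no x) y"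
proof -
  have y': "y \<in> smfun_objects C P D M Io" "fst y = S" "F.sm_data y" "F.coherent y"
    using y by (simp_all add: Over_iff F.smfun_objects_iff)
  obtain X where X: "finite X" "X \<subseteq> carrier P" "\<forall>H. submonoid H P \<and> X \<subseteq> H \<longrightarrow> H = carrier P"
    using fine unfolding fine_monoid_def finitely_generated_monoid_def by blast
  have "F.fam y p \<in> Over D S" if "p \<in> X" for p
    using F.sm_dataD(2,3)[OF y'(3)] y'(2) X(2) that by (auto simp: Over_iff)
  from locally_in_image[OF X(1) S, where L = "F.fam y", OF this] obtain \<U> where U: "\<U> \<in> Cov S" "\<And>f p. f \<in> \<U> \<Longrightarrow> p \<in> X \<Longrightarrow>
      \<exists>s \<in> Hom C (Dom C f) (mcar A). \<exists>b. b \<in> HomOver D f (qo (Dom C f, s)) (F.fam y p)" by blast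
  have "\<exists>x \<in> Over PA.AG (Dom C f). \<exists>b. b \<in> HomOver F.SM f (no x) y" if f: "f \<in> \<U>" for f
  proof -
    have fH: "f \<in> Hom C (Dom C f) S" by (rule covering_Hom[OF S U(1) f])
    note fD = HomD[OF fH]
    have "Cod C f = fst y" using fD(3) y'(2) by simp
    from F.pullback_exists[OF y'(3,4) fD(1) this] obtain z a where z: "fst z = Dom C f"
      "z \<in> smfun_objects C P D M Io" "a \<in> extensional (carrier P)" "F.sm_arrow f z y a" by blast
    have z': "F.sm_data z" "F.coherent z" using z(2) by (simp_all add: F.smfun_objects_iff)
    interpret Z: trivialisations C Cov A D M Io Ia qo qa m e P z
      by (intro trivialisations.intro trivialisations_axioms.intro div_functors_axioms z')
    have zy: "(f, z, y, a) \<in> HomOver F.SM f z y"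
      by (rule F.SM_HomOverI) (use z y' fH in simp_all)
    have "\<exists>s \<alpha>. Z.triple p s \<alpha>" if p: "p \<in> X" for p
    proof -
      have pP: "p \<in> carrier P" using p X(2) by blast
      obtain s b where s: "s \<in> Hom C (Dom C f) (mcar A)" and b: "b \<in> HomOver D f (qo (Dom C f, s)) (F.fam y p)"
        using U(2)[OF f p] by blast
      have I: "Ident C (Dom C f) \<in> Arr C" "Cod C (Ident C (Dom C f)) = Dom C f" "f \<cdot>\<^bsub>C\<^esub> Ident C (Dom C f) = f"
        using fD by simp_all
      have ap: "a p \<in> HomOver D f (F.fam z p) (F.fam y p)" by (rule F.sm_arrowD(7)[OF z(4) pP])
      \<comment> \<open>The local lift ends at the value of \<open>y\<close>. Factoring it through
        the pullback arrow makes it vertical over the member, and its inverse has the direction that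
        a trivialisation requires.\<close>
      from D.factor_ex[OF ap _ I(1,2), of b "qo (Dom C f, s)"] b I(3)
      obtain \<beta> where \<beta>: "\<beta> \<in> HomOver D (Ident C (Dom C f)) (qo (Dom C f, s)) (F.fam z p)" by auto
      obtain \<alpha> where "\<alpha> \<in> HomOver D (Ident C (Dom C f)) (F.fam z p) (qo (Dom C f, s))"
        using D.vertical_inverse[OF \<beta> fD(4)] by metis
      then show ?thesis using pP s z(1) unfolding Z.triple_def by auto
    qed
    from Z.trivialisation_exists[OF fine torsion_free X(2,3) this] obtain \<phi> c
      where \<phi>: "\<phi> \<in> monoid_hom P (Sec (Dom C f))" and c: "F.sm_arrow (Ident C (Dom C f)) z (triv (Dom C f) \<phi>) c"
      unfolding z(1) by blast
    from AP.represent[OF fD(4) \<phi>] obtain s where s: "s \<in> Hom C (Dom C f) AP"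
      "\<And>p. p \<in> carrier P \<Longrightarrow> u p \<cdot>\<^bsub>C\<^esub> s = \<phi> p" by blast
    have no_s: "no (Dom C f, s) = triv (Dom C f) \<phi>"
      unfolding no_eq triv_def using s(2) by (auto simp: restrict_def fun_eq_iff)
    have c': "F.sm_arrow (Ident C (Dom C f)) z (no (Dom C f, s)) (restrict c (carrier P))"
      using c unfolding no_s F.sm_arrow_def by simp
    have "(Ident C (Dom C f), z, no (Dom C f, s), restrict c (carrier P)) \<in>
        HomOver F.SM (Ident C (Dom C f)) z (no (Dom C f, s))"
      by (rule F.SM_HomOverI) (use c' z no_in_smfun[OF s(1)] ident[OF fD(4)] in simp_all)
    from F.SM.vertical_inverse[OF this fD(4)] obtain d
      where d: "d \<in> HomOver F.SM (Ident C (Dom C f)) (no (Dom C f, s)) z" by metis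
    have "(f, z, y, a) \<cdot>\<^bsub>F.SM\<^esub> d \<in> HomOver F.SM f (no (Dom C f, s)) y"
      using F.SM_comp_HomOver[OF zy d] fD by simp
    moreover have "(Dom C f, s) \<in> Over PA.AG (Dom C f)" using s(1) fD(4) by (simp add: Over_iff)
    ultimately show ?thesis by blast
  qed
  then show ?thesis using U(1) by blast
qed

text \<open>The natural map is full and faithful on vertical arrows, so the identity covering
  witnesses both local conditions on arrows. A genuine covering is taken only for objects.\<close>

lemma quotient: "stackification C Cov PA.AG F.SM no na"
  unfolding stackification_def
proof (intro conjI ballI impI)
  show "fibred_in_groupoids C PA.AG" by (rule PA.fibred_AG)
  show "stack C Cov F.SM" by (rule F.stack_SM)
  show "fibred_functor PA.AG F.SM no na" by (rule natural_functor)
next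
  fix S x y a b assume S: "S \<in> Obj C" and x: "x \<in> Over PA.AG S" and y: "y \<in> Over PA.AG S"
    and a: "a \<in> HomOver PA.AG (Ident C S) x y" and b: "b \<in> HomOver PA.AG (Ident C S) x y" and eq: "na a = na b"
  obtain f g t s where a': "a = (f, g, t, s)" by (cases a)
  obtain f' g' t' s' where b': "b = (f', g', t', s')" by (cases b)
  have *: "f' = f" "t' = t" "s' = s" "(f, g, t, s) \<in> Arr PA.AG" "(f', g', t', s') \<in> Arr PA.AG"
    using a b unfolding a' b' HomOver_iff by auto
  have "g = g'" by (rule na_faithful[OF *(4)]) (use * eq in \<open>simp_all only: a' b'\<close>)
  then have "a = b" unfolding a' b' using * by simp
  then show "\<exists>\<U> \<in> Cov S. \<forall>f \<in> \<U>. \<forall>z. \<forall>c \<in> HomOver PA.AG f z x. a \<cdot>\<^bsub>PA.AG\<^esub> c = b \<cdot>\<^bsub>PA.AG\<^esub> c"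
    using D.ident_covering[OF S] by blast
next
  fix S x y b assume S: "S \<in> Obj C" and x: "x \<in> Over PA.AG S" and y: "y \<in> Over PA.AG S"
    and b: "b \<in> HomOver F.SM (Ident C S) (no x) (no y)"
  obtain s where s: "x = (S, s)" "s \<in> Hom C S AP" using x by (cases x) (auto simp: Over_iff)
  obtain t where t: "y = (S, t)" "t \<in> Hom C S AP" using y by (cases y) (auto simp: Over_iff)
  obtain g where g: "(Ident C S, g, s, t) \<in> Arr PA.AG" "na (Ident C S, g, s, t) = b"
    using na_full[OF S s(2) t(2)] b unfolding s t by blast
  interpret G: fibred C PA.AG by (rule fibredI[OF category_axioms PA.fibred_AG])
  \<comment> \<open>The preimage sought is the preimage of \<open>b\<close> composed with
    \<open>c\<close>.\<close>
  have "\<exists>a \<in> HomOver PA.AG f z y. na a = b \<cdot>\<^bsub>F.SM\<^esub> na c"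
    if f: "f \<in> {Ident C S}" and c: "c \<in> HomOver PA.AG f z x" for f z c
  proof
    obtain f' k w s' where c': "c = (f', k, w, s')" by (cases c)
    have k: "f' = f" "s' = s" "(f', k, w, s') \<in> Arr PA.AG" "Cod C f = S" "z = (Dom C f, w)" "f = Ident C S"
      using c f unfolding c' s HomOver_iff by auto
    have dc: "Cod C f = Dom C (Ident C S)" using S k(4) by simp
    show "na ((Ident C S, g, s, t) \<cdot>\<^bsub>PA.AG\<^esub> c) = b \<cdot>\<^bsub>F.SM\<^esub> na c"
      using na_comp[OF g(1) k(3)[unfolded k(1,2)] dc] g(2) by (simp only: c' k(1,2))
    have "(Ident C S, g, s, t) \<cdot>\<^bsub>PA.AG\<^esub> (f, k, w, s) \<in> Arr PA.AG"
      by (rule PA.AG_comp_arr[OF k(3)[unfolded k(1,2)] g(1) dc])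
    then show "(Ident C S, g, s, t) \<cdot>\<^bsub>PA.AG\<^esub> c \<in> HomOver PA.AG f z y"
      unfolding HomOver_iff c' k(1,2,5) t(1) k(6) using S by simp
  qed
  then show "\<exists>\<U> \<in> Cov S. \<forall>f \<in> \<U>. \<forall>z. \<forall>c \<in> HomOver PA.AG f z x.
      \<exists>a \<in> HomOver PA.AG f z y. na a = b \<cdot>\<^bsub>F.SM\<^esub> na c"
    using D.ident_covering[OF S] by blast
next
  fix S y assume "S \<in> Obj C" "y \<in> Over F.SM S"
  then show "\<exists>\<U> \<in> Cov S. \<forall>f \<in> \<U>. \<exists>x \<in> Over PA.AG (Dom C f). \<exists>b. b \<in> HomOver F.SM f (no x) y"
    by (rule na_essentially_surjective)
qed

end

theorem proposition3p10:
  fixes C :: "('o, 'a) cat" and Cov :: "'o \<Rightarrow> 'a set set"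
    and A :: "('o, 'a) monoid_data" and Small :: "'a set"
    and Div :: "('o, 'a, 'x, 'e) fibcat" and M :: "('x, 'e) tensor"
    and P :: "'p monoid"
  assumes "esp C Cov A Small"
    and "is_Div C Cov A Div M Io Ia qo qa m e"
    and "fine_monoid P" and "torsion_free_monoid P"
    and "represents_homs C (sections C A) P AP u"
    and "represents_homs C (\<lambda>S. units_of (sections C A S)) P GP v"
  shows "quotient_stack C Cov
    AP
    (pointwise_monoid C (\<lambda>S. units_of (sections C A S)) P GP v)
    (pointwise_action C A P AP u v)
    (smfun_stack C P Div M Io Ia)
    (natural_map_obj C P u qo m e)
    (natural_map_arr C P u v qo qa m e)"
proof -
  have "category C" "grothendieck_topology C Cov" "subcanonical C Cov" "monoid_object C A"
    using assms(1) by (simp_all add: esp_def)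
  moreover have "comm_monoid P"
    using assms(3) by (simp add: fine_monoid_def integral_monoid_def)
  ultimately interpret natural_map C Cov A Div M Io Ia qo qa m e P AP u GP v
    using assms
    by (intro natural_map.intro div_functors.intro div_stack.intro monoid_site.intro
      monoid_site_axioms.intro div_stack_axioms.intro div_functors_axioms.intro natural_map_axioms.intro)
  show ?thesis unfolding quotient_stack_def by (rule quotient)
qed

end
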